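(* Let $r,s>0$ be integers. There exists a map $\mathrm{Ev}$ from $\mathrm{Mor}(\mathbb{D}^r,\bar{\mathbb{D}}^s)$ to the space of continuous functions $\mathcal{C}^0(\mathbb{D}^r,\bar{\mathbb{D}}^s)$ such that the following holds: (i) The map $\mathrm{Ev}(\alpha)$ is analytic if and only if $\alpha\in\mathrm{Mor}(\mathbb{D}^r,\bar{\mathbb{D}}^s)$ is rigid. In that case, the map $\mathrm{Ev}(\alpha)$ is precisely $\Phi(\alpha,\cdot)$. (ii) For any fixed $z\in\mathbb{D}^r$, the assignment $\alpha\in\mathrm{Mor}(\mathbb{D}^r,\bar{\mathbb{D}}^s)\mapsto \mathrm{Ev}(\alpha)(z)$ is a continuous map.
   Context: $k$ is an algebraically closed, complete, nontrivially valued non-Archimedean field. $\mathbb{D}^r$ and $\bar{\mathbb{D}}^s$ are the open and closed Berkovich unit polydisks over $k$ of dimensions $r$ and $s$. Let $\mathcal{S}$ be the set of maps $\mathrm{M}:\{1,\dots,s\}\times\mathbb{N}^r\to\mathbb{N}$ with finite support; for variables $a=(a_{l,I})_{1\le l\le s,\,I\in\mathbb{N}^r}$ put $a^{\mathrm{M}}=\prod_{l,I}a_{l,I}^{\mathrm{M}(l,I)}$. The Banach $k$-algebra $\mathcal{T}^{r,s}_\infty$ consists of all power series $\sum_{\mathrm{M}\in\mathcal{S}}g_{\mathrm{M}}a^{\mathrm{M}}$, $g_{\mathrm{M}}\in k$, such that for every $\epsilon>0$ the set $\{\mathrm{M}:|g_{\mathrm{M}}|>\epsilon\}$ is finite, with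 the norm $\max_{\mathrm{M}}|g_{\mathrm{M}}|$. The space $\mathrm{Mor}(\mathbb{D}^r,\bar{\mathbb{D}}^s)$ is its analytic spectrum $\mathcal{M}(\mathcal{T}^{r,s}_\infty)$ (bounded multiplicative seminorms, weakest topology making all $x\mapsto|g(x)|$ continuous). A point $\alpha$ of it is rigid if its complete residue field $\mathcal{H}(\alpha)$ equals $k$. The product $\mathrm{Mor}(\mathbb{D}^r,\bar{\mathbb{D}}^s)\times\mathbb{D}^r$ is the increasing union over $0<\rho<1$ of the analytic spectra of $\mathcal{T}^{r,s}_\infty\{\rho^{-1}T_1,\dots,\rho^{-1}T_r\}$, and $\Phi:\mathrm{Mor}(\mathbb{D}^r,\bar{\mathbb{D}}^s)\times\mathbb{D}^r\to\bar{\mathbb{D}}^s$ is the analytic map induced by the bounded morphisms $k\{S_1,\dots,S_s\}\to\mathcal{T}^{r,s}_\infty\{\rho^{-1}T_1,\dots,\rho^{-1}T_r\}$, $S_l\mapsto\sum_{I\in\mathbb{N}^r}a_{l,I}T^I$. For rigid $\alpha$, $\Phi(\alpha,\cdot)$ denotes the restriction of $\Phi$ to the fibre $\{\alpha\}\times\mathbb{D}^r\cong\mathbb{D}^r$. *)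

theory Defs
  imports
    "HOL-Analysis.Analysis"
    "HOL-Library.Poly_Mapping"
    "HOL-Computational_Algebra.Polynomial"
    "HOL-Algebra.QuotRing"
begin

section \<open>Formal power series in an arbitrary set of variables\<close>

text \<open>
  Variables are the elements of the type \<^typ>\<open>'v\<close>, possibly infinitely many.  A monomial is an
  exponent with finite support, that is, an element of \<^typ>\<open>'v \<Rightarrow>\<^sub>0 nat\<close>.  If \<^typ>\<open>'r\<close> is
  finite with \<open>r\<close> elements, then \<^typ>\<open>'r \<Rightarrow>\<^sub>0 nat\<close> is \<open>\<nat>\<^sup>r\<close>.
\<close>

typedef ('v, 'a) mfps = "UNIV :: (('v \<Rightarrow>\<^sub>0 nat) \<Rightarrow> 'a) set"
  morphisms mcoeff Abs_mfps ..

setup_lifting type_definition_mfps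

definition splits :: "('v \<Rightarrow>\<^sub>0 nat) \<Rightarrow> (('v \<Rightarrow>\<^sub>0 nat) \<times> ('v \<Rightarrow>\<^sub>0 nat)) set" where
  "splits M = {(A, B). A + B = M}"

lemma finite_splits [simp, intro]: "finite (splits M)"
proof -
  let ?F = "{f. \<forall>i. (i \<in> Poly_Mapping.keys M \<longrightarrow> f i \<in> {..Max (Poly_Mapping.lookup M ` Poly_Mapping.keys M)}) \<and> (i \<notin> Poly_Mapping.keys M \<longrightarrow> f i = (0::nat))}"
  have fin: "finite ?F"
    by (rule finite_set_of_finite_funs) auto
  have sub: "Poly_Mapping.lookup A \<in> ?F" if "A + B = M" for A B
  proof -
    have le: "Poly_Mapping.lookup A i \<le> Poly_Mapping.lookup M i" for i
      using that by (auto simp: lookup_add)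
    have "Poly_Mapping.lookup A i \<le> Max (Poly_Mapping.lookup M ` Poly_Mapping.keys M)" if "i \<in> Poly_Mapping.keys M" for i
      using le[of i] that by (meson Max_ge finite_imageI finite_keys imageI order_trans)
    moreover have "Poly_Mapping.lookup A i = 0" if "i \<notin> Poly_Mapping.keys M" for i
      using le[of i] that by (simp add: in_keys_iff)
    ultimately show ?thesis by auto
  qed
  have "finite (Poly_Mapping.lookup -` ?F)"
    by (rule finite_vimageI[OF fin]) (simp add: inj_def)
  then have "finite ((Poly_Mapping.lookup -` ?F) \<times> (Poly_Mapping.lookup -` ?F))"
    by blast
  moreover have "splits M \<subseteq> (Poly_Mapping.lookup -` ?F) \<times> (Poly_Mapping.lookup -` ?F)"
  proof
    fix p assume "p \<in> splits M"
    then have "fst p + snd p = M" "snd p + fst p = M"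
      by (auto simp: splits_def add.commute)
    then show "p \<in> (Poly_Mapping.lookup -` ?F) \<times> (Poly_Mapping.lookup -` ?F)"
      using sub[of "fst p" "snd p"] sub[of "snd p" "fst p"] by (simp only: mem_Times_iff vimage_eq)
  qed
  ultimately show ?thesis
    by (rule rev_finite_subset)
qed

instantiation mfps :: (type, comm_ring_1) comm_ring_1
begin

lift_definition zero_mfps :: "('a, 'b) mfps" is "\<lambda>_. 0" .
lift_definition one_mfps :: "('a, 'b) mfps" is "\<lambda>M. if M = 0 then 1 else 0" .
lift_definition plus_mfps :: "('a, 'b) mfps \<Rightarrow> ('a, 'b) mfps \<Rightarrow> ('a, 'b) mfps"
  is "\<lambda>f g M. f M + g M" .
lift_definition minus_mfps :: "('a, 'b) mfps \<Rightarrow> ('a, 'b) mfps \<Rightarrow> ('a, 'b) mfps"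
  is "\<lambda>f g M. f M - g M" .
lift_definition uminus_mfps :: "('a, 'b) mfps \<Rightarrow> ('a, 'b) mfps"
  is "\<lambda>f M. - f M" .
lift_definition times_mfps :: "('a, 'b) mfps \<Rightarrow> ('a, 'b) mfps \<Rightarrow> ('a, 'b) mfps"
  is "\<lambda>f g M. \<Sum>(A, B)\<in>splits M. f A * g B" .

instance
proof
  fix a b c :: "('a, 'b) mfps"
  show "a * b * c = a * (b * c)"
  proof (transfer, rule ext)
    fix f g h :: "('a \<Rightarrow>\<^sub>0 nat) \<Rightarrow> 'b" and M
    have "(\<Sum>(A, B)\<in>splits M. (\<Sum>(A, B)\<in>splits A. f A * g B) * h B)
        = (\<Sum>p\<in>splits M. \<Sum>q\<in>splits (fst p). f (fst q) * g (snd q) * h (snd p))"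
      by (simp add: case_prod_beta sum_distrib_right)
    also have "\<dots> = (\<Sum>(p, q)\<in>(SIGMA p:splits M. splits (fst p)). f (fst q) * g (snd q) * h (snd p))"
      by (rule sum.Sigma) auto
    also have "\<dots> = (\<Sum>(p, q)\<in>(SIGMA p:splits M. splits (snd p)). f (fst p) * (g (fst q) * h (snd q)))"
      by (rule sum.reindex_bij_witness
          [where i = "\<lambda>(p, q). ((fst p + fst q, snd q), (fst p, fst q))"
            and j = "\<lambda>(p, q). ((fst q, snd q + snd p), (snd q, snd p))"])
        (auto simp: splits_def add.assoc mult.assoc)
    also have "\<dots> = (\<Sum>p\<in>splits M. \<Sum>q\<in>splits (snd p). f (fst p) * (g (fst q) * h (snd q)))"
      by (rule sum.Sigma[symmetric]) auto
    also have "\<dots> = (\<Sum>(A, B)\<in>splits M. f A * (\<Sum>(A, B)\<in>splits B. g A * h B))"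
      by (simp add: case_prod_beta sum_distrib_left)
    finally show "(\<Sum>(A, B)\<in>splits M. (\<Sum>(A, B)\<in>splits A. f A * g B) * h B)
        = (\<Sum>(A, B)\<in>splits M. f A * (\<Sum>(A, B)\<in>splits B. g A * h B))" .
  qed
  show "a * b = b * a"
  proof (transfer, rule ext)
    fix f g :: "('a \<Rightarrow>\<^sub>0 nat) \<Rightarrow> 'b" and M
    show "(\<Sum>(A, B)\<in>splits M. f A * g B) = (\<Sum>(A, B)\<in>splits M. g A * f B)"
      by (rule sum.reindex_bij_witness[where i = prod.swap and j = prod.swap])
        (auto simp: splits_def add.commute mult.commute)
  qed
  show "1 * a = a"
  proof (transfer, rule ext)
    fix f :: "('a \<Rightarrow>\<^sub>0 nat) \<Rightarrow> 'b" and M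
    have "(\<Sum>(A, B)\<in>splits M. (if A = 0 then 1 else 0) * f B)
        = (\<Sum>(A, B)\<in>{(0 :: 'a \<Rightarrow>\<^sub>0 nat, M)}. (if A = 0 then 1 else 0) * f B)"
      by (rule sum.mono_neutral_right[OF finite_splits]) (auto simp: splits_def split: if_splits)
    then show "(\<Sum>(A, B)\<in>splits M. (if A = 0 then 1 else 0) * f B) = f M"
      by simp
  qed
  show "(a + b) * c = a * c + b * c"
    by (transfer, rule ext) (simp add: case_prod_beta distrib_right sum.distrib)
  show "(0::('a, 'b) mfps) \<noteq> 1"
    by transfer (metis zero_neq_one)
qed (transfer; simp add: fun_eq_iff algebra_simps)+

end

definition mconst :: "'a::zero \<Rightarrow> ('v, 'a) mfps" where
  "mconst c = Abs_mfps (\<lambda>M. if M = 0 then c else 0)"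

definition mvar :: "'v \<Rightarrow> ('v, 'a::zero_neq_one) mfps" where
  "mvar v = Abs_mfps (\<lambda>M. if M = Poly_Mapping.single v 1 then 1 else 0)"

definition mmap :: "('a \<Rightarrow> 'b) \<Rightarrow> ('v, 'a) mfps \<Rightarrow> ('v, 'b) mfps" where
  "mmap h f = Abs_mfps (\<lambda>M. h (mcoeff f M))"

definition mdeg :: "('v \<Rightarrow>\<^sub>0 nat) \<Rightarrow> nat" where
  "mdeg M = (\<Sum>v\<in>Poly_Mapping.keys M. Poly_Mapping.lookup M v)"


section \<open>Banach algebras over the ground field and their analytic spectra\<close>

locale complete_nonarch_field =
  fixes absv :: "'k::field \<Rightarrow> real"
  assumes absv_nonneg: "absv x \<ge> 0"
    and absv_eq_0_iff: "absv x = 0 \<longleftrightarrow> x = 0"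
    and absv_mult: "absv (x * y) = absv x * absv y"
    and absv_ultrametric: "absv (x + y) \<le> max (absv x) (absv y)"
    and absv_nontrivial: "\<exists>x. x \<noteq> 0 \<and> absv x \<noteq> 1"
    and absv_complete:
      "(\<And>\<epsilon>. \<epsilon> > 0 \<Longrightarrow> \<exists>N. \<forall>m\<ge>N. \<forall>n\<ge>N. absv (u m - u n) < \<epsilon>)
        \<Longrightarrow> \<exists>l. (\<lambda>n. absv (u n - l)) \<longlonglongrightarrow> 0"

text \<open>
  A normed algebra over \<open>k\<close> is given by a subring \<open>alg_carrier\<close> of an ambient ring, a norm on it
  and the structure morphism from \<open>k\<close>.
\<close>

record ('k, 'a) normed_alg =
  alg_carrier :: "'a set"
  alg_norm :: "'a \<Rightarrow> real"
  alg_const :: "'k \<Rightarrow> 'a"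

definition ground :: "('k \<Rightarrow> real) \<Rightarrow> ('k, 'k) normed_alg" where
  "ground absv = \<lparr>alg_carrier = UNIV, alg_norm = absv, alg_const = (\<lambda>c. c)\<rparr>"

text \<open>
  \<open>tate A \<rho>\<close> is \<open>A{\<rho>\<^sup>-\<^sup>1T\<^sub>v : v \<in> 'v}\<close>.  The supremum defining the norm is attained.
\<close>

definition tate :: "('k, 'a::comm_ring_1) normed_alg \<Rightarrow> real \<Rightarrow> ('k, ('v, 'a) mfps) normed_alg" where
  "tate A \<rho> = \<lparr>
     alg_carrier = {f. (\<forall>M. mcoeff f M \<in> alg_carrier A) \<and>
       (\<forall>\<epsilon>>0. finite {M. alg_norm A (mcoeff f M) * \<rho> ^ mdeg M > \<epsilon>})},
     alg_norm = (\<lambda>f. SUP M. alg_norm A (mcoeff f M) * \<rho> ^ mdeg M),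
     alg_const = (\<lambda>c. mconst (alg_const A c))\<rparr>"

definition bounded_alg_hom ::
    "('k, 'a::comm_ring_1) normed_alg \<Rightarrow> ('k, 'b::comm_ring_1) normed_alg \<Rightarrow> ('a \<Rightarrow> 'b) \<Rightarrow> bool" where
  "bounded_alg_hom A B \<phi> \<longleftrightarrow>
     \<phi> \<in> alg_carrier A \<rightarrow> alg_carrier B \<and>
     (\<forall>f\<in>alg_carrier A. \<forall>g\<in>alg_carrier A. \<phi> (f + g) = \<phi> f + \<phi> g \<and> \<phi> (f * g) = \<phi> f * \<phi> g) \<and>
     (\<forall>c. \<phi> (alg_const A c) = alg_const B c) \<and>
     (\<exists>C. \<forall>f\<in>alg_carrier A. alg_norm B (\<phi> f) \<le> C * alg_norm A f)"

definition spectrum :: "('k, 'a::comm_ring_1) normed_alg \<Rightarrow> ('a \<Rightarrow> real) set" where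
  "spectrum A = {x \<in> extensional (alg_carrier A).
     (\<forall>f\<in>alg_carrier A. x f \<ge> 0) \<and> x 0 = 0 \<and> x 1 = 1 \<and>
     (\<forall>f\<in>alg_carrier A. \<forall>g\<in>alg_carrier A. x (f + g) \<le> x f + x g \<and> x (f * g) = x f * x g) \<and>
     (\<exists>C. \<forall>f\<in>alg_carrier A. x f \<le> C * alg_norm A f)}"

text \<open>The topology of pointwise convergence on \<open>A\<close>.\<close>

definition spectrum_top :: "('k, 'a::comm_ring_1) normed_alg \<Rightarrow> ('a \<Rightarrow> real) topology" where
  "spectrum_top A =
     subtopology (product_topology (\<lambda>_. euclideanreal) (alg_carrier A)) (spectrum A)"

lemma topspace_spectrum_top [simp]: "topspace (spectrum_top A) = spectrum A"
  by (auto simp: spectrum_top_def spectrum_def PiE_def)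


section \<open>Complete residue fields and rigid points\<close>

text \<open>
  For a point \<open>x\<close> of the spectrum of \<open>A\<close>, a pair \<open>(f, g)\<close> with \<open>x g \<noteq> 0\<close> stands for the fraction
  \<open>f/g\<close> in the fraction field of \<open>A / ker x\<close>.  The function \<open>frac_dist x\<close> is the distance coming
  from the absolute value induced by \<open>x\<close>, so that two pairs stand for the same fraction if and
  only if their distance is zero.  The complete residue field \<open>\<H>(x)\<close> is the completion: Cauchy
  sequences of fractions modulo null sequences.
\<close>

definition fractions :: "('k, 'a::comm_ring_1) normed_alg \<Rightarrow> ('a \<Rightarrow> real) \<Rightarrow> ('a \<times> 'a) set" where
  "fractions A x = {(f, g). f \<in> alg_carrier A \<and> g \<in> alg_carrier A \<and> x g \<noteq> 0}"

definition frac_add :: "'a::comm_ring_1 \<times> 'a \<Rightarrow> 'a \<times> 'a \<Rightarrow> 'a \<times> 'a" where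
  "frac_add = (\<lambda>(f, g) (f', g'). (f * g' + f' * g, g * g'))"

definition frac_mult :: "'a::comm_ring_1 \<times> 'a \<Rightarrow> 'a \<times> 'a \<Rightarrow> 'a \<times> 'a" where
  "frac_mult = (\<lambda>(f, g) (f', g'). (f * f', g * g'))"

definition frac_dist :: "('a::comm_ring_1 \<Rightarrow> real) \<Rightarrow> 'a \<times> 'a \<Rightarrow> 'a \<times> 'a \<Rightarrow> real" where
  "frac_dist x = (\<lambda>(f, g) (f', g'). x (f * g' - f' * g) / (x g * x g'))"

definition cauchy_fractions ::
    "('k, 'a::comm_ring_1) normed_alg \<Rightarrow> ('a \<Rightarrow> real) \<Rightarrow> (nat \<Rightarrow> 'a \<times> 'a) set" where
  "cauchy_fractions A x = {u. (\<forall>n. u n \<in> fractions A x) \<and>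
     (\<forall>\<epsilon>>0. \<exists>N. \<forall>m\<ge>N. \<forall>n\<ge>N. frac_dist x (u m) (u n) < \<epsilon>)}"

definition completion_rel ::
    "('k, 'a::comm_ring_1) normed_alg \<Rightarrow> ('a \<Rightarrow> real) \<Rightarrow>
     ((nat \<Rightarrow> 'a \<times> 'a) \<times> (nat \<Rightarrow> 'a \<times> 'a)) set" where
  "completion_rel A x = {(u, v). u \<in> cauchy_fractions A x \<and> v \<in> cauchy_fractions A x \<and>
     (\<lambda>n. frac_dist x (u n) (v n)) \<longlonglongrightarrow> 0}"

definition residue_field ::
    "('k, 'a::comm_ring_1) normed_alg \<Rightarrow> ('a \<Rightarrow> real) \<Rightarrow> (nat \<Rightarrow> 'a \<times> 'a) set ring" where
  "residue_field A x = \<lparr>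
     carrier = cauchy_fractions A x // completion_rel A x,
     mult = (\<lambda>X Y. \<Union>u\<in>X. \<Union>v\<in>Y. completion_rel A x `` {\<lambda>n. frac_mult (u n) (v n)}),
     one = completion_rel A x `` {\<lambda>_. (1, 1)},
     zero = completion_rel A x `` {\<lambda>_. (0, 1)},
     add = (\<lambda>X Y. \<Union>u\<in>X. \<Union>v\<in>Y. completion_rel A x `` {\<lambda>n. frac_add (u n) (v n)})\<rparr>"

definition ground_ring :: "'k::field ring" where
  "ground_ring = \<lparr>carrier = UNIV, mult = (*), one = 1, zero = 0, add = (+)\<rparr>"

text \<open>\<open>\<H>(x) = k\<close> means that the canonical morphism \<open>k \<rightarrow> \<H>(x)\<close> is an isomorphism.\<close>

definition rigid :: "('k::field, 'a::comm_ring_1) normed_alg \<Rightarrow> ('a \<Rightarrow> real) \<Rightarrow> bool" where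
  "rigid A x \<longleftrightarrow> x \<in> spectrum A \<and>
     (\<lambda>c. completion_rel A x `` {\<lambda>_. (alg_const A c, 1)}) \<in> ring_iso ground_ring (residue_field A x)"


section \<open>Open and closed polydisks, analytic maps\<close>

definition closed_disk_alg :: "('k::comm_ring_1 \<Rightarrow> real) \<Rightarrow> ('k, ('s, 'k) mfps) normed_alg" where
  "closed_disk_alg absv = tate (ground absv) 1"

text \<open>
  \<open>open_disk A\<close> is the open unit polydisk over \<open>\<M>(A)\<close>, the increasing union of the spectra of
  \<open>A{\<rho>\<^sup>-\<^sup>1T}\<close> for \<open>0 < \<rho> < 1\<close>.  For \<open>\<rho> < \<rho>'\<close> the inclusion of spectra is restriction of seminorms
  along \<open>A{\<rho>'\<^sup>-\<^sup>1T} \<subseteq> A{\<rho>\<^sup>-\<^sup>1T}\<close>; it is injective, as polynomials are dense.  To have all these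
  spectra inside one set, seminorms are restricted further to \<open>disk_series A\<close>, the
  intersection of all \<open>A{\<rho>\<^sup>-\<^sup>1T}\<close>.  A set is open if its trace on every member of the union is.
\<close>

definition disk_series :: "('k, 'a::comm_ring_1) normed_alg \<Rightarrow> ('v, 'a) mfps set" where
  "disk_series A = (\<Inter>\<rho>\<in>{0<..<1}. alg_carrier (tate A \<rho>))"

definition open_disk :: "('k, 'a::comm_ring_1) normed_alg \<Rightarrow> (('v, 'a) mfps \<Rightarrow> real) set" where
  "open_disk A = (\<Union>\<rho>\<in>{0<..<1}. (\<lambda>x. restrict x (disk_series A)) ` spectrum (tate A \<rho>))"

definition open_disk_top :: "('k, 'a::comm_ring_1) normed_alg \<Rightarrow> (('v, 'a) mfps \<Rightarrow> real) topology" where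
  "open_disk_top A = topology (\<lambda>U. U \<subseteq> open_disk A \<and>
     (\<forall>\<rho>\<in>{0<..<1}. openin (spectrum_top (tate A \<rho>))
        {x \<in> spectrum (tate A \<rho>). restrict x (disk_series A) \<in> U}))"

lemma openin_open_disk_top:
  fixes A :: "('k, 'a::comm_ring_1) normed_alg" and U :: "(('v, 'a) mfps \<Rightarrow> real) set"
  shows "openin (open_disk_top A) U \<longleftrightarrow> U \<subseteq> open_disk A \<and>
     (\<forall>\<rho>\<in>{0<..<1}. openin (spectrum_top (tate A \<rho>))
        {x \<in> spectrum (tate A \<rho>). restrict x (disk_series A) \<in> U})"
proof -
  define S where "S \<rho> U = {x \<in> spectrum (tate A \<rho>). restrict x (disk_series A) \<in> U}"
    for \<rho> and U :: "(('v, 'a) mfps \<Rightarrow> real) set"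
  let ?P = "\<lambda>U. U \<subseteq> open_disk A \<and> (\<forall>\<rho>\<in>{0<..<1}. openin (spectrum_top (tate A \<rho>)) (S \<rho> U))"
  have Int: "S \<rho> (U \<inter> V) = S \<rho> U \<inter> S \<rho> V" and Un: "S \<rho> (\<Union>\<K>) = (\<Union>K\<in>\<K>. S \<rho> K)"
    for \<rho> U V \<K>
    by (auto simp: S_def)
  have "istopology ?P"
    unfolding istopology_def
  proof (intro conjI allI impI)
    fix U V assume "?P U" "?P V"
    then show "U \<inter> V \<subseteq> open_disk A" by blast
    show "\<forall>\<rho>\<in>{0<..<1}. openin (spectrum_top (tate A \<rho>)) (S \<rho> (U \<inter> V))"
      using \<open>?P U\<close> \<open>?P V\<close> by (simp add: Int openin_Int)
  next
    fix \<K> assume K: "\<forall>K\<in>\<K>. ?P K"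
    then show "\<Union>\<K> \<subseteq> open_disk A" by blast
    show "\<forall>\<rho>\<in>{0<..<1}. openin (spectrum_top (tate A \<rho>)) (S \<rho> (\<Union>\<K>))"
    proof
      fix \<rho> :: real assume "\<rho> \<in> {0<..<1}"
      with K have "\<And>T. T \<in> S \<rho> ` \<K> \<Longrightarrow> openin (spectrum_top (tate A \<rho>)) T" by auto
      then show "openin (spectrum_top (tate A \<rho>)) (S \<rho> (\<Union>\<K>))"
        unfolding Un by (rule openin_Union)
    qed
  qed
  then show ?thesis
    unfolding open_disk_top_def S_def by (simp add: topology_inverse')
qed

lemma topspace_open_disk_top [simp]:
  fixes A :: "('k, 'a::comm_ring_1) normed_alg"
  shows "topspace (open_disk_top A :: (('b, 'a) mfps \<Rightarrow> real) topology) = open_disk A"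
proof -
  have "{x \<in> spectrum (tate A \<rho>). restrict x (disk_series A) \<in> (open_disk A :: (('b, 'a) mfps \<Rightarrow> real) set)}
      = topspace (spectrum_top (tate A \<rho>))" if "\<rho> \<in> {0<..<1}" for \<rho> :: real
    using that by (auto simp: open_disk_def)
  then have "openin (open_disk_top A) (open_disk A :: (('b, 'a) mfps \<Rightarrow> real) set)"
    unfolding openin_open_disk_top by (metis (no_types, lifting) openin_topspace subset_refl)
  moreover have "U \<subseteq> open_disk A" if "openin (open_disk_top A) U" for U :: "(('b, 'a) mfps \<Rightarrow> real) set"
    using that by (simp add: openin_open_disk_top)
  ultimately show ?thesis
    by (meson openin_subset openin_topspace subset_antisym)
qed

text \<open>
  Since the closed polydisk is affinoid with algebra \<open>k{S}\<close>, an analytic map from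
  \<open>open_disk A\<close> to it is a family of bounded morphisms \<open>\<phi> \<rho> : k{S} \<rightarrow> A{\<rho>\<^sup>-\<^sup>1T}\<close> compatible
  with the inclusions; \<open>F\<close> is the underlying map on points.
\<close>

definition induced_map ::
    "('k::comm_ring_1 \<Rightarrow> real) \<Rightarrow> ('k, 'a::comm_ring_1) normed_alg \<Rightarrow>
     (real \<Rightarrow> ('s, 'k) mfps \<Rightarrow> ('r, 'a) mfps) \<Rightarrow>
     ((('r, 'a) mfps \<Rightarrow> real) \<Rightarrow> (('s, 'k) mfps \<Rightarrow> real)) \<Rightarrow> bool" where
  "induced_map absv A \<phi> F \<longleftrightarrow>
     (\<forall>\<rho>\<in>{0<..<1}. bounded_alg_hom (closed_disk_alg absv) (tate A \<rho>) (\<phi> \<rho>)) \<and>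
     (\<forall>\<rho>\<in>{0<..<1}. \<forall>\<rho>'\<in>{\<rho><..<1}. \<forall>f\<in>alg_carrier (closed_disk_alg absv). \<phi> \<rho>' f = \<phi> \<rho> f) \<and>
     (\<forall>\<rho>\<in>{0<..<1}. \<forall>x\<in>spectrum (tate A \<rho>).
        F (restrict x (disk_series A)) = (\<lambda>f\<in>alg_carrier (closed_disk_alg absv). x (\<phi> \<rho> f)))"

definition analytic_map ::
    "('k::comm_ring_1 \<Rightarrow> real) \<Rightarrow>
     ((('r, 'k) mfps \<Rightarrow> real) \<Rightarrow> (('s, 'k) mfps \<Rightarrow> real)) \<Rightarrow> bool" where
  "analytic_map absv F \<longleftrightarrow> (\<exists>\<phi>. induced_map absv (ground absv) \<phi> F)"


section \<open>The space of analytic maps\<close>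

type_synonym ('r, 's, 'k) coeff_series = "('s \<times> ('r \<Rightarrow>\<^sub>0 nat), 'k) mfps"

text \<open>The algebra \<open>\<T>\<^sub>\<infinity>\<close> on the variables \<open>a\<^sub>l\<^sub>,\<^sub>I = mvar (l, I)\<close>.\<close>

definition mor_alg :: "('k::comm_ring_1 \<Rightarrow> real) \<Rightarrow> ('k, ('r, 's, 'k) coeff_series) normed_alg" where
  "mor_alg absv = tate (ground absv) 1"

definition universal_series :: "'s \<Rightarrow> ('r, ('r, 's, 'k::comm_ring_1) coeff_series) mfps" where
  "universal_series l = Abs_mfps (\<lambda>I. mvar (l, I))"

definition Phi ::
    "('k::comm_ring_1 \<Rightarrow> real) \<Rightarrow>
     (('r, ('r, 's, 'k) coeff_series) mfps \<Rightarrow> real) \<Rightarrow> (('s, 'k) mfps \<Rightarrow> real)" where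
  "Phi absv = (THE F. F \<in> extensional (open_disk (mor_alg absv)) \<and>
     (\<exists>\<phi>. induced_map absv (mor_alg absv) \<phi> F \<and>
       (\<forall>\<rho>\<in>{0<..<1}. \<forall>l. \<phi> \<rho> (mvar l) = universal_series l)))"

text \<open>
  The two projections from the product \<open>open_disk (mor_alg absv)\<close>.  For a rigid point \<open>\<alpha>\<close>, the
  second one identifies the fibre of the first over \<open>\<alpha>\<close> with the open polydisk over \<open>k\<close>.
\<close>

definition proj_mor ::
    "('k::comm_ring_1 \<Rightarrow> real) \<Rightarrow>
     (('r, ('r, 's, 'k) coeff_series) mfps \<Rightarrow> real) \<Rightarrow> (('r, 's, 'k) coeff_series \<Rightarrow> real)" where
  "proj_mor absv p = (\<lambda>g\<in>alg_carrier (mor_alg absv). p (mconst g))"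

definition proj_disk ::
    "('k::comm_ring_1 \<Rightarrow> real) \<Rightarrow>
     (('r, ('r, 's, 'k) coeff_series) mfps \<Rightarrow> real) \<Rightarrow> (('r, 'k) mfps \<Rightarrow> real)" where
  "proj_disk absv p = (\<lambda>f\<in>disk_series (ground absv). p (mmap mconst f))"

definition mor_fibre ::
    "('k::comm_ring_1 \<Rightarrow> real) \<Rightarrow> (('r, 's, 'k) coeff_series \<Rightarrow> real) \<Rightarrow>
     (('r, ('r, 's, 'k) coeff_series) mfps \<Rightarrow> real) set" where
  "mor_fibre absv \<alpha> = {p \<in> open_disk (mor_alg absv). proj_mor absv p = \<alpha>}"

definition Phi_at ::
    "('k::comm_ring_1 \<Rightarrow> real) \<Rightarrow> (('r, 's, 'k) coeff_series \<Rightarrow> real) \<Rightarrow>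
     (('r, 'k) mfps \<Rightarrow> real) \<Rightarrow> (('s, 'k) mfps \<Rightarrow> real)" where
  "Phi_at absv \<alpha> z = Phi absv (inv_into (mor_fibre absv \<alpha>) (proj_disk absv) z)"

end

theory Submission
  imports Defs "Jordan_Normal_Form.Determinant"
begin

text \<open>
  For \<open>w \<in> k\<^sup>r\<close> in the open polydisk, the substitution \<open>S\<^sub>l \<mapsto> \<Sum>\<^sub>I a\<^sub>l\<^sub>,\<^sub>I w\<^sup>I\<close> is a bounded morphism
  from \<open>k{S}\<close> to \<open>\<T>\<^sub>\<infinity>\<close>, along which \<open>\<alpha>\<close> pulls back to a point of the closed polydisk; \<open>Ev(\<alpha>)(z)\<close> is the
  limit of these points as \<open>w\<close> tends to \<open>z\<close>.  Rigid points are dense by induction on the number of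
  variables: if a system of inequalities between polynomials has no solution in \<open>k\<close>, then this is
  certified by a solvable linear system over the valuation ring, and solvability passes to the limit.
  The limit exists and is continuous in \<open>z\<close> and in \<open>\<alpha>\<close> because on a finite-dimensional space every
  seminorm is, up to a factor close to \<open>1\<close>, a maximum of absolute values of linear forms.

  If \<open>\<alpha>\<close> is rigid, reduction of the coefficients at \<open>\<alpha>\<close> identifies \<open>Ev(\<alpha>)\<close> with \<open>\<Phi>(\<alpha>, \<cdot>)\<close>.  Conversely, if
  \<open>Ev(\<alpha>)\<close> is induced by \<open>S\<^sub>l \<mapsto> \<Sum>\<^sub>I c\<^sub>l\<^sub>,\<^sub>I T\<^sup>I\<close>, then \<open>\<alpha>\<close> vanishes on all \<open>\<Sum>\<^sub>I (a\<^sub>l\<^sub>,\<^sub>I - c\<^sub>l\<^sub>,\<^sub>I) w\<^sup>I\<close>, hence on all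
  \<open>a\<^sub>l\<^sub>,\<^sub>I - c\<^sub>l\<^sub>,\<^sub>I\<close>, so that every element of \<open>\<T>\<^sub>\<infinity>\<close> has a value in \<open>k\<close> at \<open>\<alpha>\<close>.
\<close>

section \<open>Non-Archimedean absolute values\<close>

text \<open>Multiplicativity is the obstacle behind the definition of \<open>Ev\<close>. The natural
  candidate for the value at f is the tensor product seminorm of \<alpha> and z on
  \<open>usub f\<close>, read as a sum of coefficients times powers of T, but a tensor product of
  absolute values has no visible reason to be multiplicative. A limit of pullbacks along ring
  morphisms is multiplicative for free, so the work moves to two other points: the neighbourhoods of
  z must contain points of \<open>k^r\<close>, and the limit must exist. For the first, the sizes
  prescribed by z are arbitrary real numbers, and in the induction the coefficients are controlled
  only through finitely many approximate sizes. A statement true at nearby w survives the passage to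
  the limit only if its shape is independent of w; hence certificates whose shape depends only on
  the degrees and the number of the polynomials, obtained from a resultant of fixed size. For the
  second, truncation in the degree of T leaves a finite-dimensional pairing of coefficients with
  monomials in w, on which \<alpha> and z act symmetrically.\<close>

context complete_nonarch_field
begin

lemma absv_0 [simp]: "absv 0 = 0"
  by (simp add: absv_eq_0_iff)

lemma absv_1 [simp]: "absv 1 = 1"
proof -
  have "absv 1 * absv 1 = absv 1" using absv_mult[of 1 1] by simp
  moreover have "absv 1 \<noteq> 0" by (simp add: absv_eq_0_iff)
  ultimately show ?thesis by simp
qed

lemma absv_power: "absv (x ^ n) = absv x ^ n"
  by (induction n) (simp_all add: absv_mult)

lemma absv_minus [simp]: "absv (- x) = absv x"
proof -
  have "absv (- 1) ^ 2 = 1" using absv_mult[of "-1" "-1"] by (simp add: power2_eq_square)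
  then have "absv (- 1) = 1" using absv_nonneg[of "-1"] by (simp add: power2_eq_1_iff)
  then show ?thesis using absv_mult[of "-1" x] by simp
qed

lemma absv_diff: "absv (x - y) \<le> max (absv x) (absv y)"
  using absv_ultrametric[of x "- y"] by simp

lemma absv_diff_commute: "absv (x - y) = absv (y - x)"
  by (metis absv_minus minus_diff_eq)

lemma absv_pos: "x \<noteq> 0 \<Longrightarrow> absv x > 0"
  using absv_nonneg[of x] absv_eq_0_iff[of x] by linarith

lemma absv_inverse: "absv (inverse x) = inverse (absv x)"
proof (cases "x = 0")
  case False
  then have "absv x * absv (inverse x) = 1" using absv_mult[of x "inverse x"] by simp
  then show ?thesis by (metis inverse_unique)
qed simp

lemma absv_divide: "absv (x / y) = absv x / absv y"
  by (simp add: divide_inverse absv_mult absv_inverse)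

lemma absv_sum_le: "(\<And>a. a \<in> A \<Longrightarrow> absv (f a) \<le> B) \<Longrightarrow> 0 \<le> B \<Longrightarrow> absv (sum f A) \<le> B"
proof (induction A rule: infinite_finite_induct)
  case (insert a A)
  then show ?case using absv_ultrametric[of "f a" "sum f A"] by fastforce
qed auto

lemma absv_sum_less: "(\<And>a. a \<in> A \<Longrightarrow> absv (f a) < B) \<Longrightarrow> 0 < B \<Longrightarrow> absv (sum f A) < B"
proof (induction A rule: infinite_finite_induct)
  case (insert a A)
  then show ?case using absv_ultrametric[of "f a" "sum f A"] by fastforce
qed auto

lemma absv_of_nat_le_1: "absv (of_nat n) \<le> 1"
proof (induction n)
  case (Suc n)
  then show ?case using absv_ultrametric[of 1 "of_nat n"] by simp
qed simp

lemma absv_add_eq: "absv y < absv x \<Longrightarrow> absv (x + y) = absv x"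
  using absv_ultrametric[of x y] absv_diff[of "x + y" y] by fastforce

lemma absv_diff_eq: "absv y < absv x \<Longrightarrow> absv (x - y) = absv x"
  using absv_add_eq[of "- y" x] by simp

lemma absv_diff_generic: "absv x \<noteq> absv y \<Longrightarrow> absv (x - y) = max (absv x) (absv y)"
  using absv_diff_eq[of y x] absv_diff_eq[of x y] absv_diff_commute[of x y] by linarith

lemma absv_gt_1: "\<exists>x. absv x > 1"
proof -
  obtain x where x: "x \<noteq> 0" "absv x \<noteq> 1" using absv_nontrivial by blast
  show ?thesis
  proof (cases "absv x > 1")
    case False
    then have "absv (inverse x) > 1" using x absv_pos[of x] by (simp add: absv_inverse one_less_inverse_iff)
    then show ?thesis by blast
  qed blast
qed

text \<open>The powers of an element of absolute value above 1 are pairwise distinct.\<close>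

lemma infinite_field: "infinite (UNIV :: 'k set)"
proof
  obtain x where x: "absv x > 1" using absv_gt_1 by blast
  assume "finite (UNIV :: 'k set)"
  then have "finite (range (\<lambda>n::nat. x ^ n))" by (rule rev_finite_subset) simp
  moreover have "inj (\<lambda>n::nat. x ^ n)"
  proof (rule injI)
    fix m n :: nat assume "x ^ m = x ^ n"
    then have "absv x ^ m = absv x ^ n" by (metis absv_power)
    then show "m = n" using x by simp
  qed
  ultimately show False by (simp add: finite_image_iff)
qed

lemma poly_eqI_field:
  fixes p q :: "'k poly"
  assumes "\<And>x. poly p x = poly q x" shows "p = q"
proof (rule ccontr)
  assume "p \<noteq> q"
  then have "finite {x. poly (p - q) x = 0}" by (intro poly_roots_finite) simp
  moreover have "{x. poly (p - q) x = 0} = UNIV" using assms by auto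
  ultimately show False using infinite_field by simp
qed

end

section \<open>Density of the value group and the growth of polynomials in one variable\<close>

locale alg_closed_nonarch_field = complete_nonarch_field absv
  for absv :: "'k::alg_closed_field \<Rightarrow> real"
begin

text \<open>Roots of high order of an element of absolute value above 1 have absolute values q
  tending to 1. Once \<open>q < b / a\<close>, consecutive powers of q are too close to jump over
  the interval, and the first power beyond a lies in it.\<close>

lemma absv_dense:
  assumes "0 < a" "a < b" obtains x where "a < absv x" "absv x < b"
proof -
  obtain y where y: "absv y > 1" using absv_gt_1 by blast
  have "(\<lambda>n. absv y powr (1 / real (Suc n))) \<longlonglongrightarrow> absv y powr 0"
    using y by (intro tendsto_powr tendsto_const LIMSEQ_Suc[OF lim_1_over_n]) auto
  moreover have "absv y powr 0 < b / a" using y assms by simp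
  ultimately have "eventually (\<lambda>n. absv y powr (1 / real (Suc n)) < b / a) sequentially"
    by (rule order_tendstoD)
  then obtain n where n: "absv y powr (1 / real (Suc n)) < b / a"
    by (meson eventually_sequentially le_refl)
  obtain z where z: "z ^ Suc n = y" using nth_root_exists[of "Suc n" y] by blast
  define q where "q = absv z"
  have "z \<noteq> 0" using z y by auto
  then have "q > 0" using absv_pos[of z] by (simp add: q_def)
  have q: "q ^ Suc n = absv y" using z by (metis absv_power q_def)
  have "absv y powr (1 / real (Suc n)) = (q powr real (Suc n)) powr (1 / real (Suc n))"
    using q \<open>q > 0\<close> by (simp only: powr_realpow)
  also have "\<dots> = q" unfolding powr_powr using \<open>q > 0\<close> by simp
  finally have qb: "q * a < b" using n assms by (simp add: field_simps)
  have q1: "q > 1" using q y \<open>q > 0\<close>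
    by (metis less_imp_le linorder_not_le power_le_one)
  \<comment> \<open>The least integer with \<open>a < q powr m\<close>; its predecessor gives a
    power at most a, whence \<open>q powr m \<le> q * a < b\<close>.\<close>
  define m where "m = \<lfloor>log q a\<rfloor> + 1"
  have "a < q powr m"
  proof -
    have "log q a < real_of_int m" unfolding m_def by linarith
    then show ?thesis using q1 assms by (simp add: log_less_iff)
  qed
  moreover have "q powr m \<le> q * a"
  proof -
    have "real_of_int m - 1 \<le> log q a" by (simp add: m_def)
    then have "q powr (real_of_int m - 1) \<le> a" using q1 assms by (simp add: le_log_iff)
    then show ?thesis using q1 by (simp add: powr_diff field_simps)
  qed
  moreover have "q powr m = absv (z powi m)"
    using \<open>q > 0\<close> by (simp add: powr_real_of_int power_int_def absv_power absv_inverse q_def power_inverse)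
  ultimately show ?thesis using that[of "z powi m"] qb by simp
qed

text \<open>A forbidden value inside the interval is avoided by passing to the part of the interval
  below it.\<close>

lemma absv_dense_avoid:
  assumes "finite Z" "0 < a" "a < b" obtains x where "a < absv x" "absv x < b" "absv x \<notin> Z"
proof -
  have "\<exists>x. a < absv x \<and> absv x < b \<and> absv x \<notin> Z" using assms
  proof (induction Z arbitrary: a b rule: finite_induct)
    case empty
    then show ?case using absv_dense by (metis empty_iff)
  next
    case (insert z Z)
    show ?case
    proof (cases "z < b \<and> z > a")
      case True
      then show ?thesis using insert.IH[of a z] insert.prems by force
    next
      case False
      then show ?thesis using insert.IH[of a b] insert.prems by force
    qed
  qed
  then show ?thesis using that by blast
qed

text \<open>The exceptional radii are the absolute values of the roots. Away from them each linear
  factor satisfies \<open>absv (t - z) = max (absv t) (absv z)\<close>, and the product of these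
  maxima bounds every term of p, so that |p(t)| is the Gauss norm of radius |t|.\<close>

lemma poly_generic:
  fixes p :: "'k poly"
  assumes "p \<noteq> 0"
  shows "\<exists>Z. finite Z \<and> (\<forall>t. absv t \<notin> Z \<longrightarrow> (\<forall>i. absv (coeff p i) * absv t ^ i \<le> absv (poly p t)))"
  using assms
proof (induction "degree p" arbitrary: p)
  case 0
  then obtain c where "p = [:c:]" by (metis degree_eq_zeroE)
  then show ?case by (intro exI[of _ "{}"]) (auto simp: coeff_pCons absv_nonneg split: nat.splits)
next
  case (Suc n)
  then obtain z where "poly p z = 0" using alg_closed_imp_poly_has_root[of p] by auto
  then obtain q where pq: "p = [:- z, 1:] * q" by (metis dvdE poly_eq_0_iff_dvd)
  then have q0: "q \<noteq> 0" using Suc.prems by auto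
  then have "degree p = Suc (degree q)" unfolding pq by (subst degree_mult_eq) auto
  then have "n = degree q" using Suc.hyps by simp
  then obtain Z where Z: "finite Z"
    "\<And>t i. absv t \<notin> Z \<Longrightarrow> absv (coeff q i) * absv t ^ i \<le> absv (poly q t)"
    using Suc.hyps(1)[OF _ q0] by blast
  have "absv (coeff p i) * absv t ^ i \<le> absv (poly p t)" if t: "absv t \<notin> insert (absv z) Z" for t i
  proof -
    have nn: "0 \<le> absv t" "0 \<le> absv z" "0 \<le> absv (poly q t)" by (rule absv_nonneg)+
    have pt: "absv (poly p t) = max (absv t) (absv z) * absv (poly q t)"
    proof -
      have "poly p t = (t - z) * poly q t" unfolding pq by (simp add: algebra_simps)
      then show ?thesis using absv_diff_generic[of t z] t by (simp add: absv_mult)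
    qed
    have a: "absv (coeff p i) * absv t ^ i \<le> max (absv (z * coeff q i) * absv t ^ i)
        (absv (case i of 0 \<Rightarrow> 0 | Suc j \<Rightarrow> coeff q j) * absv t ^ i)"
    proof -
      have "coeff p i = (case i of 0 \<Rightarrow> 0 | Suc j \<Rightarrow> coeff q j) - z * coeff q i"
        unfolding pq by (simp add: coeff_pCons split: nat.split)
      then have "absv (coeff p i) \<le> max (absv (case i of 0 \<Rightarrow> 0 | Suc j \<Rightarrow> coeff q j)) (absv (z * coeff q i))"
        using absv_diff by simp
      then have "absv (coeff p i) * absv t ^ i \<le> max (absv (case i of 0 \<Rightarrow> 0 | Suc j \<Rightarrow> coeff q j)) (absv (z * coeff q i)) * absv t ^ i"
        by (rule mult_right_mono) (simp add: nn)
      then show ?thesis by (simp add: max_mult_distrib_right nn max.commute)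
    qed
    have b: "absv (z * coeff q i) * absv t ^ i \<le> absv (poly p t)"
    proof -
      have "absv z * (absv (coeff q i) * absv t ^ i) \<le> max (absv t) (absv z) * absv (poly q t)"
        using Z(2)[of t i] t nn by (intro mult_mono) (auto intro: mult_nonneg_nonneg absv_nonneg)
      then show ?thesis by (simp add: pt absv_mult mult.assoc)
    qed
    have c: "absv (case i of 0 \<Rightarrow> 0 | Suc j \<Rightarrow> coeff q j) * absv t ^ i \<le> absv (poly p t)"
    proof (cases i)
      case (Suc j)
      have "absv t * (absv (coeff q j) * absv t ^ j) \<le> max (absv t) (absv z) * absv (poly q t)"
        using Z(2)[of t j] t nn by (intro mult_mono) (auto intro: mult_nonneg_nonneg absv_nonneg)
      then show ?thesis by (simp add: pt Suc mult_ac)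
    qed (simp add: absv_nonneg)
    show ?thesis using a b c by linarith
  qed
  then show ?case using Z(1) by (intro exI[of _ "insert (absv z) Z"]) auto
qed

text \<open>At generic radii tending to 1 every single term of p is bounded by the value of p, by
  \<open>poly_generic\<close>.\<close>

lemma max_modulus:
  fixes p :: "'k poly"
  assumes "\<And>t. absv t < 1 \<Longrightarrow> absv (poly p t) \<le> C"
  shows "absv (coeff p i) \<le> C"
proof (cases "p = 0")
  case True
  then show ?thesis using assms[of 0] by simp
next
  case False
  then obtain Z where Z: "finite Z" "\<And>t i. absv t \<notin> Z \<Longrightarrow> absv (coeff p i) * absv t ^ i \<le> absv (poly p t)"
    using poly_generic[OF False] by metis
  show ?thesis
  proof (rule field_le_mult_one_interval)
    fix x :: real assume x: "0 < x" "x < 1"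
    \<comment> \<open>The root of order \<open>Suc i\<close> avoids a separate case i = 0, and
      \<open>y ^ i\<close> is still at least x.\<close>
    define y where "y = root (Suc i) x"
    have y: "0 < y" "y < 1" "y ^ Suc i = x"
      using x real_root_pow_pos[of "Suc i" x] by (simp_all add: y_def del: power_Suc)
    obtain t where t: "y < absv t" "absv t < 1" "absv t \<notin> Z" by (rule absv_dense_avoid[OF Z(1) y(1,2)])
    have "x \<le> y ^ i" using power_decreasing[of i "Suc i" y] y by (simp del: power_Suc)
    also have "\<dots> \<le> absv t ^ i" using t y by (intro power_mono) auto
    finally have "x * absv (coeff p i) \<le> absv t ^ i * absv (coeff p i)" by (intro mult_right_mono absv_nonneg)
    also have "\<dots> \<le> C" using Z(2)[OF t(3), of i] assms[OF t(2)] by (simp add: mult.commute)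
    finally show "x * absv (coeff p i) \<le> C" .
  qed
qed

text \<open>All roots have absolute value at least 1, so each linear factor has the constant size
  \<open>absv z\<close> on the open disk.\<close>

lemma absv_poly_const:
  fixes p :: "'k poly"
  assumes "\<And>t. absv t < 1 \<Longrightarrow> poly p t \<noteq> 0" "absv t < 1"
  shows "absv (poly p t) = absv (poly p 0)"
  using assms(1)
proof (induction "degree p" arbitrary: p)
  case 0
  then obtain c where "p = [:c:]" by (metis degree_eq_zeroE)
  then show ?case by simp
next
  case (Suc n)
  have "degree p > 0" using Suc.hyps(2) by simp
  then obtain z where z: "poly p z = 0" using alg_closed_imp_poly_has_root[of p] by blast
  then obtain q where pq: "p = [:- z, 1:] * q" by (metis dvdE poly_eq_0_iff_dvd)
  have "poly p 0 \<noteq> 0" by (rule Suc.prems) simp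
  then have "q \<noteq> 0" unfolding pq by auto
  then have "degree p = Suc (degree q)" unfolding pq by (subst degree_mult_eq) auto
  then have n: "n = degree q" using Suc.hyps(2) by simp
  have "poly q t \<noteq> 0" if "absv t < 1" for t
    using Suc.prems[OF that] unfolding pq by (metis mult_zero_right poly_mult)
  from Suc.hyps(1)[OF n this] have IH: "absv (poly q t) = absv (poly q 0)" .
  have "absv z \<ge> 1" using Suc.prems[of z] z by linarith
  then have "absv (t - z) = absv z" using absv_diff_eq[of t z] assms(2) absv_diff_commute[of t z] by simp
  moreover have "poly p t = (t - z) * poly q t" "poly p 0 = - z * poly q 0"
    unfolding pq by (simp_all add: algebra_simps)
  ultimately show ?case using IH by (simp add: absv_mult)
qed

end

section \<open>Elimination of one variable\<close>

text \<open>Ternary forms of degree e, seen as functions. The variable w homogenises: setting w = 1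
  gives the \<open>bivar\<close> polynomial with the same coefficients.\<close>

definition homog :: "nat \<Rightarrow> ('k::comm_ring_1 \<Rightarrow> 'k \<Rightarrow> 'k \<Rightarrow> 'k) \<Rightarrow> bool" where
  "homog e f \<longleftrightarrow> (\<exists>c. \<forall>x y w. f x y w = (\<Sum>(i, j)\<in>{(i, j). i + j \<le> e}. c i j * x ^ i * y ^ j * w ^ (e - i - j)))"

lemma homogE:
  assumes "homog e f"
  obtains c where "\<forall>x y w. f x y w = (\<Sum>(i, j)\<in>{(i, j). i + j \<le> e}. c i j * x ^ i * y ^ j * w ^ (e - i - j))"
  using assms unfolding homog_def by (elim exE) (rule that)

lemma finite_index_pairs [simp]: "finite {(i, j). i + j \<le> (e::nat)}"
  by (rule finite_subset[of _ "{..e} \<times> {..e}"]) auto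

lemma homog_0: "homog e (\<lambda>x y w. 0)"
  unfolding homog_def by (rule exI[of _ "\<lambda>i j. 0"]) auto

lemma homog_add: "homog e f \<Longrightarrow> homog e g \<Longrightarrow> homog e (\<lambda>x y w. f x y w + g x y w)"
proof -
  assume fg: "homog e f" "homog e g"
  obtain c where c: "\<forall>x y w. f x y w = (\<Sum>(i, j)\<in>{(i, j). i + j \<le> e}. c i j * x ^ i * y ^ j * w ^ (e - i - j))"
    by (rule homogE[OF fg(1)])
  obtain d where d: "\<forall>x y w. g x y w = (\<Sum>(i, j)\<in>{(i, j). i + j \<le> e}. d i j * x ^ i * y ^ j * w ^ (e - i - j))"
    by (rule homogE[OF fg(2)])
  show ?thesis unfolding homog_def
    by (intro exI[of _ "\<lambda>i j. c i j + d i j"])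
      (simp add: c d case_prod_beta distrib_right flip: sum.distrib)
qed

lemma homog_cmult: "homog e f \<Longrightarrow> homog e (\<lambda>x y w. a * f x y w)"
proof -
  assume f: "homog e f"
  obtain c where c: "\<forall>x y w. f x y w = (\<Sum>(i, j)\<in>{(i, j). i + j \<le> e}. c i j * x ^ i * y ^ j * w ^ (e - i - j))"
    by (rule homogE[OF f])
  show ?thesis unfolding homog_def
    by (intro exI[of _ "\<lambda>i j. a * c i j"])
      (simp add: c case_prod_beta mult.assoc sum_distrib_left)
qed

lemma homog_sum: "(\<And>a. a \<in> A \<Longrightarrow> homog e (f a)) \<Longrightarrow> homog e (\<lambda>x y w. \<Sum>a\<in>A. f a x y w)"
  by (induction A rule: infinite_finite_induct) (simp_all add: homog_0 homog_add)

lemma homog_monom: "a + b \<le> e \<Longrightarrow> homog e (\<lambda>x y w. x ^ a * y ^ b * w ^ (e - a - b))"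
proof -
  assume ab: "a + b \<le> e"
  show ?thesis unfolding homog_def
  proof (intro exI[of _ "\<lambda>i j. if (i, j) = (a, b) then 1 else 0"] allI)
    fix x y w :: 'a
    have "(\<Sum>(i, j)\<in>{(i, j). i + j \<le> e}. (if (i, j) = (a, b) then 1 else 0) * x ^ i * y ^ j * w ^ (e - i - j))
      = (\<Sum>p\<in>{(i, j). i + j \<le> e}. if p = (a, b) then x ^ a * y ^ b * w ^ (e - a - b) else 0)"
      by (intro sum.cong refl) (auto simp: case_prod_beta prod_eq_iff)
    also have "\<dots> = x ^ a * y ^ b * w ^ (e - a - b)"
      using ab by (subst sum.delta) auto
    finally show "x ^ a * y ^ b * w ^ (e - a - b) = (\<Sum>(i, j)\<in>{(i, j). i + j \<le> e}. (if (i, j) = (a, b) then 1 else 0) * x ^ i * y ^ j * w ^ (e - i - j))" by simp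
  qed
qed

lemma homog_mult_linear:
  assumes "homog e f"
  shows "homog (Suc e) (\<lambda>x y w. (a * w + b * x + c * y) * f x y w)"
proof -
  obtain d where d: "\<forall>x y w. f x y w = (\<Sum>(i, j)\<in>{(i, j). i + j \<le> e}. d i j * x ^ i * y ^ j * w ^ (e - i - j))"
    by (rule homogE[OF assms])
  have "(a * w + b * x + c * y) * f x y w =
    (\<Sum>p\<in>{(i, j). i + j \<le> e}. (a * d (fst p) (snd p)) * (x ^ fst p * y ^ snd p * w ^ (Suc e - fst p - snd p))
       + ((b * d (fst p) (snd p)) * (x ^ Suc (fst p) * y ^ snd p * w ^ (Suc e - Suc (fst p) - snd p))
       + (c * d (fst p) (snd p)) * (x ^ fst p * y ^ Suc (snd p) * w ^ (Suc e - fst p - Suc (snd p)))))" for x y w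
    unfolding d[rule_format] sum_distrib_left
    by (intro sum.cong) (auto simp: Suc_diff_le algebra_simps)
  moreover have "homog (Suc e) (\<lambda>x y w. \<Sum>p\<in>{(i, j). i + j \<le> e}. (a * d (fst p) (snd p)) * (x ^ fst p * y ^ snd p * w ^ (Suc e - fst p - snd p))
       + ((b * d (fst p) (snd p)) * (x ^ Suc (fst p) * y ^ snd p * w ^ (Suc e - Suc (fst p) - snd p))
       + (c * d (fst p) (snd p)) * (x ^ fst p * y ^ Suc (snd p) * w ^ (Suc e - fst p - Suc (snd p)))))"
    by (intro homog_sum homog_add homog_cmult homog_monom) auto
  ultimately show ?thesis by presburger
qed

lemma homog_prod_linear:
  "homog n (\<lambda>x y w. \<Prod>i<n. (a i * w + b i * x + c i * y))"
proof (induction n)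
  case 0
  show ?case using homog_monom[of 0 0 0] by simp
next
  case (Suc n)
  show ?case using homog_mult_linear[OF Suc, of "a n" "b n" "c n"] by (simp add: mult.commute)
qed

text \<open>Every entry is a linear form in x, y and w, and the Leibniz formula is a sum of products
  of n entries.\<close>

lemma homog_det:
  "homog n (\<lambda>x y w. Determinant.det (mat n n (\<lambda>(i, j). a i j * w + b i j * x + c i j * y)))"
proof -
  have "Determinant.det (mat n n (\<lambda>(i, j). a i j * w + b i j * x + c i j * y)) =
     (\<Sum>p\<in>{p. p permutes {0..<n}}. signof p * (\<Prod>i<n. a i (p i) * w + b i (p i) * x + c i (p i) * y))" for x y w
  proof (subst det_def'[of _ n], simp, intro sum.cong refl arg_cong2[where f = "(*)"])
    fix p assume "p \<in> {p. p permutes {0..<n}}"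
    then have "p i < n" if "i < n" for i using permutes_in_image[of p "{0..<n}" i] that by simp
    then show "(\<Prod>i = 0..<n. mat n n (\<lambda>(i, j). a i j * w + b i j * x + c i j * y) $$ (i, p i)) =
      (\<Prod>i<n. a i (p i) * w + b i (p i) * x + c i (p i) * y)"
      by (intro prod.cong) auto
  qed
  moreover have "homog n (\<lambda>x y w. \<Sum>p\<in>{p. p permutes {0..<n}}. signof p * (\<Prod>i<n. a i (p i) * w + b i (p i) * x + c i (p i) * y))"
    by (intro homog_sum homog_cmult homog_prod_linear)
  ultimately show ?thesis by presburger
qed

text \<open>The matrix of \<open>(X, Z) \<mapsto> X * A + Z * B\<close> on pairs of polynomials of degree less than \<open>D\<close>.\<close>

definition elim_mat :: "nat \<Rightarrow> 'k::field poly \<Rightarrow> 'k poly \<Rightarrow> 'k mat" where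
  "elim_mat D A B = mat (2 * D) (2 * D)
     (\<lambda>(i, j). if j < D then coeff (monom 1 j * A) i else coeff (monom 1 (j - D) * B) i)"

lemma elim_mat_mult:
  fixes v :: "'k::field vec"
  assumes v: "v \<in> carrier_vec (2 * D)" and i: "i < 2 * D"
  shows "(elim_mat D A B *\<^sub>v v) $ i =
    coeff ((\<Sum>j<D. monom (v $ j) j) * A + (\<Sum>j<D. monom (v $ (D + j)) j) * B) i"
proof -
  have s: "{0..<2 * D} = {0..<D} \<union> (\<lambda>j. D + j) ` {0..<D}"
    by (auto simp: image_add_atLeastLessThan)
  have s': "{0..<D} \<inter> (\<lambda>j. D + j) ` {0..<D} = {}"
    by (auto simp: image_add_atLeastLessThan)
  have c: "coeff (monom (c::'k) j * A) i = coeff (monom 1 j * A) i * c" for c j A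
    by (simp add: coeff_monom_mult)
  have "(elim_mat D A B *\<^sub>v v) $ i = (\<Sum>j\<in>{0..<2 * D}. elim_mat D A B $$ (i, j) * v $ j)"
    using v i by (simp add: elim_mat_def scalar_prod_def)
  also have "\<dots> = (\<Sum>j\<in>{0..<D}. elim_mat D A B $$ (i, j) * v $ j) + (\<Sum>j\<in>{0..<D}. elim_mat D A B $$ (i, D + j) * v $ (D + j))"
    unfolding s by (subst sum.union_disjoint) (simp_all only: s' finite_atLeastLessThan finite_imageI sum.reindex[OF inj_on_add] o_def)
  also have "\<dots> = (\<Sum>j<D. coeff (monom 1 j * A) i * v $ j) + (\<Sum>j<D. coeff (monom 1 j * B) i * v $ (D + j))"
    unfolding lessThan_atLeast0 using i by (intro arg_cong2[where f = "(+)"] sum.cong refl) (auto simp: elim_mat_def)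
  also have "\<dots> = coeff ((\<Sum>j<D. monom (v $ j) j) * A + (\<Sum>j<D. monom (v $ (D + j)) j) * B) i"
    by (simp only: sum_distrib_right coeff_sum c[of "v $ _"] coeff_add)
  finally show ?thesis .
qed

lemma degree_sum_monom_less: "0 < D \<Longrightarrow> degree (\<Sum>j<D. monom (f j) j) < D"
  by (rule degree_sum_less) (auto intro: le_less_trans[OF degree_monom_le])

text \<open>Multiplying from the left by the row of powers of b evaluates the columns, which list
  the coefficients of the shifts of A and B, at b. This row is therefore a nonzero kernel vector of
  the transpose.\<close>

lemma elim_mat_common_root:
  fixes A B :: "'k::field poly"
  assumes D: "0 < D" and AB: "degree A \<le> D" "degree B < D" and "poly A b = 0" "poly B b = 0"
  shows "Determinant.det (elim_mat D A B) = 0"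
proof -
  let ?M = "elim_mat D A B"
  have M: "?M \<in> carrier_mat (2 * D) (2 * D)" by (simp add: elim_mat_def)
  define v where "v = vec (2 * D) (\<lambda>i. b ^ i)"
  have ev: "(\<Sum>i\<in>{0..<2 * D}. coeff p i * b ^ i) = poly p b" if "degree p < 2 * D" for p
  proof -
    have "poly p b = (\<Sum>i\<le>degree p. coeff p i * b ^ i)" by (rule poly_altdef)
    also have "\<dots> = (\<Sum>i\<in>{0..<2 * D}. coeff p i * b ^ i)"
      using that by (intro sum.mono_neutral_left) (auto simp: coeff_eq_0)
    finally show ?thesis by simp
  qed
  have d: "degree (monom 1 j * A) < 2 * D" "degree (monom 1 j * B) < 2 * D" if "j < D" for j
    using that AB degree_mult_le[of "monom 1 j" A] degree_mult_le[of "monom 1 j" B] degree_monom_le[of "1::'k" j]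
    by linarith+
  have "?M\<^sup>T *\<^sub>v v = 0\<^sub>v (2 * D)"
  proof (rule eq_vecI)
    fix j assume "j < dim_vec (0\<^sub>v (2 * D) :: 'k vec)"
    then have j: "j < 2 * D" by simp
    have "(?M\<^sup>T *\<^sub>v v) $ j = (\<Sum>i\<in>{0..<2 * D}. ?M $$ (i, j) * b ^ i)"
      using j by (simp add: elim_mat_def v_def scalar_prod_def)
    also have "\<dots> = 0"
    proof (cases "j < D")
      case True
      then have "(\<Sum>i\<in>{0..<2 * D}. ?M $$ (i, j) * b ^ i) = (\<Sum>i\<in>{0..<2 * D}. coeff (monom 1 j * A) i * b ^ i)"
        using j by (intro sum.cong) (auto simp: elim_mat_def)
      then show ?thesis using ev[OF d(1)[OF True]] assms by simp
    next
      case False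
      then have jD: "j - D < D" using j by simp
      have "(\<Sum>i\<in>{0..<2 * D}. ?M $$ (i, j) * b ^ i) = (\<Sum>i\<in>{0..<2 * D}. coeff (monom 1 (j - D) * B) i * b ^ i)"
        using j False by (intro sum.cong) (auto simp: elim_mat_def)
      then show ?thesis using ev[OF d(2)[OF jD]] assms by simp
    qed
    finally show "(?M\<^sup>T *\<^sub>v v) $ j = 0\<^sub>v (2 * D) $ j" using j by simp
  qed (simp add: elim_mat_def)
  moreover have "v \<noteq> 0\<^sub>v (2 * D)"
  proof
    assume "v = 0\<^sub>v (2 * D)"
    then have "v $ 0 = 0" using D by simp
    then show False using D by (simp add: v_def)
  qed
  ultimately have "Determinant.det (?M\<^sup>T) = 0"
    using M by (subst det_0_iff_vec_prod_zero_field[of _ "2 * D"]) (auto simp: v_def intro!: exI[of _ v])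
  then show ?thesis using det_transpose[OF M] by simp
qed

text \<open>The roots of A are split off one at a time, with multiplicity; each is a root of Z
  because it is not a root of B.\<close>

lemma dvd_of_no_common_root:
  fixes A B Z :: "'k::alg_closed_field poly"
  assumes "A dvd Z * B" "A \<noteq> 0" "\<And>b. poly A b = 0 \<Longrightarrow> poly B b \<noteq> 0"
  shows "A dvd Z"
  using assms
proof (induction "degree A" arbitrary: A Z)
  case 0
  then show ?case by (metis is_unit_iff_degree unit_imp_dvd)
next
  case (Suc n)
  then obtain a where a: "poly A a = 0" using alg_closed_imp_poly_has_root[of A] by (metis zero_less_Suc)
  then obtain A' where A: "A = [:- a, 1:] * A'" by (metis dvdE poly_eq_0_iff_dvd)
  obtain C where C: "Z * B = A * C" using Suc.prems(1) by (rule dvdE)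
  have "poly Z a * poly B a = 0" using arg_cong[OF C, of "\<lambda>p. poly p a"] a by simp
  then have "poly Z a = 0" using Suc.prems(3)[OF a] by simp
  then obtain Z' where Z: "Z = [:- a, 1:] * Z'" by (metis dvdE poly_eq_0_iff_dvd)
  have "[:- a, 1:] * (Z' * B) = [:- a, 1:] * (A' * C)" using C unfolding A Z by (simp only: mult.assoc)
  then have ZB: "Z' * B = A' * C" by (subst (asm) mult_cancel_left) simp
  have A'0: "A' \<noteq> 0" using Suc.prems(2) A by auto
  have dA: "degree A = Suc (degree A')" unfolding A using A'0 by (subst degree_mult_eq) auto
  have rA': "poly B b \<noteq> 0" if "poly A' b = 0" for b
    using that by (intro Suc.prems(3)) (simp add: A)
  have "n = degree A'" using Suc.hyps(2) dA by simp
  moreover have "A' dvd Z' * B" unfolding ZB by simp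
  ultimately have "A' dvd Z'" using A'0 rA' by (rule Suc.hyps(1))
  then show ?case unfolding A Z by (rule mult_dvd_mono[OF dvd_refl])
qed

text \<open>A kernel vector is a relation \<open>X * A + Z * B = 0\<close> with X and Z of degree
  below D. Without a common root A divides Z, whose degree is smaller than that of A, so the
  relation is trivial.\<close>

lemma elim_mat_singular:
  fixes A B :: "'k::alg_closed_field poly"
  assumes D: "0 < D" and AB: "degree A = D" "degree B < D" and "Determinant.det (elim_mat D A B) = 0"
  shows "\<exists>b. poly A b = 0 \<and> poly B b = 0"
proof (rule ccontr)
  assume no: "\<not> ?thesis"
  let ?M = "elim_mat D A B"
  have M: "?M \<in> carrier_mat (2 * D) (2 * D)" by (simp add: elim_mat_def)
  obtain v where v: "v \<in> carrier_vec (2 * D)" "v \<noteq> 0\<^sub>v (2 * D)" "?M *\<^sub>v v = 0\<^sub>v (2 * D)"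
    using assms(4) det_0_iff_vec_prod_zero_field[OF M] by auto
  define X where "X = (\<Sum>j<D. monom (v $ j) j)"
  define Z where "Z = (\<Sum>j<D. monom (v $ (D + j)) j)"
  have dX: "degree X < D" and dZ: "degree Z < D"
    unfolding X_def Z_def by (rule degree_sum_monom_less[OF D])+
  have "degree (X * A + Z * B) < 2 * D"
    using degree_mult_le[of X A] degree_mult_le[of Z B] dX dZ AB D
    by (intro degree_add_less) linarith+
  then have "coeff (X * A + Z * B) i = 0" for i
    using elim_mat_mult[OF v(1), of i A B] v(3) coeff_eq_0[of "X * A + Z * B" i]
    by (cases "i < 2 * D") (auto simp: X_def Z_def)
  then have eq: "X * A + Z * B = 0" by (simp add: poly_eq_iff)
  have A0: "A \<noteq> 0" using AB D by auto
  have "A dvd Z * B" using eq by (metis add.commute add_eq_0_iff dvd_minus_iff dvd_triv_right)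
  then have "A dvd Z" using no A0 by (intro dvd_of_no_common_root[of A Z B]) auto
  then have "Z = 0" using dZ AB(1) by (metis dvd_imp_degree_le leD)
  then have "X = 0" using eq A0 by simp
  have cX: "coeff X j = v $ j" "coeff Z j = v $ (D + j)" if "j < D" for j
    using that by (simp_all add: X_def Z_def coeff_sum)
  have "v $ i = 0" if i: "i < 2 * D" for i
    using cX(1)[of i] cX(2)[of "i - D"] i \<open>X = 0\<close> \<open>Z = 0\<close> by (cases "i < D") auto
  then have "v = 0\<^sub>v (2 * D)" using v(1) by (intro eq_vecI) auto
  with v(2) show False by simp
qed

text \<open>R is the Sylvester determinant of \<open>w F1 - x G\<close> and
  \<open>w F2 - y G\<close>: an equation for the rational plane curve parametrised by (F1 : F2 : G).
  Conversely, its zeros with w = 1 come from a parameter b.\<close>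

lemma elimination:
  fixes F1 F2 G :: "'k::alg_closed_field poly"
  assumes D: "0 < D" and "degree F1 = D" "degree F2 < D" "degree G < D"
  obtains R where "homog (2 * D) R"
    "\<forall>b. R (poly F1 b) (poly F2 b) (poly G b) = 0"
    "\<forall>x y. R x y 1 = 0 \<longrightarrow> (\<exists>b. poly F1 b = x * poly G b \<and> poly F2 b = y * poly G b)"
proof -
  define A where "A x w = Polynomial.smult w F1 - Polynomial.smult x G" for x w
  define B where "B y w = Polynomial.smult w F2 - Polynomial.smult y G" for y w
  define R where "R x y w = Determinant.det (elim_mat D (A x w) (B y w))" for x y w
  have "homog (2 * D) (\<lambda>x y w. Determinant.det (mat (2 * D) (2 * D) (\<lambda>(i, j).
      (if j < D then coeff (monom 1 j * F1) i else coeff (monom 1 (j - D) * F2) i) * w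
      + (if j < D then - coeff (monom 1 j * G) i else 0) * x
      + (if j < D then 0 else - coeff (monom 1 (j - D) * G) i) * y)))"
    by (rule homog_det)
  also have "(\<lambda>x y w. Determinant.det (mat (2 * D) (2 * D) (\<lambda>(i, j).
      (if j < D then coeff (monom 1 j * F1) i else coeff (monom 1 (j - D) * F2) i) * w
      + (if j < D then - coeff (monom 1 j * G) i else 0) * x
      + (if j < D then 0 else - coeff (monom 1 (j - D) * G) i) * y))) = R"
    unfolding R_def elim_mat_def A_def B_def
    by (intro ext arg_cong[where f = Determinant.det] cong_mat) (auto simp: coeff_monom_mult algebra_simps)
  finally have 1: "homog (2 * D) R" .
  have dA: "degree (A x w) \<le> D" for x w
    unfolding A_def using assms degree_smult_le[of w F1] degree_smult_le[of x G] by (intro degree_diff_le) linarith+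
  have dB: "degree (B y w) < D" for y w
    unfolding B_def using assms degree_smult_le[of w F2] degree_smult_le[of y G] by (intro degree_diff_less) linarith+
  have 2: "R (poly F1 b) (poly F2 b) (poly G b) = 0" for b
    unfolding R_def by (rule elim_mat_common_root[of _ _ _ b, OF D dA dB]) (simp_all add: A_def B_def)
  have 3: "\<exists>b. poly F1 b = x * poly G b \<and> poly F2 b = y * poly G b" if "R x y 1 = 0" for x y
  proof -
    \<comment> \<open>Only F1 reaches degree D, so the leading coefficient survives for w = 1 and no
      common root escapes to infinity.\<close>
    have "degree (A x 1) \<ge> D"
    proof (rule le_degree)
      have "coeff G D = 0" using assms(4) by (rule coeff_eq_0)
      moreover have "coeff F1 D \<noteq> 0" using assms(2) D by auto
      ultimately show "coeff (A x 1) D \<noteq> 0" by (simp add: A_def)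
    qed
    then have "degree (A x 1) = D" using dA by (simp add: le_antisym)
    moreover have "Determinant.det (elim_mat D (A x 1) (B y 1)) = 0" using that by (simp add: R_def)
    ultimately have "\<exists>b. poly (A x 1) b = 0 \<and> poly (B y 1) b = 0" by (intro elim_mat_singular[OF D _ dB])
    then obtain b where "poly (A x 1) b = 0 \<and> poly (B y 1) b = 0" by (elim exE)
    then show ?thesis by (intro exI[of _ b]) (simp add: A_def B_def)
  qed
  show ?thesis by (rule that[of R, OF 1]) (use 2 3 in simp_all)
qed

section \<open>Certificates for inequalities between polynomials in one variable\<close>

definition bivar :: "(nat \<Rightarrow> nat \<Rightarrow> 'k::comm_ring_1) \<Rightarrow> nat \<Rightarrow> 'k \<Rightarrow> 'k \<Rightarrow> 'k" where
  "bivar c e x y = (\<Sum>(i, j)\<in>{(i, j). i + j \<le> e}. c i j * x ^ i * y ^ j)"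

text \<open>The polynomial in x for fixed y, whose coefficients are the polynomials
  \<open>bivar_coeff\<close> in y. Results on one variable are applied along x and then along
  y.\<close>

definition bivar_poly :: "(nat \<Rightarrow> nat \<Rightarrow> 'k::comm_ring_1) \<Rightarrow> nat \<Rightarrow> 'k \<Rightarrow> 'k poly" where
  "bivar_poly c e y = (\<Sum>p\<in>{(i, j). i + j \<le> e}. monom (c (fst p) (snd p) * y ^ snd p) (fst p))"

definition bivar_coeff :: "(nat \<Rightarrow> nat \<Rightarrow> 'k::comm_ring_1) \<Rightarrow> nat \<Rightarrow> nat \<Rightarrow> 'k poly" where
  "bivar_coeff c e i = (\<Sum>p\<in>{(i, j). i + j \<le> e}. if fst p = i then monom (c i (snd p)) (snd p) else 0)"

lemma poly_bivar_poly: "poly (bivar_poly c e y) x = bivar c e x y"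
  by (simp add: bivar_def bivar_poly_def poly_sum poly_monom case_prod_beta mult_ac)

lemma coeff_bivar_poly: "coeff (bivar_poly c e y) i = poly (bivar_coeff c e i) y"
  unfolding bivar_poly_def bivar_coeff_def poly_sum coeff_sum
  by (intro sum.cong refl) (auto simp: poly_monom)

lemma coeff_bivar_coeff:
  assumes "i + j \<le> e" shows "coeff (bivar_coeff c e i) j = c i j"
proof -
  have "coeff (bivar_coeff c e i) j = (\<Sum>p\<in>{(i, j). i + j \<le> e}. if p = (i, j) then c i j else 0)"
    unfolding bivar_coeff_def coeff_sum by (intro sum.cong refl) (auto simp: prod_eq_iff)
  then show ?thesis using assms by simp
qed

section \<open>Estimates in two variables and spans over the valuation ring\<close>

context complete_nonarch_field
begin

lemma absv_power_le_1: "absv x \<le> 1 \<Longrightarrow> absv (x ^ n) \<le> 1"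
  by (simp add: absv_power absv_nonneg power_le_one)

lemma absv_mult_le: "absv x \<le> a \<Longrightarrow> absv y \<le> b \<Longrightarrow> absv (x * y) \<le> a * b"
  unfolding absv_mult by (intro mult_mono) (auto intro: absv_nonneg order_trans[OF absv_nonneg])

lemma absv_power_diff:
  assumes "absv x \<le> 1" "absv x' \<le> 1" "absv (x - x') \<le> \<theta>"
  shows "absv (x ^ n - x' ^ n) \<le> \<theta>"
proof (induction n)
  case 0
  then show ?case using assms(3) absv_nonneg[of "x - x'"] by simp
next
  case (Suc n)
  have "x ^ Suc n - x' ^ Suc n = x * (x ^ n - x' ^ n) + (x - x') * x' ^ n" by (simp add: algebra_simps)
  moreover have "absv (x * (x ^ n - x' ^ n)) \<le> 1 * \<theta>" by (rule absv_mult_le[OF assms(1) Suc])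
  moreover have "absv ((x - x') * x' ^ n) \<le> \<theta> * 1"
    by (rule absv_mult_le[OF assms(3) absv_power_le_1[OF assms(2)]])
  ultimately show ?case using absv_ultrametric[of "x * (x ^ n - x' ^ n)" "(x - x') * x' ^ n"] by simp
qed

lemma bivar_lipschitz:
  assumes "absv x \<le> 1" "absv x' \<le> 1" "absv (x - x') \<le> \<theta>"
    and "absv y \<le> 1" "absv y' \<le> 1" "absv (y - y') \<le> \<theta>"
    and c: "\<And>i j. i + j \<le> e \<Longrightarrow> absv (c i j) \<le> C" and "0 \<le> C"
  shows "absv (bivar c e x y - bivar c e x' y') \<le> \<theta> * C"
proof -
  have th: "0 \<le> \<theta>" using assms(3) absv_nonneg order_trans by blast
  have "bivar c e x y - bivar c e x' y' = (\<Sum>p\<in>{(i, j). i + j \<le> e}.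
      c (fst p) (snd p) * (x ^ fst p * (y ^ snd p - y' ^ snd p) + (x ^ fst p - x' ^ fst p) * y' ^ snd p))"
    unfolding bivar_def case_prod_beta sum_subtractf[symmetric] by (intro sum.cong refl) (simp add: algebra_simps)
  also have "absv \<dots> \<le> \<theta> * C"
  proof (rule absv_sum_le)
    fix p assume p: "p \<in> {(i, j). i + j \<le> e}"
    have "absv (x ^ fst p * (y ^ snd p - y' ^ snd p)) \<le> 1 * \<theta>"
      by (intro absv_mult_le absv_power_le_1 absv_power_diff assms)
    moreover have "absv ((x ^ fst p - x' ^ fst p) * y' ^ snd p) \<le> \<theta> * 1"
      by (intro absv_mult_le absv_power_le_1 absv_power_diff assms)
    ultimately have "absv (x ^ fst p * (y ^ snd p - y' ^ snd p) + (x ^ fst p - x' ^ fst p) * y' ^ snd p) \<le> \<theta>"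
      using absv_ultrametric[of "x ^ fst p * (y ^ snd p - y' ^ snd p)" "(x ^ fst p - x' ^ fst p) * y' ^ snd p"] by simp
    moreover have "absv (c (fst p) (snd p)) \<le> C" using c[of "fst p" "snd p"] p by auto
    ultimately show "absv (c (fst p) (snd p) * (x ^ fst p * (y ^ snd p - y' ^ snd p) + (x ^ fst p - x' ^ fst p) * y' ^ snd p)) \<le> \<theta> * C"
      by (subst mult.commute[of \<theta>]) (rule absv_mult_le)
  qed (use th assms in auto)
  finally show ?thesis .
qed

text \<open>The module generated by X over the valuation ring of k. Certificates live in such
  modules, because a combination with coefficients of absolute value at most 1 is nowhere larger
  than the largest generator.\<close>

inductive_set ospan :: "'k poly set \<Rightarrow> 'k poly set" for X where
  zero: "0 \<in> ospan X"
| add: "h \<in> ospan X \<Longrightarrow> x \<in> X \<Longrightarrow> absv c \<le> 1 \<Longrightarrow> Polynomial.smult c x + h \<in> ospan X"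

lemma ospan_base: "x \<in> X \<Longrightarrow> absv c \<le> 1 \<Longrightarrow> Polynomial.smult c x \<in> ospan X"
  using ospan.add[OF ospan.zero, of x X c] by simp

lemma ospan_base1: "x \<in> X \<Longrightarrow> x \<in> ospan X"
  using ospan_base[of x X 1] by simp

lemma ospan_add: "a \<in> ospan X \<Longrightarrow> b \<in> ospan X \<Longrightarrow> a + b \<in> ospan X"
proof (induction rule: ospan.induct)
  case (add h x c)
  then show ?case using ospan.add[of "h + b" X x c] by (simp add: add.assoc)
qed simp

lemma ospan_smult: "a \<in> ospan X \<Longrightarrow> absv d \<le> 1 \<Longrightarrow> Polynomial.smult d a \<in> ospan X"
proof (induction rule: ospan.induct)
  case (add h x c)
  then have "absv (d * c) \<le> 1" using absv_mult_le[of d 1 c 1] by simp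
  then show ?case using add ospan.add[of "Polynomial.smult d h" X x "d * c"] by (simp add: smult_add_right)
qed (simp add: ospan.zero)

lemma ospan_subset: "a \<in> ospan X \<Longrightarrow> X \<subseteq> ospan Y \<Longrightarrow> a \<in> ospan Y"
  by (induction rule: ospan.induct) (auto intro!: ospan.zero ospan_add ospan_smult)

lemma ospan_mono: "a \<in> ospan X \<Longrightarrow> X \<subseteq> Y \<Longrightarrow> a \<in> ospan Y"
  by (rule ospan_subset) (auto intro: ospan_base1)

lemma ospan_sum: "(\<And>p. p \<in> A \<Longrightarrow> f p \<in> ospan X) \<Longrightarrow> sum f A \<in> ospan X"
  by (induction A rule: infinite_finite_induct) (auto intro: ospan.zero ospan_add)

lemma ospan_mult:
  assumes "a \<in> ospan X" "b \<in> ospan Y" "\<And>x y. x \<in> X \<Longrightarrow> y \<in> Y \<Longrightarrow> x * y \<in> Z"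
  shows "a * b \<in> ospan Z"
  using assms(1)
proof (induction rule: ospan.induct)
  case (add h x c)
  have "x * b \<in> ospan Z"
    using assms(2)
  proof (induction rule: ospan.induct)
    case (add h' y d)
    then have "Polynomial.smult d (x * y) + x * h' \<in> ospan Z"
      using assms(3) \<open>x \<in> X\<close> by (intro ospan.add) auto
    then show ?case by (simp add: distrib_left)
  qed (simp add: ospan.zero)
  then have "Polynomial.smult c (x * b) + h * b \<in> ospan Z" using add by (intro ospan_add ospan_smult) auto
  then show ?case by (simp add: distrib_right)
qed (simp add: ospan.zero)

text \<open>The coefficients are indexed by J and not by the image, so that the unknowns stay the
  same when M varies. Repeated occurrences of a generator are merged by addition, which does not
  leave the valuation ring.\<close>

lemma ospan_image:
  assumes "finite J" "h \<in> ospan (M ` J)"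
  shows "\<exists>c. (\<forall>j. absv (c j) \<le> 1) \<and> h = (\<Sum>j\<in>J. Polynomial.smult (c j) (M j))"
  using assms(2)
proof (induction rule: ospan.induct)
  case zero
  then show ?case by (intro exI[of _ "\<lambda>j. 0"]) auto
next
  case (add h x d)
  from add.IH obtain c where c: "\<forall>j. absv (c j) \<le> 1" "h = (\<Sum>j\<in>J. Polynomial.smult (c j) (M j))"
    by (elim exE conjE) (rule that)
  obtain k where k: "k \<in> J" "x = M k" using add by auto
  have "Polynomial.smult d x + h = (\<Sum>j\<in>J. Polynomial.smult (c j + (if j = k then d else 0)) (M j))"
    using k assms(1) by (simp add: smult_add_left sum.distrib c(2) if_distrib[of "\<lambda>a. Polynomial.smult a _"] add.commute cong: if_cong)
  moreover have "absv (c j + (if j = k then d else 0)) \<le> 1" for j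
    using absv_ultrametric[of "c j" "if j = k then d else 0"] c(1)[rule_format, of j] add by (simp split: if_splits)
  ultimately show ?case by (intro exI[of _ "\<lambda>j. c j + (if j = k then d else 0)"]) auto
qed

end

definition list_prods :: "nat \<Rightarrow> 'a::comm_monoid_mult set \<Rightarrow> 'a set" where
  "list_prods n A = {prod_list hs |hs. length hs = n \<and> set hs \<subseteq> A}"

text \<open>The monomials allowed on the right of a certificate for \<open>g ^ n\<close>. The
  required factor from A makes such a product strictly smaller than \<open>g ^ n\<close> wherever
  all elements of A are smaller than g.\<close>

definition mixed_prods :: "nat \<Rightarrow> 'a::comm_monoid_mult set \<Rightarrow> 'a \<Rightarrow> 'a set" where
  "mixed_prods n A g = {prod_list hs |hs. length hs = n \<and> set hs \<subseteq> insert g A \<and> (\<exists>h\<in>set hs. h \<in> A)}"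

lemma list_prods_mult: "x \<in> list_prods m A \<Longrightarrow> y \<in> list_prods n A \<Longrightarrow> x * y \<in> list_prods (m + n) A"
  unfolding list_prods_def by clarify (rule exI[of _ "_ @ _"], auto)

lemma list_prods_mixed:
  assumes "x \<in> list_prods m A" "0 < m"
  shows "x * g ^ n \<in> mixed_prods (m + n) A g"
proof -
  obtain hs where hs: "x = prod_list hs" "length hs = m" "set hs \<subseteq> A"
    using assms by (auto simp: list_prods_def)
  then obtain h where "h \<in> set hs" using assms(2) by (cases hs) auto
  moreover have "prod_list (replicate n g) = g ^ n" by (induction n) auto
  ultimately show ?thesis using hs unfolding mixed_prods_def
    by (intro CollectI exI[of _ "hs @ replicate n g"]) auto
qed

context complete_nonarch_field
begin

lemma ospan_power: "a \<in> ospan A \<Longrightarrow> a ^ n \<in> ospan (list_prods n A)"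
proof (induction n)
  case 0
  have "1 \<in> list_prods 0 A" by (auto simp: list_prods_def)
  then show ?case by (simp add: ospan_base1)
next
  case (Suc n)
  show ?case unfolding power_Suc
  proof (rule ospan_mult[OF Suc.prems Suc.IH[OF Suc.prems]])
    fix x y assume "x \<in> A" "y \<in> list_prods n A"
    moreover have "x \<in> list_prods 1 A" unfolding list_prods_def using \<open>x \<in> A\<close> by (intro CollectI exI[of _ "[x]"]) auto
    ultimately show "x * y \<in> list_prods (Suc n) A" using list_prods_mult[of x 1 A y n] by simp
  qed
qed

end

section \<open>Reduction to two polynomials and extraction of certificates\<close>

context alg_closed_nonarch_field
begin

lemma bivar_max_modulus:
  assumes "\<And>x y. absv x < 1 \<Longrightarrow> absv y < 1 \<Longrightarrow> absv (bivar c e x y) \<le> C" "i + j \<le> e"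
  shows "absv (c i j) \<le> C"
proof -
  have "absv (poly (bivar_coeff c e i) y) \<le> C" if "absv y < 1" for y
    unfolding coeff_bivar_poly[symmetric]
    by (rule max_modulus) (simp add: poly_bivar_poly assms that)
  from max_modulus[OF this, of j] show ?thesis by (simp add: coeff_bivar_coeff assms)
qed

lemma bivar_nonzero_const:
  assumes nz: "\<And>x y. absv x < 1 \<Longrightarrow> absv y < 1 \<Longrightarrow> bivar c e x y \<noteq> 0" and "absv x < 1" "absv y < 1"
  shows "absv (bivar c e x y) = absv (c 0 0)"
proof -
  have p0: "poly (bivar_poly c e y) 0 = poly (bivar_coeff c e 0) y" for y
    by (simp add: poly_0_coeff_0 coeff_bivar_poly)
  have "absv (poly (bivar_poly c e y) x) = absv (poly (bivar_poly c e y) 0)"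
    by (rule absv_poly_const[OF _ \<open>absv x < 1\<close>]) (simp add: poly_bivar_poly nz assms)
  also have "\<dots> = absv (poly (bivar_coeff c e 0) y)" by (simp add: p0)
  also have "\<dots> = absv (poly (bivar_coeff c e 0) 0)"
    by (rule absv_poly_const[OF _ \<open>absv y < 1\<close>]) (simp flip: p0 add: poly_bivar_poly nz)
  finally show ?thesis by (simp add: poly_bivar_poly poly_0_coeff_0 coeff_bivar_coeff)
qed

lemma elimination_coeffs:
  fixes F1 F2 G :: "'k poly"
  assumes D: "0 < D" and "degree F1 = D" "degree F2 < D" "degree G < D"
  obtains c where
    "\<forall>b. (\<Sum>(i, j)\<in>{(i, j). i + j \<le> 2 * D}. c i j * poly F1 b ^ i * poly F2 b ^ j * poly G b ^ (2 * D - i - j)) = 0"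
    "\<forall>x y. bivar c (2 * D) x y = 0 \<longrightarrow> (\<exists>b. poly F1 b = x * poly G b \<and> poly F2 b = y * poly G b)"
proof -
  obtain R where R: "homog (2 * D) R" "\<forall>b. R (poly F1 b) (poly F2 b) (poly G b) = 0"
    "\<forall>x y. R x y 1 = 0 \<longrightarrow> (\<exists>b. poly F1 b = x * poly G b \<and> poly F2 b = y * poly G b)"
    by (rule elimination[OF assms])
  obtain c where c: "\<forall>x y w. R x y w = (\<Sum>(i, j)\<in>{(i, j). i + j \<le> 2 * D}. c i j * x ^ i * y ^ j * w ^ (2 * D - i - j))"
    by (rule homogE[OF R(1)])
  have c': "bivar c (2 * D) x y = R x y 1" for x y by (simp add: c bivar_def)
  show ?thesis
  proof (rule that[of c])
    show "\<forall>b. (\<Sum>(i, j)\<in>{(i, j). i + j \<le> 2 * D}. c i j * poly F1 b ^ i * poly F2 b ^ j * poly G b ^ (2 * D - i - j)) = 0"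
      using R(2) c by simp
    show "\<forall>x y. bivar c (2 * D) x y = 0 \<longrightarrow> (\<exists>b. poly F1 b = x * poly G b \<and> poly F2 b = y * poly G b)"
      using R(3) unfolding c' .
  qed
qed

text \<open>Where F3 is dominant, (F1/F3, F2/F3) runs through a plane curve, whose equation comes
  from \<open>elimination_coeffs\<close>. A pair (x, y) at which this equation is nearly as large as
  its largest coefficient stays away from the curve, so F1 - x F3 and F2 - y F3 cannot both be small
  compared with the three polynomials.\<close>

lemma reduce_three:
  fixes F1 F2 F3 :: "'k poly"
  assumes D: "0 < D" and deg: "degree F1 = D" "degree F2 < D" "degree F3 < D"
    and nc: "\<And>b. \<not> (poly F1 b = 0 \<and> poly F2 b = 0)" and th: "0 < \<theta>" "\<theta> < 1"
  shows "\<exists>x y. absv x < 1 \<and> absv y < 1 \<and> (\<forall>b. \<theta> * max (absv (poly F1 b)) (max (absv (poly F2 b)) (absv (poly F3 b)))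
    \<le> max (absv (poly F1 b - x * poly F3 b)) (absv (poly F2 b - y * poly F3 b)))"
proof -
  define e where "e = 2 * D"
  obtain c where c1': "\<forall>b. (\<Sum>(i, j)\<in>{(i, j). i + j \<le> e}. c i j * poly F1 b ^ i * poly F2 b ^ j * poly F3 b ^ (e - i - j)) = 0"
    and c2': "\<forall>x y. bivar c e x y = 0 \<longrightarrow> (\<exists>b. poly F1 b = x * poly F3 b \<and> poly F2 b = y * poly F3 b)"
    unfolding e_def by (rule elimination_coeffs[OF D deg])
  note c1 = c1'[rule_format] and c2 = c2'[rule_format]
  \<comment> \<open>The Gauss norm of the equation of the curve; by the maximum modulus principle it
    is nearly reached on the open bidisk.\<close>
  define C where "C = Max ((\<lambda>(i, j). absv (c i j)) ` {(i, j). i + j \<le> e})"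
  have cC: "absv (c i j) \<le> C" if "i + j \<le> e" for i j
    unfolding C_def using that by (intro Max_ge) auto
  have "C \<in> (\<lambda>(i, j). absv (c i j)) ` {(i, j). i + j \<le> e}"
    unfolding C_def by (intro Max_in) (auto intro!: exI[of _ "0::nat"])
  then obtain i0 j0 where ij: "i0 + j0 \<le> e" "C = absv (c i0 j0)" by auto
  have C0: "0 \<le> C" using ij absv_nonneg by simp
  \<comment> \<open>The equation does not vanish identically: on the line x = 0 its zeros are among
    the finitely many quotients F2(b)/F3(b) at roots b of F1.\<close>
  have "\<exists>y. bivar c e 0 y \<noteq> 0"
  proof -
    have "F1 \<noteq> 0" using deg D by auto
    then have "finite {b. poly F1 b = 0}" by (rule poly_roots_finite)
    then have "finite ((\<lambda>b. poly F2 b / poly F3 b) ` {b. poly F1 b = 0})" by simp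
    then obtain y where y: "y \<notin> (\<lambda>b. poly F2 b / poly F3 b) ` {b. poly F1 b = 0}"
      using infinite_field ex_new_if_finite by blast
    have "bivar c e 0 y \<noteq> 0"
    proof
      assume "bivar c e 0 y = 0"
      then obtain b where b: "poly F1 b = 0" "poly F2 b = y * poly F3 b" using c2[of 0 y] by auto
      then have "poly F3 b \<noteq> 0" using nc[of b] by auto
      then have "y = poly F2 b / poly F3 b" using b(2) by simp
      moreover have "b \<in> {b. poly F1 b = 0}" using b(1) by simp
      ultimately have "y \<in> (\<lambda>b. poly F2 b / poly F3 b) ` {b. poly F1 b = 0}" by (rule image_eqI)
      then show False using y by simp
    qed
    then show ?thesis by blast
  qed
  then have "C \<noteq> 0"
  proof (rule contrapos_pn)
    assume "C = 0"
    then have "c i j = 0" if "i + j \<le> e" for i j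
      using cC[OF that] absv_nonneg[of "c i j"] absv_eq_0_iff[of "c i j"] by auto
    then show "\<nexists>y. bivar c e 0 y \<noteq> 0" unfolding bivar_def by (auto intro!: sum.neutral)
  qed
  then have C: "0 < C" using C0 by simp
  have "\<exists>x y. absv x < 1 \<and> absv y < 1 \<and> \<theta> * C < absv (bivar c e x y)"
  proof (rule ccontr)
    assume nex: "\<not> ?thesis"
    have "absv (bivar c e x y) \<le> \<theta> * C" if "absv x < 1" "absv y < 1" for x y
    proof (rule ccontr)
      assume "\<not> absv (bivar c e x y) \<le> \<theta> * C"
      then have "absv x < 1 \<and> absv y < 1 \<and> \<theta> * C < absv (bivar c e x y)" using that by simp
      then have "\<exists>x y. absv x < 1 \<and> absv y < 1 \<and> \<theta> * C < absv (bivar c e x y)" by (intro exI)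
      with nex show False by (rule notE)
    qed
    then have "absv (c i0 j0) \<le> \<theta> * C" by (rule bivar_max_modulus[OF _ ij(1)])
    then show False using C th ij by simp
  qed
  then obtain x y where xy: "absv x < 1" "absv y < 1" "\<theta> * C < absv (bivar c e x y)"
    by (elim exE conjE) (rule that)
  have "\<theta> * max (absv (poly F1 b)) (max (absv (poly F2 b)) (absv (poly F3 b)))
    \<le> max (absv (poly F1 b - x * poly F3 b)) (absv (poly F2 b - y * poly F3 b))" for b
  proof (rule ccontr)
    define f1 f2 f3 where f: "f1 = poly F1 b" "f2 = poly F2 b" "f3 = poly F3 b"
    define m where "m = max (absv f1) (max (absv f2) (absv f3))"
    assume "\<not> ?thesis"
    then have lt: "absv (f1 - x * f3) < \<theta> * m" "absv (f2 - y * f3) < \<theta> * m"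
      by (simp_all add: f m_def)
    have "0 < \<theta> * m" using lt(1) absv_nonneg[of "f1 - x * f3"] by linarith
    then have m: "0 < m" using th by (simp add: zero_less_mult_iff)
    then have thlt: "\<theta> * m < m" using th by simp
    have x3: "absv (x * f3) \<le> absv f3" "absv (y * f3) \<le> absv f3"
      using absv_mult_le[of x 1 f3 "absv f3"] absv_mult_le[of y 1 f3 "absv f3"] xy by simp_all
    \<comment> \<open>If F3 did not realise the maximum, subtracting its multiples by x and y would
      not change the size of the dominant one of F1 and F2.\<close>
    have "m \<le> absv f3"
    proof (rule ccontr)
      assume "\<not> m \<le> absv f3"
      then have "absv f3 < m" by simp
      then consider "absv f1 = m" | "absv f2 = m" by (auto simp: m_def max_def split: if_splits)
      then show False
      proof cases
        case 1
        then have "absv (f1 - x * f3) = m" using absv_diff_eq[of "x * f3" f1] x3 \<open>absv f3 < m\<close> by simp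
        then show False using lt thlt by simp
      next
        case 2
        then have "absv (f2 - y * f3) = m" using absv_diff_eq[of "y * f3" f2] x3 \<open>absv f3 < m\<close> by simp
        then show False using lt thlt by simp
      qed
    qed
    then have m3: "absv f3 = m" by (simp add: m_def)
    then have f30: "f3 \<noteq> 0" using m by auto
    have le: "absv f1 \<le> m" "absv f2 \<le> m" by (simp_all add: m_def)
    define p q where "p = f1 / f3" and "q = f2 / f3"
    have pq: "absv p \<le> 1" "absv q \<le> 1" using le m3 m by (simp_all add: p_def q_def absv_divide)
    have "x - p = - ((f1 - x * f3) / f3)" "y - q = - ((f2 - y * f3) / f3)"
      using f30 by (simp_all add: p_def q_def field_simps)
    then have "absv (x - p) = absv (f1 - x * f3) / m" "absv (y - q) = absv (f2 - y * f3) / m"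
      by (simp_all only: absv_minus absv_divide m3)
    then have d: "absv (x - p) \<le> \<theta>" "absv (y - q) \<le> \<theta>" using lt m by (simp_all add: pos_divide_le_eq)
    \<comment> \<open>By homogeneity (p, q) is a zero of the dehomogenised equation. Being within
      \<theta> of (x, y), it forces the equation to be at most \<open>\<theta> * C\<close> there,
      against the choice of (x, y).\<close>
    have "f3 ^ e * bivar c e p q = (\<Sum>(i, j)\<in>{(i, j). i + j \<le> e}. c i j * f1 ^ i * f2 ^ j * f3 ^ (e - i - j))"
      unfolding bivar_def sum_distrib_left
    proof (intro sum.cong refl)
      fix r assume "r \<in> {(i, j). i + j \<le> e}"
      then obtain i j where r: "r = (i, j)" "i + j \<le> e" by auto
      then have "f3 ^ e = f3 ^ i * f3 ^ j * f3 ^ (e - i - j)" by (simp flip: power_add)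
      then have "f3 ^ e * (c i j * p ^ i * q ^ j) = c i j * (f3 * p) ^ i * (f3 * q) ^ j * f3 ^ (e - i - j)"
        by (simp add: power_mult_distrib mult_ac)
      moreover have "f3 * p = f1" "f3 * q = f2" using f30 by (simp_all add: p_def q_def)
      ultimately show "f3 ^ e * (case r of (i, j) \<Rightarrow> c i j * p ^ i * q ^ j) = (case r of (i, j) \<Rightarrow> c i j * f1 ^ i * f2 ^ j * f3 ^ (e - i - j))"
        by (simp add: r)
    qed
    also have "\<dots> = 0" using c1[of b] by (simp add: f)
    finally have "bivar c e p q = 0" using f30 by simp
    then have "absv (bivar c e x y) \<le> \<theta> * C"
      using bivar_lipschitz[of x p \<theta> y q e c C] xy pq d cC C0 by simp
    then show False using xy by simp
  qed
  then show ?thesis using xy by (intro exI[of _ x] exI[of _ y]) simp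
qed

text \<open>The bound on G says that the curve (F1/G, F2/G) misses the open unit bidisk. Its
  equation has no zero there, so its constant term dominates all other coefficients, and dividing by
  that term expresses \<open>G ^ (2 * D)\<close> through the other monomials over the valuation
  ring.\<close>

lemma certificate_two:
  fixes F1 F2 G :: "'k poly"
  assumes D: "0 < D" and deg: "degree F1 = D" "degree F2 < D" "degree G < D"
    and nc: "\<And>b. \<not> (poly F1 b = 0 \<and> poly F2 b = 0)"
    and le: "\<And>b. absv (poly G b) \<le> max (absv (poly F1 b)) (absv (poly F2 b))"
  shows "G ^ (2 * D) \<in> ospan {F1 ^ i * F2 ^ j * G ^ (2 * D - i - j) |i j. i + j \<le> 2 * D \<and> 0 < i + j}"
proof -
  define e where "e = 2 * D"
  obtain c where c1': "\<forall>b. (\<Sum>(i, j)\<in>{(i, j). i + j \<le> e}. c i j * poly F1 b ^ i * poly F2 b ^ j * poly G b ^ (e - i - j)) = 0"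
    and c2': "\<forall>x y. bivar c e x y = 0 \<longrightarrow> (\<exists>b. poly F1 b = x * poly G b \<and> poly F2 b = y * poly G b)"
    unfolding e_def by (rule elimination_coeffs[OF D deg])
  note c1 = c1'[rule_format] and c2 = c2'[rule_format]
  have nz: "bivar c e x y \<noteq> 0" if xy: "absv x < 1" "absv y < 1" for x y
  proof
    assume "bivar c e x y = 0"
    then obtain b where b: "poly F1 b = x * poly G b" "poly F2 b = y * poly G b" using c2[of x y] by auto
    then have "poly G b \<noteq> 0" using nc[of b] by auto
    then have "absv (x * poly G b) < absv (poly G b)" "absv (y * poly G b) < absv (poly G b)"
      using xy absv_pos by (simp_all add: absv_mult)
    then show False using le[of b] b by simp
  qed
  have c00: "c 0 0 \<noteq> 0"
  proof -
    have "absv (bivar c e 0 0) = absv (c 0 0)" by (rule bivar_nonzero_const[OF nz]) auto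
    then show ?thesis using nz[of 0 0] absv_eq_0_iff[of "c 0 0"] absv_eq_0_iff[of "bivar c e 0 0"] by simp
  qed
  have cle: "absv (c i j) \<le> absv (c 0 0)" if "i + j \<le> e" for i j
    by (rule bivar_max_modulus[OF _ that]) (simp add: bivar_nonzero_const[OF nz])
  define I where "I = {(i, j). i + j \<le> e} - {(0::nat, 0::nat)}"
  have I: "{(i, j). i + j \<le> e} = insert (0, 0) I" "(0, 0) \<notin> I" "finite I" by (auto simp: I_def)
  have "G ^ e = (\<Sum>p\<in>I. Polynomial.smult (- (c (fst p) (snd p) / c 0 0)) (F1 ^ fst p * F2 ^ snd p * G ^ (e - fst p - snd p)))"
  proof (rule poly_eqI_field)
    fix b
    have "c 0 0 * poly G b ^ e + (\<Sum>p\<in>I. c (fst p) (snd p) * poly F1 b ^ fst p * poly F2 b ^ snd p * poly G b ^ (e - fst p - snd p)) = 0"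
      using c1[of b] I(2,3) unfolding I(1) by (simp add: case_prod_beta)
    then have "c 0 0 * poly G b ^ e = - (\<Sum>p\<in>I. c (fst p) (snd p) * poly F1 b ^ fst p * poly F2 b ^ snd p * poly G b ^ (e - fst p - snd p))"
      by (rule eq_neg_iff_add_eq_0[THEN iffD2])
    then have "poly G b ^ e = - (\<Sum>p\<in>I. c (fst p) (snd p) * poly F1 b ^ fst p * poly F2 b ^ snd p * poly G b ^ (e - fst p - snd p)) / c 0 0"
      using c00 by (simp add: field_simps)
    then show "poly (G ^ e) b = poly (\<Sum>p\<in>I. Polynomial.smult (- (c (fst p) (snd p) / c 0 0)) (F1 ^ fst p * F2 ^ snd p * G ^ (e - fst p - snd p))) b"
      by (simp add: poly_sum sum_divide_distrib sum_negf mult_ac)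
  qed
  also have "\<dots> \<in> ospan {F1 ^ i * F2 ^ j * G ^ (e - i - j) |i j. i + j \<le> e \<and> 0 < i + j}"
  proof (intro ospan_sum ospan_base)
    fix p assume p: "p \<in> I"
    then show "F1 ^ fst p * F2 ^ snd p * G ^ (e - fst p - snd p) \<in> {F1 ^ i * F2 ^ j * G ^ (e - i - j) |i j. i + j \<le> e \<and> 0 < i + j}"
      by (intro CollectI exI[of _ "fst p"] exI[of _ "snd p"]) (auto simp: I_def)
    show "absv (- (c (fst p) (snd p) / c 0 0)) \<le> 1"
      using cle[of "fst p" "snd p"] p absv_pos[OF c00] by (auto simp: I_def absv_divide)
  qed
  finally show ?thesis unfolding e_def .
qed

text \<open>Iterating \<open>reduce_three\<close> replaces finitely many polynomials by two
  combinations of them, at the price of a factor \<theta> as close to 1 as desired.\<close>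

lemma reduce_list:
  fixes F1 F2 :: "'k poly"
  assumes "0 < D" "degree F1 = D" "degree F2 < D" "\<forall>F\<in>set Fs. degree F < D"
    and "\<And>b. \<not> (poly F1 b = 0 \<and> poly F2 b = 0)" and "0 < \<theta>" "\<theta> < 1"
  shows "\<exists>H1 H2. degree H1 = D \<and> degree H2 < D \<and> (\<forall>b. \<not> (poly H1 b = 0 \<and> poly H2 b = 0))
    \<and> H1 \<in> ospan ({F1, F2} \<union> set Fs) \<and> H2 \<in> ospan ({F1, F2} \<union> set Fs)
    \<and> (\<forall>b. \<forall>F\<in>{F1, F2} \<union> set Fs. \<theta> * absv (poly F b) \<le> max (absv (poly H1 b)) (absv (poly H2 b)))"
  using assms
proof (induction Fs arbitrary: F1 F2 \<theta>)
  case Nil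
  have "\<theta> * absv a \<le> absv a" for a using Nil.prems absv_nonneg[of a] by (simp add: mult_left_le_one_le)
  then show ?case using Nil.prems
    by (intro exI[of _ F1] exI[of _ F2]) (auto intro!: ospan_base1 intro: order_trans simp: le_max_iff_disj)
next
  case (Cons F3 Fs)
  \<comment> \<open>The loss is shared: one factor for absorbing \<open>F3\<close>, the other for
    the remaining list.\<close>
  define \<eta> where "\<eta> = sqrt \<theta>"
  have eta: "0 < \<eta>" "\<eta> < 1" "\<eta> * \<eta> = \<theta>" using Cons.prems(6,7) by (auto simp: \<eta>_def)
  have d3: "degree F3 < D" using Cons.prems(4) by simp
  obtain x y where xy: "absv x < 1" "absv y < 1"
    and red: "\<forall>b. \<eta> * max (absv (poly F1 b)) (max (absv (poly F2 b)) (absv (poly F3 b)))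
    \<le> max (absv (poly F1 b - x * poly F3 b)) (absv (poly F2 b - y * poly F3 b))"
    using reduce_three[OF Cons.prems(1,2,3) d3 Cons.prems(5) eta(1,2)] by (elim exE conjE) (rule that)
  define G1 where "G1 = F1 + Polynomial.smult (- x) F3"
  define G2 where "G2 = F2 + Polynomial.smult (- y) F3"
  have red': "\<eta> * max (absv (poly F1 b)) (max (absv (poly F2 b)) (absv (poly F3 b))) \<le> max (absv (poly G1 b)) (absv (poly G2 b))" for b
    using red[rule_format, of b] by (simp add: G1_def G2_def)
  have dG1: "degree G1 = D"
    unfolding G1_def using d3 Cons.prems(2) degree_smult_le[of "- x" F3] by (subst degree_add_eq_left) linarith+
  have dG2: "degree G2 < D"
    unfolding G2_def using d3 Cons.prems(3) degree_smult_le[of "- y" F3] by (intro degree_add_less) linarith+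
  have ncG: "\<not> (poly G1 b = 0 \<and> poly G2 b = 0)" for b
  proof
    assume "poly G1 b = 0 \<and> poly G2 b = 0"
    then have "max (absv (poly F1 b)) (max (absv (poly F2 b)) (absv (poly F3 b))) \<le> 0"
      using red'[of b] eta by (simp add: mult_le_0_iff)
    then have "absv (poly F1 b) \<le> 0" "absv (poly F2 b) \<le> 0" by auto
    then show False using Cons.prems(5)[of b] absv_nonneg[of "poly F1 b"] absv_nonneg[of "poly F2 b"]
      by (metis absv_eq_0_iff order_antisym)
  qed
  have dFs: "\<forall>F\<in>set Fs. degree F < D" using Cons.prems(4) by simp
  obtain H1 H2 where H: "degree H1 = D" "degree H2 < D" "\<forall>b. \<not> (poly H1 b = 0 \<and> poly H2 b = 0)"
    "H1 \<in> ospan ({G1, G2} \<union> set Fs)" "H2 \<in> ospan ({G1, G2} \<union> set Fs)"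
    and Hle': "\<forall>b. \<forall>F\<in>{G1, G2} \<union> set Fs. \<eta> * absv (poly F b) \<le> max (absv (poly H1 b)) (absv (poly H2 b))"
    using Cons.IH[OF Cons.prems(1) dG1 dG2 dFs ncG eta(1,2)] by (elim exE conjE) (rule that)
  have Hle: "\<eta> * absv (poly F b) \<le> max (absv (poly H1 b)) (absv (poly H2 b))" if "F \<in> {G1, G2} \<union> set Fs" for F b
    using Hle'[THEN spec, of b] that by (rule bspec)
  have sub: "{G1, G2} \<union> set Fs \<subseteq> ospan ({F1, F2} \<union> set (F3 # Fs))"
  proof -
    have "G1 \<in> ospan ({F1, F2} \<union> set (F3 # Fs))" "G2 \<in> ospan ({F1, F2} \<union> set (F3 # Fs))"
      unfolding G1_def G2_def using xy by (intro ospan_add ospan_base ospan_base1; simp)+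
    then show ?thesis by (auto intro: ospan_base1)
  qed
  have "\<theta> * absv (poly F b) \<le> max (absv (poly H1 b)) (absv (poly H2 b))" if F: "F \<in> {F1, F2} \<union> set (F3 # Fs)" for F b
  proof (cases "F \<in> set Fs")
    case True
    have "\<theta> \<le> \<eta>" using eta by (metis less_imp_le mult_left_le_one_le)
    then have "\<theta> * absv (poly F b) \<le> \<eta> * absv (poly F b)" by (intro mult_right_mono absv_nonneg)
    also have "\<dots> \<le> max (absv (poly H1 b)) (absv (poly H2 b))" using True by (intro Hle) simp
    finally show ?thesis .
  next
    case False
    then have "absv (poly F b) \<le> max (absv (poly F1 b)) (max (absv (poly F2 b)) (absv (poly F3 b)))" using F by auto
    then have "\<eta> * absv (poly F b) \<le> \<eta> * max (absv (poly F1 b)) (max (absv (poly F2 b)) (absv (poly F3 b)))"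
      using eta by (intro mult_left_mono) auto
    also note red'[of b]
    finally have "\<eta> * (\<eta> * absv (poly F b)) \<le> \<eta> * max (absv (poly G1 b)) (absv (poly G2 b))"
      using eta by (intro mult_left_mono) auto
    also have "\<dots> \<le> max (absv (poly H1 b)) (absv (poly H2 b))"
      using Hle[of G1 b] Hle[of G2 b] by (cases "absv (poly G1 b) \<le> absv (poly G2 b)") (simp_all add: max_absorb1 max_absorb2)
    finally show ?thesis using eta(3) by (simp add: mult.assoc[symmetric])
  qed
  then show ?case using H ospan_subset[OF H(4) sub] ospan_subset[OF H(5) sub]
    by (intro exI[of _ H1] exI[of _ H2]) auto
qed

text \<open>The scalar g pays for the loss in \<open>reduce_list\<close>, after which
  \<open>certificate_two\<close> applies to the two remaining polynomials; expanding their powers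
  gives products of the original ones. The exponent 2D depends only on the degree bound, so it is
  the same at every specialisation w.\<close>

lemma certificate:
  fixes F1 F2 G :: "'k poly"
  assumes D: "0 < D" and deg: "degree F1 = D" "degree F2 < D" "degree G < D" "\<forall>F\<in>set Fs. degree F < D"
    and nc: "\<And>b. \<not> (poly F1 b = 0 \<and> poly F2 b = 0)" and g: "0 < absv g" "absv g < 1"
    and le: "\<And>b. \<exists>F\<in>{F1, F2} \<union> set Fs. absv (poly G b) \<le> absv (poly F b)"
  shows "(Polynomial.smult g G) ^ (2 * D) \<in> ospan (mixed_prods (2 * D) ({F1, F2} \<union> set Fs) (Polynomial.smult g G))"
proof -
  let ?A = "{F1, F2} \<union> set Fs" and ?G = "Polynomial.smult g G"
  obtain H1 H2 where H: "degree H1 = D" "degree H2 < D" "\<forall>b. \<not> (poly H1 b = 0 \<and> poly H2 b = 0)"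
    "H1 \<in> ospan ?A" "H2 \<in> ospan ?A"
    and Hle': "\<forall>b. \<forall>F\<in>?A. absv g * absv (poly F b) \<le> max (absv (poly H1 b)) (absv (poly H2 b))"
    using reduce_list[OF D deg(1,2,4) nc g] by (elim exE conjE) (rule that)
  have Hle: "absv g * absv (poly F b) \<le> max (absv (poly H1 b)) (absv (poly H2 b))" if "F \<in> ?A" for F b
    using Hle'[THEN spec, of b] that by (rule bspec)
  have dG: "degree ?G < D" using deg(3) degree_smult_le[of g G] by linarith
  have leG: "absv (poly ?G b) \<le> max (absv (poly H1 b)) (absv (poly H2 b))" for b
  proof -
    obtain F where F: "F \<in> ?A" "absv (poly G b) \<le> absv (poly F b)" using le[of b] by blast
    have "absv (poly ?G b) \<le> absv g * absv (poly F b)"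
      using F(2) g by (simp add: absv_mult)
    then show ?thesis using Hle[OF F(1), of b] by linarith
  qed
  have "?G ^ (2 * D) \<in> ospan {H1 ^ i * H2 ^ j * ?G ^ (2 * D - i - j) |i j. i + j \<le> 2 * D \<and> 0 < i + j}"
    by (rule certificate_two[OF D H(1,2) dG H(3)[rule_format] leG])
  moreover
  have "H1 ^ i * H2 ^ j * ?G ^ (2 * D - i - j) \<in> ospan (mixed_prods (2 * D) ?A ?G)"
    if ij: "i + j \<le> 2 * D" "0 < i + j" for i j
  proof (rule ospan_mult[where Y = "{?G ^ (2 * D - i - j)}"])
    show "H1 ^ i * H2 ^ j \<in> ospan (list_prods (i + j) ?A)"
      by (rule ospan_mult[OF ospan_power[OF H(4)] ospan_power[OF H(5)]]) (rule list_prods_mult)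
    show "?G ^ (2 * D - i - j) \<in> ospan {?G ^ (2 * D - i - j)}" by (rule ospan_base1) simp
    fix x y assume "x \<in> list_prods (i + j) ?A" "y \<in> {?G ^ (2 * D - i - j)}"
    then show "x * y \<in> mixed_prods (2 * D) ?A ?G"
      using list_prods_mixed[of x "i + j" ?A ?G "2 * D - i - j"] ij by simp
  qed
  then have "{H1 ^ i * H2 ^ j * ?G ^ (2 * D - i - j) |i j. i + j \<le> 2 * D \<and> 0 < i + j} \<subseteq> ospan (mixed_prods (2 * D) ?A ?G)"
    by (intro subsetI) (elim CollectE exE conjE, simp only:)
  ultimately show ?thesis by (rule ospan_subset)
qed

end

section \<open>Density of rigid points\<close>

text \<open>The abstract situation behind the density of points: \<alpha> is a multiplicative
  seminorm on the ring P that extends the absolute value, and w runs over points with evaluations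
  \<open>\<phi> w\<close> into k. The induction adjoins elements to subrings of P, hence the absence
  of any fixed polynomial structure.\<close>

locale evaluations = complete_nonarch_field absv
  for absv :: "'k::field \<Rightarrow> real" +
  fixes P :: "'b::comm_ring_1 set" and \<alpha> :: "'b \<Rightarrow> real" and \<kappa> :: "'k \<Rightarrow> 'b" and \<phi> :: "'w \<Rightarrow> 'b \<Rightarrow> 'k"
  assumes P_add: "a \<in> P \<Longrightarrow> b \<in> P \<Longrightarrow> a + b \<in> P"
    and P_mult: "a \<in> P \<Longrightarrow> b \<in> P \<Longrightarrow> a * b \<in> P"
    and const_P: "\<kappa> c \<in> P" and const_0: "\<kappa> 0 = 0" and const_1: "\<kappa> 1 = 1" and const_minus1: "\<kappa> (- 1) = - 1"
    and \<alpha>_nonneg: "a \<in> P \<Longrightarrow> 0 \<le> \<alpha> a"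
    and \<alpha>_add: "a \<in> P \<Longrightarrow> b \<in> P \<Longrightarrow> \<alpha> (a + b) \<le> max (\<alpha> a) (\<alpha> b)"
    and \<alpha>_mult: "a \<in> P \<Longrightarrow> b \<in> P \<Longrightarrow> \<alpha> (a * b) = \<alpha> a * \<alpha> b"
    and \<alpha>_const: "\<alpha> (\<kappa> c) = absv c"
    and \<phi>_add: "a \<in> P \<Longrightarrow> b \<in> P \<Longrightarrow> \<phi> w (a + b) = \<phi> w a + \<phi> w b"
    and \<phi>_mult: "a \<in> P \<Longrightarrow> b \<in> P \<Longrightarrow> \<phi> w (a * b) = \<phi> w a * \<phi> w b"
    and \<phi>_const: "\<phi> w (\<kappa> c) = c"
begin

definition const_subring :: "'b set \<Rightarrow> bool" where
  "const_subring S \<longleftrightarrow> S \<subseteq> P \<and> range \<kappa> \<subseteq> S \<and> (\<forall>a\<in>S. \<forall>b\<in>S. a + b \<in> S \<and> a * b \<in> S)"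

text \<open>On S the seminorm lies in the closure of the points w, for the topology of pointwise
  convergence.\<close>

definition approximable :: "'b set \<Rightarrow> bool" where
  "approximable S \<longleftrightarrow> (\<forall>E \<epsilon>. finite E \<longrightarrow> E \<subseteq> S \<longrightarrow> 0 < \<epsilon> \<longrightarrow> (\<exists>w. \<forall>a\<in>E. \<bar>absv (\<phi> w a) - \<alpha> a\<bar> < \<epsilon>))"

lemma P_0 [simp]: "0 \<in> P" using const_P[of 0] by (simp add: const_0)
lemma P_1 [simp]: "1 \<in> P" using const_P[of 1] by (simp add: const_1)
lemma \<alpha>_0 [simp]: "\<alpha> 0 = 0" using \<alpha>_const[of 0] by (simp add: const_0)
lemma \<alpha>_1 [simp]: "\<alpha> 1 = 1" using \<alpha>_const[of 1] by (simp add: const_1)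
lemma \<phi>_0 [simp]: "\<phi> w 0 = 0" using \<phi>_const[of w 0] by (simp add: const_0)
lemma \<phi>_1 [simp]: "\<phi> w 1 = 1" using \<phi>_const[of w 1] by (simp add: const_1)

lemma P_minus: "a \<in> P \<Longrightarrow> - a \<in> P"
  using P_mult[of "\<kappa> (- 1)" a] const_P[of "- 1"] by (simp add: const_minus1)

lemma \<alpha>_minus: "a \<in> P \<Longrightarrow> \<alpha> (- a) = \<alpha> a"
  using \<alpha>_mult[of "\<kappa> (- 1)" a] const_P[of "- 1"] \<alpha>_const[of "- 1"] by (simp add: const_minus1)

lemma \<phi>_minus: "a \<in> P \<Longrightarrow> \<phi> w (- a) = - \<phi> w a"
  using \<phi>_mult[of "\<kappa> (- 1)" a w] const_P[of "- 1"] \<phi>_const[of w "- 1"] by (simp add: const_minus1)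

lemma \<phi>_diff: "a \<in> P \<Longrightarrow> b \<in> P \<Longrightarrow> \<phi> w (a - b) = \<phi> w a - \<phi> w b"
  using \<phi>_add[of a "- b" w] \<phi>_minus[of b w] P_minus[of b] by simp

lemma \<alpha>_diff: "a \<in> P \<Longrightarrow> b \<in> P \<Longrightarrow> \<alpha> (a - b) \<le> max (\<alpha> a) (\<alpha> b)"
  using \<alpha>_add[of a "- b"] \<alpha>_minus[of b] P_minus[of b] by simp

lemma P_sum: "(\<And>a. a \<in> A \<Longrightarrow> f a \<in> P) \<Longrightarrow> sum f A \<in> P"
  by (induction A rule: infinite_finite_induct) (auto intro: P_add)

lemma P_power: "a \<in> P \<Longrightarrow> a ^ n \<in> P"
  by (induction n) (auto intro: P_mult)

lemma \<phi>_sum: "(\<And>a. a \<in> A \<Longrightarrow> f a \<in> P) \<Longrightarrow> \<phi> w (sum f A) = (\<Sum>a\<in>A. \<phi> w (f a))"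
  by (induction A rule: infinite_finite_induct) (auto simp: \<phi>_add P_sum)

lemma \<phi>_power: "a \<in> P \<Longrightarrow> \<phi> w (a ^ n) = \<phi> w a ^ n"
  by (induction n) (auto simp: \<phi>_mult P_power)

lemma \<alpha>_power: "a \<in> P \<Longrightarrow> \<alpha> (a ^ n) = \<alpha> a ^ n"
  by (induction n) (auto simp: \<alpha>_mult P_power)

lemma \<alpha>_sum_le: "(\<And>a. a \<in> A \<Longrightarrow> f a \<in> P \<and> \<alpha> (f a) \<le> B) \<Longrightarrow> 0 \<le> B \<Longrightarrow> \<alpha> (sum f A) \<le> B"
proof (induction A rule: infinite_finite_induct)
  case (insert a A)
  then have "\<alpha> (f a + sum f A) \<le> max (\<alpha> (f a)) (\<alpha> (sum f A))" by (intro \<alpha>_add P_sum) auto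
  moreover have "\<alpha> (f a) \<le> B" "\<alpha> (sum f A) \<le> B" using insert by auto
  ultimately show ?case using insert.hyps by simp
qed auto

lemma \<alpha>_sum_less: "(\<And>a. a \<in> A \<Longrightarrow> f a \<in> P \<and> \<alpha> (f a) < B) \<Longrightarrow> 0 < B \<Longrightarrow> \<alpha> (sum f A) < B"
proof (induction A rule: infinite_finite_induct)
  case (insert a A)
  then have "\<alpha> (f a + sum f A) \<le> max (\<alpha> (f a)) (\<alpha> (sum f A))" by (intro \<alpha>_add P_sum) auto
  moreover have "\<alpha> (f a) < B" "\<alpha> (sum f A) < B" using insert by auto
  ultimately show ?case using insert.hyps by simp
qed auto

lemma const_subring_sum: "const_subring S \<Longrightarrow> (\<And>a. a \<in> A \<Longrightarrow> f a \<in> S) \<Longrightarrow> sum f A \<in> S"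
proof (induction A rule: infinite_finite_induct)
  case (insert a A)
  then show ?case by (simp add: const_subring_def)
qed (simp_all add: const_subring_def image_subset_iff flip: const_0)

lemma const_subringD:
  assumes "const_subring S"
  shows "S \<subseteq> P" "\<kappa> c \<in> S" "a \<in> S \<Longrightarrow> b \<in> S \<Longrightarrow> a + b \<in> S" "a \<in> S \<Longrightarrow> b \<in> S \<Longrightarrow> a * b \<in> S"
    "0 \<in> S" "1 \<in> S" "a \<in> S \<Longrightarrow> - a \<in> S" "a \<in> S \<Longrightarrow> b \<in> S \<Longrightarrow> a - b \<in> S"
proof -
  show k: "\<kappa> c \<in> S" for c using assms by (auto simp: const_subring_def)
  show "S \<subseteq> P" and a: "a \<in> S \<Longrightarrow> b \<in> S \<Longrightarrow> a + b \<in> S" and m: "a \<in> S \<Longrightarrow> b \<in> S \<Longrightarrow> a * b \<in> S" for a b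
    using assms by (auto simp: const_subring_def)
  show "0 \<in> S" "1 \<in> S" using k[of 0] k[of 1] by (simp_all add: const_0 const_1)
  show n: "a \<in> S \<Longrightarrow> - a \<in> S" for a using m[OF k[of "- 1"]] by (simp add: const_minus1)
  show "a \<in> S \<Longrightarrow> b \<in> S \<Longrightarrow> a - b \<in> S" using a[OF _ n] by fastforce
qed

text \<open>The proof is elimination with complete pivoting.\<close>

lemma solvable_transfer:
  fixes M :: "'i \<Rightarrow> 'j \<Rightarrow> 'b"
  assumes S: "const_subring S" and app: "approximable S" and "finite I" and "finite J"
    and "\<And>r j. r \<in> I \<Longrightarrow> j \<in> J \<Longrightarrow> M r j \<in> S" and "\<And>r. r \<in> I \<Longrightarrow> g r \<in> S"
    and "\<And>w. \<exists>c. (\<forall>j. absv (c j) \<le> 1) \<and> (\<forall>r\<in>I. \<phi> w (g r) = (\<Sum>j\<in>J. c j * \<phi> w (M r j)))"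
  shows "\<exists>\<Delta> \<delta>. \<Delta> \<in> S \<and> \<alpha> \<Delta> > 0 \<and> (\<forall>j\<in>J. \<delta> j \<in> S \<and> \<alpha> (\<delta> j) \<le> \<alpha> \<Delta>)
    \<and> (\<forall>r\<in>I. \<alpha> (\<Delta> * g r - (\<Sum>j\<in>J. \<delta> j * M r j)) = 0)"
  using assms(4-7)
proof (induction "card J" arbitrary: J M g)
  case 0
  then have J: "J = {}" by simp
  \<comment> \<open>With no unknowns left, the right-hand sides vanish at every w, hence have value
    0 at \<alpha> by approximation.\<close>
  have "\<alpha> (g r) = 0" if r: "r \<in> I" for r
  proof (rule ccontr)
    assume "\<alpha> (g r) \<noteq> 0"
    moreover have gS: "g r \<in> S" using 0(4) r by simp
    then have gP: "g r \<in> P" using const_subringD(1)[OF S] by auto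
    ultimately have "0 < \<alpha> (g r)" using \<alpha>_nonneg by force
    then obtain w where w: "\<bar>absv (\<phi> w (g r)) - \<alpha> (g r)\<bar> < \<alpha> (g r)"
      using app[unfolded approximable_def, rule_format, of "{g r}" "\<alpha> (g r)"] gS by auto
    have "\<phi> w (g r) = 0" using 0(5)[of w] r J by auto
    then show False using w by simp
  qed
  then show ?case using J const_subringD[OF S] by (intro exI[of _ 1] exI[of _ "\<lambda>_. 0"]) auto
next
  case (Suc n)
  note SD = const_subringD[OF S]
  have SP: "a \<in> P" if "a \<in> S" for a using SD(1) that by auto
  note MS = Suc.prems(2) and gS = Suc.prems(3)
  \<comment> \<open>A solution bounded by 1 at every w keeps each right-hand side below the largest
    entry of its row; approximation carries this over to \<alpha>.\<close>
  have bound: "\<alpha> (g r) \<le> B" if r: "r \<in> I" and B: "\<And>j. j \<in> J \<Longrightarrow> \<alpha> (M r j) \<le> B" "0 \<le> B" for r B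
  proof (rule ccontr)
    assume "\<not> \<alpha> (g r) \<le> B"
    define \<epsilon> where "\<epsilon> = (\<alpha> (g r) - B) / 2"
    have e: "0 < \<epsilon>" "\<alpha> (g r) = B + 2 * \<epsilon>" using \<open>\<not> \<alpha> (g r) \<le> B\<close> by (simp_all add: \<epsilon>_def field_simps)
    have "insert (g r) (M r ` J) \<subseteq> S" using MS gS r by auto
    then obtain w where w: "\<forall>a\<in>insert (g r) (M r ` J). \<bar>absv (\<phi> w a) - \<alpha> a\<bar> < \<epsilon>"
      using app[unfolded approximable_def, rule_format, of "insert (g r) (M r ` J)" \<epsilon>] Suc.prems(1) e by auto
    obtain c where c: "\<forall>j. absv (c j) \<le> 1" "\<forall>r\<in>I. \<phi> w (g r) = (\<Sum>j\<in>J. c j * \<phi> w (M r j))"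
      using Suc.prems(4)[of w] by (elim exE conjE) (rule that)
    have "absv (\<phi> w (g r)) < B + \<epsilon>"
      unfolding c(2)[rule_format, OF r]
    proof (rule absv_sum_less)
      fix j assume j: "j \<in> J"
      have "absv (c j * \<phi> w (M r j)) \<le> 1 * absv (\<phi> w (M r j))"
        using c(1) by (intro absv_mult_le) auto
      also have "\<dots> < B + \<epsilon>" using w[rule_format, of "M r j"] B(1)[OF j] j by auto
      finally show "absv (c j * \<phi> w (M r j)) < B + \<epsilon>" .
    qed (use B e in auto)
    then show False using w[rule_format, of "g r"] e by auto
  qed
  show ?case
  proof (cases "\<exists>r\<in>I. \<exists>j\<in>J. \<alpha> (M r j) \<noteq> 0")
    case False
    then have "\<alpha> (g r) = 0" if "r \<in> I" for r
      using bound[OF that, of 0] \<alpha>_nonneg[OF SP[OF gS[OF that]]] that by force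
    then show ?thesis using SD by (intro exI[of _ 1] exI[of _ "\<lambda>_. 0"]) auto
  next
    case True
    \<comment> \<open>The pivot is an entry of largest value in the whole matrix. Together with
      \<open>bound\<close> this keeps the unknown recovered by back substitution of size at most
      1.\<close>
    define mx where "mx = Max ((\<lambda>(r, j). \<alpha> (M r j)) ` (I \<times> J))"
    have fin: "finite ((\<lambda>(r, j). \<alpha> (M r j)) ` (I \<times> J))" using assms(3) Suc.prems(1) by simp
    have "mx \<in> (\<lambda>(r, j). \<alpha> (M r j)) ` (I \<times> J)"
      unfolding mx_def using True fin by (intro Max_in) auto
    then obtain r0 j0 where r0: "r0 \<in> I" "j0 \<in> J" "\<alpha> (M r0 j0) = mx" by auto
    have le: "\<alpha> (M r j) \<le> mx" if "r \<in> I" "j \<in> J" for r j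
      unfolding mx_def using fin that by (intro Max_ge) auto
    have mx: "0 < mx"
    proof -
      obtain r j where rj: "r \<in> I" "j \<in> J" "\<alpha> (M r j) \<noteq> 0" using True by blast
      then have "0 < \<alpha> (M r j)" using \<alpha>_nonneg[OF SP[OF MS]] by force
      then show ?thesis using le rj by fastforce
    qed
    define p where "p = M r0 j0"
    have pS: "p \<in> S" using MS r0 by (simp add: p_def)
    define J' where "J' = J - {j0}"
    have J: "J = insert j0 J'" "j0 \<notin> J'" "finite J'" using r0 Suc.prems(1) by (auto simp: J'_def)
    \<comment> \<open>Elimination is carried out without division, as quotients need not lie in S;
      the common denominator is collected in \<Delta>.\<close>
    define M' where "M' r j = p * M r j - M r j0 * M r0 j" for r j
    define g' where "g' r = p * g r - M r j0 * g r0" for r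
    have M'S: "M' r j \<in> S" if "r \<in> I" "j \<in> J'" for r j
      unfolding M'_def using that J r0 by (intro SD MS pS) auto
    have g'S: "g' r \<in> S" if "r \<in> I" for r
      unfolding g'_def using that r0 by (intro SD MS gS pS) auto
    have sol': "\<exists>c. (\<forall>j. absv (c j) \<le> 1) \<and> (\<forall>r\<in>I. \<phi> w (g' r) = (\<Sum>j\<in>J'. c j * \<phi> w (M' r j)))" for w
    proof -
      obtain c where c: "\<forall>j. absv (c j) \<le> 1" "\<forall>r\<in>I. \<phi> w (g r) = (\<Sum>j\<in>J. c j * \<phi> w (M r j))"
        using Suc.prems(4)[of w] by (elim exE conjE) (rule that)
      have "\<phi> w (g' r) = (\<Sum>j\<in>J'. c j * \<phi> w (M' r j))" if r: "r \<in> I" for r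
      proof -
        have mem: "M r j \<in> P" "M r0 j \<in> P" if "j \<in> J" for j using that r r0 MS SP by auto
        have memg: "g r \<in> P" "g r0 \<in> P" using r r0 gS SP by auto
        have eqM: "\<phi> w (M' r j) = \<phi> w p * \<phi> w (M r j) - \<phi> w (M r j0) * \<phi> w (M r0 j)" if "j \<in> J" for j
          unfolding M'_def using mem that r0 SP[OF pS] by (simp add: \<phi>_diff \<phi>_mult P_mult)
        have "\<phi> w (g' r) = \<phi> w p * \<phi> w (g r) - \<phi> w (M r j0) * \<phi> w (g r0)"
          unfolding g'_def using mem memg r0 SP[OF pS] by (simp add: \<phi>_diff \<phi>_mult P_mult)
        also have "\<dots> = (\<Sum>j\<in>J. c j * (\<phi> w p * \<phi> w (M r j) - \<phi> w (M r j0) * \<phi> w (M r0 j)))"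
          unfolding c(2)[rule_format, OF r] c(2)[rule_format, OF r0(1)] sum_distrib_left sum_subtractf[symmetric]
          by (intro sum.cong refl) (simp add: algebra_simps)
        also have "\<dots> = (\<Sum>j\<in>J'. c j * (\<phi> w p * \<phi> w (M r j) - \<phi> w (M r j0) * \<phi> w (M r0 j)))"
          unfolding J(1) using J(2,3) by (simp add: p_def)
        also have "\<dots> = (\<Sum>j\<in>J'. c j * \<phi> w (M' r j))"
          using J(1) by (intro sum.cong refl) (simp add: eqM)
        finally show ?thesis .
      qed
      then show ?thesis using c(1) by (intro exI[of _ c]) simp
    qed
    have card: "n = card J'" using Suc.hyps(2) J by simp
    have "\<exists>\<Delta> \<delta>. \<Delta> \<in> S \<and> \<alpha> \<Delta> > 0 \<and> (\<forall>j\<in>J'. \<delta> j \<in> S \<and> \<alpha> (\<delta> j) \<le> \<alpha> \<Delta>)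
      \<and> (\<forall>r\<in>I. \<alpha> (\<Delta> * g' r - (\<Sum>j\<in>J'. \<delta> j * M' r j)) = 0)"
    proof (rule Suc.hyps(1)[OF card J(3)])
      show "M' r j \<in> S" if "r \<in> I" "j \<in> J'" for r j by (rule M'S[OF that])
      show "g' r \<in> S" if "r \<in> I" for r by (rule g'S[OF that])
    qed (rule sol')
    then obtain \<Delta> \<delta> where D: "\<Delta> \<in> S" "\<alpha> \<Delta> > 0" "\<forall>j\<in>J'. \<delta> j \<in> S \<and> \<alpha> (\<delta> j) \<le> \<alpha> \<Delta>"
      "\<forall>r\<in>I. \<alpha> (\<Delta> * g' r - (\<Sum>j\<in>J'. \<delta> j * M' r j)) = 0"
      by (elim exE conjE) (rule that)
    have dS: "\<delta> j \<in> S" "\<alpha> (\<delta> j) \<le> \<alpha> \<Delta>" if "j \<in> J'" for j using D(3) that by auto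
    \<comment> \<open>Back substitution for the eliminated unknown. The new denominator is
      \<open>\<Delta> * p\<close>, so the other numerators are multiplied by p.\<close>
    define \<delta>0 where "\<delta>0 = \<Delta> * g r0 - (\<Sum>j\<in>J'. \<delta> j * M r0 j)"
    define \<delta>' where "\<delta>' j = (if j = j0 then \<delta>0 else p * \<delta> j)" for j
    have sS: "(\<Sum>j\<in>J'. \<delta> j * M r0 j) \<in> S"
      using J r0 by (intro const_subring_sum[OF S] SD(4) dS MS) auto
    have d0S: "\<delta>0 \<in> S" unfolding \<delta>0_def using D r0 by (intro SD(8) SD(4) gS sS) auto
    have "\<alpha> \<delta>0 \<le> \<alpha> \<Delta> * mx"
    proof -
      have "\<alpha> \<delta>0 \<le> max (\<alpha> (\<Delta> * g r0)) (\<alpha> (\<Sum>j\<in>J'. \<delta> j * M r0 j))"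
        unfolding \<delta>0_def by (intro \<alpha>_diff SP SD(4) D gS r0 sS)
      moreover have "\<alpha> (\<Delta> * g r0) \<le> \<alpha> \<Delta> * mx"
        using bound[OF r0(1) le[OF r0(1)]] mx D SP[OF D(1)] SP[OF gS[OF r0(1)]] by (simp add: \<alpha>_mult)
      moreover have "\<alpha> (\<Sum>j\<in>J'. \<delta> j * M r0 j) \<le> \<alpha> \<Delta> * mx"
      proof (intro \<alpha>_sum_le conjI)
        fix j assume j: "j \<in> J'"
        then have j': "j \<in> J" using J by simp
        show "\<delta> j * M r0 j \<in> P" by (intro SP SD(4) dS j MS r0 j')
        have "\<alpha> (\<delta> j * M r0 j) = \<alpha> (\<delta> j) * \<alpha> (M r0 j)" by (intro \<alpha>_mult SP dS j MS r0 j')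
        also have "\<dots> \<le> \<alpha> \<Delta> * mx"
          using dS(2)[OF j] le[OF r0(1) j'] D(1,2) by (intro mult_mono \<alpha>_nonneg SP MS r0 j') auto
        finally show "\<alpha> (\<delta> j * M r0 j) \<le> \<alpha> \<Delta> * mx" .
      qed (use D mx in auto)
      ultimately show ?thesis by simp
    qed
    moreover have Dp: "\<alpha> (\<Delta> * p) = \<alpha> \<Delta> * mx" using SP[OF D(1)] SP[OF pS] r0 by (simp add: \<alpha>_mult p_def)
    moreover have "\<alpha> (p * \<delta> j) \<le> \<alpha> \<Delta> * mx" if j: "j \<in> J'" for j
      using SP[OF dS(1)[OF j]] SP[OF pS] dS(2)[OF j] r0 mx by (simp add: \<alpha>_mult p_def mult.commute)
    ultimately have d': "\<forall>j\<in>J. \<delta>' j \<in> S \<and> \<alpha> (\<delta>' j) \<le> \<alpha> (\<Delta> * p)"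
      using d0S J(1,2) dS(1) SD(4)[OF pS] by (auto simp: \<delta>'_def)
    have "\<alpha> ((\<Delta> * p) * g r - (\<Sum>j\<in>J. \<delta>' j * M r j)) = 0" if r: "r \<in> I" for r
    proof -
      have "(\<Sum>j\<in>J. \<delta>' j * M r j) = \<delta>0 * M r j0 + (\<Sum>j\<in>J'. p * \<delta> j * M r j)"
        unfolding J(1) using J(2,3) by (auto simp: \<delta>'_def intro!: sum.cong)
      then have "(\<Delta> * p) * g r - (\<Sum>j\<in>J. \<delta>' j * M r j) =
          (\<Delta> * g' r) - ((\<Sum>j\<in>J'. p * \<delta> j * M r j) - M r j0 * (\<Sum>j\<in>J'. \<delta> j * M r0 j))"
        by (simp add: \<delta>0_def g'_def algebra_simps)
      also have "(\<Sum>j\<in>J'. p * \<delta> j * M r j) - M r j0 * (\<Sum>j\<in>J'. \<delta> j * M r0 j) = (\<Sum>j\<in>J'. \<delta> j * M' r j)"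
        unfolding M'_def sum_distrib_left sum_subtractf[symmetric] by (intro sum.cong refl) (simp add: algebra_simps)
      finally show ?thesis using D(4) r by simp
    qed
    then show ?thesis using d' Dp D mx SD(4)[OF D(1) pS]
      by (intro exI[of _ "\<Delta> * p"] exI[of _ \<delta>']) simp
  qed
qed

section \<open>Polynomials over a subring and their specialisations at w\<close>

definition coeffs_in :: "'b set \<Rightarrow> 'b poly \<Rightarrow> bool" where
  "coeffs_in S p \<longleftrightarrow> (\<forall>i. coeff p i \<in> S)"

context
  fixes S assumes S: "const_subring S"
begin

lemma coeffs_in_mult: "coeffs_in S p \<Longrightarrow> coeffs_in S q \<Longrightarrow> coeffs_in S (p * q)"
  unfolding coeffs_in_def coeff_mult by (intro allI const_subring_sum[OF S] const_subringD(4)[OF S]) auto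

lemma coeffs_in_smult: "a \<in> S \<Longrightarrow> coeffs_in S p \<Longrightarrow> coeffs_in S (Polynomial.smult a p)"
  unfolding coeffs_in_def by (simp add: const_subringD(4)[OF S])

lemma coeffs_in_1: "coeffs_in S 1"
  using const_subringD(5,6)[OF S] by (auto simp: coeffs_in_def coeff_1 split: if_splits)

lemma coeffs_in_monom: "a \<in> S \<Longrightarrow> coeffs_in S (monom a n)"
  using const_subringD(5)[OF S] by (auto simp: coeffs_in_def)

lemma coeffs_in_prod: "(\<And>a. a \<in> A \<Longrightarrow> coeffs_in S (f a)) \<Longrightarrow> coeffs_in S (prod f A)"
  by (induction A rule: infinite_finite_induct) (auto intro: coeffs_in_mult coeffs_in_1)

lemma coeffs_in_prod_list: "(\<And>a. a \<in> set hs \<Longrightarrow> coeffs_in S a) \<Longrightarrow> coeffs_in S (prod_list hs)"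
  by (induction hs) (auto intro: coeffs_in_mult coeffs_in_1)

lemma coeffs_in_power: "coeffs_in S p \<Longrightarrow> coeffs_in S (p ^ n)"
  by (induction n) (auto intro: coeffs_in_mult coeffs_in_1)

lemma coeffs_inD: "coeffs_in S p \<Longrightarrow> coeff p i \<in> P"
  using const_subringD(1)[OF S] by (auto simp: coeffs_in_def)

lemma map_poly_\<phi>_mult:
  assumes "coeffs_in S p" "coeffs_in S q"
  shows "map_poly (\<phi> w) (p * q) = map_poly (\<phi> w) p * map_poly (\<phi> w) q"
proof (rule poly_eqI)
  fix n
  have "\<phi> w (\<Sum>i\<le>n. coeff p i * coeff q (n - i)) = (\<Sum>i\<le>n. \<phi> w (coeff p i) * \<phi> w (coeff q (n - i)))"
    using coeffs_inD[OF assms(1)] coeffs_inD[OF assms(2)] by (subst \<phi>_sum) (auto simp: \<phi>_mult P_mult)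
  then show "coeff (map_poly (\<phi> w) (p * q)) n = coeff (map_poly (\<phi> w) p * map_poly (\<phi> w) q) n"
    by (simp add: coeff_mult coeff_map_poly)
qed

lemma map_poly_\<phi>_smult:
  "a \<in> S \<Longrightarrow> coeffs_in S p \<Longrightarrow> map_poly (\<phi> w) (Polynomial.smult a p) = Polynomial.smult (\<phi> w a) (map_poly (\<phi> w) p)"
  using const_subringD(1)[OF S] by (intro poly_eqI) (auto simp: coeff_map_poly coeffs_in_def intro!: \<phi>_mult)

lemma map_poly_\<phi>_1: "map_poly (\<phi> w) 1 = 1"
  by (intro poly_eqI) (simp add: coeff_map_poly coeff_1)

lemma map_poly_\<phi>_prod:
  "(\<And>a. a \<in> A \<Longrightarrow> coeffs_in S (f a)) \<Longrightarrow> map_poly (\<phi> w) (prod f A) = (\<Prod>a\<in>A. map_poly (\<phi> w) (f a))"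
  by (induction A rule: infinite_finite_induct) (auto simp: map_poly_\<phi>_1 map_poly_\<phi>_mult coeffs_in_prod)

lemma map_poly_\<phi>_prod_list:
  "(\<And>a. a \<in> set hs \<Longrightarrow> coeffs_in S a) \<Longrightarrow> map_poly (\<phi> w) (prod_list hs) = prod_list (map (map_poly (\<phi> w)) hs)"
  by (induction hs) (auto simp: map_poly_\<phi>_1 map_poly_\<phi>_mult coeffs_in_prod_list)

lemma map_poly_\<phi>_power: "coeffs_in S p \<Longrightarrow> map_poly (\<phi> w) (p ^ n) = map_poly (\<phi> w) p ^ n"
  by (induction n) (auto simp: map_poly_\<phi>_1 map_poly_\<phi>_mult coeffs_in_power)

lemma poly_in_P: "coeffs_in S p \<Longrightarrow> y \<in> P \<Longrightarrow> poly p y \<in> P"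
  unfolding poly_altdef by (intro P_sum P_mult P_power coeffs_inD)

lemma degree_map_poly_\<phi>: "degree (map_poly (\<phi> w) p) \<le> degree p"
  by (rule degree_le) (simp add: coeff_map_poly coeff_eq_0)

lemma \<phi>_poly:
  assumes "coeffs_in S p" "y \<in> P"
  shows "\<phi> w (poly p y) = poly (map_poly (\<phi> w) p) (\<phi> w y)"
proof -
  have "\<phi> w (poly p y) = (\<Sum>i\<le>degree p. \<phi> w (coeff p i) * \<phi> w y ^ i)"
    unfolding poly_altdef
    by (subst \<phi>_sum) (auto intro!: P_mult P_power coeffs_inD assms sum.cong simp: \<phi>_mult \<phi>_power P_power coeffs_inD assms)
  also have "\<dots> = (\<Sum>i\<le>degree (map_poly (\<phi> w) p). \<phi> w (coeff p i) * \<phi> w y ^ i)"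
  proof (intro sum.mono_neutral_right)
    show "{..degree (map_poly (\<phi> w) p)} \<subseteq> {..degree p}" using degree_map_poly_\<phi>[of w p] by auto
    show "\<forall>i\<in>{..degree p} - {..degree (map_poly (\<phi> w) p)}. \<phi> w (coeff p i) * \<phi> w y ^ i = 0"
      using coeff_eq_0[of "map_poly (\<phi> w) p"] by (auto simp: coeff_map_poly)
  qed simp
  finally show ?thesis by (simp add: poly_altdef coeff_map_poly)
qed

end
end

section \<open>Approximation after adjoining one element\<close>

locale alg_closed_evaluations = evaluations absv P \<alpha> \<kappa> \<phi> + alg_closed_nonarch_field absv
  for absv :: "'k::alg_closed_field \<Rightarrow> real" and P :: "'b::comm_ring_1 set"
    and \<alpha> :: "'b \<Rightarrow> real" and \<kappa> :: "'k \<Rightarrow> 'b" and \<phi> :: "'w \<Rightarrow> 'b \<Rightarrow> 'k"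
begin

lemma \<alpha>_prod_list_le:
  assumes "\<And>h. h \<in> set hs \<Longrightarrow> v h \<in> P \<and> \<alpha> (v h) \<le> B"
  shows "prod_list (map v hs) \<in> P \<and> \<alpha> (prod_list (map v hs)) \<le> B ^ length hs"
  using assms
proof (induction hs)
  case (Cons h hs)
  then have h: "v h \<in> P" "\<alpha> (v h) \<le> B" and hs: "prod_list (map v hs) \<in> P" "\<alpha> (prod_list (map v hs)) \<le> B ^ length hs" by auto
  have "0 \<le> B" using h \<alpha>_nonneg order_trans by blast
  then have "\<alpha> (v h) * \<alpha> (prod_list (map v hs)) \<le> B * B ^ length hs"
    using h hs \<alpha>_nonneg by (intro mult_mono) auto
  then show ?case using h hs by (simp add: \<alpha>_mult P_mult)
qed simp

lemma \<alpha>_prod_list_less: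
  assumes "\<And>h. h \<in> set hs \<Longrightarrow> v h \<in> P \<and> \<alpha> (v h) \<le> B" "h0 \<in> set hs" "\<alpha> (v h0) < B"
  shows "\<alpha> (prod_list (map v hs)) < B ^ length hs"
  using assms(1,2)
proof (induction hs)
  case (Cons h hs)
  then have h: "v h \<in> P" "\<alpha> (v h) \<le> B" by auto
  have hs: "prod_list (map v hs) \<in> P" "\<alpha> (prod_list (map v hs)) \<le> B ^ length hs"
    using \<alpha>_prod_list_le[of hs v B] Cons.prems by auto
  have "v h0 \<in> P" using Cons.prems by auto
  then have B: "0 < B" using \<alpha>_nonneg[of "v h0"] assms(3) by linarith
  have "\<alpha> (v h) * \<alpha> (prod_list (map v hs)) < B * B ^ length hs"
  proof (cases "h = h0")
    case True
    then have "\<alpha> (v h) * \<alpha> (prod_list (map v hs)) \<le> \<alpha> (v h) * B ^ length hs"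
      using hs \<alpha>_nonneg[OF h(1)] by (intro mult_left_mono)
    also have "\<dots> < B * B ^ length hs" using True assms(3) B by simp
    finally show ?thesis .
  next
    case False
    then have lt: "\<alpha> (prod_list (map v hs)) < B ^ length hs" using Cons by auto
    have "\<alpha> (v h) * \<alpha> (prod_list (map v hs)) \<le> B * \<alpha> (prod_list (map v hs))"
      using h \<alpha>_nonneg[OF hs(1)] by (intro mult_right_mono)
    also have "\<dots> < B * B ^ length hs" using lt B by simp
    finally show ?thesis .
  qed
  then show ?case using h hs by (simp add: \<alpha>_mult)
qed simp

text \<open>Comparing coefficients turns the certificates at all w into one linear system whose size
  does not depend on w. Its solution over \<alpha> is a relation at y in which
  \<open>\<Delta> * G ^ e\<close> is strictly larger than all other terms, which is absurd.\<close>

lemma not_certified: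
  assumes S: "const_subring S" and app: "approximable S" and y: "y \<in> P"
    and A: "finite A" "\<And>F. F \<in> A \<Longrightarrow> coeffs_in S F" and G: "coeffs_in S G"
    and lt: "\<And>F. F \<in> A \<Longrightarrow> \<alpha> (poly F y) < \<alpha> (poly G y)" and G0: "0 < \<alpha> (poly G y)"
    and cert: "\<And>w. map_poly (\<phi> w) G ^ e \<in> ospan (mixed_prods e (map_poly (\<phi> w) ` A) (map_poly (\<phi> w) G))"
  shows False
proof -
  \<comment> \<open>The unknowns are indexed by words in the original polynomials, since different
    polynomials may specialise to the same one at w.\<close>
  define J where "J = {hs. (length hs = e \<and> set hs \<subseteq> insert G A) \<and> (\<exists>h\<in>set hs. h \<in> A)}"
  have finJ: "finite J"
    unfolding J_def using finite_lists_length_eq[of "insert G A" e] A(1)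
    by (auto intro: rev_finite_subset simp: conj_commute)
  have Jin: "coeffs_in S h" if "hs \<in> J" "h \<in> set hs" for hs h
    using that A(2) G by (auto simp: J_def)
  have JS: "coeffs_in S (prod_list hs)" if "hs \<in> J" for hs
    by (rule coeffs_in_prod_list[OF S]) (rule Jin[OF that])
  have GS: "coeffs_in S (G ^ e)" by (rule coeffs_in_power[OF S G])
  define N where "N = Max (insert (degree (G ^ e)) ((\<lambda>hs. degree (prod_list hs)) ` J))"
  have N: "degree (G ^ e) \<le> N" "\<And>hs. hs \<in> J \<Longrightarrow> degree (prod_list hs) \<le> N"
    unfolding N_def using finJ by (auto intro!: Max_ge)
  have "\<exists>\<Delta> \<delta>. \<Delta> \<in> S \<and> \<alpha> \<Delta> > 0 \<and> (\<forall>hs\<in>J. \<delta> hs \<in> S \<and> \<alpha> (\<delta> hs) \<le> \<alpha> \<Delta>)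
    \<and> (\<forall>r\<in>{..N}. \<alpha> (\<Delta> * coeff (G ^ e) r - (\<Sum>hs\<in>J. \<delta> hs * coeff (prod_list hs) r)) = 0)"
  proof (rule solvable_transfer[OF S app _ finJ])
    fix w
    have "map_poly (\<phi> w) G ^ e \<in> ospan ((\<lambda>hs. map_poly (\<phi> w) (prod_list hs)) ` J)"
    proof (rule ospan_mono[OF cert[of w]], rule subsetI)
      fix x assume "x \<in> mixed_prods e (map_poly (\<phi> w) ` A) (map_poly (\<phi> w) G)"
      then obtain ks where ks: "x = prod_list ks" "length ks = e" "set ks \<subseteq> map_poly (\<phi> w) ` insert G A"
        "\<exists>h\<in>set ks. h \<in> map_poly (\<phi> w) ` A"
        unfolding mixed_prods_def by auto
      obtain k0 where k0: "k0 \<in> set ks" "k0 \<in> map_poly (\<phi> w) ` A" using ks(4) by blast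
      \<comment> \<open>A factor that comes from A is lifted to A even if G has the same
        specialisation; otherwise the lifted word could lose its required letter from A.\<close>
      define pre where "pre k = (SOME h. (k \<in> map_poly (\<phi> w) ` A \<longrightarrow> h \<in> A) \<and> h \<in> insert G A \<and> map_poly (\<phi> w) h = k)" for k
      have pre: "(k \<in> map_poly (\<phi> w) ` A \<longrightarrow> pre k \<in> A) \<and> pre k \<in> insert G A \<and> map_poly (\<phi> w) (pre k) = k"
        if "k \<in> set ks" for k
      proof -
        have "k \<in> map_poly (\<phi> w) ` insert G A" using ks(3) that by auto
        then have "\<exists>h. (k \<in> map_poly (\<phi> w) ` A \<longrightarrow> h \<in> A) \<and> h \<in> insert G A \<and> map_poly (\<phi> w) h = k"
          by (cases "k \<in> map_poly (\<phi> w) ` A") auto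
        then show ?thesis unfolding pre_def by (rule someI_ex)
      qed
      have mem: "map pre ks \<in> J"
        unfolding J_def using pre k0 ks(2) by (auto intro!: bexI[of _ k0])
      have "map (map_poly (\<phi> w)) (map pre ks) = ks"
        using pre by (simp add: map_idI)
      then have "x = map_poly (\<phi> w) (prod_list (map pre ks))"
        using map_poly_\<phi>_prod_list[OF S, of "map pre ks" w] Jin[OF mem] ks(1) by simp
      then show "x \<in> (\<lambda>hs. map_poly (\<phi> w) (prod_list hs)) ` J" using mem by blast
    qed
    from ospan_image[OF finJ this] obtain c where c: "\<forall>j. absv (c j) \<le> 1"
      "map_poly (\<phi> w) G ^ e = (\<Sum>hs\<in>J. Polynomial.smult (c hs) (map_poly (\<phi> w) (prod_list hs)))"
      by (elim exE conjE) (rule that)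
    have "\<phi> w (coeff (G ^ e) r) = (\<Sum>hs\<in>J. c hs * \<phi> w (coeff (prod_list hs) r))" for r
      using arg_cong[OF c(2), of "\<lambda>p. coeff p r"]
      by (simp add: map_poly_\<phi>_power[OF S G, symmetric] coeff_map_poly coeff_sum)
    then show "\<exists>c. (\<forall>j. absv (c j) \<le> 1) \<and> (\<forall>r\<in>{..N}. \<phi> w (coeff (G ^ e) r) = (\<Sum>hs\<in>J. c hs * \<phi> w (coeff (prod_list hs) r)))"
      using c(1) by (intro exI[of _ c]) simp
  qed (use JS GS in \<open>auto simp: coeffs_in_def\<close>)
  then obtain \<Delta> \<delta> where D: "\<Delta> \<in> S" "\<alpha> \<Delta> > 0" "\<forall>hs\<in>J. \<delta> hs \<in> S \<and> \<alpha> (\<delta> hs) \<le> \<alpha> \<Delta>"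
    "\<forall>r\<in>{..N}. \<alpha> (\<Delta> * coeff (G ^ e) r - (\<Sum>hs\<in>J. \<delta> hs * coeff (prod_list hs) r)) = 0"
    by (elim exE conjE) (rule that)
  have SP: "a \<in> P" if "a \<in> S" for a using const_subringD(1)[OF S] that by auto
  \<comment> \<open>The coefficients of R have value 0 at \<alpha>, although R itself may be
    nonzero.\<close>
  define R where "R = Polynomial.smult \<Delta> (G ^ e) - (\<Sum>hs\<in>J. Polynomial.smult (\<delta> hs) (prod_list hs))"
  have cR: "coeff R r = \<Delta> * coeff (G ^ e) r - (\<Sum>hs\<in>J. \<delta> hs * coeff (prod_list hs) r)" for r
    by (simp add: R_def coeff_sum)
  have cRS: "coeff R r \<in> S" for r
    unfolding cR using D JS GS unfolding coeffs_in_def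
    by (intro const_subringD(8)[OF S] const_subringD(4)[OF S] const_subring_sum[OF S]) auto
  have aR: "\<alpha> (coeff R r) = 0" for r
  proof (cases "r \<le> N")
    case True
    then show ?thesis using D(4) by (simp add: cR)
  next
    case False
    have "coeff (prod_list hs) r = 0" if "hs \<in> J" for hs
      using N(2)[OF that] False by (intro coeff_eq_0) simp
    moreover have "coeff (G ^ e) r = 0" using N(1) False by (intro coeff_eq_0) simp
    ultimately show ?thesis by (simp add: cR)
  qed
  have RP: "poly R y \<in> P" using cRS by (intro poly_in_P[OF S _ y]) (simp add: coeffs_in_def)
  have "\<alpha> (poly R y) \<le> 0"
    unfolding poly_altdef using cRS SP y aR
    by (intro \<alpha>_sum_le conjI P_mult P_power) (auto simp: \<alpha>_mult P_power)
  then have R0: "\<alpha> (poly R y) = 0" using \<alpha>_nonneg[OF RP] by simp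
  define B where "B = \<alpha> (poly G y)"
  have yP: "poly h y \<in> P" if "hs \<in> J" "h \<in> set hs" for hs h
    by (rule poly_in_P[OF S Jin[OF that] y])
  have hP: "poly (prod_list hs) y \<in> P" if "hs \<in> J" for hs by (rule poly_in_P[OF S JS[OF that] y])
  have plist: "poly (prod_list hs) y = prod_list (map (\<lambda>h. poly h y) hs)" for hs
    by (induction hs) auto
  have small: "\<alpha> (poly (prod_list hs) y) < B ^ e" if hs: "hs \<in> J" for hs
  proof -
    obtain h0 where h0: "h0 \<in> set hs" "h0 \<in> A" using hs by (auto simp: J_def)
    have "\<alpha> (prod_list (map (\<lambda>h. poly h y) hs)) < B ^ length hs"
    proof (rule \<alpha>_prod_list_less)
      show "poly h y \<in> P \<and> \<alpha> (poly h y) \<le> B" if "h \<in> set hs" for h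
        using that hs yP[OF hs that] lt by (auto simp: J_def B_def less_imp_le)
      show "\<alpha> (poly h0 y) < B" unfolding B_def by (rule lt[OF h0(2)])
    qed (rule h0(1))
    then show ?thesis using hs by (simp add: plist J_def)
  qed
  have "poly (Polynomial.smult \<Delta> (G ^ e)) y = poly R y + (\<Sum>hs\<in>J. \<delta> hs * poly (prod_list hs) y)"
    by (simp add: R_def poly_sum)
  moreover have "\<alpha> (\<Sum>hs\<in>J. \<delta> hs * poly (prod_list hs) y) < \<alpha> \<Delta> * B ^ e"
  proof (rule \<alpha>_sum_less)
    fix hs assume hs: "hs \<in> J"
    have d: "\<delta> hs \<in> P" "\<alpha> (\<delta> hs) \<le> \<alpha> \<Delta>" using D(3) hs SP by auto
    have "\<alpha> (\<delta> hs * poly (prod_list hs) y) = \<alpha> (\<delta> hs) * \<alpha> (poly (prod_list hs) y)"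
      by (rule \<alpha>_mult[OF d(1) hP[OF hs]])
    also have "\<dots> \<le> \<alpha> \<Delta> * \<alpha> (poly (prod_list hs) y)"
      using d \<alpha>_nonneg[OF hP[OF hs]] by (intro mult_right_mono)
    also have "\<dots> < \<alpha> \<Delta> * B ^ e" using small[OF hs] D(2) by simp
    finally show "\<delta> hs * poly (prod_list hs) y \<in> P \<and> \<alpha> (\<delta> hs * poly (prod_list hs) y) < \<alpha> \<Delta> * B ^ e"
      using P_mult[OF d(1) hP[OF hs]] by simp
  qed (use D(2) G0 in \<open>simp add: B_def\<close>)
  moreover have sP: "(\<Sum>hs\<in>J. \<delta> hs * poly (prod_list hs) y) \<in> P"
    using D(3) SP by (intro P_sum P_mult hP) auto
  moreover have "0 < \<alpha> \<Delta> * B ^ e" using D(2) G0 by (simp add: B_def)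
  moreover have "\<alpha> (poly R y + (\<Sum>hs\<in>J. \<delta> hs * poly (prod_list hs) y)) \<le> max 0 (\<alpha> (\<Sum>hs\<in>J. \<delta> hs * poly (prod_list hs) y))"
    using \<alpha>_add[OF RP sP] R0 by simp
  ultimately have "\<alpha> (poly (Polynomial.smult \<Delta> (G ^ e)) y) < \<alpha> \<Delta> * B ^ e"
    by (simp only: max_less_iff_conj le_less_trans)
  moreover have "\<alpha> (poly (Polynomial.smult \<Delta> (G ^ e)) y) = \<alpha> \<Delta> * B ^ e"
    using SP[OF D(1)] poly_in_P[OF S G y] by (simp add: \<alpha>_mult P_power \<alpha>_power B_def)
  ultimately show False by simp
qed

text \<open>Were no point near \<open>\<alpha>\<close>, then at every \<open>w\<close> the inequalities \<open>|F| < |G|\<close>, which hold for \<open>\<alpha>\<close> and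
  express closeness, would have no common solution, so that there would be a certificate at every \<open>w\<close>.
  The constant \<open>1\<close> and the leading power of the variable are added to the \<open>F\<close> in order to exclude
  common zeros and to control the behaviour at infinity.\<close>

lemma approximable_adjoin:
  assumes S: "const_subring S" and app: "approximable S" and y: "y \<in> P"
    and ext: "\<And>w b. \<exists>w'. (\<forall>s\<in>S. \<phi> w' s = \<phi> w s) \<and> \<phi> w' y = b"
  shows "approximable {poly p y |p. coeffs_in S p}"
  unfolding approximable_def
proof (intro allI impI)
  fix E :: "'b set" and \<epsilon> :: real
  assume E: "finite E" "E \<subseteq> {poly p y |p. coeffs_in S p}" and e: "0 < \<epsilon>"
  note SD = const_subringD[OF S]
  have "\<forall>f\<in>E. \<exists>p. f = poly p y \<and> coeffs_in S p" using E(2) by blast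
  then obtain pf where "\<forall>f\<in>E. f = poly (pf f) y \<and> coeffs_in S (pf f)" by (rule bchoice[THEN exE])
  then have pf: "f = poly (pf f) y" "coeffs_in S (pf f)" if "f \<in> E" for f using that by auto
  have EP: "f \<in> P" if "f \<in> E" for f using poly_in_P[OF S pf(2)[OF that] y] pf(1)[OF that] by simp
  define Ep where "Ep = {f \<in> E. 0 < \<alpha> f}"
  have Ep: "finite Ep" "Ep \<subseteq> E" using E by (auto simp: Ep_def)
  \<comment> \<open>Closeness of |f| to \<open>\<alpha> f\<close> is encoded by strict bounds with
    constants of k: |f| < |d f| for all f, and |c f| < |f| where \<open>\<alpha> f\<close> is
    positive.\<close>
  have "\<exists>d. \<alpha> f < absv d \<and> absv d < \<alpha> f + \<epsilon>" if "f \<in> E" for f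
  proof -
    have a: "0 < \<alpha> f + \<epsilon> / 2" "\<alpha> f + \<epsilon> / 2 < \<alpha> f + \<epsilon>" using \<alpha>_nonneg[OF EP[OF that]] e by simp_all
    obtain x where "\<alpha> f + \<epsilon> / 2 < absv x" "absv x < \<alpha> f + \<epsilon>" by (rule absv_dense[OF a])
    then show ?thesis using e by (intro exI[of _ x]) linarith
  qed
  then have "\<forall>f\<in>E. \<exists>d. \<alpha> f < absv d \<and> absv d < \<alpha> f + \<epsilon>" by blast
  then obtain d where "\<forall>f\<in>E. \<alpha> f < absv (d f) \<and> absv (d f) < \<alpha> f + \<epsilon>" by (rule bchoice[THEN exE])
  then have d: "\<alpha> f < absv (d f)" "absv (d f) < \<alpha> f + \<epsilon>" if "f \<in> E" for f using that by auto
  have "\<exists>c. max (\<alpha> f - \<epsilon>) (\<alpha> f / 2) < absv c \<and> absv c < \<alpha> f" if "f \<in> Ep" for f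
  proof -
    have a: "0 < max (\<alpha> f - \<epsilon>) (\<alpha> f / 2)" "max (\<alpha> f - \<epsilon>) (\<alpha> f / 2) < \<alpha> f"
      using that e by (simp_all add: Ep_def less_max_iff_disj)
    obtain x where "max (\<alpha> f - \<epsilon>) (\<alpha> f / 2) < absv x" "absv x < \<alpha> f" by (rule absv_dense[OF a])
    then show ?thesis by (intro exI[of _ x] conjI)
  qed
  then have "\<forall>f\<in>Ep. \<exists>c. max (\<alpha> f - \<epsilon>) (\<alpha> f / 2) < absv c \<and> absv c < \<alpha> f" by blast
  then obtain c where "\<forall>f\<in>Ep. max (\<alpha> f - \<epsilon>) (\<alpha> f / 2) < absv (c f) \<and> absv (c f) < \<alpha> f" by (rule bchoice[THEN exE])
  then have c: "\<alpha> f - \<epsilon> < absv (c f)" "absv (c f) < \<alpha> f" if "f \<in> Ep" for f using that by auto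
  \<comment> \<open>A bound for y itself, with which a polynomial of dominant degree can be scaled
    to be small at y.\<close>
  obtain d0 where d0: "\<alpha> y + 1 < absv d0" 
    by (rule absv_dense[of "\<alpha> y + 1" "\<alpha> y + 2"]) (use \<alpha>_nonneg[OF y] in auto)
  define a0 where "a0 = (\<Prod>f\<in>Ep. \<alpha> f)"
  have a0: "0 < a0" unfolding a0_def by (rule prod_pos) (simp add: Ep_def)
  obtain c0 where "a0 / 2 < absv c0" and c0': "absv c0 < a0"
    by (rule absv_dense[of "a0 / 2" a0]) (use a0 in auto)
  then have c0: "0 < absv c0" "absv c0 < a0" using a0 by auto
  then have c00: "c0 \<noteq> 0" by auto
  \<comment> \<open>Comparison with the single polynomial G, a scaled product of all f of positive
    value, expresses every condition: \<open>U f\<close> smaller than G means |f| < |d f|, and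
    \<open>L f\<close> smaller than G means |c f| < |f|. As \<open>c0\<close> is smaller than the
    product of the values, \<open>\<alpha> (poly G y)\<close> exceeds 1.\<close>
  define G where "G = Polynomial.smult (\<kappa> (1 / c0)) (\<Prod>f\<in>Ep. pf f)"
  define U where "U f = Polynomial.smult (\<kappa> (1 / d f)) (pf f * G)" for f
  define L where "L f = Polynomial.smult (\<kappa> (c f / c0)) (\<Prod>f'\<in>Ep - {f}. pf f')" for f
  define D where "D = Suc (Max (insert (degree G) (degree ` (U ` E \<union> L ` Ep))))"
  have D: "0 < D" "degree G < D" "\<And>F. F \<in> U ` E \<union> L ` Ep \<Longrightarrow> degree F < D"
    unfolding D_def using E Ep by (auto intro!: le_imp_less_Suc Max_ge)
  \<comment> \<open>This power has degree above all others and, by the choice of \<open>d0\<close>,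
    value at most 1 at y. The constant 1 has no zero, so F1 and 1 form the pair without common zeros
    that \<open>certificate\<close> starts from.\<close>
  define F1 where "F1 = monom (\<kappa> ((1 / d0) ^ D)) D"
  define A where "A = {F1, 1} \<union> (U ` E \<union> L ` Ep)"
  have finA: "finite A" using E Ep by (simp add: A_def)
  have pfS: "coeffs_in S (\<Prod>f\<in>X. pf f)" if "X \<subseteq> E" for X
    using that by (intro coeffs_in_prod[OF S] pf) auto
  have GS: "coeffs_in S G" unfolding G_def by (intro coeffs_in_smult[OF S] pfS SD Ep)
  have US: "coeffs_in S (U f)" if "f \<in> E" for f
    unfolding U_def by (intro coeffs_in_smult[OF S] coeffs_in_mult[OF S] GS pf that SD)
  have LS: "coeffs_in S (L f)" for f
    unfolding L_def using Ep by (intro coeffs_in_smult[OF S] pfS SD) auto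
  have F1S: "coeffs_in S F1" unfolding F1_def by (intro coeffs_in_monom[OF S] SD)
  have AS: "coeffs_in S F" if "F \<in> A" for F
    using that US LS F1S coeffs_in_1[OF S] by (auto simp: A_def)
  have ypr: "poly (\<Prod>f\<in>X. pf f) y \<in> P \<and> \<alpha> (poly (\<Prod>f\<in>X. pf f) y) = (\<Prod>f\<in>X. \<alpha> f)" if "X \<subseteq> E" for X
  proof -
    have "finite X" using E(1) that by (rule rev_finite_subset)
    then show ?thesis using that
    proof (induction X rule: finite_induct)
      case (insert f X)
      then show ?case using pf(1)[of f] EP[of f] by (simp add: P_mult \<alpha>_mult)
    qed simp
  qed
  have aG: "\<alpha> (poly G y) = a0 / absv c0"
    using ypr[OF Ep(2)] const_P[of "1 / c0"] by (simp add: G_def \<alpha>_mult \<alpha>_const absv_divide a0_def)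
  have aG1: "1 < \<alpha> (poly G y)" unfolding aG using c0 by simp
  have GP: "poly G y \<in> P" by (rule poly_in_P[OF S GS y])
  have ltA: "\<alpha> (poly F y) < \<alpha> (poly G y)" if FA: "F \<in> A" for F
  proof -
    consider "F = F1" | "F = 1" | f where "f \<in> E" "F = U f" | f where "f \<in> Ep" "F = L f"
      using FA unfolding A_def by blast
    then show ?thesis
    proof cases
      case 1
      have "\<alpha> (poly F y) = (\<alpha> y / absv d0) ^ D"
        using y const_P[of "(1 / d0) ^ D"]
        by (simp add: 1 F1_def poly_monom \<alpha>_mult \<alpha>_const P_power \<alpha>_power absv_power absv_divide power_divide)
      also have "\<dots> \<le> 1" using d0 \<alpha>_nonneg[OF y] by (intro power_le_one) (auto simp: divide_le_eq)
      finally show ?thesis using aG1 by simp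
    next
      case 2
      then show ?thesis using aG1 by simp
    next
      case 3
      have "\<alpha> (poly F y) = \<alpha> f / absv (d f) * \<alpha> (poly G y)"
        using const_P[of "1 / d f"] EP[OF 3(1)] GP pf(1)[OF 3(1)]
        by (simp add: 3 U_def \<alpha>_mult \<alpha>_const absv_divide P_mult)
      moreover have "\<alpha> f / absv (d f) * \<alpha> (poly G y) < 1 * \<alpha> (poly G y)"
        using d[OF 3(1)] \<alpha>_nonneg[OF EP[OF 3(1)]] aG1 by (intro mult_strict_right_mono) simp_all
      ultimately show ?thesis by simp
    next
      case 4
      have sub: "Ep - {f} \<subseteq> E" using Ep by auto
      have "\<alpha> (poly F y) = absv (c f) / absv c0 * (\<Prod>f'\<in>Ep - {f}. \<alpha> f')"
        using const_P[of "c f / c0"] ypr[OF sub] by (simp add: 4 L_def \<alpha>_mult \<alpha>_const absv_divide)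
      also have "\<dots> < \<alpha> f / absv c0 * (\<Prod>f'\<in>Ep - {f}. \<alpha> f')"
      proof (intro mult_strict_right_mono prod_pos)
        show "absv (c f) / absv c0 < \<alpha> f / absv c0" using c(2)[OF 4(1)] c0 by (simp add: divide_strict_right_mono)
      qed (simp add: Ep_def)
      also have "\<dots> = a0 / absv c0" unfolding a0_def using prod.remove[OF Ep(1) 4(1), of \<alpha>] by simp
      finally show ?thesis by (simp add: aG)
    qed
  qed
  \<comment> \<open>All ratios are at most q < 1, which leaves room for the scalar g that
    \<open>certificate\<close> puts in front of G.\<close>
  define q where "q = Max ((\<lambda>F. \<alpha> (poly F y) / \<alpha> (poly G y)) ` A)"
  have qle: "\<alpha> (poly F y) \<le> q * \<alpha> (poly G y)" if "F \<in> A" for F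
  proof -
    have "\<alpha> (poly F y) / \<alpha> (poly G y) \<le> q" unfolding q_def using finA that by (intro Max_ge) auto
    then show ?thesis using aG1 by (simp add: divide_le_eq)
  qed
  have "q \<in> (\<lambda>F. \<alpha> (poly F y) / \<alpha> (poly G y)) ` A" unfolding q_def using finA by (intro Max_in) (auto simp: A_def)
  then have q1: "q < 1" using ltA aG1 by (auto simp: divide_less_eq)
  obtain g where g: "max q (1 / 2) < absv g" "absv g < 1" 
    by (rule absv_dense[of "max q (1 / 2)" 1]) (use q1 in \<open>auto simp: less_max_iff_disj\<close>)
  have g0: "0 < absv g" using g by linarith
  define G' where "G' = Polynomial.smult (\<kappa> g) G"
  have G'S: "coeffs_in S G'" unfolding G'_def by (intro coeffs_in_smult[OF S] GS SD)
  have aG': "\<alpha> (poly G' y) = absv g * \<alpha> (poly G y)"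
    using const_P[of g] GP by (simp add: G'_def \<alpha>_mult \<alpha>_const)
  have ltA': "\<alpha> (poly F y) < \<alpha> (poly G' y)" if "F \<in> A" for F
  proof -
    have "q * \<alpha> (poly G y) < absv g * \<alpha> (poly G y)" using g aG1 by (intro mult_strict_right_mono) auto
    then show ?thesis using qle[OF that] aG' by simp
  qed
  show "\<exists>w. \<forall>a\<in>E. \<bar>absv (\<phi> w a) - \<alpha> a\<bar> < \<epsilon>"
  proof (rule ccontr)
    assume none: "\<not> ?thesis"
    have "map_poly (\<phi> w) G' ^ (2 * D) \<in> ospan (mixed_prods (2 * D) (map_poly (\<phi> w) ` A) (map_poly (\<phi> w) G'))" for w
    proof -
      let ?m = "map_poly (\<phi> w)"
      obtain Fs where Fs: "set Fs = ?m ` (U ` E \<union> L ` Ep)"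
        using finite_list[of "?m ` (U ` E \<union> L ` Ep)"] E(1) Ep(1) by auto
      have mF1: "?m F1 = monom ((1 / d0) ^ D) D"
        unfolding F1_def by (simp add: map_poly_monom \<phi>_const)
      have d00: "d0 \<noteq> 0" using d0 \<alpha>_nonneg[OF y] by auto
      have mA: "?m ` A = {?m F1, 1} \<union> set Fs" unfolding A_def Fs by (simp add: image_Un map_poly_\<phi>_1[OF S])
      have mG': "?m G' = Polynomial.smult g (?m G)"
        unfolding G'_def using map_poly_\<phi>_smult[OF S SD(2) GS] by (simp add: \<phi>_const)
      have mpr: "?m (\<Prod>f\<in>X. pf f) = (\<Prod>f\<in>X. ?m (pf f))" if "X \<subseteq> E" for X
        using that by (intro map_poly_\<phi>_prod[OF S] pf) auto
      have mG: "?m G = Polynomial.smult (1 / c0) (\<Prod>f\<in>Ep. ?m (pf f))"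
        unfolding G_def using map_poly_\<phi>_smult[OF S SD(2) pfS[OF Ep(2)]] mpr[OF Ep(2)] by (simp add: \<phi>_const)
      have mU: "?m (U f) = Polynomial.smult (1 / d f) (?m (pf f) * ?m G)" if "f \<in> E" for f
        unfolding U_def
        using map_poly_\<phi>_smult[OF S SD(2) coeffs_in_mult[OF S pf(2)[OF that] GS]] map_poly_\<phi>_mult[OF S pf(2)[OF that] GS]
        by (simp add: \<phi>_const)
      have mL: "?m (L f) = Polynomial.smult (c f / c0) (\<Prod>f'\<in>Ep - {f}. ?m (pf f'))" for f
      proof -
        have sub: "Ep - {f} \<subseteq> E" using Ep by auto
        show ?thesis unfolding L_def using map_poly_\<phi>_smult[OF S SD(2) pfS[OF sub]] mpr[OF sub] by (simp add: \<phi>_const)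
      qed
      show ?thesis unfolding mA mG'
      proof (rule certificate)
        show "degree (?m F1) = D" unfolding mF1 using d00 by (intro degree_monom_eq) simp
        show "degree (?m G) < D" using degree_map_poly_\<phi>[OF S, of w G] D(2) by simp
        show "\<forall>F\<in>set Fs. degree F < D"
          unfolding Fs using D(3) degree_map_poly_\<phi>[OF S, of w] by (auto intro: le_less_trans)
        show "\<exists>F\<in>{?m F1, 1} \<union> set Fs. absv (poly (?m G) b) \<le> absv (poly F b)" for b
        proof (rule ccontr)
          assume "\<not> ?thesis"
          then have lt: "absv (poly F b) < absv (poly (?m G) b)" if "F \<in> {?m F1, 1} \<union> set Fs" for F
            using that by (auto simp: not_le)
          define v where "v f = poly (?m (pf f)) b" for f
          have Gb: "poly (?m G) b = (\<Prod>f\<in>Ep. v f) / c0" by (simp add: mG poly_prod v_def)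
          have G0: "0 < absv (poly (?m G) b)" using lt[of 1] by simp
          have up: "absv (v f) < \<alpha> f + \<epsilon>" if f: "f \<in> E" for f
          proof -
            have "absv (poly (?m (U f)) b) < absv (poly (?m G) b)" using f by (intro lt) (auto simp: Fs)
            then have "absv (v f) / absv (d f) * absv (poly (?m G) b) < 1 * absv (poly (?m G) b)"
              by (simp add: mU[OF f] v_def absv_mult absv_divide)
            then have "absv (v f) / absv (d f) < 1" using G0 by (simp only: mult_less_cancel_right_pos)
            moreover have "0 < absv (d f)" using d(1)[OF f] \<alpha>_nonneg[OF EP[OF f]] by simp
            ultimately show ?thesis using d(2)[OF f] by (simp add: divide_less_eq)
          qed
          have low: "\<alpha> f - \<epsilon> < absv (v f)" if f: "f \<in> E" for f
          proof (cases "f \<in> Ep")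
            case True
            define w' where "w' = (\<Prod>f'\<in>Ep - {f}. v f')"
            have Gf: "poly (?m G) b = v f * w' / c0" unfolding Gb w'_def using prod.remove[OF Ep(1) True, of v] by simp
            then have "w' \<noteq> 0" using G0 by auto
            have "absv (poly (?m (L f)) b) < absv (poly (?m G) b)" using True by (intro lt) (auto simp: Fs)
            moreover have "poly (?m (L f)) b = c f * w' / c0" by (simp add: mL poly_prod w'_def v_def)
            ultimately have "absv (c f) * (absv w' / absv c0) < absv (v f) * (absv w' / absv c0)"
              unfolding Gf by (simp add: absv_mult absv_divide)
            moreover have "0 < absv w' / absv c0" using absv_pos[OF \<open>w' \<noteq> 0\<close>] c0 by simp
            ultimately have "absv (c f) < absv (v f)" by (simp only: mult_less_cancel_right_pos)
            then show ?thesis using c(1)[OF True] by simp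
          next
            case False
            then have "\<alpha> f \<le> 0" using f by (simp add: Ep_def)
            then show ?thesis using e absv_nonneg[of "v f"] by simp
          qed
          \<comment> \<open>A value b at which all inequalities hold is realised as the value of y
            at a point with the same specialisation of S; that point approximates \<alpha> on
            E.\<close>
          obtain w' where w': "\<forall>s\<in>S. \<phi> w' s = \<phi> w s" "\<phi> w' y = b" using ext[of w b] by (elim exE conjE) (rule that)
          have "\<phi> w' f = v f" if f: "f \<in> E" for f
          proof -
            have "map_poly (\<phi> w') (pf f) = ?m (pf f)"
              using pf(2)[OF f] w'(1) by (intro poly_eqI) (simp add: coeff_map_poly coeffs_in_def)
            then show ?thesis using \<phi>_poly[OF S pf(2)[OF f] y, of w'] pf(1)[OF f] w'(2) by (simp add: v_def)
          qed
          then have "\<bar>absv (\<phi> w' f) - \<alpha> f\<bar> < \<epsilon>" if "f \<in> E" for f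
            using up[OF that] low[OF that] that by (simp add: abs_less_iff)
          then show False using none by blast
        qed
      qed (use D g g0 in auto)
    qed
    then show False
    proof (rule not_certified[OF S app y finA AS G'S ltA', rotated -1])
      show "0 < \<alpha> (poly G' y)" using aG' g0 aG1 by simp
    qed
  qed
qed

end

section \<open>Monomials and power series\<close>

text \<open>The additive extension of h from variables to exponents. Multiples are iterated sums,
  because the target is only a commutative monoid; the degree, \<open>lproj\<close> and
  \<open>wt\<close> are instances.\<close>

definition wsum :: "('v \<Rightarrow> 'a::comm_monoid_add) \<Rightarrow> ('v \<Rightarrow>\<^sub>0 nat) \<Rightarrow> 'a" where
  "wsum h M = (\<Sum>v\<in>Poly_Mapping.keys M. \<Sum>i<Poly_Mapping.lookup M v. h v)"

definition wprod :: "('v \<Rightarrow> 'a::comm_monoid_mult) \<Rightarrow> ('v \<Rightarrow>\<^sub>0 nat) \<Rightarrow> 'a" where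
  "wprod w M = (\<Prod>v\<in>Poly_Mapping.keys M. w v ^ Poly_Mapping.lookup M v)"

lemma wsum_superset:
  "finite X \<Longrightarrow> Poly_Mapping.keys M \<subseteq> X \<Longrightarrow> wsum h M = (\<Sum>v\<in>X. \<Sum>i<Poly_Mapping.lookup M v. h v)"
  unfolding wsum_def by (rule sum.mono_neutral_left) (auto simp: in_keys_iff)

lemma wprod_superset:
  "finite X \<Longrightarrow> Poly_Mapping.keys M \<subseteq> X \<Longrightarrow> wprod w M = (\<Prod>v\<in>X. w v ^ Poly_Mapping.lookup M v)"
  unfolding wprod_def by (rule prod.mono_neutral_left) (auto simp: in_keys_iff)

lemma keys_add_nat: "Poly_Mapping.keys (A + B :: 'v \<Rightarrow>\<^sub>0 nat) = Poly_Mapping.keys A \<union> Poly_Mapping.keys B"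
  by (auto simp: in_keys_iff lookup_add)

lemma sum_lessThan_add_const: "(\<Sum>i<m + n. c) = (\<Sum>i<m. c) + (\<Sum>i<n. (c::'a::comm_monoid_add))" for m n :: nat
  by (induction n) (auto simp: add.assoc)

lemma wsum_add: "wsum h (A + B) = wsum h A + wsum h B"
proof -
  let ?X = "Poly_Mapping.keys A \<union> Poly_Mapping.keys B"
  show ?thesis
    by (subst (1 2 3) wsum_superset[of ?X])
      (auto simp: keys_add_nat lookup_add sum_lessThan_add_const sum.distrib)
qed

lemma wprod_add: "wprod w (A + B) = wprod w A * wprod w B"
proof -
  let ?X = "Poly_Mapping.keys A \<union> Poly_Mapping.keys B"
  show ?thesis
    by (subst (1 2 3) wprod_superset[of ?X])
      (auto simp: keys_add_nat lookup_add power_add prod.distrib)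
qed

lemma wsum_0 [simp]: "wsum h 0 = 0" by (simp add: wsum_def)
lemma wprod_0 [simp]: "wprod w 0 = 1" by (simp add: wprod_def)
lemma wsum_single [simp]: "wsum h (Poly_Mapping.single v (Suc 0)) = h v" by (simp add: wsum_def)
lemma wprod_single [simp]: "wprod w (Poly_Mapping.single v (Suc 0)) = w v" by (simp add: wprod_def)

lemma mdeg_wsum: "mdeg M = wsum (\<lambda>_. 1) M"
  by (simp add: mdeg_def wsum_def)

lemma mdeg_add [simp]: "mdeg (A + B) = mdeg A + mdeg B"
  by (simp add: mdeg_wsum wsum_add)

lemma mdeg_0 [simp]: "mdeg 0 = 0" by (simp add: mdeg_def)

lemma mdeg_single [simp]: "mdeg (Poly_Mapping.single v (Suc 0)) = 1" by (simp add: mdeg_wsum)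

lemma lookup_le_mdeg: "Poly_Mapping.lookup M v \<le> mdeg M"
  unfolding mdeg_def by (cases "v \<in> Poly_Mapping.keys M") (auto intro: member_le_sum simp: in_keys_iff)

lemma mdeg_eq_0: "mdeg M = 0 \<Longrightarrow> M = 0"
  using lookup_le_mdeg[of M] by (intro poly_mapping_eqI) auto

lemma single_decomp:
  assumes "v \<in> Poly_Mapping.keys (M :: 'v \<Rightarrow>\<^sub>0 nat)"
  obtains M' where "M = M' + Poly_Mapping.single v (Suc 0)"
proof (rule that[of "M - Poly_Mapping.single v (Suc 0)"])
  show "M = M - Poly_Mapping.single v (Suc 0) + Poly_Mapping.single v (Suc 0)"
    using assms by (intro poly_mapping_eqI) (auto simp: lookup_add lookup_minus lookup_single in_keys_iff when_def)
qed

lemma exponent_induct [case_names zero add]: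
  assumes "Q 0" "\<And>M v. Q M \<Longrightarrow> Q (M + Poly_Mapping.single v (Suc 0))"
  shows "Q M"
proof (induction "mdeg M" arbitrary: M)
  case 0
  then show ?case using assms(1) mdeg_eq_0[of M] by simp
next
  case (Suc n)
  then have "M \<noteq> 0" by auto
  then obtain v where "v \<in> Poly_Mapping.keys M" using keys_eq_empty by blast
  then obtain M' where M: "M = M' + Poly_Mapping.single v (Suc 0)" by (rule single_decomp)
  then have "n = mdeg M'" using Suc.hyps(2) by simp
  then show ?case unfolding M by (intro assms(2) Suc.hyps(1))
qed

lemma finite_bounded_exponents:
  assumes "finite K"
  shows "finite {M :: 'v \<Rightarrow>\<^sub>0 nat. Poly_Mapping.keys M \<subseteq> K \<and> (\<forall>v. Poly_Mapping.lookup M v \<le> N)}"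
proof -
  let ?F = "{f. \<forall>i. (i \<in> K \<longrightarrow> f i \<in> {..N}) \<and> (i \<notin> K \<longrightarrow> f i = (0::nat))}"
  have "finite ?F" by (rule finite_set_of_finite_funs[OF assms]) simp
  then have "finite (Poly_Mapping.lookup -` ?F)" by (rule finite_vimageI) (simp add: inj_def)
  then show ?thesis by (rule rev_finite_subset) (auto simp: in_keys_iff)
qed

lemma finite_mdeg_le: "finite {M :: 'v::finite \<Rightarrow>\<^sub>0 nat. mdeg M \<le> N}"
  by (rule finite_subset[OF _ finite_bounded_exponents[of UNIV N]]) (auto intro: order_trans[OF lookup_le_mdeg])

section \<open>Coefficients, monomials, supports and truncations of power series\<close>

lemma mcoeff_Abs [simp]: "mcoeff (Abs_mfps f) = f"
  by (simp add: Abs_mfps_inverse)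

lemma mfps_eqI: "(\<And>M. mcoeff f M = mcoeff g M) \<Longrightarrow> f = g"
  by (metis ext mcoeff_inject)

lemmas mcoeff_simps [simp] = zero_mfps.rep_eq one_mfps.rep_eq plus_mfps.rep_eq minus_mfps.rep_eq uminus_mfps.rep_eq

lemma mcoeff_times: "mcoeff (f * g) M = (\<Sum>p\<in>splits M. mcoeff f (fst p) * mcoeff g (snd p))"
  by (simp add: times_mfps.rep_eq case_prod_beta)

lemma mcoeff_sum: "mcoeff (sum f A) M = (\<Sum>a\<in>A. mcoeff (f a) M)"
  by (induction A rule: infinite_finite_induct) auto

lemma mcoeff_mconst: "mcoeff (mconst c) M = (if M = 0 then c else 0)"
  by (simp add: mconst_def)

lemma mcoeff_mvar: "mcoeff (mvar v) M = (if M = Poly_Mapping.single v 1 then 1 else 0)"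
  by (simp add: mvar_def)

lemma mcoeff_mmap [simp]: "mcoeff (mmap h f) M = h (mcoeff f M)"
  by (simp add: mmap_def)

definition mmono :: "('v \<Rightarrow>\<^sub>0 nat) \<Rightarrow> ('v, 'a::comm_ring_1) mfps" where
  "mmono M = Abs_mfps (\<lambda>A. if A = M then 1 else 0)"

lemma mcoeff_mmono: "mcoeff (mmono M) A = (if A = M then 1 else 0)"
  by (simp add: mmono_def)

lemma mcoeff_mconst_mult [simp]: "mcoeff (mconst c * f) M = c * mcoeff f M"
proof -
  have "mcoeff (mconst c * f) M = (\<Sum>p\<in>splits M. if p = (0, M) then c * mcoeff f M else 0)"
    unfolding mcoeff_times by (intro sum.cong refl) (auto simp: mcoeff_mconst splits_def)
  also have "\<dots> = c * mcoeff f M"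
    using finite_splits[of M] by (subst sum.delta) (auto simp: splits_def)
  finally show ?thesis .
qed

lemma mmono_add: "mmono (A + B) = mmono A * (mmono B :: ('v, 'a::comm_ring_1) mfps)"
proof (rule mfps_eqI)
  fix M
  have "mcoeff (mmono A * mmono B :: ('v, 'a) mfps) M = (\<Sum>p\<in>splits M. if p = (A, B) then 1 else 0)"
    unfolding mcoeff_times by (intro sum.cong refl) (auto simp: mcoeff_mmono)
  also have "\<dots> = (if (A, B) \<in> splits M then 1 else 0)" using finite_splits[of M] by (subst sum.delta) auto
  finally show "mcoeff (mmono (A + B)) M = mcoeff (mmono A * mmono B :: ('v, 'a) mfps) M"
    by (auto simp: mcoeff_mmono splits_def)
qed

lemma mmono_0 [simp]: "mmono 0 = 1"
  by (rule mfps_eqI) (simp add: mcoeff_mmono)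

lemma mmono_single: "mmono (Poly_Mapping.single v (Suc 0)) = mvar v"
  by (rule mfps_eqI) (simp add: mcoeff_mmono mcoeff_mvar)

lemma mconst_0 [simp]: "mconst 0 = 0" by (rule mfps_eqI) (simp add: mcoeff_mconst)
lemma mconst_1 [simp]: "mconst 1 = 1" by (rule mfps_eqI) (simp add: mcoeff_mconst)
lemma mconst_minus: "mconst (- c) = - (mconst c :: ('v, 'a::comm_ring_1) mfps)" by (rule mfps_eqI) (simp add: mcoeff_mconst)
lemma mconst_add: "mconst (c + d) = mconst c + (mconst d :: ('v, 'a::comm_ring_1) mfps)" by (rule mfps_eqI) (simp add: mcoeff_mconst)
lemma mconst_diff: "mconst (c - d) = mconst c - (mconst d :: ('v, 'a::comm_ring_1) mfps)" by (rule mfps_eqI) (simp add: mcoeff_mconst)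
lemma mconst_mult: "mconst (c * d) = mconst c * (mconst d :: ('v, 'a::comm_ring_1) mfps)" by (rule mfps_eqI) (simp add: mcoeff_mconst)

definition msupp :: "('v, 'a::zero) mfps \<Rightarrow> ('v \<Rightarrow>\<^sub>0 nat) set" where
  "msupp f = {M. mcoeff f M \<noteq> 0}"

lemma finite_msupp_eq:
  assumes "finite X" "msupp f \<subseteq> X" shows "f = (\<Sum>M\<in>X. mconst (mcoeff f M) * mmono M)"
proof (rule mfps_eqI)
  fix A
  have "mcoeff (\<Sum>M\<in>X. mconst (mcoeff f M) * mmono M) A = (\<Sum>M\<in>X. if A = M then mcoeff f M else 0)"
    unfolding mcoeff_sum by (intro sum.cong refl) (auto simp: mcoeff_mmono)
  then show "mcoeff f A = mcoeff (\<Sum>M\<in>X. mconst (mcoeff f M) * mmono M) A"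
    using assms by (auto simp: msupp_def)
qed

definition mtrunc :: "('v \<Rightarrow>\<^sub>0 nat) set \<Rightarrow> ('v, 'a::zero) mfps \<Rightarrow> ('v, 'a) mfps" where
  "mtrunc X f = Abs_mfps (\<lambda>M. if M \<in> X then mcoeff f M else 0)"

lemma mcoeff_mtrunc: "mcoeff (mtrunc X f) M = (if M \<in> X then mcoeff f M else 0)"
  by (simp add: mtrunc_def)

lemma mtrunc_eq_sum: "finite X \<Longrightarrow> mtrunc X f = (\<Sum>M\<in>X. mconst (mcoeff f M) * mmono M)"
  by (subst finite_msupp_eq[of X]) (auto simp: msupp_def mcoeff_mtrunc)

section \<open>Normed algebras and their spectra\<close>

text \<open>Common ground for k, for Tate algebras over k and for Tate algebras over these. By
  \<open>nonarch_algebra_tate\<close> the construction can be iterated, as the product with the open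
  polydisk requires.\<close>

locale nonarch_algebra = complete_nonarch_field absv
  for absv :: "'k::field \<Rightarrow> real" +
  fixes A :: "('k, 'a::comm_ring_1) normed_alg"
  assumes carrier_add: "f \<in> alg_carrier A \<Longrightarrow> g \<in> alg_carrier A \<Longrightarrow> f + g \<in> alg_carrier A"
    and carrier_mult: "f \<in> alg_carrier A \<Longrightarrow> g \<in> alg_carrier A \<Longrightarrow> f * g \<in> alg_carrier A"
    and const_carrier: "alg_const A c \<in> alg_carrier A"
    and const_1: "alg_const A 1 = 1"
    and const_add: "alg_const A (c + d) = alg_const A c + alg_const A d"
    and const_mult: "alg_const A (c * d) = alg_const A c * alg_const A d"
    and norm_nonneg: "f \<in> alg_carrier A \<Longrightarrow> 0 \<le> alg_norm A f"
    and norm_add: "f \<in> alg_carrier A \<Longrightarrow> g \<in> alg_carrier A \<Longrightarrow> alg_norm A (f + g) \<le> max (alg_norm A f) (alg_norm A g)"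
    and norm_mult: "f \<in> alg_carrier A \<Longrightarrow> g \<in> alg_carrier A \<Longrightarrow> alg_norm A (f * g) \<le> alg_norm A f * alg_norm A g"
    and norm_const: "alg_norm A (alg_const A c) = absv c"
    and norm_eq_0: "f \<in> alg_carrier A \<Longrightarrow> alg_norm A f = 0 \<Longrightarrow> f = 0"
begin

lemma const_0: "alg_const A 0 = 0"
  using const_add[of 0 0] by simp

lemma const_minus: "alg_const A (- c) = - alg_const A c"
  using const_add[of c "- c"] const_0 by (simp add: eq_neg_iff_add_eq_0 add.commute)

lemma carrier_0: "0 \<in> alg_carrier A" using const_carrier[of 0] by (simp add: const_0)
lemma carrier_1: "1 \<in> alg_carrier A" using const_carrier[of 1] by (simp add: const_1)

lemma carrier_minus: "f \<in> alg_carrier A \<Longrightarrow> - f \<in> alg_carrier A"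
  using carrier_mult[OF const_carrier[of "- 1"], of f] by (simp add: const_minus const_1)

lemma carrier_diff: "f \<in> alg_carrier A \<Longrightarrow> g \<in> alg_carrier A \<Longrightarrow> f - g \<in> alg_carrier A"
  using carrier_add[OF _ carrier_minus, of f g] by simp

lemma carrier_sum: "(\<And>a. a \<in> X \<Longrightarrow> f a \<in> alg_carrier A) \<Longrightarrow> sum f X \<in> alg_carrier A"
  by (induction X rule: infinite_finite_induct) (auto intro: carrier_add carrier_0)

lemma carrier_power: "f \<in> alg_carrier A \<Longrightarrow> f ^ n \<in> alg_carrier A"
  by (induction n) (auto intro: carrier_mult carrier_1)

lemma norm_0: "alg_norm A 0 = 0" using norm_const[of 0] by (simp add: const_0)

lemma norm_1: "alg_norm A 1 = 1" using norm_const[of 1] by (simp add: const_1)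

lemma norm_minus: "f \<in> alg_carrier A \<Longrightarrow> alg_norm A (- f) = alg_norm A f"
proof -
  have le: "alg_norm A (- g) \<le> alg_norm A g" if "g \<in> alg_carrier A" for g
    using norm_mult[OF const_carrier[of "- 1"] that] by (simp add: const_minus const_1 norm_const[of "- 1", unfolded const_minus const_1])
  assume f: "f \<in> alg_carrier A"
  show ?thesis using le[OF f] le[OF carrier_minus[OF f]] by simp
qed

lemma norm_diff: "f \<in> alg_carrier A \<Longrightarrow> g \<in> alg_carrier A \<Longrightarrow> alg_norm A (f - g) \<le> max (alg_norm A f) (alg_norm A g)"
  using norm_add[OF _ carrier_minus, of f g] norm_minus[of g] by simp

lemma norm_sum_le:
  "(\<And>a. a \<in> X \<Longrightarrow> f a \<in> alg_carrier A \<and> alg_norm A (f a) \<le> B) \<Longrightarrow> 0 \<le> B \<Longrightarrow> alg_norm A (sum f X) \<le> B"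
proof (induction X rule: infinite_finite_induct)
  case (insert a X)
  then have "alg_norm A (f a + sum f X) \<le> max (alg_norm A (f a)) (alg_norm A (sum f X))"
    by (intro norm_add carrier_sum) auto
  moreover have "alg_norm A (f a) \<le> B" "alg_norm A (sum f X) \<le> B" using insert by auto
  ultimately show ?case using insert.hyps by simp
qed (auto simp: norm_0)

lemma norm_power_le: "f \<in> alg_carrier A \<Longrightarrow> alg_norm A (f ^ n) \<le> alg_norm A f ^ n"
proof (induction n)
  case (Suc n)
  have "alg_norm A (f * f ^ n) \<le> alg_norm A f * alg_norm A (f ^ n)"
    using Suc by (intro norm_mult carrier_power)
  also have "\<dots> \<le> alg_norm A f * alg_norm A f ^ n"
    using Suc by (intro mult_left_mono norm_nonneg) auto
  finally show ?case by simp
qed (simp add: norm_1)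

end

text \<open>Geometric growth with a larger ratio beats any linear factor. Applied to the powers of
  an element, this shows that points of the spectrum are bounded by the norm and satisfy the
  ultrametric inequality.\<close>

lemma le_of_power_le_linear:
  fixes a b :: real
  assumes "0 \<le> a" "0 \<le> b" "\<And>n. a ^ n \<le> C * (real n + 1) * b ^ n"
  shows "a \<le> b"
proof (rule ccontr)
  assume "\<not> a \<le> b"
  then have ab: "b < a" by simp
  show False
  proof (cases "b = 0")
    case True
    then show ?thesis using assms(3)[of 1] ab by simp
  next
    case False
    then have b: "0 < b" using assms by simp
    define q where "q = b / a"
    have q: "0 \<le> q" "q < 1" using b ab by (auto simp: q_def)
    have "(\<lambda>n. C * (real n * q ^ n + q ^ n)) \<longlonglongrightarrow> C * (0 + 0)"
      using q by (intro tendsto_mult tendsto_add tendsto_const powser_times_n_limit_0 LIMSEQ_power_zero) auto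
    then have "eventually (\<lambda>n. C * (real n * q ^ n + q ^ n) < 1) sequentially"
      by (intro order_tendstoD(2)[where y = "C * (0 + 0)"]) auto
    then obtain n where n: "C * (real n * q ^ n + q ^ n) < 1" by (meson eventually_sequentially order_refl)
    have "a ^ n \<le> C * (real n + 1) * b ^ n" by (rule assms(3))
    also have "\<dots> = C * (real n * q ^ n + q ^ n) * a ^ n" using ab b by (simp add: q_def power_divide field_simps)
    also have "\<dots> < 1 * a ^ n" using n ab b by (intro mult_strict_right_mono) auto
    finally show False by simp
  qed
qed

section \<open>Bounded multiplicative seminorms on a normed algebra\<close>

context nonarch_algebra
begin

context
  fixes x assumes x: "x \<in> spectrum A"
begin

lemma spec_nonneg: "f \<in> alg_carrier A \<Longrightarrow> 0 \<le> x f"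
  and spec_0: "x 0 = 0" and spec_1: "x 1 = 1"
  and spec_mult: "f \<in> alg_carrier A \<Longrightarrow> g \<in> alg_carrier A \<Longrightarrow> x (f * g) = x f * x g"
  using x by (auto simp: spectrum_def)

lemma spec_power: "f \<in> alg_carrier A \<Longrightarrow> x (f ^ n) = x f ^ n"
  by (induction n) (auto simp: spec_1 spec_mult carrier_power)

lemma spec_le_norm:
  assumes f: "f \<in> alg_carrier A" shows "x f \<le> alg_norm A f"
proof -
  obtain C where C: "\<forall>f\<in>alg_carrier A. x f \<le> C * alg_norm A f"
    using x unfolding spectrum_def by auto
  have C0: "0 \<le> C" using C[rule_format, OF carrier_1] by (simp add: spec_1 norm_1)
  show ?thesis
  proof (rule le_of_power_le_linear)
    fix n
    have "x f ^ n \<le> C * alg_norm A (f ^ n)"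
      using C carrier_power[OF f, of n] spec_power[OF f, of n] by metis
    also have "\<dots> \<le> C * alg_norm A f ^ n" using norm_power_le[OF f] C0 by (intro mult_left_mono)
    also have "\<dots> \<le> C * (real n + 1) * alg_norm A f ^ n"
      using C0 norm_nonneg[OF f] by (intro mult_right_mono) (auto simp: algebra_simps)
    finally show "x f ^ n \<le> C * (real n + 1) * alg_norm A f ^ n" .
  qed (use f in \<open>auto intro: spec_nonneg norm_nonneg\<close>)
qed

text \<open>A nonzero c and its inverse are both bounded by their norms, while the product of their
  values is 1.\<close>

lemma spec_const: "x (alg_const A c) = absv c"
proof (cases "c = 0")
  case False
  have "x (alg_const A c) * x (alg_const A (inverse c)) = 1"
    using False by (simp add: spec_mult[symmetric] const_carrier const_mult[symmetric] const_1 spec_1)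
  moreover have "x (alg_const A c) \<le> absv c" "x (alg_const A (inverse c)) \<le> inverse (absv c)"
    using spec_le_norm[OF const_carrier] by (simp_all add: norm_const absv_inverse[symmetric])
  moreover have "0 \<le> x (alg_const A c)" by (intro spec_nonneg const_carrier)
  ultimately have "1 \<le> x (alg_const A c) * inverse (absv c)" by (metis mult_left_mono)
  then have "absv c \<le> x (alg_const A c)" using absv_pos[OF False] by (simp add: field_simps)
  then show ?thesis using \<open>x (alg_const A c) \<le> absv c\<close> by simp
qed (simp add: const_0 spec_0)

lemma spec_minus: "f \<in> alg_carrier A \<Longrightarrow> x (- f) = x f"
  using spec_mult[OF const_carrier[of "- 1"], of f] spec_const[of "- 1"] by (simp add: const_minus const_1)

lemma spec_subadd: "f \<in> alg_carrier A \<Longrightarrow> g \<in> alg_carrier A \<Longrightarrow> x (f + g) \<le> x f + x g"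
  using x by (auto simp: spectrum_def)

lemma spec_sum_le: "(\<And>a. a \<in> X \<Longrightarrow> f a \<in> alg_carrier A) \<Longrightarrow> x (sum f X) \<le> (\<Sum>a\<in>X. x (f a))"
proof (induction X rule: infinite_finite_induct)
  case (insert a X)
  then have "x (f a + sum f X) \<le> x (f a) + x (sum f X)" by (intro spec_subadd carrier_sum) auto
  then show ?case using insert by fastforce
qed (auto simp: spec_0)

lemma const_of_nat: "alg_const A (of_nat n) = of_nat n"
  by (induction n) (auto simp: const_0 const_add const_1)

text \<open>The spectrum is defined by mere subadditivity. In the binomial expansion of
  \<open>(f + g) ^ n\<close> the integer coefficients have absolute value at most 1, so there are n
  + 1 terms, each at most the n-th power of the maximum.\<close>

lemma spec_add: 
  assumes f: "f \<in> alg_carrier A" and g: "g \<in> alg_carrier A"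
  shows "x (f + g) \<le> max (x f) (x g)"
proof (rule le_of_power_le_linear[where C = 1])
  fix n
  define m where "m = max (x f) (x g)"
  have m0: "0 \<le> x f" "0 \<le> x g" using f g by (auto intro: spec_nonneg)
  have mem: "of_nat (n choose k) * f ^ k * g ^ (n - k) \<in> alg_carrier A" for k
    using f g const_carrier[of "of_nat (n choose k)"] by (intro carrier_mult carrier_power) (simp_all add: const_of_nat)
  have "x (f + g) ^ n = x (\<Sum>k\<le>n. of_nat (n choose k) * f ^ k * g ^ (n - k))"
    using f g by (simp add: spec_power[symmetric] carrier_add binomial_ring)
  also have "\<dots> \<le> (\<Sum>k\<le>n. x (of_nat (n choose k) * f ^ k * g ^ (n - k)))" by (rule spec_sum_le[OF mem])
  also have "\<dots> \<le> (\<Sum>k\<le>n. m ^ n)"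
  proof (rule sum_mono)
    fix k assume k: "k \<in> {..n}"
    have "x (of_nat (n choose k) * f ^ k * g ^ (n - k)) = absv (of_nat (n choose k)) * x f ^ k * x g ^ (n - k)"
      using f g const_carrier[of "of_nat (n choose k)"] spec_const[of "of_nat (n choose k)"]
      by (simp add: spec_mult spec_power carrier_mult carrier_power const_of_nat)
    also have "\<dots> \<le> 1 * m ^ k * m ^ (n - k)"
      using m0 absv_of_nat_le_1 absv_nonneg unfolding m_def
      by (intro mult_mono power_mono mult_nonneg_nonneg zero_le_power) auto
    also have "\<dots> = m ^ n" using k by (simp flip: power_add)
    finally show "x (of_nat (n choose k) * f ^ k * g ^ (n - k)) \<le> m ^ n" .
  qed
  finally show "x (f + g) ^ n \<le> 1 * (real n + 1) * max (x f) (x g) ^ n" by (simp add: m_def add.commute)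
qed (use f g in \<open>auto intro: spec_nonneg carrier_add simp: le_max_iff_disj\<close>)

lemma spec_diff: "f \<in> alg_carrier A \<Longrightarrow> g \<in> alg_carrier A \<Longrightarrow> x (f - g) \<le> max (x f) (x g)"
  using spec_add[OF _ carrier_minus, of f g] spec_minus[of g] by simp

lemma spec_abs_diff:
  assumes f: "f \<in> alg_carrier A" and g: "g \<in> alg_carrier A" shows "\<bar>x f - x g\<bar> \<le> x (f - g)"
  using spec_subadd[OF carrier_diff[OF f g] g] spec_subadd[OF carrier_minus[OF carrier_diff[OF f g]] f]
    spec_minus[OF carrier_diff[OF f g]] by simp

lemma spec_sum_max:
  "(\<And>a. a \<in> X \<Longrightarrow> f a \<in> alg_carrier A \<and> x (f a) \<le> B) \<Longrightarrow> 0 \<le> B \<Longrightarrow> x (sum f X) \<le> B"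
proof (induction X rule: infinite_finite_induct)
  case (insert a X)
  then have "x (f a + sum f X) \<le> max (x (f a)) (x (sum f X))" by (intro spec_add carrier_sum) auto
  moreover have "x (f a) \<le> B" "x (sum f X) \<le> B" using insert by auto
  ultimately show ?case using insert.hyps by simp
qed (auto simp: spec_0)

end
end

lemma (in complete_nonarch_field) nonarch_algebra_ground: "nonarch_algebra absv (ground absv)"
  by unfold_locales (auto simp: ground_def absv_nonneg absv_ultrametric absv_mult absv_eq_0_iff)

section \<open>Tate algebras\<close>

lemma alg_const_tate [simp]: "alg_const (tate A \<rho>) c = mconst (alg_const A c)"
  by (simp add: tate_def)

locale tate_algebra = nonarch_algebra absv A
  for absv :: "'k::field \<Rightarrow> real" and A :: "('k, 'a::comm_ring_1) normed_alg" +
  fixes \<rho> :: real assumes \<rho>: "0 < \<rho>"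
begin

definition tnorm :: "('v, 'a) mfps \<Rightarrow> ('v \<Rightarrow>\<^sub>0 nat) \<Rightarrow> real" where
  "tnorm f M = alg_norm A (mcoeff f M) * \<rho> ^ mdeg M"

abbreviation "T \<equiv> tate A \<rho>"

lemma carrier_iff: "f \<in> alg_carrier T \<longleftrightarrow> (\<forall>M. mcoeff f M \<in> alg_carrier A) \<and> (\<forall>\<epsilon>>0. finite {M. tnorm f M > \<epsilon>})"
  by (simp add: tate_def tnorm_def)

lemma norm_def: "alg_norm T f = (SUP M. tnorm f M)"
  by (simp add: tate_def tnorm_def)

lemma coeff_carrier: "f \<in> alg_carrier T \<Longrightarrow> mcoeff f M \<in> alg_carrier A"
  by (simp add: carrier_iff)

lemma tnorm_nonneg: "f \<in> alg_carrier T \<Longrightarrow> 0 \<le> tnorm f M"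
  using \<rho> by (simp add: tnorm_def coeff_carrier norm_nonneg)

lemma tnorm_bdd: "f \<in> alg_carrier T \<Longrightarrow> bdd_above (range (tnorm f))"
proof -
  assume f: "f \<in> alg_carrier T"
  then have "finite {M. tnorm f M > 1}" by (simp add: carrier_iff)
  then have "bdd_above (tnorm f ` {M. tnorm f M > 1})" by (intro bdd_above_finite finite_imageI)
  moreover have "range (tnorm f) \<subseteq> tnorm f ` {M. tnorm f M > 1} \<union> {..1}" by force
  ultimately show ?thesis by (meson bdd_above_Iic bdd_above_Un bdd_above_mono)
qed

lemma tnorm_le: "f \<in> alg_carrier T \<Longrightarrow> tnorm f M \<le> alg_norm T f"
  unfolding norm_def by (rule cSUP_upper[OF UNIV_I tnorm_bdd])

lemma norm_leI: "(\<And>M. tnorm f M \<le> C) \<Longrightarrow> alg_norm T f \<le> C"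
  unfolding norm_def by (rule cSUP_least) auto

lemma tnorm_add: "f \<in> alg_carrier T \<Longrightarrow> g \<in> alg_carrier T \<Longrightarrow> tnorm (f + g) M \<le> max (tnorm f M) (tnorm g M)"
proof -
  assume "f \<in> alg_carrier T" "g \<in> alg_carrier T"
  then have "alg_norm A (mcoeff f M + mcoeff g M) \<le> max (alg_norm A (mcoeff f M)) (alg_norm A (mcoeff g M))"
    by (intro norm_add coeff_carrier)
  then have "tnorm (f + g) M \<le> max (alg_norm A (mcoeff f M)) (alg_norm A (mcoeff g M)) * \<rho> ^ mdeg M"
    unfolding tnorm_def using \<rho> by (simp add: mult_right_mono)
  also have "\<dots> = max (tnorm f M) (tnorm g M)" using \<rho> by (simp add: tnorm_def max_mult_distrib_right)
  finally show ?thesis .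
qed

lemma tnorm_mult:
  assumes f: "f \<in> alg_carrier T" and g: "g \<in> alg_carrier T"
    and C: "\<And>A B. A + B = M \<Longrightarrow> tnorm f A * tnorm g B \<le> C" "0 \<le> C"
  shows "tnorm (f * g) M \<le> C"
proof -
  have rM: "0 < \<rho> ^ mdeg M" using \<rho> by simp
  have "alg_norm A (mcoeff (f * g) M) \<le> C / \<rho> ^ mdeg M"
    unfolding mcoeff_times
  proof (intro norm_sum_le conjI)
    fix p assume "p \<in> splits M"
    then have p: "fst p + snd p = M" by (auto simp: splits_def)
    show "mcoeff f (fst p) * mcoeff g (snd p) \<in> alg_carrier A" by (intro carrier_mult coeff_carrier f g)
    have "alg_norm A (mcoeff f (fst p) * mcoeff g (snd p)) \<le> alg_norm A (mcoeff f (fst p)) * alg_norm A (mcoeff g (snd p))"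
      by (intro norm_mult coeff_carrier f g)
    also have "\<dots> = tnorm f (fst p) * tnorm g (snd p) / \<rho> ^ mdeg M"
      using \<rho> by (simp add: tnorm_def p[symmetric] power_add)
    also have "\<dots> \<le> C / \<rho> ^ mdeg M" using C(1)[OF p] rM by (simp add: divide_right_mono)
    finally show "alg_norm A (mcoeff f (fst p) * mcoeff g (snd p)) \<le> C / \<rho> ^ mdeg M" .
  qed (use C rM in auto)
  then show ?thesis using rM by (simp add: tnorm_def pos_le_divide_eq)
qed

lemma carrier_const:
  assumes c: "c \<in> alg_carrier A" shows "(mconst c :: ('v, 'a) mfps) \<in> alg_carrier T"
proof -
  have "finite {M. tnorm (mconst c :: ('v, 'a) mfps) M > \<epsilon>}" if "\<epsilon> > 0" for \<epsilon>
    by (rule finite_subset[of _ "{0}"]) (use that in \<open>auto simp: tnorm_def mcoeff_mconst norm_0 split: if_splits\<close>)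
  then show ?thesis using c by (simp add: carrier_iff mcoeff_mconst carrier_0)
qed

lemma nonarch_algebra_tate: "nonarch_algebra absv T"
proof unfold_locales
  fix f g :: "('v, 'a) mfps" and c d :: 'k
  assume f: "f \<in> alg_carrier T"
  show "0 \<le> alg_norm T f" using tnorm_le[OF f, of 0] tnorm_nonneg[OF f, of 0] by linarith
  show "f = 0" if "alg_norm T f = 0"
  proof (rule mfps_eqI)
    fix M
    have "tnorm f M = 0" using tnorm_le[OF f, of M] tnorm_nonneg[OF f, of M] that by simp
    then have "alg_norm A (mcoeff f M) = 0" using \<rho> by (simp add: tnorm_def)
    then show "mcoeff f M = mcoeff 0 M" using norm_eq_0[OF coeff_carrier[OF f]] by simp
  qed
  assume g: "g \<in> alg_carrier T"
  have "finite {M. tnorm (f + g) M > \<epsilon>}" if "\<epsilon> > 0" for \<epsilon>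
  proof (rule finite_subset)
    show "{M. tnorm (f + g) M > \<epsilon>} \<subseteq> {M. tnorm f M > \<epsilon>} \<union> {M. tnorm g M > \<epsilon>}"
    proof
      fix M assume "M \<in> {M. tnorm (f + g) M > \<epsilon>}"
      then show "M \<in> {M. tnorm f M > \<epsilon>} \<union> {M. tnorm g M > \<epsilon>}" using tnorm_add[OF f g, of M] by auto
    qed
  qed (use f g that in \<open>simp add: carrier_iff\<close>)
  then show "f + g \<in> alg_carrier T" using f g by (simp add: carrier_iff carrier_add)
  show "alg_norm T (f + g) \<le> max (alg_norm T f) (alg_norm T g)"
  proof (rule norm_leI)
    fix M show "tnorm (f + g) M \<le> max (alg_norm T f) (alg_norm T g)"
      using tnorm_add[OF f g, of M] tnorm_le[OF f, of M] tnorm_le[OF g, of M] by linarith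
  qed
  \<comment> \<open>Adding 1 keeps these bounds positive, as they serve as divisors.\<close>
  define F where "F = alg_norm T f + 1"
  define G where "G = alg_norm T g + 1"
  have F: "0 \<le> tnorm f M" "tnorm f M \<le> F - 1" and G: "0 \<le> tnorm g M" "tnorm g M \<le> G - 1" for M
    using tnorm_le[OF f, of M] tnorm_nonneg[OF f, of M] tnorm_le[OF g, of M] tnorm_nonneg[OF g, of M]
    by (auto simp: F_def G_def)
  have FG: "0 < F" "0 < G" using F[of 0] G[of 0] by linarith+
  have "finite {M. tnorm (f * g) M > \<epsilon>}" if e: "\<epsilon> > 0" for \<epsilon>
  proof (rule finite_subset)
    let ?X = "{M. tnorm f M > \<epsilon> / G}" and ?Y = "{M. tnorm g M > \<epsilon> / F}"
    \<comment> \<open>A large coefficient of the product requires a splitting of M in which both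
      factors are large, and there are only finitely many such pairs.\<close>
    show "{M. tnorm (f * g) M > \<epsilon>} \<subseteq> (\<lambda>p. fst p + snd p) ` (?X \<times> ?Y)"
    proof
      fix M assume M: "M \<in> {M. tnorm (f * g) M > \<epsilon>}"
      have "\<exists>A B. A + B = M \<and> \<epsilon> < tnorm f A * tnorm g B"
      proof (rule ccontr)
        assume "\<not> ?thesis"
        then have "tnorm (f * g) M \<le> \<epsilon>" using e by (intro tnorm_mult[OF f g]) (auto simp: not_less)
        then show False using M by simp
      qed
      then obtain A B where AB: "A + B = M" "\<epsilon> < tnorm f A * tnorm g B" by blast
      have "tnorm f A * tnorm g B \<le> tnorm f A * G" using F[of A] G[of B] by (intro mult_left_mono) auto
      moreover have "tnorm f A * tnorm g B \<le> F * tnorm g B" using F[of A] G[of B] by (intro mult_right_mono) auto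
      ultimately have "A \<in> ?X" "B \<in> ?Y" using AB(2) FG by (auto simp: pos_divide_less_eq mult.commute)
      then show "M \<in> (\<lambda>p. fst p + snd p) ` (?X \<times> ?Y)" using AB(1) by (intro image_eqI[of _ _ "(A, B)"]) auto
    qed
    show "finite ((\<lambda>p. fst p + snd p) ` (?X \<times> ?Y))"
      using f g e FG by (intro finite_imageI finite_cartesian_product) (auto simp: carrier_iff)
  qed
  moreover have "mcoeff (f * g) M \<in> alg_carrier A" for M
    unfolding mcoeff_times by (intro carrier_sum carrier_mult coeff_carrier f g)
  ultimately show "f * g \<in> alg_carrier T" by (simp add: carrier_iff)
  have nn: "0 \<le> alg_norm T f" "0 \<le> alg_norm T g"
    using tnorm_le[OF f, of 0] tnorm_nonneg[OF f, of 0] tnorm_le[OF g, of 0] tnorm_nonneg[OF g, of 0] by linarith+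
  show "alg_norm T (f * g) \<le> alg_norm T f * alg_norm T g"
    using nn tnorm_nonneg[OF g] by (intro norm_leI tnorm_mult[OF f g] mult_mono tnorm_le f g) auto
next
  fix c d :: 'k
  show "alg_const T c \<in> alg_carrier (T :: ('k, ('v, 'a) mfps) normed_alg)"
    by (simp add: carrier_const const_carrier)
  show "alg_const T 1 = (1 :: ('v, 'a) mfps)" by (simp add: const_1)
  show "alg_const T (c + d) = alg_const T c + (alg_const T d :: ('v, 'a) mfps)" by (simp add: const_add mconst_add)
  show "alg_const T (c * d) = alg_const T c * (alg_const T d :: ('v, 'a) mfps)" by (simp add: const_mult mconst_mult)
  show "alg_norm T (alg_const T c :: ('v, 'a) mfps) = absv c"
  proof (rule antisym)
    have "tnorm (mconst (alg_const A c) :: ('v, 'a) mfps) M \<le> absv c" for M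
      by (auto simp: tnorm_def mcoeff_mconst norm_const norm_0 absv_nonneg)
    then show "alg_norm T (alg_const T c :: ('v, 'a) mfps) \<le> absv c" by (intro norm_leI) simp
    have "tnorm (mconst (alg_const A c) :: ('v, 'a) mfps) 0 \<le> alg_norm T (mconst (alg_const A c) :: ('v, 'a) mfps)"
      by (intro tnorm_le carrier_const const_carrier)
    then show "absv c \<le> alg_norm T (alg_const T c :: ('v, 'a) mfps)" by (simp add: tnorm_def mcoeff_mconst norm_const)
  qed
qed

end

section \<open>Points of the polydisk as limits of rigid points\<close>

definition polys :: "('v, 'a::zero) mfps set" where
  "polys = {f. finite (msupp f)}"

definition peval :: "('v \<Rightarrow> 'a) \<Rightarrow> ('v, 'a::comm_ring_1) mfps \<Rightarrow> 'a" where
  "peval w f = (\<Sum>M\<in>msupp f. mcoeff f M * wprod w M)"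

lemma peval_superset: "finite X \<Longrightarrow> msupp f \<subseteq> X \<Longrightarrow> peval w f = (\<Sum>M\<in>X. mcoeff f M * wprod w M)"
  unfolding peval_def by (rule sum.mono_neutral_left) (auto simp: msupp_def)

lemma msupp_add: "msupp (f + g) \<subseteq> msupp f \<union> msupp (g :: ('v, 'a::comm_ring_1) mfps)"
  by (auto simp: msupp_def)

lemma msupp_mult: "msupp (f * g) \<subseteq> (\<lambda>p. fst p + snd p) ` (msupp f \<times> msupp (g :: ('v, 'a::comm_ring_1) mfps))"
proof
  fix M assume "M \<in> msupp (f * g)"
  then have "(\<Sum>p\<in>splits M. mcoeff f (fst p) * mcoeff g (snd p)) \<noteq> 0" by (simp add: msupp_def mcoeff_times)
  then obtain p where p: "p \<in> splits M" "mcoeff f (fst p) * mcoeff g (snd p) \<noteq> 0" by (rule sum.not_neutral_contains_not_neutral)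
  then have "mcoeff f (fst p) \<noteq> 0" "mcoeff g (snd p) \<noteq> 0" by auto
  then show "M \<in> (\<lambda>p. fst p + snd p) ` (msupp f \<times> msupp g)"
    using p(1) by (intro image_eqI[of _ _ p]) (auto simp: splits_def msupp_def)
qed

lemma polys_add: "f \<in> polys \<Longrightarrow> g \<in> polys \<Longrightarrow> f + g \<in> (polys :: ('v, 'a::comm_ring_1) mfps set)"
  unfolding polys_def using msupp_add[of f g] by (auto intro: finite_subset)

lemma polys_mult: "f \<in> polys \<Longrightarrow> g \<in> polys \<Longrightarrow> f * g \<in> (polys :: ('v, 'a::comm_ring_1) mfps set)"
  unfolding polys_def using msupp_mult[of f g] by (auto intro: finite_subset)

lemma msupp_mconst: "msupp (mconst c) \<subseteq> {0}"
  by (auto simp: msupp_def mcoeff_mconst split: if_splits)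

lemma polys_mconst: "mconst c \<in> polys"
  unfolding polys_def using msupp_mconst[of c] by (auto intro: finite_subset)

lemma msupp_mmono: "msupp (mmono M) \<subseteq> {M}"
  by (auto simp: msupp_def mcoeff_mmono split: if_splits)

lemma polys_mmono: "mmono M \<in> polys"
  unfolding polys_def using msupp_mmono[of M] by (auto intro: finite_subset)

lemma polys_mvar: "(mvar v :: ('v, 'a::comm_ring_1) mfps) \<in> polys"
  using polys_mmono[of "Poly_Mapping.single v (Suc 0)"] by (simp only: mmono_single)

lemma polys_sum: "(\<And>a. a \<in> A \<Longrightarrow> f a \<in> polys) \<Longrightarrow> sum f A \<in> (polys :: ('v, 'a::comm_ring_1) mfps set)"
  by (induction A rule: infinite_finite_induct) (auto intro: polys_add simp flip: mconst_0 intro: polys_mconst)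

lemma peval_add: 
  assumes "f \<in> polys" "g \<in> polys" shows "peval w (f + g) = peval w f + peval w g"
proof -
  let ?X = "msupp f \<union> msupp g"
  have "finite ?X" using assms by (simp add: polys_def)
  then show ?thesis
    using msupp_add[of f g] by (subst (1 2 3) peval_superset[of ?X]) (auto simp: distrib_right sum.distrib)
qed

lemma peval_mult:
  assumes "f \<in> polys" "g \<in> polys" shows "peval w (f * g) = peval w f * peval w g"
proof -
  let ?X = "msupp f" and ?Y = "msupp g"
  let ?Z = "(\<lambda>p. fst p + snd p) ` (?X \<times> ?Y)"
  let ?h = "\<lambda>p. mcoeff f (fst p) * mcoeff g (snd p) * wprod w (fst p + snd p)"
  have fin: "finite ?X" "finite ?Y" "finite ?Z" using assms by (simp_all add: polys_def)
  have "peval w (f * g) = (\<Sum>M\<in>?Z. mcoeff (f * g) M * wprod w M)"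
    by (rule peval_superset[OF fin(3) msupp_mult])
  also have "\<dots> = (\<Sum>M\<in>?Z. \<Sum>p\<in>{p \<in> ?X \<times> ?Y. fst p + snd p = M}. ?h p)"
  proof (intro sum.cong refl)
    fix M
    have "mcoeff (f * g) M * wprod w M = (\<Sum>p\<in>splits M. ?h p)"
      unfolding mcoeff_times sum_distrib_right by (intro sum.cong refl) (auto simp: splits_def)
    also have "\<dots> = (\<Sum>p\<in>{p \<in> ?X \<times> ?Y. fst p + snd p = M}. ?h p)"
    proof (rule sum.mono_neutral_right[OF finite_splits])
      show "{p \<in> ?X \<times> ?Y. fst p + snd p = M} \<subseteq> splits M" by (auto simp: splits_def)
      show "\<forall>p\<in>splits M - {p \<in> ?X \<times> ?Y. fst p + snd p = M}. ?h p = 0"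
        by (auto simp: splits_def msupp_def)
    qed
    finally show "mcoeff (f * g) M * wprod w M = (\<Sum>p\<in>{p \<in> ?X \<times> ?Y. fst p + snd p = M}. ?h p)" .
  qed
  also have "\<dots> = (\<Sum>p\<in>?X \<times> ?Y. ?h p)"
    by (rule sum.group) (use fin in auto)
  also have "\<dots> = (\<Sum>p\<in>?X \<times> ?Y. (mcoeff f (fst p) * wprod w (fst p)) * (mcoeff g (snd p) * wprod w (snd p)))"
    by (intro sum.cong refl) (simp add: wprod_add mult_ac)
  also have "\<dots> = peval w f * peval w g"
    unfolding peval_def sum_product sum.cartesian_product by (simp add: case_prod_beta)
  finally show ?thesis .
qed

lemma peval_mconst [simp]: "peval w (mconst c) = c"
  using msupp_mconst[of c] by (subst peval_superset[of "{0}"]) (auto simp: mcoeff_mconst)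

lemma peval_mmono [simp]: "peval w (mmono M) = wprod w M"
  using msupp_mmono[of M] by (subst peval_superset[of "{M}"]) (auto simp: mcoeff_mmono)

lemma peval_mvar [simp]: "peval w (mvar v) = w v"
  using peval_mmono[of w "Poly_Mapping.single v (Suc 0)"] by (simp add: mmono_single)

lemma peval_sum: "(\<And>a. a \<in> A \<Longrightarrow> f a \<in> polys) \<Longrightarrow> peval w (sum f A) = (\<Sum>a\<in>A. peval w (f a))"
proof (induction A rule: infinite_finite_induct)
  case (insert a A)
  then show ?case by (simp add: peval_add polys_sum)
qed (simp_all flip: mconst_0)

context tate_algebra
begin

lemma polys_carrier:
  assumes "f \<in> polys" "\<And>M. mcoeff f M \<in> alg_carrier A" shows "f \<in> alg_carrier T"
proof -
  have "finite {M. tnorm f M > \<epsilon>}" if "\<epsilon> > 0" for \<epsilon>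
  proof (rule finite_subset)
    show "{M. tnorm f M > \<epsilon>} \<subseteq> msupp f" using that by (auto simp: tnorm_def msupp_def norm_0)
    show "finite (msupp f)" using assms(1) by (simp add: polys_def)
  qed
  then show ?thesis using assms(2) by (simp add: carrier_iff)
qed

lemma mmono_carrier: "mmono M \<in> alg_carrier T"
  by (rule polys_carrier[OF polys_mmono]) (auto simp: mcoeff_mmono carrier_0 carrier_1)

lemma mvar_carrier: "mvar v \<in> alg_carrier T"
  using mmono_carrier[of "Poly_Mapping.single v (Suc 0)"] by (simp only: mmono_single)

lemma norm_mmono: "alg_norm T (mmono M) \<le> \<rho> ^ mdeg M"
  using \<rho> by (intro norm_leI) (auto simp: tnorm_def mcoeff_mmono norm_0 norm_1)

lemma norm_mvar: "alg_norm T (mvar v) \<le> \<rho>"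
  using norm_mmono[of "Poly_Mapping.single v (Suc 0)"] by (simp add: mmono_single)

lemma mtrunc_carrier: "f \<in> alg_carrier T \<Longrightarrow> mtrunc X f \<in> alg_carrier T"
proof -
  assume f: "f \<in> alg_carrier T"
  have "finite {M. tnorm (mtrunc X f) M > \<epsilon>}" if "\<epsilon> > 0" for \<epsilon>
    by (rule finite_subset[of _ "{M. tnorm f M > \<epsilon>}"])
      (use f that in \<open>auto simp: carrier_iff tnorm_def mcoeff_mtrunc norm_0 split: if_splits\<close>)
  then show ?thesis using f by (simp add: carrier_iff mcoeff_mtrunc carrier_0)
qed

lemma norm_mtrunc_le:
  assumes "f \<in> alg_carrier T" "\<And>M. M \<notin> X \<Longrightarrow> tnorm f M \<le> \<epsilon>" "0 \<le> \<epsilon>"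
  shows "alg_norm T (f - mtrunc X f) \<le> \<epsilon>"
  using assms by (intro norm_leI) (auto simp: tnorm_def mcoeff_mtrunc norm_0)

text \<open>The estimate covers all larger sets as well, so that it also serves truncation by
  degree.\<close>

lemma mtrunc_approx:
  assumes "f \<in> alg_carrier T" "0 < \<epsilon>"
  obtains X where "finite X" "\<And>Y. X \<subseteq> Y \<Longrightarrow> alg_norm T (f - mtrunc Y f) \<le> \<epsilon>"
proof (rule that[of "{M. tnorm f M > \<epsilon>}"])
  show "finite {M. tnorm f M > \<epsilon>}" using assms by (simp add: carrier_iff)
  fix Y assume "{M. tnorm f M > \<epsilon>} \<subseteq> Y"
  then show "alg_norm T (f - mtrunc Y f) \<le> \<epsilon>" 
    using assms by (intro norm_mtrunc_le) (auto simp: subset_iff not_less[symmetric])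
qed

end

lemma mtrunc_polys: "finite X \<Longrightarrow> mtrunc X f \<in> polys"
  unfolding polys_def by (auto simp: msupp_def mcoeff_mtrunc elim!: rev_finite_subset split: if_splits)

context complete_nonarch_field
begin

lemma tate_ground: "0 < \<rho> \<Longrightarrow> tate_algebra absv (ground absv) \<rho>"
  by (intro tate_algebra.intro nonarch_algebra_ground) (simp add: tate_algebra_axioms_def)

lemma ground_simps [simp]: "alg_carrier (ground absv) = UNIV" "alg_norm (ground absv) = absv" "alg_const (ground absv) c = c"
  by (simp_all add: ground_def)

lemma polys_tate_ground: "0 < \<rho> \<Longrightarrow> polys \<subseteq> alg_carrier (tate (ground absv) \<rho>)"
  using tate_algebra.polys_carrier[OF tate_ground] by auto

lemma evaluations_spectrum:
  fixes x :: "('r, 'k) mfps \<Rightarrow> real"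
  assumes "0 < \<rho>" "x \<in> spectrum (tate (ground absv) \<rho>)"
  shows "evaluations absv polys x mconst peval"
proof -
  interpret tate_algebra absv "ground absv" \<rho> by (rule tate_ground[OF assms(1)])
  interpret T: nonarch_algebra absv "tate (ground absv) \<rho> :: ('k, ('r, 'k) mfps) normed_alg"
    by (rule nonarch_algebra_tate)
  have P: "f \<in> alg_carrier (tate (ground absv) \<rho>)" if "f \<in> polys" for f :: "('r, 'k) mfps"
    using polys_tate_ground[OF assms(1)] that by blast
  show ?thesis
    using T.spec_const[OF assms(2)] P
    by unfold_locales
      (auto intro: polys_add polys_mult polys_mconst T.spec_nonneg[OF assms(2)] T.spec_add[OF assms(2)] T.spec_mult[OF assms(2)]
        simp: peval_add peval_mult mconst_minus)
qed

end

lemma mmono_single_power: "mmono (Poly_Mapping.single v n) = (mvar v :: ('v, 'a::comm_ring_1) mfps) ^ n"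
proof (induction n)
  case (Suc n)
  have "Poly_Mapping.single v (Suc n) = Poly_Mapping.single v (Suc 0) + Poly_Mapping.single v n"
    by (simp flip: single_add)
  then show ?case using Suc by (simp add: mmono_add mmono_single)
qed simp

lemma (in evaluations) approximable_subset:
  assumes "approximable S" "S' \<subseteq> S" shows "approximable S'"
  unfolding approximable_def
proof (intro allI impI)
  fix E :: "'b set" and \<epsilon> :: real assume E: "finite E" "E \<subseteq> S'" "0 < \<epsilon>"
  have "E \<subseteq> S" using E(2) assms(2) by (rule order_trans)
  then show "\<exists>w. \<forall>a\<in>E. \<bar>absv (\<phi> w a) - \<alpha> a\<bar> < \<epsilon>"
    using assms(1)[unfolded approximable_def, rule_format, of E \<epsilon>] E by simp
qed

definition polys_in :: "'v set \<Rightarrow> ('v, 'a::zero) mfps set" where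
  "polys_in V = {f \<in> polys. \<forall>M\<in>msupp f. Poly_Mapping.keys M \<subseteq> V}"

section \<open>Density of the points of \<open>k^r\<close> for finitely many polynomials\<close>

context alg_closed_nonarch_field
begin

text \<open>Polynomials in \<open>insert v V\<close> are the values at \<open>mvar v\<close> of
  polynomials over \<open>polys_in V\<close>, so \<open>approximable_adjoin\<close> provides the
  inductive step: changing the v-th coordinate of w leaves the values on \<open>polys_in V\<close>
  unchanged.\<close>

lemma rigid_dense_finite:
  fixes x :: "('r::finite, 'k) mfps \<Rightarrow> real"
  assumes \<rho>: "0 < \<rho>" and x: "x \<in> spectrum (tate (ground absv) \<rho>)"
    and E: "finite E" "E \<subseteq> polys" and e: "0 < \<epsilon>"
  shows "\<exists>w. \<forall>f\<in>E. \<bar>absv (peval w f) - x f\<bar> < \<epsilon>"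
proof -
  interpret ev: evaluations absv polys x mconst peval by (rule evaluations_spectrum[OF \<rho> x])
  interpret ev: alg_closed_evaluations absv polys x mconst peval ..
  have sub: "ev.const_subring (polys_in V)" for V
  proof -
    have add: "f + g \<in> polys_in V" if fg: "f \<in> polys_in V" "g \<in> polys_in V" for f g :: "('r, 'k) mfps"
    proof -
      have "Poly_Mapping.keys M \<subseteq> V" if "M \<in> msupp (f + g)" for M
        using set_mp[OF msupp_add that] fg by (auto simp only: Un_iff polys_in_def mem_Collect_eq)
      then show ?thesis using fg polys_add[of f g] by (simp add: polys_in_def)
    qed
    have mult: "f * g \<in> polys_in V" if fg: "f \<in> polys_in V" "g \<in> polys_in V" for f g :: "('r, 'k) mfps"
    proof -
      have "Poly_Mapping.keys M \<subseteq> V" if "M \<in> msupp (f * g)" for M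
      proof -
        have "M \<in> (\<lambda>p. fst p + snd p) ` (msupp f \<times> msupp g)" using that msupp_mult by (rule set_mp[rotated])
        then obtain p where "M = fst p + snd p" "fst p \<in> msupp f" "snd p \<in> msupp g" by auto
        then show ?thesis using fg by (simp add: polys_in_def keys_add_nat)
      qed
      then show ?thesis using fg polys_mult[of f g] by (simp add: polys_in_def)
    qed
    have const: "mconst c \<in> (polys_in V :: ('r, 'k) mfps set)" for c
    proof -
      have "Poly_Mapping.keys M \<subseteq> V" if "M \<in> msupp (mconst c)" for M :: "'r \<Rightarrow>\<^sub>0 nat"
        using that msupp_mconst[of c] by auto
      then show ?thesis by (simp add: polys_in_def polys_mconst)
    qed
    show ?thesis unfolding ev.const_subring_def
    proof (intro conjI ballI)
      show "polys_in V \<subseteq> (polys :: ('r, 'k) mfps set)" by (simp add: polys_in_def subset_iff)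
      show "range mconst \<subseteq> (polys_in V :: ('r, 'k) mfps set)" by (rule image_subsetI) (rule const)
    qed (rule add mult; assumption)+
  qed
  have "ev.approximable (polys_in V)" if "finite V" for V
    using that
  proof (induction V rule: finite_induct)
    case empty
    have "\<exists>c. f = mconst c" if "f \<in> polys_in {}" for f :: "('r, 'k) mfps"
    proof -
      have z: "mcoeff f M = 0" if "M \<noteq> 0" for M
      proof (rule ccontr)
        assume "mcoeff f M \<noteq> 0"
        then have "M \<in> msupp f" by (simp add: msupp_def)
        then have "Poly_Mapping.keys M = {}" using \<open>f \<in> polys_in {}\<close> by (simp add: polys_in_def)
        then show False using \<open>M \<noteq> 0\<close> by simp
      qed
      have "mcoeff f M = mcoeff (mconst (mcoeff f 0)) M" for M
        by (cases "M = 0") (simp_all add: mcoeff_mconst z)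
      then show ?thesis by (intro exI[of _ "mcoeff f 0"] mfps_eqI)
    qed
    note const = this
    show ?case unfolding ev.approximable_def
    proof (intro allI impI exI[of _ undefined] ballI)
      fix E :: "('r, 'k) mfps set" and \<epsilon> :: real and f assume E: "E \<subseteq> polys_in {}" and "0 < \<epsilon>" and fE: "f \<in> E"
      have "f \<in> polys_in {}" by (rule subsetD[OF E fE])
      from const[OF this] obtain c where fc: "f = mconst c" by (rule exE)
      show "\<bar>absv (peval undefined f) - x f\<bar> < \<epsilon>" unfolding fc using \<open>0 < \<epsilon>\<close> by (simp add: ev.\<alpha>_const)
    qed
  next
    case (insert v V)
    have ad: "ev.approximable {poly p (mvar v) |p. ev.coeffs_in (polys_in V) p}"
    proof (rule ev.approximable_adjoin[OF sub insert.IH polys_mvar])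
      fix w :: "'r \<Rightarrow> 'k" and b
      have "peval (w(v := b)) s = peval w s" if "s \<in> polys_in V" for s
        unfolding peval_def
      proof (intro sum.cong refl arg_cong2[where f = "(*)"])
        fix M assume "M \<in> msupp s"
        then have "v \<notin> Poly_Mapping.keys M" using that insert.hyps by (auto simp: polys_in_def)
        then show "wprod (w(v := b)) M = wprod w M" unfolding wprod_def by (intro prod.cong) auto
      qed
      then show "\<exists>w'. (\<forall>s\<in>polys_in V. peval w' s = peval w s) \<and> peval w' (mvar v) = b"
        by (intro exI[of _ "w(v := b)"]) simp
    qed
    have "polys_in (insert v V) \<subseteq> {poly p (mvar v) |p. ev.coeffs_in (polys_in V) p}"
    proof
      fix f :: "('r, 'k) mfps" assume f: "f \<in> polys_in (insert v V)"
      then have fin: "finite (msupp f)" by (simp add: polys_in_def polys_def)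
      \<comment> \<open>The monomial without the variable v, whose exponent becomes the degree in
        the new one-variable polynomial.\<close>
      define off where "off M = M - Poly_Mapping.single v (Poly_Mapping.lookup M v)" for M :: "'r \<Rightarrow>\<^sub>0 nat"
      have off: "M = off M + Poly_Mapping.single v (Poly_Mapping.lookup M v)" "v \<notin> Poly_Mapping.keys (off M)"
        "Poly_Mapping.keys (off M) \<subseteq> Poly_Mapping.keys M" for M
      proof -
        have l: "Poly_Mapping.lookup (off M) i = (if i = v then 0 else Poly_Mapping.lookup M i)" for i
          by (simp add: off_def lookup_minus lookup_single when_def)
        show "M = off M + Poly_Mapping.single v (Poly_Mapping.lookup M v)"
          by (rule poly_mapping_eqI) (simp add: lookup_add l lookup_single when_def)
        show "v \<notin> Poly_Mapping.keys (off M)" by (simp add: in_keys_iff l)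
        show "Poly_Mapping.keys (off M) \<subseteq> Poly_Mapping.keys M" by (simp add: subset_iff in_keys_iff l)
      qed
      define p where "p = (\<Sum>M\<in>msupp f. monom (mconst (mcoeff f M) * mmono (off M)) (Poly_Mapping.lookup M v))"
      have "f = (\<Sum>M\<in>msupp f. mconst (mcoeff f M) * mmono M)" by (rule finite_msupp_eq[OF fin order_refl])
      also have "\<dots> = poly p (mvar v)"
        unfolding p_def poly_sum
      proof (intro sum.cong refl)
        fix M
        have "mmono M = mmono (off M) * (mvar v :: ('r, 'k) mfps) ^ Poly_Mapping.lookup M v"
          using arg_cong[OF off(1)[of M], of mmono] by (simp only: mmono_add mmono_single_power)
        then show "mconst (mcoeff f M) * mmono M = poly (monom (mconst (mcoeff f M) * mmono (off M)) (Poly_Mapping.lookup M v)) (mvar v)"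
          by (simp add: poly_monom mult.assoc)
      qed
      finally have fp: "f = poly p (mvar v)" .
      have cp: "ev.coeffs_in (polys_in V) p"
        unfolding ev.coeffs_in_def p_def coeff_sum
      proof (intro allI ev.const_subring_sum[OF sub])
        fix i M assume M: "M \<in> msupp f"
        have "Poly_Mapping.keys (off M) \<subseteq> V"
        proof -
          have "Poly_Mapping.keys M \<subseteq> insert v V" using M f by (simp add: polys_in_def)
          then show ?thesis using off(2)[of M] off(3)[of M] by blast
        qed
        then have "mmono (off M) \<in> (polys_in V :: ('r, 'k) mfps set)"
          by (simp add: polys_in_def polys_mmono msupp_def mcoeff_mmono)
        then have "mconst (mcoeff f M) * mmono (off M) \<in> polys_in V"
          by (rule ev.const_subringD(4)[OF sub ev.const_subringD(2)[OF sub]])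
        then show "coeff (monom (mconst (mcoeff f M) * mmono (off M)) (Poly_Mapping.lookup M v)) i \<in> polys_in V"
          using ev.const_subringD(5)[OF sub] by simp
      qed
      show "f \<in> {poly p (mvar v) |p. ev.coeffs_in (polys_in V) p}"
        by (rule CollectI, rule exI[of _ p], rule conjI[OF fp cp])
    qed
    with ad show ?case by (rule ev.approximable_subset)
  qed
  from this[of UNIV] have "ev.approximable polys" by (simp add: polys_in_def)
  from this[unfolded ev.approximable_def, rule_format, OF E e] show ?thesis .
qed

end

text \<open>The trace of the neighbourhood filter of \<open>z\<close> on the points of \<open>k\<^sup>r\<close>.\<close>

definition rigid_near :: "('k::comm_ring_1 \<Rightarrow> real) \<Rightarrow> (('r, 'k) mfps \<Rightarrow> real) \<Rightarrow> ('r \<Rightarrow> 'k) filter" where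
  "rigid_near absv z = (INF p\<in>polys \<times> {0<..}. principal {w. \<bar>absv (peval w (fst p)) - z (fst p)\<bar> < snd p})"

lemma rigid_near_tendsto:
  assumes "f \<in> polys" shows "((\<lambda>w. absv (peval w f)) \<longlongrightarrow> z f) (rigid_near absv z)"
proof (rule tendstoI)
  fix e :: real assume "0 < e"
  then have "rigid_near absv z \<le> principal {w. \<bar>absv (peval w f) - z f\<bar> < e}"
    unfolding rigid_near_def using assms by (intro INF_lower2[of "(f, e)"]) auto
  then show "\<forall>\<^sub>F w in rigid_near absv z. dist (absv (peval w f)) (z f) < e"
    by (auto simp: le_principal dist_real_def)
qed

lemma disk_series_carrier: "0 < \<rho> \<Longrightarrow> \<rho> < 1 \<Longrightarrow> f \<in> disk_series A \<Longrightarrow> f \<in> alg_carrier (tate A \<rho>)"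
  by (auto simp: disk_series_def)

context alg_closed_nonarch_field
begin

lemma polys_disk_series: "polys \<subseteq> disk_series (ground absv)"
  unfolding disk_series_def by (intro INT_greatest polys_tate_ground) simp

text \<open>Finitely many basic conditions at z have a common solution in \<open>k^r\<close> by
  density. Without this the limit defining \<open>Ev\<close> would be meaningless.\<close>

lemma rigid_near_not_bot:
  fixes z :: "('r::finite, 'k) mfps \<Rightarrow> real"
  assumes "z \<in> open_disk (ground absv)" shows "rigid_near absv z \<noteq> bot"
  unfolding rigid_near_def
proof (rule INF_filter_not_bot)
  fix X :: "(('r, 'k) mfps \<times> real) set" assume X: "X \<subseteq> polys \<times> {0<..}" "finite X"
  obtain \<rho> x where x: "0 < \<rho>" "\<rho> < 1" "x \<in> spectrum (tate (ground absv) \<rho>)" "z = restrict x (disk_series (ground absv))"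
    using assms by (auto simp: open_disk_def)
  \<comment> \<open>The 1 covers an empty set of conditions.\<close>
  define e where "e = Min (insert 1 (snd ` X))"
  have XD: "fst p \<in> polys" "0 < snd p" if "p \<in> X" for p
    using set_mp[OF X(1) that] by (simp_all add: mem_Times_iff)
  have e: "0 < e" unfolding e_def using X(2) XD(2) by (subst Min_gr_iff) auto
  have e_le: "e \<le> snd p" if "p \<in> X" for p unfolding e_def using X(2) that by (intro Min_le) auto
  have "fst ` X \<subseteq> polys" using XD(1) by (rule image_subsetI)
  from rigid_dense_finite[OF x(1,3) finite_imageI[OF X(2)] this e]
  obtain w where w: "\<forall>f\<in>fst ` X. \<bar>absv (peval w f) - x f\<bar> < e" by (elim exE) (rule that)
  have "w \<in> (\<Inter>p\<in>X. {w. \<bar>absv (peval w (fst p)) - z (fst p)\<bar> < snd p})"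
  proof
    fix p assume p: "p \<in> X"
    then have "fst p \<in> disk_series (ground absv)" using set_mp[OF polys_disk_series XD(1)] by simp
    then have "z (fst p) = x (fst p)" using x(4) by simp
    moreover have "\<bar>absv (peval w (fst p)) - x (fst p)\<bar> < e" using w p by simp
    ultimately show "w \<in> {w. \<bar>absv (peval w (fst p)) - z (fst p)\<bar> < snd p}" using e_le[OF p] by simp
  qed
  then show "(INF p\<in>X. principal {w. \<bar>absv (peval w (fst p)) - z (fst p)\<bar> < snd p}) \<noteq> bot"
    unfolding INF_principal_finite[OF X(2)] principal_eq_bot_iff by blast
qed

text \<open>The coordinate functions have value at most \<rho> at x and are among the functions
  defining the filter. On the polydisk obtained this way, truncation errors are uniform.\<close>

lemma rigid_near_bounded:
  fixes x :: "('r::finite, 'k) mfps \<Rightarrow> real"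
  assumes x: "0 < \<rho>" "x \<in> spectrum (tate (ground absv) \<rho>)" and r: "\<rho> < \<rho>'"
  shows "\<forall>\<^sub>F w in rigid_near absv (restrict x (disk_series (ground absv))). \<forall>v. absv (w v) < \<rho>'"
proof (rule eventually_all_finite)
  fix v :: 'r
  interpret tate_algebra absv "ground absv" \<rho> by (rule tate_ground[OF x(1)])
  interpret T: nonarch_algebra absv "tate (ground absv) \<rho> :: ('k, ('r, 'k) mfps) normed_alg"
    by (rule nonarch_algebra_tate)
  have "x (mvar v) \<le> \<rho>" by (rule order_trans[OF T.spec_le_norm[OF x(2) mvar_carrier] norm_mvar])
  moreover have "restrict x (disk_series (ground absv)) (mvar v) = x (mvar v)"
    by (rule restrict_apply'[OF set_mp[OF polys_disk_series polys_mvar]])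
  ultimately have lt: "restrict x (disk_series (ground absv)) (mvar v) < \<rho>'" using r by linarith
  have lim: "((\<lambda>w. absv (peval w (mvar v))) \<longlongrightarrow> restrict x (disk_series (ground absv)) (mvar v))
      (rigid_near absv (restrict x (disk_series (ground absv))))"
    by (rule rigid_near_tendsto[OF polys_mvar])
  show "\<forall>\<^sub>F w in rigid_near absv (restrict x (disk_series (ground absv))). absv (w v) < \<rho>'"
    using order_tendstoD(2)[OF lim lt] by (simp only: peval_mvar)
qed

end

section \<open>Seminorms on finite-dimensional spaces\<close>

text \<open>The 0 gives the empty family the maximum 0, as befits the zero seminorm.\<close>

definition fmax :: "nat \<Rightarrow> (nat \<Rightarrow> real) \<Rightarrow> real" where
  "fmax n h = Max (insert 0 (h ` {..<n}))"

lemma fmax_le_iff: "fmax n h \<le> B \<longleftrightarrow> 0 \<le> B \<and> (\<forall>k<n. h k \<le> B)"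
  by (auto simp: fmax_def)

lemma fmax_ge: "k < n \<Longrightarrow> h k \<le> fmax n h" and fmax_nonneg: "0 \<le> fmax n h"
  using fmax_le_iff[of n h "fmax n h"] by auto

lemma fmax_cong: "(\<And>k. k < n \<Longrightarrow> h k = h' k) \<Longrightarrow> fmax n h = fmax n h'"
  by (simp add: fmax_def)

lemma fmax_Suc: "fmax (Suc n) h = max (h n) (fmax n h)"
proof (rule antisym)
  show "fmax (Suc n) h \<le> max (h n) (fmax n h)"
    unfolding fmax_le_iff[of "Suc n"]
  proof (intro conjI allI impI)
    show "0 \<le> max (h n) (fmax n h)" using fmax_nonneg[of n h] by simp
    fix k assume "k < Suc n"
    then have "k = n \<or> k < n" by auto
    then show "h k \<le> max (h n) (fmax n h)" using fmax_ge[of k n h] by (elim disjE) simp_all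
  qed
  have "fmax n h \<le> fmax (Suc n) h"
    using fmax_nonneg[of "Suc n" h] fmax_ge[of _ "Suc n" h] by (auto simp: fmax_le_iff[of n])
  then show "max (h n) (fmax n h) \<le> fmax (Suc n) h"
    using fmax_ge[of n "Suc n" h] by simp
qed

lemma fmax_0: "fmax 0 h = 0" by (simp add: fmax_def)

lemma fmax_cmult: "0 \<le> c \<Longrightarrow> fmax n (\<lambda>k. c * h k) = c * fmax n h"
  by (induction n) (auto simp: fmax_0 fmax_Suc max_mult_distrib_left)

lemma fmax_mono: "(\<And>k. k < n \<Longrightarrow> h k \<le> h' k) \<Longrightarrow> fmax n h \<le> fmax n h'"
  unfolding fmax_le_iff[of n h] using fmax_ge[of _ n h'] fmax_nonneg[of n h'] by (meson order_trans)

lemma tendsto_fmax: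
  "(\<And>k. k < n \<Longrightarrow> (h k \<longlongrightarrow> l k) F) \<Longrightarrow> ((\<lambda>x. fmax n (\<lambda>k. h k x)) \<longlongrightarrow> fmax n l) F"
  by (induction n) (auto simp: fmax_0 fmax_Suc intro!: tendsto_max)

lemma fmax_swap_le:
  "fmax m (\<lambda>j. fmax n (\<lambda>k. h j k)) \<le> fmax n (\<lambda>k. fmax m (\<lambda>j. h j k))"
  unfolding fmax_le_iff[of m]
proof (intro conjI allI impI fmax_nonneg)
  fix j assume j: "j < m"
  show "fmax n (\<lambda>k. h j k) \<le> fmax n (\<lambda>k. fmax m (\<lambda>j. h j k))"
    by (rule fmax_mono) (rule fmax_ge[OF j])
qed

lemma fmax_swap: "fmax m (\<lambda>j. fmax n (\<lambda>k. h j k)) = fmax n (\<lambda>k. fmax m (\<lambda>j. h j k))"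
  by (rule antisym[OF fmax_swap_le fmax_swap_le])

definition lincomb :: "'i set \<Rightarrow> ('i \<Rightarrow> 'k::comm_ring_1) \<Rightarrow> ('i \<Rightarrow> 'k) \<Rightarrow> 'k" where
  "lincomb J N c = (\<Sum>i\<in>J. N i * c i)"

text \<open>Vectors are functions on the whole index type, of which only the coordinates in J count;
  this lets J grow in an induction without a change of type.\<close>

locale coord_seminorm = complete_nonarch_field absv
  for absv :: "'k::field \<Rightarrow> real" +
  fixes J :: "'i set" and q :: "('i \<Rightarrow> 'k) \<Rightarrow> real"
  assumes q_nonneg: "0 \<le> q c"
    and q_add: "q (\<lambda>i. c i + d i) \<le> max (q c) (q d)"
    and q_scale: "q (\<lambda>i. t * c i) = absv t * q c"
    and q_cong: "(\<And>i. i \<in> J \<Longrightarrow> c i = d i) \<Longrightarrow> q c = q d"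
begin

lemma q_diff: "q (\<lambda>i. c i - d i) \<le> max (q c) (q d)"
  using q_add[of c "\<lambda>i. - 1 * d i"] q_scale[of "- 1" d] by simp

end

text \<open>Completeness of the field is used when the distance to a hyperplane is \<open>0\<close>: it is then attained.\<close>

lemma (in complete_nonarch_field) seminorm_functionals:
  fixes q :: "('i \<Rightarrow> 'k) \<Rightarrow> real"
  assumes "finite J" "coord_seminorm absv J q" "0 < \<delta>" "\<delta> < 1"
  shows "\<exists>n N a. (\<forall>k<n. (0::real) < a k)
    \<and> (\<forall>c. (1 - \<delta>) * fmax n (\<lambda>k. a k * absv (lincomb J (N k) c)) \<le> q c
         \<and> q c \<le> fmax n (\<lambda>k. a k * absv (lincomb J (N k) c)))
    \<and> (\<forall>l. \<exists>c. \<forall>k<n. lincomb J (N k) c = l k)"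
  using assms
proof (induction J arbitrary: q \<delta> rule: finite_induct)
  case empty
  interpret coord_seminorm absv "{}" q by (rule empty.prems(1))
  have "q c = 0" for c using q_scale[of 0 c] q_cong[of c "\<lambda>i. 0 * c i"] by simp
  then show ?case by (intro exI[of _ 0]) (simp add: fmax_0)
next
  case (insert i0 J)
  interpret coord_seminorm absv "insert i0 J" q by (rule insert.prems(1))
  \<comment> \<open>Two losses of \<eta> occur, one for the seminorm on the smaller space and one
    for a nearly closest point; together they cost at most \<delta>.\<close>
  define \<eta> where "\<eta> = \<delta> / 2"
  have eta: "0 < \<eta>" "\<eta> < 1" "1 - \<delta> \<le> (1 - \<eta>) * (1 - \<eta>)" "1 - \<delta> \<le> 1 - \<eta>"
    using insert.prems by (auto simp: \<eta>_def field_simps)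
  define off where "off c i = (if i = i0 then 0 else c i)" for c :: "'i \<Rightarrow> 'k" and i
  define q0 where "q0 c = q (off c)" for c
  have q0: "coord_seminorm absv J q0"
  proof unfold_locales
    fix c d :: "'i \<Rightarrow> 'k" and t
    show "0 \<le> q0 c" by (simp add: q0_def q_nonneg)
    have "off (\<lambda>i. c i + d i) = (\<lambda>i. off c i + off d i)" by (auto simp: off_def)
    then show "q0 (\<lambda>i. c i + d i) \<le> max (q0 c) (q0 d)" by (simp add: q0_def q_add)
    have "off (\<lambda>i. t * c i) = (\<lambda>i. t * off c i)" by (auto simp: off_def)
    then show "q0 (\<lambda>i. t * c i) = absv t * q0 c" by (simp add: q0_def q_scale)
    show "q0 c = q0 d" if "\<And>i. i \<in> J \<Longrightarrow> c i = d i"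
      unfolding q0_def using that by (intro q_cong) (auto simp: off_def)
  qed
  interpret q0: coord_seminorm absv J q0 by (rule q0)
  obtain n N a where N: "\<forall>k<n. (0::real) < a k"
    "\<forall>c. (1 - \<eta>) * fmax n (\<lambda>k. a k * absv (lincomb J (N k) c)) \<le> q0 c
         \<and> q0 c \<le> fmax n (\<lambda>k. a k * absv (lincomb J (N k) c))"
    "\<forall>l. \<exists>c. \<forall>k<n. lincomb J (N k) c = l k"
    using insert.IH[OF q0 eta(1,2)] by (elim exE conjE) (rule that)
  \<comment> \<open>The affine hyperplane where the coordinate \<open>i0\<close> is 1; D below is
    its distance from 0.\<close>
  define u where "u c i = (if i = i0 then 1 else c i)" for c :: "'i \<Rightarrow> 'k" and i
  have diff_u: "q (\<lambda>i. u c i - u d i) = q0 (\<lambda>i. c i - d i)" for c d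
    unfolding q0_def by (rule arg_cong[where f = q]) (auto simp: u_def off_def)
  define D where "D = Inf (range (\<lambda>c. q (u c)))"
  have D_le: "D \<le> q (u c)" for c
    unfolding D_def by (rule cInf_lower) (auto intro!: bdd_belowI[of _ 0] simp: q_nonneg)
  have D0: "0 \<le> D" unfolding D_def by (rule cInf_greatest) (auto simp: q_nonneg)
  have scale_u: "absv (c i0) * D \<le> q c" for c
  proof (cases "c i0 = 0")
    case False
    have "q c = q (\<lambda>i. c i0 * u (\<lambda>i. c i / c i0) i)"
      using False by (intro q_cong) (auto simp: u_def)
    also have "\<dots> = absv (c i0) * q (u (\<lambda>i. c i / c i0))" by (rule q_scale)
    finally show ?thesis using D_le by (simp add: mult_left_mono absv_nonneg)
  qed (simp add: q_nonneg)
  have near: "\<exists>c. q (u c) < D + e" if "0 < e" for e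
    using cInf_lessD[of "range (\<lambda>c. q (u c))" "D + e"] that by (auto simp: D_def)
  \<comment> \<open>The extension of the functional \<open>N k\<close> that vanishes on the vector
    \<open>u c0\<close>.\<close>
  define N' where "N' c0 k i = (if i = i0 then - lincomb J (N k) c0 else N k i)" for c0 k i
  have N': "lincomb (insert i0 J) (N' c0 k) c = lincomb J (N k) (\<lambda>i. c i - c i0 * c0 i)" for c0 k c
  proof -
    have "lincomb (insert i0 J) (N' c0 k) c = - lincomb J (N k) c0 * c i0 + (\<Sum>i\<in>J. N k i * c i)"
      unfolding lincomb_def[of "insert i0 J"] using insert.hyps by (auto simp: N'_def intro!: sum.cong)
    also have "\<dots> = lincomb J (N k) (\<lambda>i. c i - c i0 * c0 i)"
      by (simp add: lincomb_def algebra_simps sum_subtractf sum_distrib_left)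
    finally show ?thesis .
  qed
  have split: "q c \<le> max (absv (c i0) * q (u c0)) (q0 (\<lambda>i. c i - c i0 * c0 i))" for c c0
  proof -
    have "q c = q (\<lambda>i. c i0 * u c0 i + off (\<lambda>i. c i - c i0 * c0 i) i)"
      by (intro q_cong) (auto simp: u_def off_def)
    then show ?thesis using q_add[of "\<lambda>i. c i0 * u c0 i" "off (\<lambda>i. c i - c i0 * c0 i)"]
      by (simp add: q_scale q0_def)
  qed
  have split': "q0 (\<lambda>i. c i - c i0 * c0 i) \<le> max (q c) (absv (c i0) * q (u c0))" for c c0
  proof -
    have "q0 (\<lambda>i. c i - c i0 * c0 i) = q (\<lambda>i. c i - c i0 * u c0 i)"
      unfolding q0_def by (intro q_cong) (auto simp: u_def off_def)
    then show ?thesis using q_diff[of c "\<lambda>i. c i0 * u c0 i"] by (simp add: q_scale)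
  qed
  define m where "m c0 c = fmax n (\<lambda>k. a k * absv (lincomb (insert i0 J) (N' c0 k) c))" for c0 c
  have m: "(1 - \<eta>) * m c0 c \<le> q0 (\<lambda>i. c i - c i0 * c0 i)" "q0 (\<lambda>i. c i - c i0 * c0 i) \<le> m c0 c" for c0 c
    using N(2) unfolding m_def N' by auto
  show ?case
  proof (cases "D = 0")
    case False
    then have Dpos: "0 < D" using D0 by simp
    then have "0 < D * \<eta> / (1 - \<eta>)" using eta by simp
    \<comment> \<open>The size of this vector exceeds D by a factor of at most 1/(1 - \<eta>), so it
      is nearly orthogonal to the span of J. The coordinate \<open>i0\<close>, weighted by its size
      b, becomes the additional functional.\<close>
    from near[OF this] obtain c0 where c0: "q (u c0) < D + D * \<eta> / (1 - \<eta>)" by blast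
    define b where "b = q (u c0)"
    have b: "0 < b" "(1 - \<eta>) * b \<le> D"
      using D_le[of c0] Dpos c0 eta by (auto simp: b_def field_simps)
    define a' where "a' k = (if k = n then b else a k)" for k
    define N'' where "N'' k = (if k = n then (\<lambda>i. if i = i0 then 1 else 0) else N' c0 k)" for k
    have ln: "lincomb (insert i0 J) (N'' n) c = c i0" for c
      unfolding lincomb_def N''_def using insert.hyps by (simp add: if_distrib[of "\<lambda>x. x * _"] cong: if_cong)
    have fm: "fmax (Suc n) (\<lambda>k. a' k * absv (lincomb (insert i0 J) (N'' k) c)) = max (b * absv (c i0)) (m c0 c)" for c
    proof -
      have "fmax n (\<lambda>k. a' k * absv (lincomb (insert i0 J) (N'' k) c)) = m c0 c"
        unfolding m_def by (intro fmax_cong) (simp add: a'_def N''_def)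
      then show ?thesis by (simp add: fmax_Suc ln) (simp add: a'_def)
    qed
    have "(1 - \<delta>) * max (b * absv (c i0)) (m c0 c) \<le> q c" for c
    proof -
      have 1: "(1 - \<eta>) * (b * absv (c i0)) \<le> q c"
        using mult_right_mono[OF b(2) absv_nonneg[of "c i0"]] scale_u[of c] by (simp add: mult_ac)
      have "(1 - \<eta>) * max (q c) (absv (c i0) * b) \<le> q c"
      proof -
        have "(1 - \<eta>) * q c \<le> q c" using eta q_nonneg[of c] by (simp add: mult_left_le_one_le)
        then show ?thesis using 1 by (simp add: max_def mult_ac)
      qed
      moreover have "(1 - \<eta>) * q0 (\<lambda>i. c i - c i0 * c0 i) \<le> (1 - \<eta>) * max (q c) (absv (c i0) * b)"
        using split'[of c c0] eta by (intro mult_left_mono) (auto simp: b_def)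
      moreover have "(1 - \<eta>) * ((1 - \<eta>) * m c0 c) \<le> (1 - \<eta>) * q0 (\<lambda>i. c i - c i0 * c0 i)"
        using m(1)[of c0 c] eta by (intro mult_left_mono) auto
      moreover have mnn: "0 \<le> m c0 c" unfolding m_def by (rule fmax_nonneg)
      then have "(1 - \<delta>) * m c0 c \<le> ((1 - \<eta>) * (1 - \<eta>)) * m c0 c" by (rule mult_right_mono[OF eta(3)])
      ultimately have 2: "(1 - \<delta>) * m c0 c \<le> q c" by (simp add: mult.assoc)
      have "(1 - \<delta>) * (b * absv (c i0)) \<le> (1 - \<eta>) * (b * absv (c i0))"
        using eta b absv_nonneg[of "c i0"] by (intro mult_right_mono) auto
      then show ?thesis using 1 2 by (simp add: max_def)
    qed
    moreover have "q c \<le> max (b * absv (c i0)) (m c0 c)" for c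
      using split[of c c0] m(2)[of c c0] by (simp add: b_def mult.commute le_max_iff_disj max_def split: if_splits)
    moreover have "\<exists>c. \<forall>k<Suc n. lincomb (insert i0 J) (N'' k) c = l k" for l
    proof -
      obtain c' where c': "\<forall>k<n. lincomb J (N k) c' = l k" using N(3) by blast
      define c where "c i = (if i = i0 then l n else c' i + l n * c0 i)" for i
      have "lincomb (insert i0 J) (N'' k) c = l k" if "k < n" for k
      proof -
        have "lincomb (insert i0 J) (N'' k) c = lincomb J (N k) (\<lambda>i. c i - c i0 * c0 i)"
          using that by (simp add: N''_def N')
        also have "\<dots> = lincomb J (N k) c'"
          unfolding lincomb_def using insert.hyps by (intro sum.cong) (auto simp: c_def)
        finally show ?thesis using c' that by simp
      qed
      moreover have "lincomb (insert i0 J) (N'' n) c = l n" by (simp add: ln c_def)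
      ultimately show ?thesis by (intro exI[of _ c]) (auto simp: less_Suc_eq)
    qed
    moreover have "\<forall>k<Suc n. 0 < a' k" using N(1) b by (auto simp: a'_def less_Suc_eq)
    ultimately show ?thesis by (intro exI[of _ "Suc n"] exI[of _ N''] exI[of _ a']) (simp add: fm)
  next
    case True
    \<comment> \<open>Along a minimising sequence the values of the functionals are Cauchy. Their
      limits are the values at some vector, because the functionals can take any prescribed values;
      this is the purpose of the last clause of the statement.\<close>
    have "\<exists>c0. q (u c0) = 0"
    proof -
      have "\<exists>c. q (u c) < inverse (real (Suc j))" for j using near[of "inverse (real (Suc j))"] True by simp
      then have "\<forall>j. \<exists>c. q (u c) < inverse (real (Suc j))" ..
      then obtain cs where cs: "\<forall>j. q (u (cs j)) < inverse (real (Suc j))" by (rule choice[THEN exE])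
      have lim: "\<exists>l. (\<lambda>j. absv (lincomb J (N k) (cs j) - l)) \<longlonglongrightarrow> 0" if k: "k < n" for k
      proof (rule absv_complete)
        fix \<epsilon> :: real assume e: "0 < \<epsilon>"
        have ak: "0 < a k" using N(1) k by simp
        then obtain j0 where j0: "inverse (real (Suc j0)) < (1 - \<eta>) * a k * \<epsilon>"
          using reals_Archimedean[of "(1 - \<eta>) * a k * \<epsilon>"] eta e by auto
        have "absv (lincomb J (N k) (cs i) - lincomb J (N k) (cs j)) < \<epsilon>" if ij: "i \<ge> j0" "j \<ge> j0" for i j
        proof -
          have inv: "inverse (real (Suc p)) \<le> inverse (real (Suc j0))" if "p \<ge> j0" for p using that by simp
          have "lincomb J (N k) (cs i) - lincomb J (N k) (cs j) = lincomb J (N k) (\<lambda>p. cs i p - cs j p)"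
            by (simp add: lincomb_def algebra_simps sum_subtractf)
          then have "(1 - \<eta>) * (a k * absv (lincomb J (N k) (cs i) - lincomb J (N k) (cs j))) \<le> (1 - \<eta>) * fmax n (\<lambda>k. a k * absv (lincomb J (N k) (\<lambda>p. cs i p - cs j p)))"
            using fmax_ge[OF k, of "\<lambda>k. a k * absv (lincomb J (N k) (\<lambda>p. cs i p - cs j p))"] eta by (intro mult_left_mono) auto
          also have "\<dots> \<le> q0 (\<lambda>p. cs i p - cs j p)" using N(2) by simp
          also have "\<dots> \<le> max (q (u (cs i))) (q (u (cs j)))" unfolding diff_u[symmetric] by (rule q_diff)
          also have "\<dots> < (1 - \<eta>) * a k * \<epsilon>"
            using less_le_trans[OF cs[rule_format, of i] inv[OF ij(1)]] less_le_trans[OF cs[rule_format, of j] inv[OF ij(2)]] j0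
            by (simp only: max_less_iff_conj less_trans)
          finally have "((1 - \<eta>) * a k) * absv (lincomb J (N k) (cs i) - lincomb J (N k) (cs j)) < ((1 - \<eta>) * a k) * \<epsilon>"
            by (simp add: mult.assoc)
          then show ?thesis using ak eta by (subst (asm) mult_less_cancel_left_pos) auto
        qed
        then show "\<exists>N'. \<forall>m\<ge>N'. \<forall>j\<ge>N'. absv (lincomb J (N k) (cs m) - lincomb J (N k) (cs j)) < \<epsilon>" by blast
      qed
      then have "\<forall>k\<in>{..<n}. \<exists>l. (\<lambda>j. absv (lincomb J (N k) (cs j) - l)) \<longlonglongrightarrow> 0" by auto
      then obtain l where l: "\<forall>k\<in>{..<n}. (\<lambda>j. absv (lincomb J (N k) (cs j) - l k)) \<longlonglongrightarrow> 0" by (rule bchoice[THEN exE])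
      obtain c0 where c0: "\<forall>k<n. lincomb J (N k) c0 = l k" using N(3) by blast
      have le: "q (u c0) \<le> inverse (real (Suc j)) + fmax n (\<lambda>k. a k * absv (lincomb J (N k) (cs j) - l k))" for j
      proof -
        have "q (u c0) = q (\<lambda>i. u (cs j) i - (u (cs j) i - u c0 i))" by (intro q_cong) simp
        also have "\<dots> \<le> max (q (u (cs j))) (q (\<lambda>i. u (cs j) i - u c0 i))" by (rule q_diff)
        finally have "q (u c0) \<le> max (q (u (cs j))) (q (\<lambda>i. u (cs j) i - u c0 i))" .
        moreover have "q (\<lambda>i. u (cs j) i - u c0 i) \<le> fmax n (\<lambda>k. a k * absv (lincomb J (N k) (\<lambda>p. cs j p - c0 p)))"
          unfolding diff_u using N(2) by simp
        moreover have "fmax n (\<lambda>k. a k * absv (lincomb J (N k) (\<lambda>p. cs j p - c0 p))) = fmax n (\<lambda>k. a k * absv (lincomb J (N k) (cs j) - l k))"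
        proof (rule fmax_cong)
          fix k assume "k < n"
          then have "l k = lincomb J (N k) c0" using c0 by simp
          then show "a k * absv (lincomb J (N k) (\<lambda>p. cs j p - c0 p)) = a k * absv (lincomb J (N k) (cs j) - l k)"
            by (simp add: lincomb_def algebra_simps sum_subtractf)
        qed
        ultimately show ?thesis
          using cs[rule_format, of j] fmax_nonneg[of n "\<lambda>k. a k * absv (lincomb J (N k) (cs j) - l k)"]
            q_nonneg[of "u (cs j)"]
          by linarith
      qed
      have "(\<lambda>j. fmax n (\<lambda>k. a k * absv (lincomb J (N k) (cs j) - l k))) \<longlonglongrightarrow> fmax n (\<lambda>k. a k * 0)"
        using l by (intro tendsto_fmax tendsto_mult tendsto_const) auto
      moreover have "fmax n (\<lambda>k. a k * 0) = 0" using fmax_cmult[of 0 n "\<lambda>k. 0"] by simp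
      ultimately have "(\<lambda>j. inverse (real (Suc j)) + fmax n (\<lambda>k. a k * absv (lincomb J (N k) (cs j) - l k))) \<longlonglongrightarrow> 0 + 0"
        by (intro tendsto_add LIMSEQ_inverse_real_of_nat) simp
      then have "q (u c0) \<le> 0 + 0" using le by (intro LIMSEQ_le_const) auto
      then show ?thesis using q_nonneg[of "u c0"] by (intro exI[of _ c0]) simp
    qed
    then obtain c0 where c0: "q (u c0) = 0" by blast
    have "(1 - \<delta>) * m c0 c \<le> q c" for c
    proof -
      have "0 \<le> m c0 c" unfolding m_def by (rule fmax_nonneg)
      then have "(1 - \<delta>) * m c0 c \<le> (1 - \<eta>) * m c0 c" by (rule mult_right_mono[OF eta(4)])
      also have "\<dots> \<le> q c" using m(1)[of c0 c] split'[of c c0] q_nonneg[of c] c0 by simp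
      finally show ?thesis .
    qed
    moreover have "q c \<le> m c0 c" for c
    proof -
      have "0 \<le> m c0 c" unfolding m_def by (rule fmax_nonneg)
      then show ?thesis using split[of c c0] m(2)[of c c0] c0 by simp
    qed
    moreover have "\<exists>c. \<forall>k<n. lincomb (insert i0 J) (N' c0 k) c = l k" for l
    proof -
      obtain c' where c': "\<forall>k<n. lincomb J (N k) c' = l k" using N(3) by blast
      define c where "c i = (if i = i0 then 0 else c' i)" for i
      have "lincomb J (N k) (\<lambda>i. c i - c i0 * c0 i) = lincomb J (N k) c'" for k
        unfolding lincomb_def using insert.hyps by (intro sum.cong) (auto simp: c_def)
      then show ?thesis using c' by (intro exI[of _ c]) (simp add: N')
    qed
    ultimately show ?thesis using N(1)
      by (intro exI[of _ n] exI[of _ "N' c0"] exI[of _ a]) (simp add: m_def)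
  qed
qed

section \<open>The universal substitution\<close>

text \<open>\<open>vsub\<close> is the formal substitution of \<open>\<Sum>\<^sub>i a\<^sub>l\<^sub>,\<^sub>i\<close> for the variable \<open>S\<^sub>l\<close>.  It makes sense on all power series
  because the coefficient of a monomial \<open>M\<close> in the \<open>a\<^sub>l\<^sub>,\<^sub>i\<close> only involves the monomial \<open>lproj M\<close> in the \<open>S\<^sub>l\<close>.
  The substitution \<open>S\<^sub>l \<mapsto> \<Sum>\<^sub>I a\<^sub>l\<^sub>,\<^sub>I T\<^sup>I\<close> and its values at \<open>T = w\<close> are the graded versions \<open>usub\<close> and \<open>usub_at\<close> of it.\<close>

definition lproj :: "('s \<times> 'i \<Rightarrow>\<^sub>0 nat) \<Rightarrow> ('s \<Rightarrow>\<^sub>0 nat)" where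
  "lproj M = wsum (\<lambda>p. Poly_Mapping.single (fst p) (Suc 0)) M"

text \<open>The exponent of T that a monomial brings along when each variable \<open>a_(l,I)\<close>
  is accompanied by \<open>T^I\<close>.\<close>

definition wt :: "('s \<times> ('r \<Rightarrow>\<^sub>0 nat) \<Rightarrow>\<^sub>0 nat) \<Rightarrow> ('r \<Rightarrow>\<^sub>0 nat)" where
  "wt M = wsum snd M"

lemma lproj_add: "lproj (A + B) = lproj A + lproj B" and wt_add: "wt (C + E) = wt C + wt E"
  by (simp_all add: lproj_def wt_def wsum_add)

lemma lproj_simps [simp]: "lproj 0 = 0" "lproj (Poly_Mapping.single p (Suc 0)) = Poly_Mapping.single (fst p) (Suc 0)"
  by (simp_all add: lproj_def)

lemma wt_simps [simp]: "wt 0 = 0" "wt (Poly_Mapping.single p (Suc 0)) = snd p"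
  by (simp_all add: wt_def)

lemma mdeg_lproj: "mdeg (lproj M) = mdeg M"
  by (induction M rule: exponent_induct) (simp_all add: lproj_add)

lemma mdeg_wt_ge: "p \<in> Poly_Mapping.keys M \<Longrightarrow> mdeg (snd p) \<le> mdeg (wt M)"
proof (induction M rule: exponent_induct)
  case (add M q)
  then show ?case by (auto simp: wt_add keys_add_nat)
qed simp

text \<open>Infinitely many monomials lie over B, as the index I is unbounded. A bound on the weight
  bounds every I that occurs, and B bounds the number of factors.\<close>

lemma finite_lproj_wt:
  "finite {M :: 's \<times> ('r::finite \<Rightarrow>\<^sub>0 nat) \<Rightarrow>\<^sub>0 nat. lproj M = B \<and> mdeg (wt M) \<le> N}"
proof (rule finite_subset)
  let ?K = "Poly_Mapping.keys B \<times> {I :: 'r \<Rightarrow>\<^sub>0 nat. mdeg I \<le> N}"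
  show "finite {M :: 's \<times> ('r \<Rightarrow>\<^sub>0 nat) \<Rightarrow>\<^sub>0 nat. Poly_Mapping.keys M \<subseteq> ?K \<and> (\<forall>p. Poly_Mapping.lookup M p \<le> mdeg B)}"
    by (intro finite_bounded_exponents finite_cartesian_product finite_keys finite_mdeg_le)
  show "{M. lproj M = B \<and> mdeg (wt M) \<le> N} \<subseteq> {M. Poly_Mapping.keys M \<subseteq> ?K \<and> (\<forall>p. Poly_Mapping.lookup M p \<le> mdeg B)}"
  proof
    fix M :: "'s \<times> ('r \<Rightarrow>\<^sub>0 nat) \<Rightarrow>\<^sub>0 nat" assume "M \<in> {M. lproj M = B \<and> mdeg (wt M) \<le> N}"
    then have M: "lproj M = B" "mdeg (wt M) \<le> N" by auto
    have "fst p \<in> Poly_Mapping.keys (lproj M)" if "p \<in> Poly_Mapping.keys M" for p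
      using that by (induction M rule: exponent_induct) (auto simp: lproj_add keys_add_nat)
    then have "Poly_Mapping.keys M \<subseteq> ?K"
      using M(1) order_trans[OF mdeg_wt_ge M(2)] by (intro subsetI) (simp add: mem_Times_iff)
    moreover have "Poly_Mapping.lookup M p \<le> mdeg B" for p
      using lookup_le_mdeg[of M p] mdeg_lproj[of M] M by simp
    ultimately show "M \<in> {M. Poly_Mapping.keys M \<subseteq> ?K \<and> (\<forall>p. Poly_Mapping.lookup M p \<le> mdeg B)}" by simp
  qed
qed

text \<open>The formal sum of the variables \<open>a_(l,i)\<close> over all i. With infinitely many
  i it is no element of the Banach algebra; only its pieces of fixed weight, or the sum damped by
  powers of w, belong to it.\<close>

definition usum :: "'s \<Rightarrow> ('s \<times> 'i, 'a::comm_ring_1) mfps" where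
  "usum l = Abs_mfps (\<lambda>M. if \<exists>i. M = Poly_Mapping.single (l, i) (Suc 0) then 1 else 0)"

definition graded :: "('s \<Rightarrow>\<^sub>0 nat) \<Rightarrow> ('s \<times> 'i, 'a::comm_ring_1) mfps \<Rightarrow> bool" where
  "graded B g \<longleftrightarrow> (\<forall>M. mcoeff g M \<noteq> 0 \<longrightarrow> lproj M = B)"

lemma graded_mult: "graded B g \<Longrightarrow> graded C h \<Longrightarrow> graded (B + C) (g * h)"
  unfolding graded_def
proof (intro allI impI)
  fix M assume g: "\<forall>M. mcoeff g M \<noteq> 0 \<longrightarrow> lproj M = B" and h: "\<forall>M. mcoeff h M \<noteq> 0 \<longrightarrow> lproj M = C"
    and "mcoeff (g * h) M \<noteq> 0"
  then have "(\<Sum>p\<in>splits M. mcoeff g (fst p) * mcoeff h (snd p)) \<noteq> 0" by (simp add: mcoeff_times)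
  then obtain p where p: "p \<in> splits M" "mcoeff g (fst p) * mcoeff h (snd p) \<noteq> 0" by (rule sum.not_neutral_contains_not_neutral)
  then have "mcoeff g (fst p) \<noteq> 0" "mcoeff h (snd p) \<noteq> 0" by auto
  then have "lproj (fst p) = B" "lproj (snd p) = C" using g h by simp_all
  moreover have "M = fst p + snd p" using p(1) by (auto simp: splits_def)
  ultimately show "lproj M = B + C" by (simp add: lproj_add)
qed

lemma graded_wprod: "graded B (wprod usum B)"
proof (induction B rule: exponent_induct)
  case zero
  show ?case by (simp add: graded_def)
next
  case (add B v)
  have "graded (Poly_Mapping.single v (Suc 0)) (usum v)" by (auto simp: graded_def usum_def)
  from graded_mult[OF add this] show ?case by (simp add: wprod_add)
qed

definition vsub :: "('s, 'a::comm_ring_1) mfps \<Rightarrow> ('s \<times> 'i, 'a) mfps" where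
  "vsub f = Abs_mfps (\<lambda>M. mcoeff f (lproj M) * mcoeff (wprod usum (lproj M)) M)"

lemma mcoeff_vsub: "mcoeff (vsub f) M = mcoeff f (lproj M) * mcoeff (wprod usum (lproj M)) M"
  by (simp add: vsub_def)

lemma vsub_add: "vsub (f + g) = vsub f + vsub g"
  by (rule mfps_eqI) (simp add: mcoeff_vsub distrib_right)

text \<open>The splittings of M are grouped by the splitting of \<open>lproj M\<close> that they
  induce. Within a group the coefficients of f and g are constant, and the rest is the
  multiplicativity of \<open>wprod usum\<close>, as this series is supported over a single
  multidegree.\<close>

lemma vsub_mult: "vsub (f * g) = vsub f * (vsub g :: ('s \<times> 'i, 'a::comm_ring_1) mfps)"
proof (rule mfps_eqI)
  fix M :: "'s \<times> 'i \<Rightarrow>\<^sub>0 nat"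
  let ?u = "\<lambda>B. wprod usum B :: ('s \<times> 'i, 'a) mfps"
  let ?L = "\<lambda>q. (lproj (fst q), lproj (snd q))"
  have "mcoeff (vsub f * vsub g) M = (\<Sum>q\<in>splits M. mcoeff f (lproj (fst q)) * mcoeff g (lproj (snd q)) *
      (mcoeff (?u (lproj (fst q))) (fst q) * mcoeff (?u (lproj (snd q))) (snd q)))"
    unfolding mcoeff_times by (intro sum.cong refl) (simp add: mcoeff_vsub mult_ac)
  also have "\<dots> = (\<Sum>p\<in>splits (lproj M). \<Sum>q\<in>{q \<in> splits M. ?L q = p}. mcoeff f (lproj (fst q)) * mcoeff g (lproj (snd q)) *
      (mcoeff (?u (lproj (fst q))) (fst q) * mcoeff (?u (lproj (snd q))) (snd q)))"
  proof (rule sum.group[symmetric])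
    show "?L ` splits M \<subseteq> splits (lproj M)" by (auto simp: splits_def lproj_add)
  qed (rule finite_splits)+
  also have "\<dots> = (\<Sum>p\<in>splits (lproj M). mcoeff f (fst p) * mcoeff g (snd p) * mcoeff (?u (lproj M)) M)"
  proof (intro sum.cong refl)
    fix p assume p: "p \<in> splits (lproj M)"
    have "(\<Sum>q\<in>{q \<in> splits M. ?L q = p}. mcoeff f (lproj (fst q)) * mcoeff g (lproj (snd q)) *
        (mcoeff (?u (lproj (fst q))) (fst q) * mcoeff (?u (lproj (snd q))) (snd q)))
      = mcoeff f (fst p) * mcoeff g (snd p) * (\<Sum>q\<in>{q \<in> splits M. ?L q = p}. mcoeff (?u (fst p)) (fst q) * mcoeff (?u (snd p)) (snd q))"
      unfolding sum_distrib_left by (intro sum.cong refl) auto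
    also have "(\<Sum>q\<in>{q \<in> splits M. ?L q = p}. mcoeff (?u (fst p)) (fst q) * mcoeff (?u (snd p)) (snd q))
      = (\<Sum>q\<in>splits M. mcoeff (?u (fst p)) (fst q) * mcoeff (?u (snd p)) (snd q))"
    proof (rule sum.mono_neutral_left[OF finite_splits])
      show "{q \<in> splits M. ?L q = p} \<subseteq> splits M" by simp
      show "\<forall>q\<in>splits M - {q \<in> splits M. ?L q = p}. mcoeff (?u (fst p)) (fst q) * mcoeff (?u (snd p)) (snd q) = 0"
      proof
        fix q assume q: "q \<in> splits M - {q \<in> splits M. ?L q = p}"
        show "mcoeff (?u (fst p)) (fst q) * mcoeff (?u (snd p)) (snd q) = 0"
        proof (rule ccontr)
          assume "mcoeff (?u (fst p)) (fst q) * mcoeff (?u (snd p)) (snd q) \<noteq> 0"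
          then have "mcoeff (?u (fst p)) (fst q) \<noteq> 0" "mcoeff (?u (snd p)) (snd q) \<noteq> 0" by auto
          then have "lproj (fst q) = fst p" "lproj (snd q) = snd p" using graded_wprod unfolding graded_def by metis+
          then show False using q by simp
        qed
      qed
    qed
    also have "\<dots> = mcoeff (?u (fst p + snd p)) M" by (simp add: wprod_add mcoeff_times)
    also have "fst p + snd p = lproj M" using p by (auto simp: splits_def)
    finally show "(\<Sum>q\<in>{q \<in> splits M. ?L q = p}. mcoeff f (lproj (fst q)) * mcoeff g (lproj (snd q)) *
        (mcoeff (?u (lproj (fst q))) (fst q) * mcoeff (?u (lproj (snd q))) (snd q)))
      = mcoeff f (fst p) * mcoeff g (snd p) * mcoeff (?u (lproj M)) M" .
  qed
  also have "\<dots> = mcoeff (vsub (f * g)) M" by (simp add: mcoeff_vsub mcoeff_times sum_distrib_right)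
  finally show "mcoeff (vsub (f * g)) M = mcoeff (vsub f * vsub g) M" ..
qed

lemma vsub_mconst: "vsub (mconst c) = mconst c"
proof (rule mfps_eqI)
  fix M
  have "lproj M = 0 \<longleftrightarrow> M = 0" using mdeg_lproj[of M] mdeg_eq_0[of M] by auto
  then show "mcoeff (vsub (mconst c)) M = mcoeff (mconst c) M"
    by (simp add: mcoeff_vsub mcoeff_mconst)
qed

lemma vsub_mvar: "vsub (mvar l) = usum l"
proof (rule mfps_eqI)
  fix M
  have 0: "mcoeff (usum l) M = 0" if "lproj M \<noteq> Poly_Mapping.single l (Suc 0)"
    using graded_wprod[of "Poly_Mapping.single l (Suc 0)"] that by (auto simp: graded_def)
  show "mcoeff (vsub (mvar l)) M = mcoeff (usum l) M"
    by (cases "lproj M = Poly_Mapping.single l (Suc 0)") (simp_all add: mcoeff_vsub mcoeff_mvar 0)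
qed

section \<open>The substitution graded by powers of T, and its specialisation at T = w\<close>

definition usub :: "('s, 'a::comm_ring_1) mfps \<Rightarrow> ('r, ('s \<times> ('r \<Rightarrow>\<^sub>0 nat), 'a) mfps) mfps" where
  "usub f = Abs_mfps (\<lambda>I. Abs_mfps (\<lambda>M. if wt M = I then mcoeff (vsub f) M else 0))"

definition usub_at :: "('r \<Rightarrow> 'a) \<Rightarrow> ('s, 'a::comm_ring_1) mfps \<Rightarrow> ('s \<times> ('r \<Rightarrow>\<^sub>0 nat), 'a) mfps" where
  "usub_at w f = Abs_mfps (\<lambda>M. mcoeff (vsub f) M * wprod w (wt M))"

lemma mcoeff_usub: "mcoeff (mcoeff (usub f) I) M = (if wt M = I then mcoeff (vsub f) M else 0)"
  by (simp add: usub_def)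

lemma mcoeff_usub_at: "mcoeff (usub_at w f) M = mcoeff (vsub f) M * wprod w (wt M)"
  by (simp add: usub_at_def)

lemma usub_add: "usub (f + g) = usub f + usub g"
  by (intro mfps_eqI) (simp add: mcoeff_usub vsub_add)

lemma usub_mult: "usub (f * g) = usub f * usub g"
proof (intro mfps_eqI)
  fix I M
  let ?h = "\<lambda>q. mcoeff (vsub f) (fst q) * mcoeff (vsub g) (snd q)"
  have "mcoeff (mcoeff (usub f * usub g) I) M = (\<Sum>p\<in>splits I. \<Sum>q\<in>splits M.
      (if wt (fst q) = fst p then mcoeff (vsub f) (fst q) else 0) * (if wt (snd q) = snd p then mcoeff (vsub g) (snd q) else 0))"
    by (simp add: mcoeff_times mcoeff_sum mcoeff_usub)
  also have "\<dots> = (\<Sum>q\<in>splits M. \<Sum>p\<in>splits I. if p = (wt (fst q), wt (snd q)) then ?h q else 0)"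
    by (subst sum.swap) (intro sum.cong refl, auto simp: prod_eq_iff)
  also have "\<dots> = (\<Sum>q\<in>splits M. if wt M = I then ?h q else 0)"
  proof (intro sum.cong refl)
    fix q assume "q \<in> splits M"
    then have "wt M = wt (fst q) + wt (snd q)" by (auto simp: splits_def wt_add)
    then have "(wt (fst q), wt (snd q)) \<in> splits I \<longleftrightarrow> wt M = I" by (simp add: splits_def)
    then show "(\<Sum>p\<in>splits I. if p = (wt (fst q), wt (snd q)) then ?h q else 0) = (if wt M = I then ?h q else 0)"
      using finite_splits[of I] by (subst sum.delta) auto
  qed
  also have "\<dots> = mcoeff (mcoeff (usub (f * g)) I) M"
    by (simp add: mcoeff_usub vsub_mult mcoeff_times)
  finally show "mcoeff (mcoeff (usub (f * g)) I) M = mcoeff (mcoeff (usub f * usub g) I) M" ..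
qed

lemma usub_mconst: "usub (mconst c) = mconst (mconst c)"
  by (intro mfps_eqI) (auto simp: mcoeff_usub vsub_mconst mcoeff_mconst)

lemma usub_mvar: "usub (mvar l) = universal_series l"
proof (intro mfps_eqI)
  fix I M
  show "mcoeff (mcoeff (usub (mvar l)) I) M = mcoeff (mcoeff (universal_series l) I) M"
    by (auto simp: mcoeff_usub vsub_mvar usum_def universal_series_def mcoeff_mvar)
qed

lemma usub_at_add: "usub_at w (f + g) = usub_at w f + usub_at w g"
  by (intro mfps_eqI) (simp add: mcoeff_usub_at vsub_add distrib_right)

lemma usub_at_mult: "usub_at w (f * g) = usub_at w f * usub_at w g"
proof (intro mfps_eqI)
  fix M
  have "mcoeff (usub_at w f * usub_at w g) M =
    (\<Sum>q\<in>splits M. mcoeff (vsub f) (fst q) * mcoeff (vsub g) (snd q) * wprod w (wt M))"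
    unfolding mcoeff_times by (intro sum.cong refl) (auto simp: mcoeff_usub_at splits_def wt_add wprod_add)
  then show "mcoeff (usub_at w (f * g)) M = mcoeff (usub_at w f * usub_at w g) M"
    by (simp add: mcoeff_usub_at vsub_mult mcoeff_times sum_distrib_right)
qed

lemma usub_at_mconst: "usub_at w (mconst c) = mconst c"
  by (intro mfps_eqI) (auto simp: mcoeff_usub_at vsub_mconst mcoeff_mconst)

context complete_nonarch_field
begin

text \<open>These coefficients are integers, namely products of multinomial coefficients or 0; the
  bound follows directly from the ultrametric inequality.\<close>

lemma absv_mcoeff_wprod_usum:
  fixes M :: "'s \<times> 'i \<Rightarrow>\<^sub>0 nat"
  shows "absv (mcoeff (wprod usum B) M) \<le> 1"
proof (induction B arbitrary: M rule: exponent_induct)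
  case zero
  show ?case by simp
next
  case (add B v)
  have "absv (mcoeff (usum v) N) \<le> 1" for N :: "'s \<times> 'i \<Rightarrow>\<^sub>0 nat" by (simp add: usum_def)
  then have "absv (mcoeff (wprod usum B) K * mcoeff (usum v) N) \<le> 1 * 1" for K N :: "'s \<times> 'i \<Rightarrow>\<^sub>0 nat"
    by (intro absv_mult_le add)
  then show ?case unfolding wprod_add wprod_single mcoeff_times by (intro absv_sum_le) simp_all
qed

lemma absv_vsub_le: "absv (mcoeff (vsub f) M) \<le> absv (mcoeff f (lproj M))"
  using absv_mult_le[OF order_refl absv_mcoeff_wprod_usum] by (simp add: mcoeff_vsub)

lemma absv_wprod_le:
  assumes w: "\<And>v. absv (w v) \<le> a"
  shows "absv (wprod w I) \<le> a ^ mdeg I"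
proof (induction I rule: exponent_induct)
  case zero
  show ?case by simp
next
  case (add I v)
  have "absv (wprod w I * w v) \<le> a ^ mdeg I * a" by (rule absv_mult_le[OF add w])
  then show ?case by (simp add: wprod_add mult.commute)
qed

end

section \<open>Evaluation of the universal substitution\<close>

context complete_nonarch_field
begin

text \<open>With variables \<open>S_l\<close> this is \<open>closed_disk_alg\<close>, with variables
  \<open>a_(l,I)\<close> it is \<open>mor_alg\<close>. Both algebras share their lemmas through
  polymorphism in the type of variables.\<close>

abbreviation K1 :: "('k, ('v, 'k) mfps) normed_alg" where "K1 \<equiv> tate (ground absv) 1"

lemma K1_carrier_iff: "f \<in> alg_carrier K1 \<longleftrightarrow> (\<forall>\<epsilon>>0. finite {M. absv (mcoeff f M) > \<epsilon>})"
  by (simp add: tate_def)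

lemma nonarch_algebra_K1: "nonarch_algebra absv K1"
  by (rule tate_algebra.nonarch_algebra_tate[OF tate_ground]) simp

lemma tate_algebra_K1: "0 < \<rho> \<Longrightarrow> tate_algebra absv K1 \<rho>"
  by (intro tate_algebra.intro nonarch_algebra_K1) (simp add: tate_algebra_axioms_def)

lemma K1_norm_leI: "(\<And>M. absv (mcoeff f M) \<le> C) \<Longrightarrow> alg_norm K1 f \<le> C"
  using tate_algebra.norm_leI[OF tate_ground, of 1 f C] tate_algebra.tnorm_def[OF tate_ground, of 1 f] by simp

lemma K1_coeff_le: "f \<in> alg_carrier K1 \<Longrightarrow> absv (mcoeff f M) \<le> alg_norm K1 f"
  using tate_algebra.tnorm_le[OF tate_ground, of 1 f M] tate_algebra.tnorm_def[OF tate_ground, of 1 f M] by simp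

lemma K1_norm_nonneg: "f \<in> alg_carrier K1 \<Longrightarrow> 0 \<le> alg_norm K1 f"
  by (rule nonarch_algebra.norm_nonneg[OF nonarch_algebra_K1])

lemma K1_mconst: "mconst c \<in> alg_carrier K1"
  using tate_algebra.carrier_const[OF tate_ground, of 1 c] by simp

lemma K1_mvar: "mvar v \<in> alg_carrier K1"
  by (rule tate_algebra.mvar_carrier[OF tate_ground]) simp

lemma spec_mconst: "\<alpha> \<in> spectrum K1 \<Longrightarrow> \<alpha> (mconst c) = absv c"
  using nonarch_algebra.spec_const[OF nonarch_algebra_K1, of \<alpha> c] by simp

text \<open>Two sources of finiteness combine: large coefficients of g lie over the finitely many
  large coefficients of f, and within a fibre of \<open>lproj\<close> their weight is
  bounded.\<close>

lemma K1_carrierI: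
  fixes g :: "('s \<times> ('r::finite \<Rightarrow>\<^sub>0 nat), 'k) mfps"
  assumes f: "f \<in> alg_carrier K1" and g: "\<And>M. absv (mcoeff g M) \<le> absv (mcoeff f (lproj M))"
    and N: "\<And>\<epsilon>. 0 < \<epsilon> \<Longrightarrow> \<exists>N. \<forall>M. \<epsilon> < absv (mcoeff g M) \<longrightarrow> mdeg (wt M) \<le> N"
  shows "g \<in> alg_carrier K1"
  unfolding K1_carrier_iff
proof (intro allI impI)
  fix \<epsilon> :: real assume e: "0 < \<epsilon>"
  obtain N where N': "\<forall>M. \<epsilon> < absv (mcoeff g M) \<longrightarrow> mdeg (wt M) \<le> N" using N[OF e] by (rule exE)
  have "{M. absv (mcoeff g M) > \<epsilon>} \<subseteq> (\<Union>B\<in>{B. absv (mcoeff f B) > \<epsilon>}. {M. lproj M = B \<and> mdeg (wt M) \<le> N})"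
  proof
    fix M assume "M \<in> {M. absv (mcoeff g M) > \<epsilon>}"
    then have M: "\<epsilon> < absv (mcoeff g M)" by simp
    then have "\<epsilon> < absv (mcoeff f (lproj M))" using g[of M] by linarith
    then show "M \<in> (\<Union>B\<in>{B. absv (mcoeff f B) > \<epsilon>}. {M. lproj M = B \<and> mdeg (wt M) \<le> N})" using N' M by simp
  qed
  moreover have "finite {B. absv (mcoeff f B) > \<epsilon>}" using f e by (simp add: K1_carrier_iff)
  ultimately show "finite {M. absv (mcoeff g M) > \<epsilon>}" by (rule finite_subset[OF _ finite_UN_I]) (rule finite_lproj_wt)
qed

lemma usub_coeff:
  fixes f :: "('s, 'k) mfps" and I :: "'r::finite \<Rightarrow>\<^sub>0 nat"
  assumes f: "f \<in> alg_carrier K1"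
  shows "mcoeff (usub f) I \<in> alg_carrier K1" "alg_norm K1 (mcoeff (usub f) I) \<le> alg_norm K1 f"
proof -
  have le: "absv (mcoeff (mcoeff (usub f) I) M) \<le> absv (mcoeff f (lproj M))" for M
    using absv_vsub_le[of f M] by (simp add: mcoeff_usub absv_nonneg)
  show "mcoeff (usub f) I \<in> alg_carrier K1"
  proof (rule K1_carrierI[OF f le])
    fix \<epsilon> :: real assume "0 < \<epsilon>"
    then show "\<exists>N. \<forall>M. \<epsilon> < absv (mcoeff (mcoeff (usub f) I) M) \<longrightarrow> mdeg (wt M) \<le> N"
      by (intro exI[of _ "mdeg I"]) (simp add: mcoeff_usub)
  qed
  show "alg_norm K1 (mcoeff (usub f) I) \<le> alg_norm K1 f"
    by (rule K1_norm_leI) (rule order_trans[OF le K1_coeff_le[OF f]])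
qed

lemma power_decay:
  fixes \<rho> :: real assumes "0 < \<rho>" "\<rho> < 1" "0 < \<epsilon>"
  shows "\<exists>N. \<forall>n\<ge>N. C * \<rho> ^ n < \<epsilon>"
proof -
  have "(\<lambda>n. C * \<rho> ^ n) \<longlonglongrightarrow> C * 0" using assms by (intro tendsto_mult tendsto_const LIMSEQ_power_zero) simp
  from order_tendstoD(2)[OF this, of \<epsilon>] have "\<forall>\<^sub>F n in sequentially. C * \<rho> ^ n < \<epsilon>" using assms by simp
  then show ?thesis by (simp add: eventually_sequentially)
qed

text \<open>The coefficients of \<open>usub f\<close> are in general only bounded; the decay comes
  from the factors \<open>\<rho> ^ mdeg I\<close> with \<rho> below 1.\<close>

lemma usub_carrier:
  fixes f :: "('s, 'k) mfps"
  assumes f: "f \<in> alg_carrier K1" and r: "0 < \<rho>" "\<rho> < 1"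
  shows "(usub f :: ('r::finite, _) mfps) \<in> alg_carrier (tate K1 \<rho>)"
    "alg_norm (tate K1 \<rho>) (usub f :: ('r, _) mfps) \<le> alg_norm K1 f"
proof -
  interpret tate_algebra absv "K1 :: ('k, ('r, 's, 'k) coeff_series) normed_alg" \<rho> by (rule tate_algebra_K1[OF r(1)])
  have le: "tnorm (usub f) I \<le> alg_norm K1 f * \<rho> ^ mdeg I" for I :: "'r \<Rightarrow>\<^sub>0 nat"
    unfolding tnorm_def using r by (intro mult_right_mono usub_coeff f) simp
  have "finite {I :: 'r \<Rightarrow>\<^sub>0 nat. \<epsilon> < tnorm (usub f) I}" if e: "0 < \<epsilon>" for \<epsilon>
  proof -
    obtain N where N: "\<forall>n\<ge>N. alg_norm K1 f * \<rho> ^ n < \<epsilon>" using power_decay[OF r e] by (rule exE)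
    have "{I :: 'r \<Rightarrow>\<^sub>0 nat. \<epsilon> < tnorm (usub f) I} \<subseteq> {I. mdeg I \<le> N}"
    proof
      fix I :: "'r \<Rightarrow>\<^sub>0 nat" assume "I \<in> {I. \<epsilon> < tnorm (usub f) I}"
      then have "\<not> N \<le> mdeg I" using le[of I] N[rule_format, of "mdeg I"] by auto
      then show "I \<in> {I. mdeg I \<le> N}" by simp
    qed
    then show ?thesis by (rule finite_subset) (rule finite_mdeg_le)
  qed
  then show "(usub f :: ('r, _) mfps) \<in> alg_carrier (tate K1 \<rho>)" by (simp add: carrier_iff usub_coeff f)
  show "alg_norm (tate K1 \<rho>) (usub f :: ('r, _) mfps) \<le> alg_norm K1 f"
  proof (rule norm_leI)
    fix I :: "'r \<Rightarrow>\<^sub>0 nat"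
    have "alg_norm K1 f * \<rho> ^ mdeg I \<le> alg_norm K1 f * 1"
      using r by (intro mult_left_mono power_le_one K1_norm_nonneg f) auto
    then show "tnorm (usub f) I \<le> alg_norm K1 f" using le[of I] by simp
  qed
qed

text \<open>The part of \<open>usub f\<close> of degree at most N in T, with free scalars
  \<open>c I\<close> in place of \<open>T^I\<close>. It is linear in c, so \<alpha> becomes a
  seminorm on a finite-dimensional space, and a point w enters only through the vector
  \<open>wprod w\<close>.\<close>

definition ucomb :: "('s, 'k) mfps \<Rightarrow> nat \<Rightarrow> (('r::finite \<Rightarrow>\<^sub>0 nat) \<Rightarrow> 'k) \<Rightarrow> ('r, 's, 'k) coeff_series" where
  "ucomb f N c = (\<Sum>I\<in>{I. mdeg I \<le> N}. mconst (c I) * mcoeff (usub f) I)"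

lemma mcoeff_ucomb: "mcoeff (ucomb f N c) M = (if mdeg (wt M) \<le> N then c (wt M) * mcoeff (vsub f) M else 0)"
proof -
  have "mcoeff (ucomb f N c) M = (\<Sum>I\<in>{I. mdeg I \<le> N}. if wt M = I then c I * mcoeff (vsub f) M else 0)"
    unfolding ucomb_def mcoeff_sum by (intro sum.cong refl) (simp add: mcoeff_usub)
  then show ?thesis by (simp add: finite_mdeg_le)
qed

lemma ucomb_carrier: "f \<in> alg_carrier K1 \<Longrightarrow> ucomb f N c \<in> alg_carrier K1"
  unfolding ucomb_def
  by (intro nonarch_algebra.carrier_sum[OF nonarch_algebra_K1] nonarch_algebra.carrier_mult[OF nonarch_algebra_K1] K1_mconst usub_coeff)

context
  fixes f :: "('s, 'k) mfps" and w :: "'r::finite \<Rightarrow> 'k" and \<rho> :: real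
  assumes f: "f \<in> alg_carrier K1" and r: "0 < \<rho>" "\<rho> < 1" and w: "\<And>v. absv (w v) \<le> \<rho>"
begin

lemma absv_usub_at:
  "absv (mcoeff (usub_at w f) M) \<le> absv (mcoeff f (lproj M)) * \<rho> ^ mdeg (wt M)"
  unfolding mcoeff_usub_at by (intro absv_mult_le absv_vsub_le absv_wprod_le w)

lemma absv_usub_at_le: "absv (mcoeff (usub_at w f) M) \<le> absv (mcoeff f (lproj M))"
proof -
  have "absv (mcoeff f (lproj M)) * \<rho> ^ mdeg (wt M) \<le> absv (mcoeff f (lproj M)) * 1"
    using r by (intro mult_left_mono power_le_one absv_nonneg) auto
  then show ?thesis using absv_usub_at[of M] by simp
qed

lemma absv_usub_at_deg: "absv (mcoeff (usub_at w f) M) \<le> alg_norm K1 f * \<rho> ^ mdeg (wt M)"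
  by (rule order_trans[OF absv_usub_at]) (use r in \<open>intro mult_right_mono K1_coeff_le f; simp\<close>)

lemma usub_at_carrier: "usub_at w f \<in> alg_carrier K1"
proof (rule K1_carrierI[OF f absv_usub_at_le])
  fix \<epsilon> :: real assume e: "0 < \<epsilon>"
  obtain N where N: "\<forall>n\<ge>N. alg_norm K1 f * \<rho> ^ n < \<epsilon>" using power_decay[OF r e] by (rule exE)
  show "\<exists>N. \<forall>M. \<epsilon> < absv (mcoeff (usub_at w f) M) \<longrightarrow> mdeg (wt M) \<le> N"
  proof (intro exI[of _ N] allI impI)
    fix M assume "\<epsilon> < absv (mcoeff (usub_at w f) M)"
    then have "\<not> N \<le> mdeg (wt M)" using absv_usub_at_deg[of M] N[rule_format, of "mdeg (wt M)"] by auto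
    then show "mdeg (wt M) \<le> N" by simp
  qed
qed

lemma norm_usub_at: "alg_norm K1 (usub_at w f) \<le> alg_norm K1 f"
  by (rule K1_norm_leI) (rule order_trans[OF absv_usub_at_le K1_coeff_le[OF f]])

text \<open>Every discarded monomial has weight of degree above N and hence carries more than N
  factors of size at most \<rho>.\<close>

lemma usub_at_approx: "alg_norm K1 (usub_at w f - ucomb f N (wprod w)) \<le> alg_norm K1 f * \<rho> ^ N"
proof (rule K1_norm_leI)
  fix M
  have nn: "0 \<le> alg_norm K1 f * \<rho> ^ N" using r K1_norm_nonneg[OF f] by simp
  show "absv (mcoeff (usub_at w f - ucomb f N (wprod w)) M) \<le> alg_norm K1 f * \<rho> ^ N"
  proof (cases "mdeg (wt M) \<le> N")
    case True
    then show ?thesis using nn by (simp add: mcoeff_ucomb mcoeff_usub_at mult.commute)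
  next
    case False
    have "\<rho> ^ mdeg (wt M) \<le> \<rho> ^ N" using False r by (intro power_decreasing) auto
    then have "alg_norm K1 f * \<rho> ^ mdeg (wt M) \<le> alg_norm K1 f * \<rho> ^ N"
      by (intro mult_left_mono K1_norm_nonneg f)
    then show ?thesis using False absv_usub_at_deg[of M] by (simp add: mcoeff_ucomb)
  qed
qed

lemma norm_ucomb_wprod: "alg_norm K1 (ucomb f N (wprod w)) \<le> alg_norm K1 f"
proof (rule K1_norm_leI)
  fix M
  have "absv (mcoeff (ucomb f N (wprod w)) M) \<le> absv (mcoeff (usub_at w f) M)"
    by (simp add: mcoeff_ucomb mcoeff_usub_at mult.commute absv_nonneg)
  then show "absv (mcoeff (ucomb f N (wprod w)) M) \<le> alg_norm K1 f"
    using absv_usub_at_le[of M] K1_coeff_le[OF f, of "lproj M"] by linarith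
qed

end

lemma (in nonarch_algebra) coord_seminorm_spec:
  fixes J :: "'i set"
  assumes x: "x \<in> spectrum A" and F: "\<And>i. i \<in> J \<Longrightarrow> F i \<in> alg_carrier A"
  shows "coord_seminorm absv J (\<lambda>c. x (\<Sum>i\<in>J. alg_const A (c i) * F i))"
proof unfold_locales
  fix c d :: "'i \<Rightarrow> 'k" and t
  have mem: "(\<Sum>i\<in>J. alg_const A (e i) * F i) \<in> alg_carrier A" for e
    by (intro carrier_sum carrier_mult const_carrier F)
  show "0 \<le> x (\<Sum>i\<in>J. alg_const A (c i) * F i)" by (rule spec_nonneg[OF x mem])
  have "(\<Sum>i\<in>J. alg_const A (c i + d i) * F i) = (\<Sum>i\<in>J. alg_const A (c i) * F i) + (\<Sum>i\<in>J. alg_const A (d i) * F i)"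
    by (simp add: const_add distrib_right sum.distrib)
  then show "x (\<Sum>i\<in>J. alg_const A (c i + d i) * F i) \<le> max (x (\<Sum>i\<in>J. alg_const A (c i) * F i)) (x (\<Sum>i\<in>J. alg_const A (d i) * F i))"
    using spec_add[OF x mem mem] by simp
  have "(\<Sum>i\<in>J. alg_const A (t * c i) * F i) = alg_const A t * (\<Sum>i\<in>J. alg_const A (c i) * F i)"
    by (simp add: const_mult sum_distrib_left mult.assoc)
  then show "x (\<Sum>i\<in>J. alg_const A (t * c i) * F i) = absv t * x (\<Sum>i\<in>J. alg_const A (c i) * F i)"
    by (simp add: spec_mult[OF x const_carrier mem] spec_const[OF x])
  show "x (\<Sum>i\<in>J. alg_const A (c i) * F i) = x (\<Sum>i\<in>J. alg_const A (d i) * F i)" if "\<And>i. i \<in> J \<Longrightarrow> c i = d i"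
    using that by simp
qed

definition functionals ::
    "'i set \<Rightarrow> (('i \<Rightarrow> 'k) \<Rightarrow> real) \<Rightarrow> real \<Rightarrow> nat \<Rightarrow> (nat \<Rightarrow> 'i \<Rightarrow> 'k) \<Rightarrow> (nat \<Rightarrow> real) \<Rightarrow> bool" where
  "functionals J q \<delta> n N a \<longleftrightarrow> (\<forall>k<n. 0 < a k) \<and>
     (\<forall>c. (1 - \<delta>) * fmax n (\<lambda>k. a k * absv (lincomb J (N k) c)) \<le> q c \<and>
       q c \<le> fmax n (\<lambda>k. a k * absv (lincomb J (N k) c)))"

lemma functionals_exist:
  assumes "finite J" "coord_seminorm absv J q" "0 < \<delta>" "\<delta> < 1"
  shows "\<exists>n N a. functionals J q \<delta> n N a"
proof -
  obtain n N a where "\<forall>k<n. (0::real) < a k"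
    "\<forall>c. (1 - \<delta>) * fmax n (\<lambda>k. a k * absv (lincomb J (N k) c)) \<le> q c
         \<and> q c \<le> fmax n (\<lambda>k. a k * absv (lincomb J (N k) c))"
    using seminorm_functionals[OF assms] by (elim exE conjE) (rule that)
  then show ?thesis unfolding functionals_def by (intro exI conjI)
qed

text \<open>A relative error becomes an absolute one once \<open>q c\<close> is bounded: for
  \<delta> at most 1/2 the maximum is at most twice \<open>q c\<close>.\<close>

lemma functionals_close:
  assumes "functionals J q \<delta> n N a" "0 < \<delta>" "\<delta> \<le> 1/2" "q c \<le> B"
  shows "\<bar>q c - fmax n (\<lambda>k. a k * absv (lincomb J (N k) c))\<bar> \<le> 2 * \<delta> * B"
proof -
  define F where "F = fmax n (\<lambda>k. a k * absv (lincomb J (N k) c))"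
  have F: "(1 - \<delta>) * F \<le> q c" "q c \<le> F" using assms(1) by (simp_all add: functionals_def F_def)
  have "0 \<le> F" by (simp add: F_def fmax_nonneg)
  then have "(1/2) * F \<le> (1 - \<delta>) * F" using assms by (intro mult_right_mono) auto
  then have "F \<le> 2 * B" using F assms by linarith
  then have "\<delta> * F \<le> \<delta> * (2 * B)" using assms by (intro mult_left_mono) auto
  then show ?thesis using F unfolding F_def[symmetric] by (simp add: algebra_simps abs_le_iff)
qed

lemma small_multiple:
  fixes B \<epsilon> :: real assumes "0 \<le> B" "0 < \<epsilon>" shows "2 * min (1/2) (\<epsilon> / (4 * (B + 1))) * B \<le> \<epsilon> / 2"
proof -
  have "min (1/2) (\<epsilon> / (4 * (B + 1))) * (2 * B) \<le> \<epsilon> / (4 * (B + 1)) * (2 * B)"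
    using assms by (intro mult_right_mono) auto
  also have "\<dots> \<le> \<epsilon> / (4 * (B + 1)) * (2 * (B + 1))" using assms by (intro mult_left_mono) auto
  also have "\<dots> = \<epsilon> / 2" using assms by (simp add: field_simps)
  finally show ?thesis by (simp add: mult_ac)
qed

text \<open>N controls the truncation and \<delta> the replacement of a seminorm by linear forms,
  each with half of \<epsilon>.\<close>

lemma approximation_parameters:
  assumes B: "0 \<le> B" and e: "0 < \<epsilon>" and r: "0 < \<rho>" "\<rho> < (1::real)"
  shows "\<exists>\<delta> N. 0 < \<delta> \<and> \<delta> \<le> 1/2 \<and> B * \<rho> ^ N + 2 * \<delta> * B \<le> \<epsilon>"
proof -
  define \<delta> where "\<delta> = min (1/2) (\<epsilon> / (4 * (B + 1)))"
  have "0 < \<epsilon> / (4 * (B + 1))" using B e by simp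
  then have d: "0 < \<delta>" "\<delta> \<le> 1/2" unfolding \<delta>_def by (simp, intro min.cobounded1)
  have "2 * \<delta> * B \<le> \<epsilon> / 2" unfolding \<delta>_def by (rule small_multiple[OF B e])
  moreover have "0 < \<epsilon> / 2" using e by simp
  from power_decay[OF r this] obtain N where "\<forall>n\<ge>N. B * \<rho> ^ n < \<epsilon> / 2" by (rule exE)
  then have "B * \<rho> ^ N < \<epsilon> / 2" by simp
  ultimately show ?thesis using d by (intro exI[of _ \<delta>] exI[of _ N]) simp
qed

text \<open>A linear form in the monomials of w is the value of a polynomial at w; in this guise it
  also has a value at z.\<close>

definition lpoly :: "nat \<Rightarrow> (('r::finite \<Rightarrow>\<^sub>0 nat) \<Rightarrow> 'k) \<Rightarrow> ('r, 'k) mfps" where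
  "lpoly N c = (\<Sum>I\<in>{I. mdeg I \<le> N}. mconst (c I) * mmono I)"

lemma lpoly_polys: "lpoly N c \<in> polys"
  unfolding lpoly_def by (intro polys_sum polys_mult polys_mconst polys_mmono)

lemma peval_lpoly: "peval w (lpoly N c) = lincomb {I. mdeg I \<le> N} c (wprod w)"
  unfolding lpoly_def lincomb_def
  by (simp add: peval_sum peval_mult polys_mult polys_mconst polys_mmono)

lemma coord_seminorm_ucomb:
  assumes "\<alpha> \<in> spectrum K1" "f \<in> alg_carrier K1"
  shows "coord_seminorm absv {I. mdeg I \<le> N} (\<lambda>c. \<alpha> (ucomb f N c))"
  using nonarch_algebra.coord_seminorm_spec[OF nonarch_algebra_K1 assms(1) usub_coeff(1)[OF assms(2)]]
  by (simp add: ucomb_def)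

lemma coord_seminorm_lpoly:
  fixes x :: "('r::finite, 'k) mfps \<Rightarrow> real"
  assumes "0 < \<rho>" "x \<in> spectrum (tate (ground absv) \<rho>)"
  shows "coord_seminorm absv {I. mdeg I \<le> N} (\<lambda>c. x (lpoly N c))"
proof -
  interpret tate_algebra absv "ground absv" \<rho> by (rule tate_ground[OF assms(1)])
  show ?thesis
    using nonarch_algebra.coord_seminorm_spec[OF nonarch_algebra_tate assms(2) mmono_carrier] by (simp add: lpoly_def)
qed

text \<open>As a function of w, the pulled-back seminorm is a maximum of weighted absolute values of
  finitely many polynomials, up to a uniform error. Such maxima have limits along
  \<open>rigid_near\<close>.\<close>

lemma usub_at_functionals:
  fixes f :: "('s, 'k) mfps" and w :: "'r::finite \<Rightarrow> 'k"
  assumes f: "f \<in> alg_carrier K1" and \<rho>: "0 < \<rho>" "\<rho> < 1" and \<alpha>: "\<alpha> \<in> spectrum K1"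
    and F: "functionals {I. mdeg I \<le> N} (\<lambda>c. \<alpha> (ucomb f N c)) \<delta> n L a" and d: "0 < \<delta>" "\<delta> \<le> 1/2"
    and w: "\<forall>v. absv (w v) \<le> \<rho>"
  shows "\<bar>\<alpha> (usub_at w f) - fmax n (\<lambda>k. a k * absv (peval w (lpoly N (L k))))\<bar>
    \<le> alg_norm K1 f * \<rho> ^ N + 2 * \<delta> * alg_norm K1 f"
proof -
  interpret nonarch_algebra absv K1 by (rule nonarch_algebra_K1)
  note fw = f \<rho> w[rule_format]
  have "\<bar>\<alpha> (usub_at w f) - \<alpha> (ucomb f N (wprod w))\<bar> \<le> \<alpha> (usub_at w f - ucomb f N (wprod w))"
    by (rule spec_abs_diff[OF \<alpha> usub_at_carrier[OF fw] ucomb_carrier[OF f]])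
  also have "\<dots> \<le> alg_norm K1 (usub_at w f - ucomb f N (wprod w))"
    by (rule spec_le_norm[OF \<alpha> carrier_diff[OF usub_at_carrier[OF fw] ucomb_carrier[OF f]]])
  also have "\<dots> \<le> alg_norm K1 f * \<rho> ^ N" by (rule usub_at_approx[OF fw])
  finally have 1: "\<bar>\<alpha> (usub_at w f) - \<alpha> (ucomb f N (wprod w))\<bar> \<le> alg_norm K1 f * \<rho> ^ N" .
  have "\<alpha> (ucomb f N (wprod w)) \<le> alg_norm K1 f"
    by (rule order_trans[OF spec_le_norm[OF \<alpha> ucomb_carrier[OF f]] norm_ucomb_wprod[OF fw]])
  from functionals_close[OF F d this]
  have "\<bar>\<alpha> (ucomb f N (wprod w)) - fmax n (\<lambda>k. a k * absv (peval w (lpoly N (L k))))\<bar> \<le> 2 * \<delta> * alg_norm K1 f"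
    by (simp only: peval_lpoly)
  with 1 show ?thesis by linarith
qed

end

text \<open>A Cauchy criterion for a proper filter: two eventual estimates hold at a common point,
  so the approximate limits \<open>l n\<close> form a Cauchy sequence.\<close>

lemma tendsto_of_approximations:
  fixes g :: "'b \<Rightarrow> real"
  assumes F: "F \<noteq> bot"
    and a: "\<And>\<epsilon>. 0 < \<epsilon> \<Longrightarrow> \<exists>h l. (h \<longlongrightarrow> l) F \<and> (\<forall>\<^sub>F w in F. \<bar>g w - h w\<bar> \<le> \<epsilon>)"
  shows "\<exists>L. (g \<longlongrightarrow> L) F"
proof -
  have "\<exists>l. \<forall>\<^sub>F w in F. \<bar>g w - l\<bar> < \<epsilon>" if "0 < \<epsilon>" for \<epsilon>
  proof -
    have "0 < \<epsilon> / 2" using that by simp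
    from a[OF this] obtain h l where h: "(h \<longlongrightarrow> l) F" "\<forall>\<^sub>F w in F. \<bar>g w - h w\<bar> \<le> \<epsilon> / 2" by (elim exE conjE) (rule that)
    have "\<forall>\<^sub>F w in F. dist (h w) l < \<epsilon> / 2" using h(1) that by (intro tendstoD) auto
    with h(2) have "\<forall>\<^sub>F w in F. \<bar>g w - l\<bar> < \<epsilon>" by eventually_elim (unfold dist_real_def, linarith)
    then show ?thesis by (rule exI)
  qed
  then have "\<forall>n. \<exists>l. \<forall>\<^sub>F w in F. \<bar>g w - l\<bar> < 1 / real (Suc n)" by simp
  then obtain l where l: "\<forall>n. \<forall>\<^sub>F w in F. \<bar>g w - l n\<bar> < 1 / real (Suc n)" unfolding choice_iff by (rule exE)
  have near: "\<bar>l m - l n\<bar> < 1 / real (Suc m) + 1 / real (Suc n)" for m n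
  proof -
    have "\<forall>\<^sub>F w in F. \<bar>g w - l m\<bar> < 1 / real (Suc m) \<and> \<bar>g w - l n\<bar> < 1 / real (Suc n)"
      using l by (intro eventually_conj) simp_all
    from eventually_happens'[OF F this] obtain w
      where "\<bar>g w - l m\<bar> < 1 / real (Suc m)" "\<bar>g w - l n\<bar> < 1 / real (Suc n)" by (elim exE conjE) (rule that)
    then show ?thesis by linarith
  qed
  have inv: "1 / real (Suc n) < e" if "inverse (real (Suc N)) < e" "N \<le> n" for N n e
  proof -
    have "1 / real (Suc n) \<le> 1 / real (Suc N)" using that by (intro divide_left_mono) auto
    then show ?thesis using that by (simp add: inverse_eq_divide)
  qed
  have "Cauchy l"
  proof (rule metric_CauchyI)
    fix e :: real assume "0 < e"
    then obtain N where N: "inverse (real (Suc N)) < e / 2" using reals_Archimedean[of "e / 2"] by auto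
    show "\<exists>N. \<forall>m\<ge>N. \<forall>n\<ge>N. dist (l m) (l n) < e"
    proof (intro exI[of _ N] allI impI)
      fix m n assume "N \<le> m" "N \<le> n"
      then show "dist (l m) (l n) < e" using near[of m n] inv[OF N, of m] inv[OF N, of n] by (simp add: dist_real_def)
    qed
  qed
  then obtain L where L: "l \<longlonglongrightarrow> L" using Cauchy_convergent_iff convergent_def by blast
  have "(g \<longlongrightarrow> L) F"
  proof (rule tendstoI)
    fix e :: real assume e: "0 < e"
    then obtain N where N: "inverse (real (Suc N)) < e / 2" using reals_Archimedean[of "e / 2"] by auto
    have "\<forall>\<^sub>F n in sequentially. dist (l n) L < e / 2" using L e by (intro tendstoD) auto
    then obtain N' where N': "\<forall>n\<ge>N'. dist (l n) L < e / 2" unfolding eventually_sequentially by (rule exE)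
    define n where "n = max N N'"
    have n: "dist (l n) L < e / 2" "1 / real (Suc n) < e / 2"
      using N' by (simp add: n_def) (rule inv[OF N], simp add: n_def)
    from l[rule_format, of n] show "\<forall>\<^sub>F w in F. dist (g w) L < e"
      by eventually_elim (use n in \<open>unfold dist_real_def, linarith\<close>)
  qed
  then show ?thesis by (rule exI)
qed

definition Ev :: "('k::field \<Rightarrow> real) \<Rightarrow> (('r, 's, 'k) coeff_series \<Rightarrow> real) \<Rightarrow>
    (('r, 'k) mfps \<Rightarrow> real) \<Rightarrow> (('s, 'k) mfps \<Rightarrow> real)" where
  "Ev absv \<alpha> z = (\<lambda>f\<in>alg_carrier (tate (ground absv) 1). Lim (rigid_near absv z) (\<lambda>w. \<alpha> (usub_at w f)))"

section \<open>Existence, multiplicativity and boundedness of the limit\<close>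

context alg_closed_nonarch_field
begin

lemma rigid_near_lpoly:
  fixes x :: "('r::finite, 'k) mfps \<Rightarrow> real"
  shows "((\<lambda>w. fmax n (\<lambda>k. a k * absv (peval w (lpoly N (L k))))) \<longlongrightarrow> fmax n (\<lambda>k. a k * x (lpoly N (L k))))
    (rigid_near absv (restrict x (disk_series (ground absv))))"
proof (intro tendsto_fmax tendsto_mult tendsto_const)
  fix k
  have "restrict x (disk_series (ground absv)) (lpoly N (L k)) = x (lpoly N (L k))"
    by (rule restrict_apply'[OF set_mp[OF polys_disk_series lpoly_polys]])
  then show "((\<lambda>w. absv (peval w (lpoly N (L k)))) \<longlongrightarrow> x (lpoly N (L k)))
    (rigid_near absv (restrict x (disk_series (ground absv))))"
    using rigid_near_tendsto[OF lpoly_polys[of N "L k"], where absv = absv and z = "restrict x (disk_series (ground absv))"] by (simp only:)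
qed

context
  fixes \<alpha> :: "('s \<times> ('r::finite \<Rightarrow>\<^sub>0 nat), 'k) mfps \<Rightarrow> real" and x :: "('r, 'k) mfps \<Rightarrow> real" and \<rho> \<rho>' :: real and z
  assumes \<alpha>: "\<alpha> \<in> spectrum K1" and \<rho>: "0 < \<rho>" "\<rho> < \<rho>'" "\<rho>' < 1"
    and x: "x \<in> spectrum (tate (ground absv) \<rho>)" and z: "z = restrict x (disk_series (ground absv))"
begin

lemma eventually_small: "\<forall>\<^sub>F w in rigid_near absv z. \<forall>v. absv (w v) \<le> \<rho>'"
  unfolding z using rigid_near_bounded[OF \<rho>(1) x \<rho>(2)] by eventually_elim (simp add: less_imp_le)

lemma rigid_near_z_not_bot: "rigid_near absv z \<noteq> bot"
  using \<rho> x by (intro rigid_near_not_bot) (auto simp: open_disk_def z)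

lemma Ev_tendsto:
  assumes f: "f \<in> alg_carrier K1"
  shows "((\<lambda>w. \<alpha> (usub_at w f)) \<longlongrightarrow> Ev absv \<alpha> z f) (rigid_near absv z)"
proof -
  have "\<exists>L. ((\<lambda>w. \<alpha> (usub_at w f)) \<longlongrightarrow> L) (rigid_near absv z)"
  proof (rule tendsto_of_approximations[OF rigid_near_z_not_bot])
    fix \<epsilon> :: real assume e: "0 < \<epsilon>"
    have r': "0 < \<rho>'" using \<rho> by simp
    obtain \<delta> N where d: "0 < \<delta>" "\<delta> \<le> 1/2" "alg_norm K1 f * \<rho>' ^ N + 2 * \<delta> * alg_norm K1 f \<le> \<epsilon>"
      using approximation_parameters[OF K1_norm_nonneg[OF f] e r' \<rho>(3)] by (elim exE conjE) (rule that)
    have d1: "\<delta> < 1" using d(2) by simp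
    obtain n L a where F: "functionals {I. mdeg I \<le> N} (\<lambda>c. \<alpha> (ucomb f N c)) \<delta> n L a"
      using functionals_exist[OF finite_mdeg_le coord_seminorm_ucomb[OF \<alpha> f] d(1) d1, of N] by (elim exE) (rule that)
    have "\<forall>\<^sub>F w in rigid_near absv z. \<bar>\<alpha> (usub_at w f) - fmax n (\<lambda>k. a k * absv (peval w (lpoly N (L k))))\<bar> \<le> \<epsilon>"
      using eventually_small
    proof eventually_elim
      case (elim w)
      from usub_at_functionals[OF f r' \<rho>(3) \<alpha> F d(1,2) elim] d(3) show ?case by linarith
    qed
    moreover have "((\<lambda>w. fmax n (\<lambda>k. a k * absv (peval w (lpoly N (L k))))) \<longlongrightarrow> fmax n (\<lambda>k. a k * x (lpoly N (L k))))
        (rigid_near absv z)" unfolding z by (rule rigid_near_lpoly)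
    ultimately show "\<exists>h l. (h \<longlongrightarrow> l) (rigid_near absv z) \<and> (\<forall>\<^sub>F w in rigid_near absv z. \<bar>\<alpha> (usub_at w f) - h w\<bar> \<le> \<epsilon>)"
      by (intro exI conjI)
  qed
  then obtain L where L: "((\<lambda>w. \<alpha> (usub_at w f)) \<longlongrightarrow> L) (rigid_near absv z)" by (rule exE)
  then have "Ev absv \<alpha> z f = L" using f rigid_near_z_not_bot by (simp add: Ev_def tendsto_Lim)
  then show ?thesis using L by simp
qed

text \<open>The estimate of \<open>usub_at_functionals\<close> in the limit. Its error and its
  linear forms do not depend on x, which gives continuity in z; they do depend on \<alpha>, and
  continuity in \<alpha> has to go through \<open>Ev_dual\<close>.\<close>

lemma Ev_functionals:
  assumes f: "f \<in> alg_carrier K1"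
    and F: "functionals {I. mdeg I \<le> N} (\<lambda>c. \<alpha> (ucomb f N c)) \<delta> n L a" and d: "0 < \<delta>" "\<delta> \<le> 1/2"
  shows "\<bar>Ev absv \<alpha> z f - fmax n (\<lambda>k. a k * x (lpoly N (L k)))\<bar> \<le> alg_norm K1 f * \<rho>' ^ N + 2 * \<delta> * alg_norm K1 f"
proof (rule tendsto_upperbound[OF _ _ rigid_near_z_not_bot])
  show "((\<lambda>w. \<bar>\<alpha> (usub_at w f) - fmax n (\<lambda>k. a k * absv (peval w (lpoly N (L k))))\<bar>) \<longlongrightarrow>
      \<bar>Ev absv \<alpha> z f - fmax n (\<lambda>k. a k * x (lpoly N (L k)))\<bar>) (rigid_near absv z)"
    by (intro tendsto_rabs tendsto_diff Ev_tendsto f) (unfold z, rule rigid_near_lpoly)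
  have r': "0 < \<rho>'" using \<rho> by simp
  show "\<forall>\<^sub>F w in rigid_near absv z. \<bar>\<alpha> (usub_at w f) - fmax n (\<lambda>k. a k * absv (peval w (lpoly N (L k))))\<bar>
      \<le> alg_norm K1 f * \<rho>' ^ N + 2 * \<delta> * alg_norm K1 f"
    using eventually_small by eventually_elim (rule usub_at_functionals[OF f r' \<rho>(3) \<alpha> F d])
qed

text \<open>Every w in the smaller polydisk pulls \<alpha> back along a ring morphism that does not
  increase norms. Being multiplicative, subadditive and bounded by the norm are closed
  conditions.\<close>

lemma Ev_spectrum: "(Ev absv \<alpha> z :: ('s, 'k) mfps \<Rightarrow> real) \<in> spectrum K1"
  and Ev_le_norm: "f \<in> alg_carrier K1 \<Longrightarrow> Ev absv \<alpha> z f \<le> alg_norm K1 f"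
proof -
  interpret A: nonarch_algebra absv "K1 :: ('k, ('s, 'k) mfps) normed_alg" by (rule nonarch_algebra_K1)
  interpret M: nonarch_algebra absv "K1 :: ('k, ('r, 's, 'k) coeff_series) normed_alg" by (rule nonarch_algebra_K1)
  note nb = rigid_near_z_not_bot
  have r': "0 < \<rho>'" using \<rho> by simp
  have ev: "\<forall>\<^sub>F w in rigid_near absv z. \<forall>f\<in>alg_carrier K1. usub_at w f \<in> alg_carrier K1 \<and> \<alpha> (usub_at w f) \<le> alg_norm K1 (f :: ('s, 'k) mfps)"
    using eventually_small
  proof eventually_elim
    case (elim w)
    show ?case
    proof (intro ballI conjI)
      fix f :: "('s, 'k) mfps" assume f: "f \<in> alg_carrier K1"
      show c: "usub_at w f \<in> alg_carrier K1" by (rule usub_at_carrier[OF f r' \<rho>(3) elim[rule_format]])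
      show "\<alpha> (usub_at w f) \<le> alg_norm K1 f"
        by (rule order_trans[OF M.spec_le_norm[OF \<alpha> c] norm_usub_at[OF f r' \<rho>(3) elim[rule_format]]])
    qed
  qed
  have le: "Ev absv \<alpha> z f \<le> alg_norm K1 f" if f: "f \<in> alg_carrier K1" for f :: "('s, 'k) mfps"
    by (rule tendsto_upperbound[OF Ev_tendsto[OF f] _ nb]) (use ev in eventually_elim, use f in simp)
  then show "f \<in> alg_carrier K1 \<Longrightarrow> Ev absv \<alpha> z f \<le> alg_norm K1 f" .
  have c: "Ev absv \<alpha> z (mconst c) = absv c" for c :: 'k
  proof (rule tendsto_unique[OF nb Ev_tendsto[OF K1_mconst]])
    show "((\<lambda>w. \<alpha> (usub_at w (mconst c))) \<longlongrightarrow> absv c) (rigid_near absv z)"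
      by (simp add: usub_at_mconst spec_mconst[OF \<alpha>])
  qed
  have nn: "0 \<le> Ev absv \<alpha> z f" if f: "f \<in> alg_carrier K1" for f :: "('s, 'k) mfps"
    by (rule tendsto_lowerbound[OF Ev_tendsto[OF f] _ nb]) (use ev in eventually_elim, use f in \<open>simp add: M.spec_nonneg[OF \<alpha>]\<close>)
  have add: "Ev absv \<alpha> z (f + g) \<le> Ev absv \<alpha> z f + Ev absv \<alpha> z g"
    if f: "f \<in> alg_carrier K1" and g: "g \<in> alg_carrier K1" for f g :: "('s, 'k) mfps"
  proof (rule tendsto_le[OF nb tendsto_add[OF Ev_tendsto[OF f] Ev_tendsto[OF g]] Ev_tendsto[OF A.carrier_add[OF f g]]])
    show "\<forall>\<^sub>F w in rigid_near absv z. \<alpha> (usub_at w (f + g)) \<le> \<alpha> (usub_at w f) + \<alpha> (usub_at w g)"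
      using ev by eventually_elim (use f g in \<open>simp add: usub_at_add M.spec_subadd[OF \<alpha>]\<close>)
  qed
  have mult: "Ev absv \<alpha> z (f * g) = Ev absv \<alpha> z f * Ev absv \<alpha> z g"
    if f: "f \<in> alg_carrier K1" and g: "g \<in> alg_carrier K1" for f g :: "('s, 'k) mfps"
  proof (rule tendsto_unique[OF nb Ev_tendsto[OF A.carrier_mult[OF f g]]])
    have "\<forall>\<^sub>F w in rigid_near absv z. \<alpha> (usub_at w f) * \<alpha> (usub_at w g) = \<alpha> (usub_at w (f * g))"
      using ev by eventually_elim (use f g in \<open>simp add: usub_at_mult M.spec_mult[OF \<alpha>]\<close>)
    then show "((\<lambda>w. \<alpha> (usub_at w (f * g))) \<longlongrightarrow> Ev absv \<alpha> z f * Ev absv \<alpha> z g) (rigid_near absv z)"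
      by (rule Lim_transform_eventually[rotated]) (intro tendsto_mult Ev_tendsto f g)
  qed
  have "(Ev absv \<alpha> z :: ('s, 'k) mfps \<Rightarrow> real) \<in> extensional (alg_carrier K1)" by (simp add: Ev_def)
  moreover have "Ev absv \<alpha> z (0 :: ('s, 'k) mfps) = 0" "Ev absv \<alpha> z (1 :: ('s, 'k) mfps) = 1" using c[of 0] c[of 1] by simp_all
  moreover have "\<exists>C. \<forall>f\<in>alg_carrier K1. Ev absv \<alpha> z (f :: ('s, 'k) mfps) \<le> C * alg_norm K1 f"
    using le by (intro exI[of _ 1]) simp
  ultimately show "(Ev absv \<alpha> z :: ('s, 'k) mfps \<Rightarrow> real) \<in> spectrum K1"
    unfolding spectrum_def using nn add mult by simp
qed

end

end

section \<open>Continuity of the evaluation\<close>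

lemma continuous_map_of_approximations:
  fixes g :: "'a \<Rightarrow> real"
  assumes a: "\<And>\<epsilon>. 0 < \<epsilon> \<Longrightarrow> \<exists>h. continuous_map X euclideanreal h \<and> (\<forall>x\<in>topspace X. \<bar>g x - h x\<bar> \<le> \<epsilon>)"
  shows "continuous_map X euclideanreal g"
  unfolding continuous_map_atin limitin_canonical_iff
proof (intro ballI tendstoI)
  fix x and e :: real assume x: "x \<in> topspace X" and e: "0 < e"
  have "0 < e / 3" using e by simp
  from a[OF this] obtain h where h: "continuous_map X euclideanreal h" "\<forall>x\<in>topspace X. \<bar>g x - h x\<bar> \<le> e / 3"
    by (elim exE conjE) (rule that)
  have "(h \<longlongrightarrow> h x) (atin X x)" using h(1) x by (simp add: continuous_map_atin)
  then have 1: "\<forall>\<^sub>F y in atin X x. dist (h y) (h x) < e / 3" using e by (intro tendstoD) auto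
  have 2: "\<forall>\<^sub>F y in atin X x. y \<in> topspace X"
    using x by (auto simp: eventually_atin intro!: exI[of _ "topspace X"])
  from 1 2 show "\<forall>\<^sub>F y in atin X x. dist (g y) (g x) < e"
  proof eventually_elim
    case (elim y)
    then have "\<bar>g y - h y\<bar> \<le> e / 3" "\<bar>g x - h x\<bar> \<le> e / 3" using h(2) x by auto
    then show ?case using elim e unfolding dist_real_def by linarith
  qed
qed

lemma continuous_map_fmax:
  "(\<And>k. k < n \<Longrightarrow> continuous_map X euclideanreal (\<lambda>x. h k x)) \<Longrightarrow> continuous_map X euclideanreal (\<lambda>x. fmax n (\<lambda>k. h k x))"
  by (induction n) (simp_all add: fmax_0 fmax_Suc continuous_map_real_max)

lemma continuous_map_spectrum_eval:
  assumes "f \<in> alg_carrier A" shows "continuous_map (spectrum_top A) euclideanreal (\<lambda>x. x f)"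
  unfolding spectrum_top_def
  by (intro continuous_map_from_subtopology continuous_map_product_projection assms)

lemma continuous_map_into_spectrum:
  assumes "\<And>y. y \<in> topspace Y \<Longrightarrow> F y \<in> spectrum A"
    and "\<And>f. f \<in> alg_carrier A \<Longrightarrow> continuous_map Y euclideanreal (\<lambda>y. F y f)"
  shows "continuous_map Y (spectrum_top A) F"
proof -
  have "F y \<in> extensional (alg_carrier A)" if "y \<in> topspace Y" for y
    using assms(1)[OF that] by (simp add: spectrum_def)
  then show ?thesis
    using assms unfolding spectrum_top_def continuous_map_in_subtopology continuous_map_componentwise
    by (simp add: image_subset_iff)
qed

text \<open>The open polydisk carries the colimit topology of the closed ones, so continuity is
  tested on each of them.\<close>

lemma continuous_map_from_open_disk:
  fixes A :: "('k, 'a::comm_ring_1) normed_alg" and F :: "(('v, 'a) mfps \<Rightarrow> real) \<Rightarrow> 'c"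
  assumes F: "\<And>\<rho>. 0 < \<rho> \<Longrightarrow> \<rho> < 1 \<Longrightarrow> continuous_map (spectrum_top (tate A \<rho>)) Y (\<lambda>x. F (restrict x (disk_series A)))"
  shows "continuous_map (open_disk_top A) Y F"
  unfolding continuous_map_def topspace_open_disk_top
proof (intro conjI allI impI)
  show "F \<in> open_disk A \<rightarrow> topspace Y"
  proof
    fix z :: "('v, 'a) mfps \<Rightarrow> real" assume "z \<in> open_disk A"
    then obtain \<rho> x where x: "0 < \<rho>" "\<rho> < 1" "x \<in> spectrum (tate A \<rho>)" "z = restrict x (disk_series A)"
      by (auto simp: open_disk_def)
    from continuous_map_image_subset_topspace[OF F[OF x(1,2)]] x(3,4) show "F z \<in> topspace Y" by (auto simp: image_subset_iff)
  qed
next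
  fix U assume U: "openin Y U"
  show "openin (open_disk_top A) {z \<in> open_disk A. F z \<in> U}"
    unfolding openin_open_disk_top
  proof (intro conjI ballI)
    fix \<rho> :: real assume r: "\<rho> \<in> {0<..<1}"
    have "openin (spectrum_top (tate A \<rho>)) {x \<in> topspace (spectrum_top (tate A \<rho>)). F (restrict x (disk_series A)) \<in> U}"
      using F r U by (intro openin_continuous_map_preimage) auto
    also have "{x \<in> topspace (spectrum_top (tate A \<rho>)). F (restrict x (disk_series A)) \<in> U}
        = {x \<in> spectrum (tate A \<rho>). restrict x (disk_series A) \<in> {z \<in> open_disk A. F z \<in> U}}"
      using r by (auto simp: open_disk_def)
    finally show "openin (spectrum_top (tate A \<rho>)) {x \<in> spectrum (tate A \<rho>). restrict x (disk_series A) \<in> {z \<in> open_disk A. F z \<in> U}}" .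
  qed simp
qed

context alg_closed_nonarch_field
begin

text \<open>For fixed \<alpha> the linear forms are fixed and approximate \<open>Ev\<close>
  uniformly in x, and the values of x at polynomials are continuous in x by the definition of the
  topology.\<close>

lemma continuous_map_Ev_disk:
  fixes \<alpha> :: "('s \<times> ('r::finite \<Rightarrow>\<^sub>0 nat), 'k) mfps \<Rightarrow> real"
  assumes \<alpha>: "\<alpha> \<in> spectrum K1"
  shows "continuous_map (open_disk_top (ground absv)) (spectrum_top K1) (Ev absv \<alpha>)"
proof (rule continuous_map_from_open_disk)
  fix \<rho> :: real assume r: "0 < \<rho>" "\<rho> < 1"
  \<comment> \<open>A radius strictly between \<rho> and 1: the points of \<open>k^r\<close> near x
    lie in this polydisk, where truncation errors still decay.\<close>
  define \<rho>' where "\<rho>' = (1 + \<rho>) / 2"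
  have r': "\<rho> < \<rho>'" "\<rho>' < 1" "0 < \<rho>'" using r by (simp_all add: \<rho>'_def)
  show "continuous_map (spectrum_top (tate (ground absv) \<rho>)) (spectrum_top K1)
      (\<lambda>x. Ev absv \<alpha> (restrict x (disk_series (ground absv))))"
  proof (rule continuous_map_into_spectrum)
    fix x :: "('r, 'k) mfps \<Rightarrow> real" assume "x \<in> topspace (spectrum_top (tate (ground absv) \<rho>))"
    then have "x \<in> spectrum (tate (ground absv) \<rho>)" by simp
    from Ev_spectrum[OF \<alpha> r(1) r'(1,2) this refl]
    show "(Ev absv \<alpha> (restrict x (disk_series (ground absv))) :: ('s, 'k) mfps \<Rightarrow> real) \<in> spectrum K1" .
  next
    fix f :: "('s, 'k) mfps" assume f: "f \<in> alg_carrier K1"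
    interpret tate_algebra absv "ground absv" \<rho> by (rule tate_ground[OF r(1)])
    show "continuous_map (spectrum_top (tate (ground absv) \<rho>)) euclideanreal
      (\<lambda>x. Ev absv \<alpha> (restrict x (disk_series (ground absv))) f)"
    proof (rule continuous_map_of_approximations)
      fix \<epsilon> :: real assume e: "0 < \<epsilon>"
      obtain \<delta> N where d: "0 < \<delta>" "\<delta> \<le> 1/2" "alg_norm K1 f * \<rho>' ^ N + 2 * \<delta> * alg_norm K1 f \<le> \<epsilon>"
        using approximation_parameters[OF K1_norm_nonneg[OF f] e r'(3,2)] by (elim exE conjE) (rule that)
      have d1: "\<delta> < 1" using d(2) by simp
      obtain n L a where F: "functionals {I. mdeg I \<le> N} (\<lambda>c. \<alpha> (ucomb f N c)) \<delta> n L a"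
        using functionals_exist[OF finite_mdeg_le coord_seminorm_ucomb[OF \<alpha> f] d(1) d1, of N] by (elim exE) (rule that)
      have "lpoly N c \<in> alg_carrier (tate (ground absv) \<rho>)" for c :: "('r \<Rightarrow>\<^sub>0 nat) \<Rightarrow> 'k"
        by (rule set_mp[OF polys_tate_ground[OF r(1)] lpoly_polys])
      then have cont: "continuous_map (spectrum_top (tate (ground absv) \<rho>)) euclideanreal (\<lambda>x. fmax n (\<lambda>k. a k * x (lpoly N (L k))))"
        by (intro continuous_map_fmax continuous_map_real_mult continuous_map_const[THEN iffD2] continuous_map_spectrum_eval) simp_all
      show "\<exists>h. continuous_map (spectrum_top (tate (ground absv) \<rho>)) euclideanreal h \<and>
          (\<forall>x\<in>topspace (spectrum_top (tate (ground absv) \<rho>)). \<bar>Ev absv \<alpha> (restrict x (disk_series (ground absv))) f - h x\<bar> \<le> \<epsilon>)"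
      proof (intro exI[of _ "\<lambda>x. fmax n (\<lambda>k. a k * x (lpoly N (L k)))"] conjI cont ballI)
        fix x :: "('r, 'k) mfps \<Rightarrow> real" assume "x \<in> topspace (spectrum_top (tate (ground absv) \<rho>))"
        then have "x \<in> spectrum (tate (ground absv) \<rho>)" by simp
        from Ev_functionals[OF \<alpha> r(1) r'(1,2) this refl f F d(1,2)]
        show "\<bar>Ev absv \<alpha> (restrict x (disk_series (ground absv))) f - fmax n (\<lambda>k. a k * x (lpoly N (L k)))\<bar> \<le> \<epsilon>"
          using d(3) by linarith
      qed
    qed
  qed
qed

lemma lincomb_commute: "lincomb J a b = lincomb J b a"
  by (simp add: lincomb_def mult.commute)

text \<open>The approximation of \<open>Ev \<alpha> z f\<close> by a maximum of \<open>a\<^sub>k z(E\<^sub>k)\<close> is dualised: with \<open>z \<approx> max r\<^sub>j |m\<^sub>j|\<close> on the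
  polynomials of bounded degree, it is also a maximum of \<open>r\<^sub>j \<alpha>(G\<^sub>j)\<close> where \<open>r\<^sub>j\<close> and \<open>G\<^sub>j\<close> do not depend on \<open>\<alpha>\<close>.\<close>

lemma Ev_dual:
  fixes f :: "('s, 'k) mfps" and x :: "('r::finite, 'k) mfps \<Rightarrow> real"
  assumes r: "0 < \<rho>" "\<rho> < 1" and x: "x \<in> spectrum (tate (ground absv) \<rho>)"
    and f: "f \<in> alg_carrier K1" and e: "0 < \<epsilon>"
  shows "\<exists>N m M r. \<forall>\<alpha>\<in>spectrum K1.
    \<bar>Ev absv \<alpha> (restrict x (disk_series (ground absv))) f - fmax m (\<lambda>j. r j * \<alpha> (ucomb f N (M j)))\<bar> \<le> \<epsilon>"
proof -
  define \<rho>' where "\<rho>' = (1 + \<rho>) / 2"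
  have r': "\<rho> < \<rho>'" "\<rho>' < 1" "0 < \<rho>'" using r by (simp_all add: \<rho>'_def)
  define B where "B = alg_norm K1 f"
  have B: "0 \<le> B" by (simp add: B_def K1_norm_nonneg[OF f])
  \<comment> \<open>The tolerance is spent twice; its cap at 1 yields the bound B + 1 for the
    approximation X below.\<close>
  define \<epsilon>' where "\<epsilon>' = min 1 (\<epsilon> / 2)"
  have e': "0 < \<epsilon>'" "\<epsilon>' \<le> 1" "\<epsilon>' \<le> \<epsilon> / 2" using e by (simp_all add: \<epsilon>'_def)
  have B1: "0 \<le> B + 1" using B by simp
  obtain \<delta> N where d: "0 < \<delta>" "\<delta> \<le> 1/2" "(B + 1) * \<rho>' ^ N + 2 * \<delta> * (B + 1) \<le> \<epsilon>'"
    using approximation_parameters[OF B1 e'(1) r'(3,2)] by (elim exE conjE) (rule that)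
  have d1: "\<delta> < 1" using d(2) by simp
  have pos: "0 \<le> \<rho>' ^ N" using r' by simp
  have d3: "2 * \<delta> * (B + 1) \<le> \<epsilon>'" using d(3) mult_nonneg_nonneg[OF B1 pos] by linarith
  have d4: "B * \<rho>' ^ N + 2 * \<delta> * B \<le> \<epsilon>'" using d pos by (simp add: distrib_right distrib_left)
  let ?J = "{I :: 'r \<Rightarrow>\<^sub>0 nat. mdeg I \<le> N}"
  obtain m M b where M: "functionals ?J (\<lambda>c. x (lpoly N c)) \<delta> m M b"
    using functionals_exist[OF finite_mdeg_le coord_seminorm_lpoly[OF r(1) x] d(1) d1, of N] by (elim exE) (rule that)
  have "\<bar>Ev absv \<alpha> (restrict x (disk_series (ground absv))) f - fmax m (\<lambda>j. b j * \<alpha> (ucomb f N (M j)))\<bar> \<le> \<epsilon>"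
    if \<alpha>: "\<alpha> \<in> spectrum K1" for \<alpha> :: "('r, 's, 'k) coeff_series \<Rightarrow> real"
  proof -
    obtain n L a where L: "functionals ?J (\<lambda>c. \<alpha> (ucomb f N c)) \<delta> n L a"
      using functionals_exist[OF finite_mdeg_le coord_seminorm_ucomb[OF \<alpha> f] d(1) d1, of N] by (elim exE) (rule that)
    define X where "X = fmax n (\<lambda>k. a k * x (lpoly N (L k)))"
    define H where "H = fmax m (\<lambda>j. b j * \<alpha> (ucomb f N (M j)))"
    \<comment> \<open>The double maximum in which both seminorms are replaced by linear forms.
      Taking the maximum over j or over k first shows that X and H both lie between
      \<open>(1 - \<delta>) * C\<close> and C.\<close>
    define C where "C = fmax n (\<lambda>k. a k * fmax m (\<lambda>j. b j * absv (lincomb ?J (M j) (L k))))"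
    have a: "0 \<le> a k" if "k < n" for k using L that by (simp add: functionals_def less_imp_le)
    have b: "0 \<le> b j" if "j < m" for j using M that by (simp add: functionals_def less_imp_le)
    have "C = fmax n (\<lambda>k. fmax m (\<lambda>j. a k * (b j * absv (lincomb ?J (M j) (L k)))))"
      unfolding C_def by (intro fmax_cong fmax_cmult[symmetric] a)
    also have "\<dots> = fmax m (\<lambda>j. fmax n (\<lambda>k. b j * (a k * absv (lincomb ?J (L k) (M j)))))"
      unfolding fmax_swap[of n] by (simp add: mult.left_commute lincomb_commute[of ?J "M _"])
    also have "\<dots> = fmax m (\<lambda>j. b j * fmax n (\<lambda>k. a k * absv (lincomb ?J (L k) (M j))))"
      by (intro fmax_cong fmax_cmult b)
    finally have C': "C = fmax m (\<lambda>j. b j * fmax n (\<lambda>k. a k * absv (lincomb ?J (L k) (M j))))" .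
    have X: "(1 - \<delta>) * C \<le> X" "X \<le> C"
    proof -
      have "(1 - \<delta>) * C = fmax n (\<lambda>k. (1 - \<delta>) * (a k * fmax m (\<lambda>j. b j * absv (lincomb ?J (M j) (L k)))))"
        unfolding C_def using d1 by (intro fmax_cmult[symmetric]) simp
      also have "\<dots> \<le> X" unfolding X_def
      proof (rule fmax_mono)
        fix k assume "k < n"
        then have "a k * ((1 - \<delta>) * fmax m (\<lambda>j. b j * absv (lincomb ?J (M j) (L k)))) \<le> a k * x (lpoly N (L k))"
          using M by (intro mult_left_mono a) (simp_all add: functionals_def)
        then show "(1 - \<delta>) * (a k * fmax m (\<lambda>j. b j * absv (lincomb ?J (M j) (L k)))) \<le> a k * x (lpoly N (L k))"
          by (simp add: mult.left_commute)
      qed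
      finally show "(1 - \<delta>) * C \<le> X" .
      show "X \<le> C" unfolding X_def C_def
        by (intro fmax_mono mult_left_mono a) (use M in \<open>simp_all add: functionals_def\<close>)
    qed
    have H: "(1 - \<delta>) * C \<le> H" "H \<le> C"
    proof -
      have "(1 - \<delta>) * C = fmax m (\<lambda>j. (1 - \<delta>) * (b j * fmax n (\<lambda>k. a k * absv (lincomb ?J (L k) (M j)))))"
        unfolding C' using d1 by (intro fmax_cmult[symmetric]) simp
      also have "\<dots> \<le> H" unfolding H_def
      proof (rule fmax_mono)
        fix j assume "j < m"
        then have "b j * ((1 - \<delta>) * fmax n (\<lambda>k. a k * absv (lincomb ?J (L k) (M j)))) \<le> b j * \<alpha> (ucomb f N (M j))"
          using L by (intro mult_left_mono b) (simp_all add: functionals_def)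
        then show "(1 - \<delta>) * (b j * fmax n (\<lambda>k. a k * absv (lincomb ?J (L k) (M j)))) \<le> b j * \<alpha> (ucomb f N (M j))"
          by (simp add: mult.left_commute)
      qed
      finally show "(1 - \<delta>) * C \<le> H" .
      show "H \<le> C" unfolding H_def C'
        by (intro fmax_mono mult_left_mono b) (use L in \<open>simp_all add: functionals_def\<close>)
    qed
    have E: "\<bar>Ev absv \<alpha> (restrict x (disk_series (ground absv))) f - X\<bar> \<le> \<epsilon>'"
      using Ev_functionals[OF \<alpha> r(1) r'(1,2) x refl f L d(1,2)] d4 unfolding X_def B_def by linarith
    have "Ev absv \<alpha> (restrict x (disk_series (ground absv))) f \<le> B"
      unfolding B_def by (rule Ev_le_norm[OF \<alpha> r(1) r'(1,2) x refl f])
    then have XB: "X \<le> B + 1" using E e' by linarith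
    have "0 \<le> C" by (simp add: C_def fmax_nonneg)
    then have "(1/2) * C \<le> (1 - \<delta>) * C" using d(2) by (intro mult_right_mono) auto
    from order_trans[OF this X(1)] have "C \<le> 2 * (B + 1)" using XB by simp
    then have "\<delta> * C \<le> \<delta> * (2 * (B + 1))" using d by (intro mult_left_mono) auto
    then have dC: "\<delta> * C \<le> \<epsilon>'" using d3 by (simp add: mult_ac)
    have "(1 - \<delta>) * C = C - \<delta> * C" by (simp add: algebra_simps)
    then have "\<bar>X - H\<bar> \<le> \<epsilon>'" using X H dC by linarith
    then show ?thesis using E e' unfolding H_def by linarith
  qed
  then show ?thesis by (intro exI ballI)
qed

text \<open>By \<open>Ev_dual\<close> the elements \<open>ucomb f N (M j)\<close> and the weights
  stay fixed while \<alpha> varies, so the approximations are continuous in \<alpha>.\<close>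

lemma continuous_map_Ev_mor:
  fixes z :: "('r::finite, 'k) mfps \<Rightarrow> real"
  assumes z: "z \<in> open_disk (ground absv)"
  shows "continuous_map (spectrum_top K1) (spectrum_top K1) (\<lambda>\<alpha> :: ('r, 's, 'k) coeff_series \<Rightarrow> real. Ev absv \<alpha> z)"
proof -
  obtain \<rho> x where x: "0 < \<rho>" "\<rho> < 1" "x \<in> spectrum (tate (ground absv) \<rho>)" "z = restrict x (disk_series (ground absv))"
    using z by (auto simp: open_disk_def)
  define \<rho>' where "\<rho>' = (1 + \<rho>) / 2"
  have r': "\<rho> < \<rho>'" "\<rho>' < 1" using x by (simp_all add: \<rho>'_def)
  show ?thesis
  proof (rule continuous_map_into_spectrum)
    fix \<alpha> :: "('r, 's, 'k) coeff_series \<Rightarrow> real" assume "\<alpha> \<in> topspace (spectrum_top K1)"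
    then have "\<alpha> \<in> spectrum K1" by simp
    from Ev_spectrum[OF this x(1) r' x(3,4)] show "(Ev absv \<alpha> z :: ('s, 'k) mfps \<Rightarrow> real) \<in> spectrum K1" .
  next
    fix f :: "('s, 'k) mfps" assume f: "f \<in> alg_carrier K1"
    show "continuous_map (spectrum_top K1) euclideanreal (\<lambda>\<alpha> :: ('r, 's, 'k) coeff_series \<Rightarrow> real. Ev absv \<alpha> z f)"
    proof (rule continuous_map_of_approximations)
      fix \<epsilon> :: real assume e: "0 < \<epsilon>"
      obtain N m M r where M: "\<forall>\<alpha>\<in>spectrum K1. \<bar>Ev absv \<alpha> z f - fmax m (\<lambda>j. r j * \<alpha> (ucomb f N (M j)))\<bar> \<le> \<epsilon>"
        using Ev_dual[OF x(1,2,3) f e, folded x(4)] by (elim exE) (rule that)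
      show "\<exists>h. continuous_map (spectrum_top K1) euclideanreal h \<and>
          (\<forall>\<alpha>\<in>topspace (spectrum_top K1). \<bar>Ev absv \<alpha> z f - h (\<alpha> :: ('r, 's, 'k) coeff_series \<Rightarrow> real)\<bar> \<le> \<epsilon>)"
      proof (intro exI[of _ "\<lambda>\<alpha>. fmax m (\<lambda>j. r j * \<alpha> (ucomb f N (M j)))"] conjI)
        show "continuous_map (spectrum_top K1) euclideanreal
            (\<lambda>\<alpha> :: ('r, 's, 'k) coeff_series \<Rightarrow> real. fmax m (\<lambda>j. r j * \<alpha> (ucomb f N (M j))))"
          by (intro continuous_map_fmax continuous_map_real_mult continuous_map_const[THEN iffD2] continuous_map_spectrum_eval ucomb_carrier f)
            simp
      qed (use M in simp)
    qed
  qed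
qed

end

section \<open>The universal map\<close>

lemma bounded_alg_homD:
  assumes "bounded_alg_hom A B \<phi>"
  shows "f \<in> alg_carrier A \<Longrightarrow> \<phi> f \<in> alg_carrier B"
    and "f \<in> alg_carrier A \<Longrightarrow> g \<in> alg_carrier A \<Longrightarrow> \<phi> (f + g) = \<phi> f + \<phi> g"
    and "f \<in> alg_carrier A \<Longrightarrow> g \<in> alg_carrier A \<Longrightarrow> \<phi> (f * g) = \<phi> f * \<phi> g"
    and "\<phi> (alg_const A c) = alg_const B c"
  using assms by (auto simp: bounded_alg_hom_def)

lemma bounded_alg_hom_bound:
  assumes \<phi>: "bounded_alg_hom A B \<phi>" and A: "nonarch_algebra absv A"
  shows "\<exists>C\<ge>0. \<forall>f\<in>alg_carrier A. alg_norm B (\<phi> f) \<le> C * alg_norm A f"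
proof -
  obtain C where C: "\<forall>f\<in>alg_carrier A. alg_norm B (\<phi> f) \<le> C * alg_norm A f"
    using \<phi> unfolding bounded_alg_hom_def by (elim conjE exE) (rule that)
  have "alg_norm B (\<phi> f) \<le> max 0 C * alg_norm A f" if f: "f \<in> alg_carrier A" for f
  proof -
    have "C * alg_norm A f \<le> max 0 C * alg_norm A f"
      by (intro mult_right_mono nonarch_algebra.norm_nonneg[OF A f]) simp
    then show ?thesis using C f by fastforce
  qed
  then show ?thesis by (intro exI[of _ "max 0 C"]) simp
qed

lemma (in nonarch_algebra) bounded_alg_hom_sum:
  assumes \<phi>: "bounded_alg_hom A B \<phi>" and f: "\<And>a. a \<in> X \<Longrightarrow> f a \<in> alg_carrier A"
  shows "\<phi> (sum f X) = (\<Sum>a\<in>X. \<phi> (f a))"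
proof -
  have 0: "\<phi> 0 = 0" using bounded_alg_homD(2)[OF \<phi> carrier_0 carrier_0] by simp
  show ?thesis using f
  proof (induction X rule: infinite_finite_induct)
    case (insert a X)
    then show ?case using bounded_alg_homD(2)[OF \<phi>, of "f a" "sum f X"] by (simp add: carrier_sum)
  qed (simp_all add: 0)
qed

context complete_nonarch_field
begin

lemma K1_mtrunc: "f \<in> alg_carrier K1 \<Longrightarrow> mtrunc X f \<in> alg_carrier K1"
  by (rule tate_algebra.mtrunc_carrier[OF tate_ground]) simp

lemma K1_mmono: "mmono M \<in> alg_carrier K1"
  by (rule tate_algebra.mmono_carrier[OF tate_ground]) simp

text \<open>Agreement on the variables spreads to polynomials, and then to all series because
  polynomials are dense and both morphisms are bounded.\<close>

lemma bounded_alg_hom_eqI: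
  fixes \<phi> \<psi> :: "('v, 'k) mfps \<Rightarrow> 'b::comm_ring_1"
  assumes B: "nonarch_algebra absv B" and \<phi>: "bounded_alg_hom K1 B \<phi>" and \<psi>: "bounded_alg_hom K1 B \<psi>"
    and v: "\<And>v. \<phi> (mvar v) = \<psi> (mvar v)" and f: "f \<in> alg_carrier K1"
  shows "\<phi> f = \<psi> f"
proof -
  interpret B: nonarch_algebra absv B by (rule B)
  interpret A: nonarch_algebra absv "K1 :: ('k, ('v, 'k) mfps) normed_alg" by (rule nonarch_algebra_K1)
  have c: "\<phi> (mconst c) = \<psi> (mconst c)" for c
    using bounded_alg_homD(4)[OF \<phi>, of c] bounded_alg_homD(4)[OF \<psi>, of c] by simp
  have m: "\<phi> (mmono M) = \<psi> (mmono M)" for M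
  proof (induction M rule: exponent_induct)
    case zero
    show ?case using c[of 1] by simp
  next
    case (add M v)
    then show ?case
      by (simp add: mmono_add mmono_single v bounded_alg_homD(3)[OF \<phi>] bounded_alg_homD(3)[OF \<psi>] K1_mmono K1_mvar)
  qed
  have t: "\<phi> (mtrunc X f) = \<psi> (mtrunc X f)" if "finite X" for X
  proof -
    have cm: "mconst a * mmono M \<in> alg_carrier K1" for a :: 'k and M :: "'v \<Rightarrow>\<^sub>0 nat" by (intro A.carrier_mult K1_mconst K1_mmono)
    have "\<phi> (mconst a * mmono M) = \<psi> (mconst a * mmono M)" for a M
      by (simp add: bounded_alg_homD(3)[OF \<phi>] bounded_alg_homD(3)[OF \<psi>] K1_mmono K1_mconst c m)
    then show ?thesis
      unfolding mtrunc_eq_sum[OF that] A.bounded_alg_hom_sum[OF \<phi> cm] A.bounded_alg_hom_sum[OF \<psi> cm] by simp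
  qed
  obtain C where C: "0 \<le> C" "\<forall>f\<in>alg_carrier K1. alg_norm B (\<phi> f) \<le> C * alg_norm K1 f"
    using bounded_alg_hom_bound[OF \<phi> nonarch_algebra_K1] by (elim exE conjE) (rule that)
  obtain D where D: "0 \<le> D" "\<forall>f\<in>alg_carrier K1. alg_norm B (\<psi> f) \<le> D * alg_norm K1 f"
    using bounded_alg_hom_bound[OF \<psi> nonarch_algebra_K1] by (elim exE conjE) (rule that)
  define b where "b = \<phi> f - \<psi> f"
  have b: "b \<in> alg_carrier B" unfolding b_def by (intro B.carrier_diff bounded_alg_homD(1)[OF \<phi> f] bounded_alg_homD(1)[OF \<psi> f])
  have "alg_norm B b \<le> 0 + e" if e: "0 < e" for e
  proof -
    have e': "0 < e / (max C D + 1)" and r1: "0 < (1::real)" using e C(1) by simp_all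
    obtain X where X: "finite X" "\<And>Y. X \<subseteq> Y \<Longrightarrow> alg_norm K1 (f - mtrunc Y f) \<le> e / (max C D + 1)"
      using tate_algebra.mtrunc_approx[OF tate_ground[OF r1] f e'] by auto
    let ?d = "f - mtrunc X f"
    have d: "?d \<in> alg_carrier K1" by (intro A.carrier_diff K1_mtrunc f)
    have "\<phi> f = \<phi> (?d + mtrunc X f)" "\<psi> f = \<psi> (?d + mtrunc X f)" by simp_all
    then have "b = \<phi> ?d - \<psi> ?d"
      unfolding b_def bounded_alg_homD(2)[OF \<phi> d K1_mtrunc[OF f]] bounded_alg_homD(2)[OF \<psi> d K1_mtrunc[OF f]] t[OF X(1)] by simp
    then have "alg_norm B b \<le> max (alg_norm B (\<phi> ?d)) (alg_norm B (\<psi> ?d))"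
      using B.norm_diff[OF bounded_alg_homD(1)[OF \<phi> d] bounded_alg_homD(1)[OF \<psi> d]] by simp
    moreover have "alg_norm B (\<phi> ?d) \<le> C * alg_norm K1 ?d" "alg_norm B (\<psi> ?d) \<le> D * alg_norm K1 ?d" using C D d by auto
    moreover have "C * alg_norm K1 ?d \<le> max C D * alg_norm K1 ?d" "D * alg_norm K1 ?d \<le> max C D * alg_norm K1 ?d"
      by (intro mult_right_mono A.norm_nonneg d; simp)+
    moreover have "max C D * alg_norm K1 ?d \<le> max C D * (e / (max C D + 1))"
      using C(1) X(2)[OF order_refl] by (intro mult_left_mono) auto
    moreover have "max C D * (e / (max C D + 1)) \<le> e" using e C(1) by (simp add: field_simps)
    ultimately show ?thesis by linarith
  qed
  then have "alg_norm B b \<le> 0" by (rule field_le_epsilon)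
  then have "b = 0" using B.norm_nonneg[OF b] B.norm_eq_0[OF b] by simp
  then show ?thesis by (simp add: b_def)
qed

lemma usub_disk_series: "f \<in> alg_carrier K1 \<Longrightarrow> (usub f :: ('r::finite, _) mfps) \<in> disk_series K1"
  by (simp add: disk_series_def usub_carrier)

lemma bounded_alg_hom_usub:
  assumes "0 < \<rho>" "\<rho> < 1"
  shows "bounded_alg_hom K1 (tate K1 \<rho>) (usub :: ('s, 'k) mfps \<Rightarrow> ('r::finite, _) mfps)"
  unfolding bounded_alg_hom_def
proof (intro conjI ballI allI exI[of _ 1])
  fix c
  show "usub (alg_const K1 c :: ('s, 'k) mfps) = (alg_const (tate K1 \<rho>) c :: ('r, _) mfps)" by (simp add: usub_mconst)
qed (use assms in \<open>simp_all add: usub_carrier usub_add usub_mult\<close>)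

text \<open>The morphism with the prescribed values on the variables is unique by
  \<open>bounded_alg_hom_eqI\<close>, and \<open>usub\<close> provides it for all radii at once;
  this resolves the definite description of \<open>Phi\<close>.\<close>

lemma Phi_eq:
  "Phi absv = (\<lambda>p\<in>open_disk (mor_alg absv). \<lambda>f\<in>alg_carrier (closed_disk_alg absv).
     p (usub f :: ('r::finite, ('r, 's, 'k) coeff_series) mfps))"
  (is "_ = ?F")
  unfolding Phi_def
proof (rule the_equality)
  note defs = mor_alg_def closed_disk_alg_def
  have F: "?F (restrict x (disk_series (mor_alg absv))) = (\<lambda>f\<in>alg_carrier (closed_disk_alg absv). x (usub f))"
    if "\<rho> \<in> {0<..<1}" "x \<in> spectrum (tate (mor_alg absv) \<rho>)"
    for \<rho> :: real and x :: "('r, ('r, 's, 'k) coeff_series) mfps \<Rightarrow> real"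
  proof -
    have "restrict x (disk_series (mor_alg absv)) \<in> open_disk (mor_alg absv)" using that by (auto simp: open_disk_def)
    then show ?thesis using usub_disk_series unfolding defs by (auto simp: restrict_def fun_eq_iff)
  qed
  have "induced_map absv (mor_alg absv) (\<lambda>_. usub :: ('s, 'k) mfps \<Rightarrow> ('r, ('r, 's, 'k) coeff_series) mfps) ?F"
    unfolding induced_map_def
  proof (intro conjI ballI)
    fix \<rho> :: real assume "\<rho> \<in> {0<..<1}"
    then show "bounded_alg_hom (closed_disk_alg absv) (tate (mor_alg absv) \<rho>)
        (usub :: ('s, 'k) mfps \<Rightarrow> ('r, ('r, 's, 'k) coeff_series) mfps)"
      unfolding defs by (intro bounded_alg_hom_usub) auto
  qed (use F in auto)
  then show "?F \<in> extensional (open_disk (mor_alg absv)) \<and>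
    (\<exists>\<phi>. induced_map absv (mor_alg absv) \<phi> ?F \<and> (\<forall>\<rho>\<in>{0<..<1}. \<forall>l. \<phi> \<rho> (mvar l) = universal_series l))"
    by (intro conjI restrict_extensional exI[of _ "\<lambda>_. usub"] ballI allI usub_mvar)
  fix G :: "(('r, ('r, 's, 'k) coeff_series) mfps \<Rightarrow> real) \<Rightarrow> (('s, 'k) mfps \<Rightarrow> real)"
  assume G: "G \<in> extensional (open_disk (mor_alg absv)) \<and>
    (\<exists>\<phi>. induced_map absv (mor_alg absv) \<phi> G \<and> (\<forall>\<rho>\<in>{0<..<1}. \<forall>l. \<phi> \<rho> (mvar l) = universal_series l))"
  then obtain \<phi> where \<phi>: "induced_map absv (mor_alg absv) \<phi> G" "\<forall>\<rho>\<in>{0<..<1}. \<forall>l. \<phi> \<rho> (mvar l) = universal_series l"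
    by (elim conjE exE) (rule that)
  show "G = ?F"
  proof (rule extensionalityI)
    show "G \<in> extensional (open_disk (mor_alg absv))" using G by (rule conjunct1)
    fix p :: "('r, ('r, 's, 'k) coeff_series) mfps \<Rightarrow> real" assume p: "p \<in> open_disk (mor_alg absv)"
    then obtain \<rho> x where x: "\<rho> \<in> {0<..<1}" "x \<in> spectrum (tate (mor_alg absv) \<rho>)" "p = restrict x (disk_series (mor_alg absv))"
      by (auto simp: open_disk_def)
    have r: "0 < \<rho>" "\<rho> < 1" using x by auto
    have "\<phi> \<rho> f = usub f" if f: "f \<in> alg_carrier K1" for f
    proof (rule bounded_alg_hom_eqI[OF tate_algebra.nonarch_algebra_tate[OF tate_algebra_K1[OF r(1)]] _ bounded_alg_hom_usub[OF r] _ f])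
      show "bounded_alg_hom K1 (tate K1 \<rho>) (\<phi> \<rho>)" using \<phi>(1) x(1) by (simp add: induced_map_def defs)
      show "\<phi> \<rho> (mvar v) = usub (mvar v)" for v using \<phi>(2) x(1) by (simp add: usub_mvar)
    qed
    moreover have "G p = (\<lambda>f\<in>alg_carrier (closed_disk_alg absv). x (\<phi> \<rho> f))"
      using \<phi>(1) x by (simp add: induced_map_def)
    ultimately show "G p = ?F p" unfolding x(3) F[OF x(1,2)] by (simp add: closed_disk_alg_def cong: restrict_cong)
  qed (rule restrict_extensional)
qed

end

section \<open>Rigid points\<close>

context complete_nonarch_field
begin

context
  fixes \<alpha> :: "('v, 'k) mfps \<Rightarrow> real"
  assumes \<alpha>: "\<alpha> \<in> spectrum K1"
begin

interpretation A: nonarch_algebra absv "K1 :: ('k, ('v, 'k) mfps) normed_alg" by (rule nonarch_algebra_K1)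

text \<open>If k fills the completed residue field, the class of the constant sequence g is the
  class of some constant c, and then g - c has value 0.\<close>

lemma rigid_imp_values:
  assumes "rigid K1 \<alpha>" and g: "g \<in> alg_carrier K1"
  shows "\<exists>c. \<alpha> (g - mconst c) = 0"
proof -
  let ?k = "\<lambda>c. completion_rel K1 \<alpha> `` {\<lambda>_. (mconst c, 1)}"
  have bij: "bij_betw ?k UNIV (cauchy_fractions K1 \<alpha> // completion_rel K1 \<alpha>)"
    using assms(1) by (simp add: rigid_def ring_iso_def ground_ring_def residue_field_def)
  let ?u = "\<lambda>_::nat. (g, 1 :: ('v, 'k) mfps)"
  have u: "?u \<in> cauchy_fractions K1 \<alpha>"
    using g A.carrier_1 A.spec_1[OF \<alpha>] A.spec_0[OF \<alpha>] by (simp add: cauchy_fractions_def fractions_def frac_dist_def)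
  then have uu: "(?u, ?u) \<in> completion_rel K1 \<alpha>"
    using A.spec_0[OF \<alpha>] by (simp add: completion_rel_def frac_dist_def)
  have "completion_rel K1 \<alpha> `` {?u} \<in> range ?k" using bij u by (auto simp: bij_betw_def intro: quotientI)
  then obtain c where "completion_rel K1 \<alpha> `` {?u} = ?k c" by auto
  then have "?u \<in> ?k c" using uu by blast
  then have "(\<lambda>n. frac_dist \<alpha> (mconst c, 1) (g, 1)) \<longlonglongrightarrow> 0" by (simp add: completion_rel_def)
  then have "\<alpha> (mconst c - g) = 0" by (simp add: frac_dist_def A.spec_1[OF \<alpha>] LIMSEQ_const_iff)
  then show ?thesis using A.spec_minus[OF \<alpha> A.carrier_diff[OF K1_mconst g], of c] by (intro exI[of _ c]) simp
qed

section \<open>The character with values in k and the completed residue field\<close>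

context
  fixes \<theta> assumes \<theta>: "\<forall>g\<in>alg_carrier K1. \<alpha> (g - mconst (\<theta> g)) = 0"
begin

lemmas theta_val = \<theta>[rule_format]

text \<open>Two candidates differ by a constant of value 0. This uniqueness makes \<theta> a ring
  morphism, with \<open>absv (\<theta> g) = \<alpha> g\<close>.\<close>

lemma chi_eq: "g \<in> alg_carrier K1 \<Longrightarrow> \<alpha> (g - mconst c) = 0 \<Longrightarrow> \<theta> g = c"
proof -
  assume g: "g \<in> alg_carrier K1" and c: "\<alpha> (g - mconst c) = 0"
  have "absv (\<theta> g - c) = \<alpha> ((g - mconst c) - (g - mconst (\<theta> g)))"
    using spec_mconst[OF \<alpha>, of "\<theta> g - c"] by (simp add: mconst_diff)
  also have "\<dots> \<le> max (\<alpha> (g - mconst c)) (\<alpha> (g - mconst (\<theta> g)))"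
    by (intro A.spec_diff[OF \<alpha>] A.carrier_diff g K1_mconst)
  finally show ?thesis using c theta_val[OF g] absv_nonneg[of "\<theta> g - c"] by (simp add: absv_eq_0_iff)
qed

lemma chi_mconst: "\<theta> (mconst c) = c"
  using A.spec_0[OF \<alpha>] by (intro chi_eq K1_mconst) simp

lemma chi_add: "f \<in> alg_carrier K1 \<Longrightarrow> g \<in> alg_carrier K1 \<Longrightarrow> \<theta> (f + g) = \<theta> f + \<theta> g"
proof -
  assume f: "f \<in> alg_carrier K1" and g: "g \<in> alg_carrier K1"
  have "\<alpha> ((f - mconst (\<theta> f)) + (g - mconst (\<theta> g))) \<le> max (\<alpha> (f - mconst (\<theta> f))) (\<alpha> (g - mconst (\<theta> g)))"
    by (intro A.spec_add[OF \<alpha>] A.carrier_diff f g K1_mconst)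
  moreover have "(f - mconst (\<theta> f)) + (g - mconst (\<theta> g)) = f + g - mconst (\<theta> f + \<theta> g)" by (simp add: mconst_add)
  moreover have "0 \<le> \<alpha> (f + g - mconst (\<theta> f + \<theta> g))" by (intro A.spec_nonneg[OF \<alpha>] A.carrier_diff A.carrier_add f g K1_mconst)
  ultimately show ?thesis using theta_val[OF f] theta_val[OF g] by (intro chi_eq A.carrier_add f g) simp
qed

lemma chi_mult: "f \<in> alg_carrier K1 \<Longrightarrow> g \<in> alg_carrier K1 \<Longrightarrow> \<theta> (f * g) = \<theta> f * \<theta> g"
proof -
  assume f: "f \<in> alg_carrier K1" and g: "g \<in> alg_carrier K1"
  have df: "f - mconst (\<theta> f) \<in> alg_carrier K1" "g - mconst (\<theta> g) \<in> alg_carrier K1" by (intro A.carrier_diff f g K1_mconst)+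
  have "\<alpha> ((f - mconst (\<theta> f)) * g + mconst (\<theta> f) * (g - mconst (\<theta> g)))
      \<le> max (\<alpha> ((f - mconst (\<theta> f)) * g)) (\<alpha> (mconst (\<theta> f) * (g - mconst (\<theta> g))))"
    by (intro A.spec_add[OF \<alpha>] A.carrier_mult df g K1_mconst)
  also have "\<dots> = 0" by (simp add: A.spec_mult[OF \<alpha>] df g K1_mconst theta_val f)
  finally have "\<alpha> ((f - mconst (\<theta> f)) * g + mconst (\<theta> f) * (g - mconst (\<theta> g))) \<le> 0" .
  moreover have "(f - mconst (\<theta> f)) * g + mconst (\<theta> f) * (g - mconst (\<theta> g)) = f * g - mconst (\<theta> f * \<theta> g)"
    by (simp add: mconst_mult algebra_simps)
  moreover have "0 \<le> \<alpha> (f * g - mconst (\<theta> f * \<theta> g))" by (intro A.spec_nonneg[OF \<alpha>] A.carrier_diff A.carrier_mult f g K1_mconst)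
  ultimately show ?thesis by (intro chi_eq A.carrier_mult f g) simp
qed

lemma absv_chi: "g \<in> alg_carrier K1 \<Longrightarrow> absv (\<theta> g) = \<alpha> g"
  using A.spec_abs_diff[OF \<alpha> _ K1_mconst, of g "\<theta> g"] theta_val[of g] spec_mconst[OF \<alpha>, of "\<theta> g"] by simp

lemma chi_minus: "g \<in> alg_carrier K1 \<Longrightarrow> \<theta> (- g) = - \<theta> g"
proof -
  assume "g \<in> alg_carrier K1"
  from chi_mult[OF K1_mconst[of "- 1"] this] have "\<theta> (mconst (- 1) * g) = - \<theta> g" by (simp add: chi_mconst)
  moreover have "mconst (- 1) * g = - g" by (simp add: mconst_minus)
  ultimately show ?thesis by simp
qed

lemma chi_diff: "f \<in> alg_carrier K1 \<Longrightarrow> g \<in> alg_carrier K1 \<Longrightarrow> \<theta> (f - g) = \<theta> f - \<theta> g"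
  using chi_add[OF _ A.carrier_minus, of f g] by (simp add: chi_minus)

lemma chi_0: "\<theta> 0 = 0" and chi_1: "\<theta> 1 = 1"
  using chi_mconst[of 0] chi_mconst[of 1] by simp_all

lemma chi_sum: "(\<And>a. a \<in> X \<Longrightarrow> f a \<in> alg_carrier K1) \<Longrightarrow> \<theta> (sum f X) = (\<Sum>a\<in>X. \<theta> (f a))"
proof (induction X rule: infinite_finite_induct)
  case (insert a X)
  then show ?case by (simp add: chi_add A.carrier_sum)
qed (simp_all add: chi_0)

text \<open>A Cauchy sequence of fractions \<open>f\<^sub>n/g\<^sub>n\<close> is
  equivalent to the constant sequence given by the limit of \<open>\<theta> f\<^sub>n / \<theta> g\<^sub>n\<close>.\<close>

definition fval :: "('v, 'k) mfps \<times> ('v, 'k) mfps \<Rightarrow> 'k" where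
  "fval p = \<theta> (fst p) / \<theta> (snd p)"

lemma fractions_iff: "p \<in> fractions K1 \<alpha> \<longleftrightarrow> fst p \<in> alg_carrier K1 \<and> snd p \<in> alg_carrier K1 \<and> \<theta> (snd p) \<noteq> 0"
  using absv_chi[of "snd p"] by (cases p) (auto simp: fractions_def absv_eq_0_iff[symmetric])

lemma frac_dist_eq:
  assumes "p \<in> fractions K1 \<alpha>" "q \<in> fractions K1 \<alpha>"
  shows "frac_dist \<alpha> p q = absv (fval p - fval q)"
proof -
  have pq: "fst p \<in> alg_carrier K1" "snd p \<in> alg_carrier K1" "\<theta> (snd p) \<noteq> 0"
    "fst q \<in> alg_carrier K1" "snd q \<in> alg_carrier K1" "\<theta> (snd q) \<noteq> 0"
    using assms by (simp_all add: fractions_iff)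
  have "frac_dist \<alpha> p q = absv (\<theta> (fst p) * \<theta> (snd q) - \<theta> (fst q) * \<theta> (snd p)) / (absv (\<theta> (snd p)) * absv (\<theta> (snd q)))"
    using pq by (simp add: frac_dist_def case_prod_beta absv_chi[symmetric] chi_diff chi_mult A.carrier_mult A.carrier_diff)
  also have "\<dots> = absv (fval p - fval q)"
    using pq by (simp add: fval_def absv_mult[symmetric] absv_divide[symmetric] diff_frac_eq)
  finally show ?thesis .
qed

lemma fval_mult:
  assumes "p \<in> fractions K1 \<alpha>" "q \<in> fractions K1 \<alpha>"
  shows "frac_mult p q \<in> fractions K1 \<alpha>" "fval (frac_mult p q) = fval p * fval q"
  using assms by (simp_all add: fractions_iff frac_mult_def fval_def case_prod_beta chi_mult A.carrier_mult)

lemma fval_add: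
  assumes "p \<in> fractions K1 \<alpha>" "q \<in> fractions K1 \<alpha>"
  shows "frac_add p q \<in> fractions K1 \<alpha>" "fval (frac_add p q) = fval p + fval q"
  using assms
  by (simp_all add: fractions_iff frac_add_def fval_def case_prod_beta chi_mult chi_add A.carrier_mult A.carrier_add add_frac_eq)

definition flim :: "(nat \<Rightarrow> ('v, 'k) mfps \<times> ('v, 'k) mfps) \<Rightarrow> 'k \<Rightarrow> bool" where
  "flim u l \<longleftrightarrow> (\<forall>n. u n \<in> fractions K1 \<alpha>) \<and> (\<lambda>n. absv (fval (u n) - l)) \<longlonglongrightarrow> 0"

lemma flim_const: "flim (\<lambda>_. (mconst c, 1)) c"
  by (simp add: flim_def fractions_iff K1_mconst A.carrier_1 chi_1 fval_def chi_mconst)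

lemma null_add:
  assumes "(\<lambda>n. absv (a n)) \<longlonglongrightarrow> 0" "(\<lambda>n. absv (b n)) \<longlonglongrightarrow> 0" shows "(\<lambda>n. absv (a n + b n)) \<longlonglongrightarrow> 0"
proof (rule tendsto_sandwich[OF _ _ tendsto_const])
  show "\<forall>\<^sub>F n in sequentially. absv (a n + b n) \<le> absv (a n) + absv (b n)"
  proof (rule always_eventually, rule allI)
    fix n show "absv (a n + b n) \<le> absv (a n) + absv (b n)"
      using absv_ultrametric[of "a n" "b n"] absv_nonneg[of "a n"] absv_nonneg[of "b n"] by linarith
  qed
  show "(\<lambda>n. absv (a n) + absv (b n)) \<longlonglongrightarrow> 0" using tendsto_add[OF assms] by simp
qed (simp add: absv_nonneg)

lemma flim_unique:
  assumes "flim u l" "flim u m" shows "l = m"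
proof -
  have "(\<lambda>n. absv (- (fval (u n) - l))) \<longlonglongrightarrow> 0" using assms(1) by (simp only: flim_def absv_minus)
  moreover have "(\<lambda>n. absv (fval (u n) - m)) \<longlonglongrightarrow> 0" using assms(2) by (simp add: flim_def)
  ultimately have "(\<lambda>n. absv (- (fval (u n) - l) + (fval (u n) - m))) \<longlonglongrightarrow> 0" by (rule null_add)
  then have "absv (l - m) = 0" by (simp add: LIMSEQ_const_iff)
  then show ?thesis by (simp add: absv_eq_0_iff)
qed

lemma flim_add:
  assumes "flim u l" "flim v m" shows "flim (\<lambda>n. frac_add (u n) (v n)) (l + m)"
proof -
  have f: "u n \<in> fractions K1 \<alpha>" "v n \<in> fractions K1 \<alpha>" for n using assms by (simp_all add: flim_def)
  have "(\<lambda>n. absv ((fval (u n) - l) + (fval (v n) - m))) \<longlonglongrightarrow> 0"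
    using assms by (intro null_add) (simp_all add: flim_def)
  moreover have "(fval (u n) - l) + (fval (v n) - m) = fval (frac_add (u n) (v n)) - (l + m)" for n
    by (simp add: fval_add f)
  ultimately show ?thesis by (simp add: flim_def fval_add(1) f)
qed

lemma flim_mult:
  assumes "flim u l" "flim v m" shows "flim (\<lambda>n. frac_mult (u n) (v n)) (l * m)"
proof -
  have f: "u n \<in> fractions K1 \<alpha>" "v n \<in> fractions K1 \<alpha>" for n using assms by (simp_all add: flim_def)
  let ?a = "\<lambda>n. fval (u n) - l" and ?b = "\<lambda>n. fval (v n) - m"
  have a: "(\<lambda>n. absv (?a n)) \<longlonglongrightarrow> 0" and b: "(\<lambda>n. absv (?b n)) \<longlonglongrightarrow> 0" using assms by (simp_all add: flim_def)
  have "(\<lambda>n. absv (?a n * ?b n)) \<longlonglongrightarrow> 0" using tendsto_mult[OF a b] by (simp add: absv_mult)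
  moreover have "(\<lambda>n. absv (l * ?b n)) \<longlonglongrightarrow> 0" using tendsto_mult[OF tendsto_const[of "absv l"] b] by (simp add: absv_mult)
  moreover have "(\<lambda>n. absv (m * ?a n)) \<longlonglongrightarrow> 0" using tendsto_mult[OF tendsto_const[of "absv m"] a] by (simp add: absv_mult)
  ultimately have "(\<lambda>n. absv (?a n * ?b n + l * ?b n + m * ?a n)) \<longlonglongrightarrow> 0" by (intro null_add)
  moreover have "?a n * ?b n + l * ?b n + m * ?a n = fval (frac_mult (u n) (v n)) - l * m" for n
    by (simp add: fval_mult f algebra_simps)
  ultimately show ?thesis by (simp add: flim_def fval_mult(1) f)
qed

text \<open>Through \<open>fval\<close> the distance of fractions is the distance in k, so Cauchy
  sequences of fractions converge by completeness of k.\<close>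

lemma cauchy_fractions_iff: "u \<in> cauchy_fractions K1 \<alpha> \<longleftrightarrow> (\<exists>l. flim u l)"
proof
  assume u: "u \<in> cauchy_fractions K1 \<alpha>"
  then have f: "\<forall>n. u n \<in> fractions K1 \<alpha>" by (simp add: cauchy_fractions_def)
  have "\<exists>l. (\<lambda>n. absv (fval (u n) - l)) \<longlonglongrightarrow> 0"
  proof (rule absv_complete)
    fix \<epsilon> :: real assume "0 < \<epsilon>"
    then show "\<exists>N. \<forall>m\<ge>N. \<forall>n\<ge>N. absv (fval (u m) - fval (u n)) < \<epsilon>"
      using u f by (simp add: cauchy_fractions_def frac_dist_eq)
  qed
  then show "\<exists>l. flim u l" using f by (simp add: flim_def)
next
  assume "\<exists>l. flim u l"
  then obtain l where "flim u l" by (rule exE)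
  then have f: "\<forall>n. u n \<in> fractions K1 \<alpha>" and l: "(\<lambda>n. absv (fval (u n) - l)) \<longlonglongrightarrow> 0" by (simp_all add: flim_def)
  have "\<exists>N. \<forall>m\<ge>N. \<forall>n\<ge>N. frac_dist \<alpha> (u m) (u n) < \<epsilon>" if e: "0 < \<epsilon>" for \<epsilon>
  proof -
    obtain N where N: "\<forall>n\<ge>N. absv (fval (u n) - l) < \<epsilon>"
      using order_tendstoD(2)[OF l e] unfolding eventually_sequentially by (rule exE)
    show ?thesis
    proof (intro exI[of _ N] allI impI)
      fix m n assume mn: "N \<le> m" "N \<le> n"
      have "absv ((fval (u m) - l) - (fval (u n) - l)) \<le> max (absv (fval (u m) - l)) (absv (fval (u n) - l))" by (rule absv_diff)
      then show "frac_dist \<alpha> (u m) (u n) < \<epsilon>" using N mn f by (simp add: frac_dist_eq) (smt (verit))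
    qed
  qed
  then show "u \<in> cauchy_fractions K1 \<alpha>" using f by (simp add: cauchy_fractions_def)
qed

lemma completion_class: "flim u l \<Longrightarrow> completion_rel K1 \<alpha> `` {u} = {v. flim v l}"
proof -
  assume u: "flim u l"
  then have uf: "\<forall>n. u n \<in> fractions K1 \<alpha>" by (simp add: flim_def)
  have "(\<lambda>n. frac_dist \<alpha> (u n) (v n)) \<longlonglongrightarrow> 0 \<longleftrightarrow> l = m" if v: "flim v m" for v m
  proof -
    have vf: "\<forall>n. v n \<in> fractions K1 \<alpha>" using v by (simp add: flim_def)
    have d: "frac_dist \<alpha> (u n) (v n) = absv (fval (u n) - fval (v n))" for n using uf vf by (simp add: frac_dist_eq)
    have un: "(\<lambda>n. absv (fval (u n) - l)) \<longlonglongrightarrow> 0" and vn: "(\<lambda>n. absv (- (fval (v n) - m))) \<longlonglongrightarrow> 0"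
      using u v by (simp_all add: flim_def absv_diff_commute)
    show ?thesis unfolding d
    proof
      assume "l = m"
      then show "(\<lambda>n. absv (fval (u n) - fval (v n))) \<longlonglongrightarrow> 0" using null_add[OF un vn] by simp
    next
      assume "(\<lambda>n. absv (fval (u n) - fval (v n))) \<longlonglongrightarrow> 0"
      moreover have "(\<lambda>n. absv (fval (v n) - m)) \<longlonglongrightarrow> 0" using v by (simp add: flim_def)
      ultimately have "(\<lambda>n. absv ((fval (u n) - fval (v n)) + (fval (v n) - m))) \<longlonglongrightarrow> 0" by (rule null_add)
      then have "flim u m" using uf by (simp add: flim_def)
      with u show "l = m" by (rule flim_unique)
    qed
  qed
  then show ?thesis using u by (auto simp: completion_rel_def cauchy_fractions_iff)
qed

text \<open>An element of the completion is the set of all sequences of fractions with a given limit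
  in k; in this description addition and multiplication are those of limits.\<close>

lemma values_imp_rigid: "rigid K1 \<alpha>"
proof -
  let ?k = "\<lambda>c. completion_rel K1 \<alpha> `` {\<lambda>_. (mconst c, 1)}"
  have k: "?k c = {v. flim v c}" for c by (rule completion_class[OF flim_const])
  \<comment> \<open>The operations of \<open>residue_field\<close> are unions over all
    representatives; each pair of representatives contributes the same class.\<close>
  have op: "(\<Union>u\<in>{v. flim v c}. \<Union>v\<in>{v. flim v d}. completion_rel K1 \<alpha> `` {\<lambda>n. h (u n) (v n)}) = {v. flim v (e c d)}"
    if "\<And>u v. flim u c \<Longrightarrow> flim v d \<Longrightarrow> flim (\<lambda>n. h (u n) (v n)) (e c d)" for c d h e
  proof -
    have "completion_rel K1 \<alpha> `` {\<lambda>n. h (u n) (v n)} = {v. flim v (e c d)}" if "flim u c" "flim v d" for u v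
      by (rule completion_class) (rule \<open>\<And>u v. flim u c \<Longrightarrow> flim v d \<Longrightarrow> flim (\<lambda>n. h (u n) (v n)) (e c d)\<close>[OF that])
    then show ?thesis using flim_const[of c] flim_const[of d] by auto
  qed
  have "?k \<in> Ring.ring_hom ground_ring (residue_field K1 \<alpha>)"
  proof (rule ring_hom_memI)
    fix c d
    have "(\<lambda>_. (mconst c, 1)) \<in> cauchy_fractions K1 \<alpha>" using flim_const[of c] by (auto simp: cauchy_fractions_iff)
    then show "?k c \<in> carrier (residue_field K1 \<alpha>)" by (simp add: residue_field_def quotientI)
    show "?k (c \<otimes>\<^bsub>ground_ring\<^esub> d) = ?k c \<otimes>\<^bsub>residue_field K1 \<alpha>\<^esub> ?k d"
      unfolding k by (simp add: ground_ring_def residue_field_def op[of c d frac_mult "(*)", OF flim_mult])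
    show "?k (c \<oplus>\<^bsub>ground_ring\<^esub> d) = ?k c \<oplus>\<^bsub>residue_field K1 \<alpha>\<^esub> ?k d"
      unfolding k by (simp add: ground_ring_def residue_field_def op[of c d frac_add "(+)", OF flim_add])
  next
    show "?k \<one>\<^bsub>ground_ring\<^esub> = \<one>\<^bsub>residue_field K1 \<alpha>\<^esub>" by (simp add: ground_ring_def residue_field_def)
  qed
  moreover have "bij_betw ?k (carrier ground_ring) (carrier (residue_field K1 \<alpha>))"
  proof (rule bij_betw_imageI)
    show "inj_on ?k (carrier ground_ring)"
    proof (rule inj_onI)
      fix c d assume "?k c = ?k d"
      then have "{v. flim v c} = {v. flim v d}" unfolding k .
      then have "flim (\<lambda>_. (mconst c, 1)) d" using flim_const[of c] by blast
      with flim_const show "c = d" by (rule flim_unique)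
    qed
    show "?k ` carrier ground_ring = carrier (residue_field K1 \<alpha>)"
    proof (rule antisym)
      have "(\<lambda>_. (mconst c, 1)) \<in> cauchy_fractions K1 \<alpha>" for c using flim_const[of c] by (auto simp: cauchy_fractions_iff)
      then show "?k ` carrier ground_ring \<subseteq> carrier (residue_field K1 \<alpha>)" by (auto simp: residue_field_def quotientI)
      show "carrier (residue_field K1 \<alpha>) \<subseteq> ?k ` carrier ground_ring"
      proof
        fix X assume "X \<in> carrier (residue_field K1 \<alpha>)"
        then have "X \<in> cauchy_fractions K1 \<alpha> // completion_rel K1 \<alpha>" by (simp add: residue_field_def)
        then obtain u where u: "u \<in> cauchy_fractions K1 \<alpha>" "X = completion_rel K1 \<alpha> `` {u}" by (rule quotientE)
        then obtain l where "flim u l" unfolding cauchy_fractions_iff by (elim exE)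
        then have "X = ?k l" unfolding k u(2) by (rule completion_class)
        then show "X \<in> ?k ` carrier ground_ring" by (simp add: ground_ring_def)
      qed
    qed
  qed
  ultimately show ?thesis using \<alpha> unfolding rigid_def ring_iso_def by simp
qed

end
end
end

section \<open>Evaluation at rigid points\<close>

context complete_nonarch_field
begin

context
  fixes \<alpha> :: "('v, 'k) mfps \<Rightarrow> real" and \<theta>
  assumes \<alpha>: "\<alpha> \<in> spectrum K1" and \<theta>: "\<forall>g\<in>alg_carrier K1. \<alpha> (g - mconst (\<theta> g)) = 0"
begin

interpretation A: nonarch_algebra absv "K1 :: ('k, ('v, 'k) mfps) normed_alg" by (rule nonarch_algebra_K1)

text \<open>Since \<open>absv (\<theta> g) = \<alpha> g\<close> is at most the norm of g, reduction
  of coefficients increases no term.\<close>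

lemma mmap_theta:
  assumes "0 < \<rho>" and F: "F \<in> alg_carrier (tate K1 \<rho>)"
  shows "mmap \<theta> F \<in> alg_carrier (tate (ground absv) \<rho>)"
    "alg_norm (tate (ground absv) \<rho>) (mmap \<theta> F) \<le> alg_norm (tate K1 \<rho>) F"
proof -
  interpret D: tate_algebra absv "K1 :: ('k, ('v, 'k) mfps) normed_alg" \<rho> by (rule tate_algebra_K1[OF assms(1)])
  interpret E: tate_algebra absv "ground absv" \<rho> by (rule tate_ground[OF assms(1)])
  have le: "E.tnorm (mmap \<theta> F) I \<le> D.tnorm F I" for I
    unfolding E.tnorm_def D.tnorm_def using D.coeff_carrier[OF F, of I] assms(1)
    by (intro mult_right_mono) (simp_all add: absv_chi[OF \<alpha> \<theta>] A.spec_le_norm[OF \<alpha>])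
  have "finite {I. \<epsilon> < E.tnorm (mmap \<theta> F) I}" if "0 < \<epsilon>" for \<epsilon>
  proof (rule finite_subset)
    show "{I. \<epsilon> < E.tnorm (mmap \<theta> F) I} \<subseteq> {I. \<epsilon> < D.tnorm F I}" by (intro Collect_mono impI) (rule less_le_trans[OF _ le])
    show "finite {I. \<epsilon> < D.tnorm F I}" using F that by (simp add: D.carrier_iff)
  qed
  then show "mmap \<theta> F \<in> alg_carrier (tate (ground absv) \<rho>)" by (simp add: E.carrier_iff)
  show "alg_norm (tate (ground absv) \<rho>) (mmap \<theta> F) \<le> alg_norm (tate K1 \<rho>) F"
    by (rule E.norm_leI) (rule order_trans[OF le D.tnorm_le[OF F]])
qed

lemma mmap_theta_hom:
  assumes "0 < \<rho>" shows "bounded_alg_hom (tate K1 \<rho>) (tate (ground absv) \<rho>) (mmap \<theta> :: ('w, ('v, 'k) mfps) mfps \<Rightarrow> _)"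
proof -
  interpret D: tate_algebra absv "K1 :: ('k, ('v, 'k) mfps) normed_alg" \<rho> by (rule tate_algebra_K1[OF assms(1)])
  show ?thesis unfolding bounded_alg_hom_def
  proof (intro conjI ballI allI exI[of _ 1])
    fix F G :: "('w, ('v, 'k) mfps) mfps" assume F: "F \<in> alg_carrier (tate K1 \<rho>)" and G: "G \<in> alg_carrier (tate K1 \<rho>)"
    show "mmap \<theta> (F + G) = mmap \<theta> F + mmap \<theta> G"
      by (rule mfps_eqI) (simp add: chi_add[OF \<alpha> \<theta>] D.coeff_carrier F G)
    show "mmap \<theta> (F * G) = mmap \<theta> F * mmap \<theta> G"
      by (rule mfps_eqI) (simp add: mcoeff_times chi_sum[OF \<alpha> \<theta>] chi_mult[OF \<alpha> \<theta>] D.coeff_carrier F G A.carrier_mult)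
  next
    fix c
    show "mmap \<theta> (alg_const (tate K1 \<rho>) c :: ('w, ('v, 'k) mfps) mfps) = alg_const (tate (ground absv) \<rho>) c"
      by (rule mfps_eqI) (simp add: mcoeff_mconst chi_mconst[OF \<alpha> \<theta>] chi_0[OF \<alpha> \<theta>])
  qed (use assms in \<open>simp_all add: mmap_theta\<close>)
qed

end

lemma spectrum_comp:
  assumes A: "nonarch_algebra absv A" and B: "nonarch_algebra absv B" and x: "x \<in> spectrum B" and \<phi>: "bounded_alg_hom A B \<phi>"
  shows "(\<lambda>f\<in>alg_carrier A. x (\<phi> f)) \<in> spectrum A"
proof -
  interpret A: nonarch_algebra absv A by (rule A)
  interpret B: nonarch_algebra absv B by (rule B)
  note h = bounded_alg_homD[OF \<phi>]
  obtain C where C: "0 \<le> C" "\<forall>f\<in>alg_carrier A. alg_norm B (\<phi> f) \<le> C * alg_norm A f"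
    using bounded_alg_hom_bound[OF \<phi> A] by (elim exE conjE) (rule that)
  have "x (\<phi> f) \<le> C * alg_norm A f" if f: "f \<in> alg_carrier A" for f
    using B.spec_le_norm[OF x h(1)[OF f]] C(2) f by fastforce
  then have bd: "\<exists>C. \<forall>f\<in>alg_carrier A. (\<lambda>f\<in>alg_carrier A. x (\<phi> f)) f \<le> C * alg_norm A f" by (intro exI[of _ C]) simp
  have 1: "\<phi> 1 = 1" and 0: "\<phi> 0 = 0" using h(4)[of 1] h(4)[of 0] by (simp_all add: A.const_1 B.const_1 A.const_0 B.const_0)
  show ?thesis unfolding spectrum_def
    using bd by (simp add: A.carrier_0 A.carrier_1 0 1 B.spec_0[OF x] B.spec_1[OF x] B.spec_nonneg[OF x] h A.carrier_add A.carrier_mult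
      B.spec_subadd[OF x] B.spec_mult[OF x])
qed

end

context alg_closed_nonarch_field
begin

context
  fixes \<alpha> :: "('s \<times> ('r::finite \<Rightarrow>\<^sub>0 nat), 'k) mfps \<Rightarrow> real" and \<theta>
  assumes \<alpha>: "\<alpha> \<in> spectrum K1" and \<theta>: "\<forall>g\<in>alg_carrier K1. \<alpha> (g - mconst (\<theta> g)) = 0"
begin

interpretation M: nonarch_algebra absv "K1 :: ('k, ('r, 's, 'k) coeff_series) normed_alg" by (rule nonarch_algebra_K1)

text \<open>For truncations the identity holds at each w: the value of \<alpha> at
  \<open>ucomb f N (wprod w)\<close> is the absolute value at w of the truncated series h. Both
  sides are approximated by truncations with errors decaying like
  \<open>\<rho>' ^ N\<close>.\<close>

lemma Ev_rigid:
  fixes f :: "('s, 'k) mfps" and x :: "('r, 'k) mfps \<Rightarrow> real"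
  assumes r: "0 < \<rho>" "\<rho> < 1" and x: "x \<in> spectrum (tate (ground absv) \<rho>)" and f: "f \<in> alg_carrier K1"
  shows "Ev absv \<alpha> (restrict x (disk_series (ground absv))) f = x (mmap \<theta> (usub f))"
proof -
  define \<rho>' where "\<rho>' = (1 + \<rho>) / 2"
  have r': "\<rho> < \<rho>'" "\<rho>' < 1" "0 < \<rho>'" using r by (simp_all add: \<rho>'_def)
  define z where "z = restrict x (disk_series (ground absv))"
  interpret T: tate_algebra absv "ground absv" \<rho> by (rule tate_ground[OF r(1)])
  interpret D: nonarch_algebra absv "tate (ground absv) \<rho> :: ('k, ('r, 'k) mfps) normed_alg" by (rule T.nonarch_algebra_tate)
  define B where "B = alg_norm K1 f"
  define h where "h = mmap \<theta> (usub f :: ('r, _) mfps)"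
  have h: "h \<in> alg_carrier (tate (ground absv) \<rho>)" unfolding h_def by (rule mmap_theta(1)[OF \<alpha> \<theta> r(1) usub_carrier(1)[OF f r]])
  define t where "t N = mtrunc {I. mdeg I \<le> N} h" for N
  have t: "t N \<in> polys" for N unfolding t_def by (rule mtrunc_polys[OF finite_mdeg_le])
  have hb: "absv (mcoeff h I) \<le> B" for I
    unfolding h_def mcoeff_mmap absv_chi[OF \<alpha> \<theta> usub_coeff(1)[OF f]] B_def
    by (rule order_trans[OF M.spec_le_norm[OF \<alpha> usub_coeff(1)[OF f]] usub_coeff(2)[OF f]])
  have B0: "0 \<le> B" by (simp add: B_def K1_norm_nonneg[OF f])
  have ev: "\<forall>\<^sub>F w in rigid_near absv z. \<bar>\<alpha> (usub_at w f) - absv (peval w (t N))\<bar> \<le> B * \<rho>' ^ N" for N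
    using eventually_small[OF \<alpha> r(1) r'(1,2) x z_def]
  proof eventually_elim
    case (elim w)
    note fw = f r'(3,2) elim[rule_format]
    have "absv (peval w (t N)) = \<alpha> (ucomb f N (wprod w))"
    proof -
      have "t N = (\<Sum>I\<in>{I. mdeg I \<le> N}. mconst (mcoeff h I) * mmono I)" unfolding t_def by (rule mtrunc_eq_sum[OF finite_mdeg_le])
      then have "peval w (t N) = (\<Sum>I\<in>{I. mdeg I \<le> N}. wprod w I * \<theta> (mcoeff (usub f) I))"
        by (simp add: peval_sum peval_mult polys_mult polys_mconst polys_mmono h_def mult.commute)
      also have "\<dots> = \<theta> (ucomb f N (wprod w))"
        unfolding ucomb_def
        by (simp add: chi_sum[OF \<alpha> \<theta>] chi_mult[OF \<alpha> \<theta>] chi_mconst[OF \<alpha> \<theta>] K1_mconst usub_coeff(1)[OF f] M.carrier_mult)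
      finally show ?thesis using absv_chi[OF \<alpha> \<theta> ucomb_carrier[OF f]] by simp
    qed
    moreover have "\<bar>\<alpha> (usub_at w f) - \<alpha> (ucomb f N (wprod w))\<bar> \<le> B * \<rho>' ^ N"
      unfolding B_def
      by (rule order_trans[OF M.spec_abs_diff[OF \<alpha> usub_at_carrier[OF fw] ucomb_carrier[OF f]]
        order_trans[OF M.spec_le_norm[OF \<alpha> M.carrier_diff[OF usub_at_carrier[OF fw] ucomb_carrier[OF f]]] usub_at_approx[OF fw]]])
    ultimately show ?case by simp
  qed
  have bound: "\<bar>Ev absv \<alpha> z f - x h\<bar> \<le> 2 * B * \<rho>' ^ N" for N
  proof -
    have zt: "z (t N) = x (t N)" unfolding z_def by (rule restrict_apply'[OF set_mp[OF polys_disk_series t]])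
    have "((\<lambda>w. \<bar>\<alpha> (usub_at w f) - absv (peval w (t N))\<bar>) \<longlongrightarrow> \<bar>Ev absv \<alpha> z f - z (t N)\<bar>) (rigid_near absv z)"
      by (intro tendsto_rabs tendsto_diff Ev_tendsto[OF \<alpha> r(1) r'(1,2) x z_def f] rigid_near_tendsto t)
    from tendsto_upperbound[OF this ev rigid_near_z_not_bot[OF \<alpha> r(1) r'(1,2) x z_def]]
    have 1: "\<bar>Ev absv \<alpha> z f - x (t N)\<bar> \<le> B * \<rho>' ^ N" unfolding zt .
    have tc: "t N \<in> alg_carrier (tate (ground absv) \<rho>)" unfolding t_def by (rule T.mtrunc_carrier[OF h])
    have "\<bar>x h - x (t N)\<bar> \<le> x (h - t N)" by (rule D.spec_abs_diff[OF x h tc])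
    also have "\<dots> \<le> alg_norm (tate (ground absv) \<rho>) (h - t N)" by (rule D.spec_le_norm[OF x D.carrier_diff[OF h tc]])
    also have "\<dots> \<le> B * \<rho>' ^ N" unfolding t_def
    proof (rule T.norm_mtrunc_le[OF h])
      fix I :: "'r \<Rightarrow>\<^sub>0 nat" assume "I \<notin> {I. mdeg I \<le> N}"
      then have I: "N \<le> mdeg I" by simp
      have "\<rho> ^ mdeg I \<le> \<rho> ^ N" using I r by (intro power_decreasing) auto
      also have "\<dots> \<le> \<rho>' ^ N" using r r' by (intro power_mono) auto
      finally show "T.tnorm h I \<le> B * \<rho>' ^ N"
        unfolding T.tnorm_def using hb[of I] B0 r by (simp add: mult_mono)
    qed (use B0 r' in simp)
    finally show ?thesis using 1 by linarith
  qed
  have "(\<lambda>N. 2 * B * \<rho>' ^ N) \<longlonglongrightarrow> 2 * B * 0" using r' by (intro tendsto_mult tendsto_const LIMSEQ_power_zero) simp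
  from tendsto_lowerbound[OF this always_eventually[OF allI[OF bound]]] have "\<bar>Ev absv \<alpha> z f - x h\<bar> \<le> 0" by simp
  then show ?thesis by (simp add: z_def h_def)
qed

lemma bounded_alg_hom_comp_theta:
  assumes r: "0 < \<rho>" "\<rho> < 1"
  shows "bounded_alg_hom K1 (tate (ground absv) \<rho>) (\<lambda>f. mmap \<theta> (usub f :: ('r, ('r, 's, 'k) coeff_series) mfps))"
proof -
  note u = bounded_alg_homD[OF bounded_alg_hom_usub[OF r]]
  note m = bounded_alg_homD[OF mmap_theta_hom[OF \<alpha> \<theta> r(1)]]
  have "alg_norm (tate (ground absv) \<rho>) (mmap \<theta> (usub f :: ('r, ('r, 's, 'k) coeff_series) mfps)) \<le> 1 * alg_norm K1 f"
    if "f \<in> alg_carrier K1" for f :: "('s, 'k) mfps"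
    using order_trans[OF mmap_theta(2)[OF \<alpha> \<theta> r(1) usub_carrier(1)[OF that r]] usub_carrier(2)[OF that r]] by simp
  then show ?thesis unfolding bounded_alg_hom_def
    by (intro conjI ballI allI exI[of _ 1]) (auto simp only: Pi_iff u m)
qed

lemma analytic_Ev: "analytic_map absv (Ev absv \<alpha> :: _ \<Rightarrow> ('s, 'k) mfps \<Rightarrow> real)"
  unfolding analytic_map_def induced_map_def
proof (intro exI[of _ "\<lambda>_ f. mmap \<theta> (usub f)"] conjI ballI)
  fix \<rho> :: real assume "\<rho> \<in> {0<..<1}"
  then have r: "0 < \<rho>" "\<rho> < 1" by auto
  show "bounded_alg_hom (closed_disk_alg absv) (tate (ground absv) \<rho>) (\<lambda>f. mmap \<theta> (usub f :: ('r, ('r, 's, 'k) coeff_series) mfps))"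
    unfolding closed_disk_alg_def by (rule bounded_alg_hom_comp_theta[OF r])
  fix x :: "('r, 'k) mfps \<Rightarrow> real" assume x: "x \<in> spectrum (tate (ground absv) \<rho>)"
  show "Ev absv \<alpha> (restrict x (disk_series (ground absv))) = (\<lambda>f\<in>alg_carrier (closed_disk_alg absv). x (mmap \<theta> (usub f)))"
    unfolding closed_disk_alg_def
  proof (rule extensionalityI)
    show "Ev absv \<alpha> (restrict x (disk_series (ground absv))) \<in> extensional (alg_carrier K1)" by (simp add: Ev_def)
    fix f :: "('s, 'k) mfps" assume f: "f \<in> alg_carrier K1"
    then show "Ev absv \<alpha> (restrict x (disk_series (ground absv))) f = (\<lambda>f\<in>alg_carrier K1. x (mmap \<theta> (usub f))) f"
      using Ev_rigid[OF r x f] by simp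
  qed (rule restrict_extensional)
qed (rule refl)

text \<open>\<open>Phi_at\<close> picks some point of the fibre that projects to z. Such a point has
  to exist, and \<open>Phi\<close> has to take the expected value at whichever one is
  picked.\<close>

lemma Ev_eq_Phi_at:
  fixes z :: "('r, 'k) mfps \<Rightarrow> real"
  assumes z: "z \<in> open_disk (ground absv)"
  shows "(Ev absv \<alpha> z :: ('s, 'k) mfps \<Rightarrow> real) = Phi_at absv \<alpha> z"
proof -
  obtain \<rho> x where x: "\<rho> \<in> {0<..<1}" "x \<in> spectrum (tate (ground absv) \<rho>)" "z = restrict x (disk_series (ground absv))"
    using z by (auto simp: open_disk_def)
  have r: "0 < \<rho>" "\<rho> < 1" using x(1) by auto
  interpret D: tate_algebra absv "K1 :: ('k, ('r, 's, 'k) coeff_series) normed_alg" \<rho> by (rule tate_algebra_K1[OF r(1)])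
  interpret T: tate_algebra absv "ground absv" \<rho> by (rule tate_ground[OF r(1)])
  have mc: "(mmap mconst f :: ('r, ('r, 's, 'k) coeff_series) mfps) \<in> disk_series K1" if f: "f \<in> disk_series (ground absv)" for f :: "('r, 'k) mfps"
    unfolding disk_series_def
  proof (rule INT_I)
    fix \<sigma> :: real assume "\<sigma> \<in> {0<..<1}"
    then have s: "0 < \<sigma>" "\<sigma> < 1" by auto
    interpret D': tate_algebra absv "K1 :: ('k, ('r, 's, 'k) coeff_series) normed_alg" \<sigma> by (rule tate_algebra_K1[OF s(1)])
    interpret T': tate_algebra absv "ground absv" \<sigma> by (rule tate_ground[OF s(1)])
    have "alg_norm K1 (mconst c :: ('r, 's, 'k) coeff_series) = absv c" for c using M.norm_const[of c] by simp
    then have "D'.tnorm (mmap mconst f :: ('r, ('r, 's, 'k) coeff_series) mfps) I = T'.tnorm f I" for I by (simp add: D'.tnorm_def T'.tnorm_def)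
    then show "(mmap mconst f :: ('r, ('r, 's, 'k) coeff_series) mfps) \<in> alg_carrier (tate K1 \<sigma>)"
      using disk_series_carrier[OF s f] by (simp add: D'.carrier_iff T'.carrier_iff K1_mconst)
  qed
  have th_mc: "mmap \<theta> (mmap mconst f) = f" for f :: "('r, 'k) mfps"
    by (rule mfps_eqI) (simp add: chi_mconst[OF \<alpha> \<theta>])
  \<comment> \<open>The point over (\<alpha>, z): x is pulled back along the reduction of
    coefficients by \<theta>.\<close>
  define y where "y = (\<lambda>F\<in>alg_carrier (tate K1 \<rho>). x (mmap \<theta> F))"
  have y: "y \<in> spectrum (tate K1 \<rho>)" unfolding y_def
    by (rule spectrum_comp[OF D.nonarch_algebra_tate T.nonarch_algebra_tate x(2) mmap_theta_hom[OF \<alpha> \<theta> r(1)]])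
  define p where "p = restrict y (disk_series K1)"
  have pe: "p F = x (mmap \<theta> F)" if "F \<in> disk_series K1" for F
    using that disk_series_carrier[OF r that] by (simp add: p_def y_def)
  have pd: "p \<in> open_disk K1" using y x(1) by (auto simp: p_def open_disk_def)
  have cd: "(mconst g :: ('r, ('r, 's, 'k) coeff_series) mfps) \<in> disk_series K1" if "g \<in> alg_carrier K1" for g :: "('r, 's, 'k) coeff_series"
    unfolding disk_series_def using that by (intro INT_I tate_algebra.carrier_const[OF tate_algebra_K1]) auto
  interpret TD: nonarch_algebra absv "tate (ground absv) \<rho> :: ('k, ('r, 'k) mfps) normed_alg" by (rule T.nonarch_algebra_tate)
  have "proj_mor absv p = \<alpha>"
    unfolding proj_mor_def mor_alg_def
  proof (rule extensionalityI)
    show "\<alpha> \<in> extensional (alg_carrier K1)" using \<alpha> by (simp add: spectrum_def)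
    fix g assume g: "g \<in> alg_carrier (K1 :: ('k, ('r, 's, 'k) coeff_series) normed_alg)"
    have "mmap \<theta> (mconst g) = (mconst (\<theta> g) :: ('r, 'k) mfps)"
      by (rule mfps_eqI) (simp add: mcoeff_mconst chi_0[OF \<alpha> \<theta>])
    then have "p (mconst g) = absv (\<theta> g)" using pe[OF cd[OF g]] TD.spec_const[OF x(2), of "\<theta> g"] by simp
    then show "(\<lambda>g\<in>alg_carrier K1. p (mconst g)) g = \<alpha> g" using g absv_chi[OF \<alpha> \<theta> g] by simp
  qed (rule restrict_extensional)
  then have fib: "p \<in> mor_fibre absv \<alpha>" using pd by (simp add: mor_fibre_def mor_alg_def)
  have "proj_disk absv p = z"
    unfolding proj_disk_def x(3)
    by (rule restrict_ext) (simp add: pe mc th_mc)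
  then have img: "z \<in> proj_disk absv ` mor_fibre absv \<alpha>" using fib by blast
  \<comment> \<open>The point picked by \<open>inv_into\<close>, of which only the two projections
    are known.\<close>
  define q where "q = inv_into (mor_fibre absv \<alpha>) (proj_disk absv) z"
  have q: "q \<in> mor_fibre absv \<alpha>" "proj_disk absv q = z"
    unfolding q_def by (rule inv_into_into[OF img]) (rule f_inv_into_f[OF img])
  have qd: "q \<in> open_disk K1" and q\<alpha>: "proj_mor absv q = \<alpha>" using q(1) by (simp_all add: mor_fibre_def mor_alg_def)
  then obtain \<sigma> u where u: "\<sigma> \<in> {0<..<1}" "u \<in> spectrum (tate K1 \<sigma>)" "q = restrict u (disk_series K1)"
    by (auto simp: open_disk_def)
  have s: "0 < \<sigma>" "\<sigma> < 1" using u(1) by auto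
  interpret S: tate_algebra absv "K1 :: ('k, ('r, 's, 'k) coeff_series) normed_alg" \<sigma> by (rule tate_algebra_K1[OF s(1)])
  interpret SD: nonarch_algebra absv "tate K1 \<sigma> :: ('k, ('r, ('r, 's, 'k) coeff_series) mfps) normed_alg" by (rule S.nonarch_algebra_tate)
  have u_const: "u (mconst g) = \<alpha> g" if "g \<in> alg_carrier K1" for g
    using fun_cong[OF q\<alpha>, of g] that cd[OF that] by (simp add: proj_mor_def mor_alg_def u(3))
  show ?thesis
  proof (rule extensionalityI)
    show "(Ev absv \<alpha> z :: ('s, 'k) mfps \<Rightarrow> real) \<in> extensional (alg_carrier K1)" by (simp add: Ev_def)
    show "Phi_at absv \<alpha> z \<in> extensional (alg_carrier K1)"
      using qd by (simp add: Phi_at_def Phi_eq q_def[symmetric] mor_alg_def closed_disk_alg_def)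
    fix f :: "('s, 'k) mfps" assume f: "f \<in> alg_carrier K1"
    define F where "F = (usub f :: ('r, ('r, 's, 'k) coeff_series) mfps)"
    define h where "h = mmap \<theta> F"
    have Fd: "F \<in> disk_series K1" unfolding F_def by (rule usub_disk_series[OF f])
    have F: "F \<in> alg_carrier (tate K1 \<sigma>)" by (rule disk_series_carrier[OF s Fd])
    have hd: "h \<in> disk_series (ground absv)"
      unfolding disk_series_def h_def F_def by (intro INT_I mmap_theta(1)[OF \<alpha> \<theta>] usub_carrier f) auto
    have Hm: "(mmap mconst h :: ('r, ('r, 's, 'k) coeff_series) mfps) \<in> alg_carrier (tate K1 \<sigma>)" by (rule disk_series_carrier[OF s mc[OF hd]])
    \<comment> \<open>All coefficients of G have value 0 at \<alpha>, so u vanishes on its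
      truncations and by density on G. Hence u sees only the reduction h, whose value is fixed by
      the projection to z.\<close>
    define G where "G = F - mmap mconst h"
    have G: "G \<in> alg_carrier (tate K1 \<sigma>)" unfolding G_def by (rule SD.carrier_diff[OF F Hm])
    have G0: "\<alpha> (mcoeff G I) = 0" for I using bspec[OF \<theta> S.coeff_carrier[OF F, of I]] by (simp add: G_def h_def)
    have "u G \<le> 0 + e" if e: "0 < e" for e
    proof -
      obtain X where X: "finite X" "\<And>Y. X \<subseteq> Y \<Longrightarrow> alg_norm (tate K1 \<sigma>) (G - mtrunc Y G) \<le> e"
        using S.mtrunc_approx[OF G e] by auto
      have t: "mtrunc X G \<in> alg_carrier (tate K1 \<sigma>)" by (rule S.mtrunc_carrier[OF G])
      have "u (mtrunc X G) \<le> 0" unfolding mtrunc_eq_sum[OF X(1)]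
      proof (rule SD.spec_sum_max[OF u(2)])
        fix I
        have c: "(mconst (mcoeff G I) :: ('r, ('r, 's, 'k) coeff_series) mfps) \<in> alg_carrier (tate K1 \<sigma>)" by (intro S.carrier_const S.coeff_carrier G)
        then show "mconst (mcoeff G I) * mmono I \<in> alg_carrier (tate K1 \<sigma>) \<and> u (mconst (mcoeff G I) * mmono I) \<le> 0"
          by (simp add: SD.carrier_mult S.mmono_carrier SD.spec_mult[OF u(2)] u_const[OF S.coeff_carrier[OF G]] G0)
      qed simp
      moreover have "u (G - mtrunc X G) \<le> e"
        by (rule order_trans[OF SD.spec_le_norm[OF u(2) SD.carrier_diff[OF G t]] X(2)[OF order_refl]])
      moreover have "u G \<le> max (u (G - mtrunc X G)) (u (mtrunc X G))"
        using SD.spec_add[OF u(2) SD.carrier_diff[OF G t] t] by simp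
      ultimately show ?thesis using e by linarith
    qed
    then have "u G \<le> 0" by (rule field_le_epsilon)
    then have "u F = u (mmap mconst h)" using SD.spec_abs_diff[OF u(2) F Hm] unfolding G_def by simp
    moreover have "u (mmap mconst h) = z h"
      using fun_cong[OF q(2), of h] hd mc[OF hd] by (simp add: proj_disk_def u(3))
    moreover have "z h = x h" using hd by (simp add: x(3))
    moreover have "Ev absv \<alpha> z f = x h" unfolding x(3) h_def F_def by (rule Ev_rigid[OF r x(2) f])
    moreover have "Phi_at absv \<alpha> z f = q F"
      using qd f by (simp add: Phi_at_def Phi_eq q_def[symmetric] mor_alg_def closed_disk_alg_def F_def)
    moreover have "q F = u F" using Fd by (simp add: u(3))
    ultimately show "Ev absv \<alpha> z f = Phi_at absv \<alpha> z f" by simp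
  qed
qed

end
end

section \<open>Analytic evaluations come from rigid points\<close>

lemma polys_diff: "f \<in> polys \<Longrightarrow> g \<in> polys \<Longrightarrow> f - g \<in> (polys :: ('v, 'a::comm_ring_1) mfps set)"
  using polys_add[OF _ polys_mult[OF polys_mconst], of f g "- 1"] by (simp add: mconst_minus)

lemma peval_diff: "f \<in> polys \<Longrightarrow> g \<in> polys \<Longrightarrow> peval w (f - g) = peval w f - peval w g"
proof -
  assume f: "f \<in> polys" and g: "g \<in> polys"
  have "f = (f - g) + g" by simp
  then have "peval w f = peval w (f - g) + peval w g" using peval_add[OF polys_diff[OF f g] g, of w] by simp
  then show ?thesis by simp
qed

lemma (in complete_nonarch_field) absv_abs_diff: "\<bar>absv a - absv b\<bar> \<le> absv (a - b)"
proof -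
  have "absv a \<le> max (absv (a - b)) (absv b)" using absv_ultrametric[of "a - b" b] by simp
  moreover have "absv b \<le> max (absv (b - a)) (absv a)" using absv_ultrametric[of "b - a" a] by simp
  ultimately show ?thesis using absv_nonneg[of a] absv_nonneg[of b] absv_nonneg[of "a - b"] absv_diff_commute[of a b] by linarith
qed

lemma mtrunc_add: "mtrunc X (f + g) = mtrunc X f + (mtrunc X g :: ('v, 'a::comm_ring_1) mfps)"
  by (rule mfps_eqI) (simp add: mcoeff_mtrunc)

lemma (in tate_algebra) mtrunc_deg_approx:
  assumes "f \<in> alg_carrier T" "0 < \<epsilon>"
  shows "\<forall>\<^sub>F N in sequentially. alg_norm T (f - mtrunc {I. mdeg I \<le> N} f) \<le> \<epsilon>"
proof -
  obtain X where X: "finite X" "\<And>Y. X \<subseteq> Y \<Longrightarrow> alg_norm T (f - mtrunc Y f) \<le> \<epsilon>"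
    using mtrunc_approx[OF assms] by auto
  have "finite (mdeg ` X)" using X(1) by simp
  then obtain N0 where N0: "\<forall>d\<in>mdeg ` X. d \<le> N0" unfolding finite_nat_set_iff_bounded_le by (rule exE)
  show ?thesis unfolding eventually_sequentially
  proof (intro exI[of _ N0] allI impI X(2))
    fix N assume "N0 \<le> N"
    then show "X \<subseteq> {I. mdeg I \<le> N}" using N0 by fastforce
  qed
qed

lemma (in tate_algebra) norm_mtrunc_le_norm: "f \<in> alg_carrier T \<Longrightarrow> alg_norm T (mtrunc X f) \<le> alg_norm T f"
proof (rule norm_leI)
  fix M assume f: "f \<in> alg_carrier T"
  show "tnorm (mtrunc X f) M \<le> alg_norm T f"
    using tnorm_le[OF f, of M] tnorm_nonneg[OF f, of M] by (simp add: tnorm_def mcoeff_mtrunc norm_0)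
qed

context complete_nonarch_field
begin

text \<open>Evaluation of polynomials at w is bounded by the norm of radius \<rho>, so the values of
  the truncations of a series converge; the limit defines the seminorm.\<close>

lemma rigid_point_exists:
  fixes w :: "'r::finite \<Rightarrow> 'k"
  assumes r: "0 < \<rho>" and w: "\<forall>v. absv (w v) \<le> \<rho>"
  shows "\<exists>x\<in>spectrum (tate (ground absv) \<rho>). \<forall>p\<in>polys. x p = absv (peval w p)"
proof -
  interpret tate_algebra absv "ground absv" \<rho> by (rule tate_ground[OF r])
  interpret D: nonarch_algebra absv "T :: ('k, ('r, 'k) mfps) normed_alg" by (rule nonarch_algebra_tate)
  have pc: "p \<in> alg_carrier T" if "p \<in> polys" for p :: "('r, 'k) mfps"
    by (rule set_mp[OF polys_tate_ground[OF r] that])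
  have le: "absv (peval w p) \<le> alg_norm T p" if p: "p \<in> polys" for p
    unfolding peval_def
  proof (rule absv_sum_le)
    fix M
    have "absv (mcoeff p M * wprod w M) \<le> absv (mcoeff p M) * \<rho> ^ mdeg M"
      using w by (intro absv_mult_le order_refl absv_wprod_le) simp
    also have "\<dots> \<le> alg_norm T p" using tnorm_le[OF pc[OF p], of M] by (simp add: tnorm_def)
    finally show "absv (mcoeff p M * wprod w M) \<le> alg_norm T p" .
  qed (rule D.norm_nonneg[OF pc[OF p]])
  define t where "t N f = mtrunc {I. mdeg I \<le> N} f" for N and f :: "('r, 'k) mfps"
  have t: "t N f \<in> polys" for N f unfolding t_def by (rule mtrunc_polys[OF finite_mdeg_le])
  have tc: "t N f \<in> alg_carrier T" for N f by (rule pc[OF t])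
  define g where "g f N = absv (peval w (t N f))" for f N
  have close: "\<bar>absv (peval w p) - absv (peval w q)\<bar> \<le> alg_norm T (p - q)" if "p \<in> polys" "q \<in> polys" for p q
    using order_trans[OF absv_abs_diff le[OF polys_diff[OF that], unfolded peval_diff[OF that]]] .
  have approx: "\<forall>\<^sub>F N in sequentially. alg_norm T (f - t N f) \<le> e" if "f \<in> alg_carrier T" "0 < e" for f e
    unfolding t_def by (rule mtrunc_deg_approx[OF that])
  have "\<exists>L. g f \<longlonglongrightarrow> L" if f: "f \<in> alg_carrier T" for f
  proof (rule tendsto_of_approximations[OF sequentially_bot])
    fix e :: real assume e: "0 < e"
    obtain N0 where N0: "\<forall>N\<ge>N0. alg_norm T (f - t N f) \<le> e"
      using approx[OF f e] unfolding eventually_sequentially by (rule exE)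
    have "\<bar>g f N - g f N0\<bar> \<le> e" if "N0 \<le> N" for N
    proof -
      have eq: "t N f - t N0 f = (f - t N0 f) - (f - t N f)" by simp
      have "alg_norm T (t N f - t N0 f) \<le> max (alg_norm T (f - t N0 f)) (alg_norm T (f - t N f))"
        unfolding eq by (rule D.norm_diff[OF D.carrier_diff[OF f tc] D.carrier_diff[OF f tc]])
      also have "\<dots> \<le> e" using N0 that by simp
      finally show ?thesis unfolding g_def using close[OF t t, of N f N0 f] by linarith
    qed
    then have "\<forall>\<^sub>F N in sequentially. \<bar>g f N - g f N0\<bar> \<le> e" unfolding eventually_sequentially by (intro exI[of _ N0] allI impI)
    then show "\<exists>h l. h \<longlonglongrightarrow> l \<and> (\<forall>\<^sub>F N in sequentially. \<bar>g f N - h N\<bar> \<le> e)"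
      by (intro exI[of _ "\<lambda>_. g f N0"] exI[of _ "g f N0"] conjI tendsto_const)
  qed
  then have "\<forall>f\<in>alg_carrier T. \<exists>L. g f \<longlonglongrightarrow> L" by simp
  then obtain y where y: "\<forall>f\<in>alg_carrier T. g f \<longlonglongrightarrow> y f" unfolding bchoice_iff by (rule exE)
  define x where "x = restrict y (alg_carrier T)"
  have lim: "g f \<longlonglongrightarrow> x f" if "f \<in> alg_carrier T" for f using y that by (simp add: x_def)
  have xp: "x p = absv (peval w p)" if p: "p \<in> polys" for p
  proof (rule LIMSEQ_unique[OF lim[OF pc[OF p]]])
    have "finite (mdeg ` msupp p)" using p by (simp add: polys_def)
    then obtain N0 where N0: "\<forall>d\<in>mdeg ` msupp p. d \<le> N0" unfolding finite_nat_set_iff_bounded_le by (rule exE)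
    have "g p N = absv (peval w p)" if "N0 \<le> N" for N
    proof -
      have "mcoeff (t N p) M = mcoeff p M" for M
      proof (cases "M \<in> msupp p")
        case True
        then have "mdeg M \<le> N" using N0 \<open>N0 \<le> N\<close> by fastforce
        then show ?thesis by (simp add: t_def mcoeff_mtrunc)
      qed (simp add: t_def mcoeff_mtrunc msupp_def)
      then have "t N p = p" by (rule mfps_eqI)
      then show ?thesis by (simp add: g_def)
    qed
    then have "\<forall>\<^sub>F N in sequentially. g p N = absv (peval w p)" unfolding eventually_sequentially by (intro exI[of _ N0] allI impI)
    then show "g p \<longlonglongrightarrow> absv (peval w p)" by (rule tendsto_eventually)
  qed
  have x_le: "x f \<le> 1 * alg_norm T f" if f: "f \<in> alg_carrier T" for f
  proof (rule LIMSEQ_le_const2[OF lim[OF f]])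
    have "g f n \<le> 1 * alg_norm T f" for n
    proof -
      have "alg_norm T (t n f) \<le> alg_norm T f" unfolding t_def by (rule norm_mtrunc_le_norm[OF f])
      then show ?thesis using le[OF t[of n f]] by (simp add: g_def)
    qed
    then show "\<exists>N. \<forall>n\<ge>N. g f n \<le> 1 * alg_norm T f" by (intro exI allI impI)
  qed
  have nn: "0 \<le> x f" if f: "f \<in> alg_carrier T" for f
    by (rule LIMSEQ_le_const[OF lim[OF f]]) (simp add: g_def absv_nonneg)
  have add: "x (a + b) \<le> x a + x b" if a: "a \<in> alg_carrier T" and b: "b \<in> alg_carrier T" for a b
  proof (rule LIMSEQ_le[OF lim[OF D.carrier_add[OF a b]] tendsto_add[OF lim[OF a] lim[OF b]]])
    have "g (a + b) n \<le> g a n + g b n" for n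
    proof -
      have "t n (a + b) = t n a + t n b" unfolding t_def by (rule mtrunc_add)
      then have "g (a + b) n = absv (peval w (t n a) + peval w (t n b))" unfolding g_def by (simp add: peval_add t)
      then show ?thesis unfolding g_def
        using absv_ultrametric[of "peval w (t n a)" "peval w (t n b)"] absv_nonneg[of "peval w (t n a)"] absv_nonneg[of "peval w (t n b)"]
        by linarith
    qed
    then show "\<exists>N. \<forall>n\<ge>N. g (a + b) n \<le> g a n + g b n" by simp
  qed
  \<comment> \<open>Truncation is not multiplicative; the truncation of the product and the product
    of the truncations agree only up to a small norm.\<close>
  have mult: "x (a * b) = x a * x b" if a: "a \<in> alg_carrier T" and b: "b \<in> alg_carrier T" for a b
  proof -
    have ab: "a * b \<in> alg_carrier T" by (rule D.carrier_mult[OF a b])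
    have "\<bar>x (a * b) - x a * x b\<bar> \<le> 0 + e" if e: "0 < e" for e
    proof -
      define B where "B = alg_norm T a + alg_norm T b + 1"
      have B: "1 \<le> B" "alg_norm T a \<le> B" "alg_norm T b \<le> B"
        using D.norm_nonneg[OF a] D.norm_nonneg[OF b] by (simp_all add: B_def)
      define e' where "e' = e / B"
      have e': "0 < e'" "e' \<le> e" "e' * B = e" using e B by (simp_all add: e'_def field_simps)
      have "\<forall>\<^sub>F n in sequentially. \<bar>g (a * b) n - g a n * g b n\<bar> \<le> e"
        using approx[OF ab e'(1)] approx[OF a e'(1)] approx[OF b e'(1)]
      proof eventually_elim
        case (elim n)
        have da: "a - t n a \<in> alg_carrier T" and db: "b - t n b \<in> alg_carrier T" and dab: "a * b - t n (a * b) \<in> alg_carrier T"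
          by (intro D.carrier_diff a b ab tc)+
        have 1: "alg_norm T ((a - t n a) * b) \<le> e"
        proof -
          have "alg_norm T ((a - t n a) * b) \<le> alg_norm T (a - t n a) * alg_norm T b" by (rule D.norm_mult[OF da b])
          also have "\<dots> \<le> e' * B" using elim B e' D.norm_nonneg[OF b] by (intro mult_mono) auto
          finally show ?thesis by (simp add: e')
        qed
        have 2: "alg_norm T (t n a * (b - t n b)) \<le> e"
        proof -
          have "alg_norm T (t n a * (b - t n b)) \<le> alg_norm T (t n a) * alg_norm T (b - t n b)" by (rule D.norm_mult[OF tc db])
          also have "\<dots> \<le> B * e'"
            using elim B e' D.norm_nonneg[OF db] order_trans[OF norm_mtrunc_le_norm[OF a, of "{I. mdeg I \<le> n}"] B(2)]
            by (intro mult_mono) (auto simp: t_def)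
          finally show ?thesis using e' by (simp add: mult.commute)
        qed
        have eq: "t n (a * b) - t n a * t n b = ((a - t n a) * b + t n a * (b - t n b)) - (a * b - t n (a * b))"
          by (simp add: algebra_simps)
        have "alg_norm T (t n (a * b) - t n a * t n b)
            \<le> max (alg_norm T ((a - t n a) * b + t n a * (b - t n b))) (alg_norm T (a * b - t n (a * b)))"
          unfolding eq by (rule D.norm_diff[OF D.carrier_add[OF D.carrier_mult[OF da b] D.carrier_mult[OF tc db]] dab])
        also have "\<dots> \<le> e"
          using D.norm_add[OF D.carrier_mult[OF da b] D.carrier_mult[OF tc db], of n a] 1 2 elim(1) e'(2) by linarith
        finally have "alg_norm T (t n (a * b) - t n a * t n b) \<le> e" .
        moreover have "g a n * g b n = absv (peval w (t n a * t n b))" by (simp add: g_def peval_mult t absv_mult)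
        ultimately show ?case unfolding g_def using close[OF t polys_mult[OF t t], of n "a * b" n a n b] by (simp add: g_def)
      qed
      from tendsto_upperbound[OF tendsto_rabs[OF tendsto_diff[OF lim[OF ab] tendsto_mult[OF lim[OF a] lim[OF b]]]] this sequentially_bot]
      show ?thesis by simp
    qed
    then have "\<bar>x (a * b) - x a * x b\<bar> \<le> 0" by (rule field_le_epsilon)
    then show ?thesis by simp
  qed
  have c: "x (mconst c) = absv c" for c by (simp add: xp polys_mconst)
  have "x \<in> spectrum T" unfolding spectrum_def
    using nn add mult x_le c[of 0] c[of 1] by (auto simp: x_def intro!: exI[of _ 1])
  then show ?thesis using xp by (intro bexI[of _ x] ballI)
qed

end

section \<open>Recovering the values of the variables from the values at points\<close>

context alg_closed_nonarch_field
begin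

text \<open>The same linear forms approximate both sides within the same error, since x takes at
  polynomials the absolute values of their values at w.\<close>

lemma Ev_at_point:
  fixes f :: "('s, 'k) mfps" and x :: "('r::finite, 'k) mfps \<Rightarrow> real"
  assumes \<alpha>: "\<alpha> \<in> spectrum K1" and r: "0 < \<rho>" "\<rho> < 1" and w: "\<forall>v. absv (w v) \<le> \<rho>"
    and x: "x \<in> spectrum (tate (ground absv) \<rho>)" "\<forall>p\<in>polys. x p = absv (peval w p)" and f: "f \<in> alg_carrier K1"
  shows "Ev absv \<alpha> (restrict x (disk_series (ground absv))) f = \<alpha> (usub_at w f)"
proof -
  define \<rho>' where "\<rho>' = (1 + \<rho>) / 2"
  have r': "\<rho> < \<rho>'" "\<rho>' < 1" "0 < \<rho>'" using r by (simp_all add: \<rho>'_def)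
  have w': "\<forall>v. absv (w v) \<le> \<rho>'" using w less_imp_le[OF r'(1)] by (intro allI) (rule order_trans, rule spec)
  let ?z = "restrict x (disk_series (ground absv))"
  have "\<bar>Ev absv \<alpha> ?z f - \<alpha> (usub_at w f)\<bar> \<le> 0 + e" if e: "0 < e" for e
  proof -
    have e2: "0 < e / 2" using e by simp
    obtain \<delta> N where d: "0 < \<delta>" "\<delta> \<le> 1/2" "alg_norm K1 f * \<rho>' ^ N + 2 * \<delta> * alg_norm K1 f \<le> e / 2"
      using approximation_parameters[OF K1_norm_nonneg[OF f] e2 r'(3,2)] by (elim exE conjE) (rule that)
    have d1: "\<delta> < 1" using d(2) by simp
    obtain n L a where F: "functionals {I. mdeg I \<le> N} (\<lambda>c. \<alpha> (ucomb f N c)) \<delta> n L a"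
      using functionals_exist[OF finite_mdeg_le coord_seminorm_ucomb[OF \<alpha> f] d(1) d1, of N] by (elim exE) (rule that)
    have eq: "x (lpoly N (L k)) = absv (peval w (lpoly N (L k)))" for k by (rule bspec[OF x(2) lpoly_polys])
    from Ev_functionals[OF \<alpha> r(1) r'(1,2) x(1) refl f F d(1,2)] usub_at_functionals[OF f r'(3,2) \<alpha> F d(1,2) w']
    show ?thesis unfolding eq using d(3) by linarith
  qed
  then have "\<bar>Ev absv \<alpha> ?z f - \<alpha> (usub_at w f)\<bar> \<le> 0" by (rule field_le_epsilon)
  then show ?thesis by simp
qed

text \<open>A maximum modulus principle in several variables. The monomials that share the exponent
  of v with \<open>I0\<close> are treated by induction; the coordinate at v is then chosen by
  \<open>poly_generic\<close> on a generic radius between \<sigma> and \<rho>.\<close>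

lemma gauss_lower:
  fixes V :: "'r set" and c :: "('r \<Rightarrow>\<^sub>0 nat) \<Rightarrow> 'k"
  assumes "finite V" "0 < \<sigma>" "\<sigma> < \<rho>" "finite J" "\<forall>I\<in>J. Poly_Mapping.keys I \<subseteq> V" "I0 \<in> J"
  shows "\<exists>w. (\<forall>v. absv (w v) \<le> \<rho>) \<and> absv (c I0) * \<sigma> ^ mdeg I0 \<le> absv (\<Sum>I\<in>J. c I * wprod w I)"
  using assms
proof (induction V arbitrary: J I0 c rule: finite_induct)
  case empty
  have "I = 0" if "I \<in> J" for I using empty.prems(4) that by auto
  then have "J = {0}" "I0 = 0" using empty.prems(5) by auto
  then show ?case using empty.prems by (intro exI[of _ "\<lambda>_. 0"]) simp
next
  case (insert v V)
  define off where "off M = M - Poly_Mapping.single v (Poly_Mapping.lookup M v)" for M :: "'r \<Rightarrow>\<^sub>0 nat"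
  define i0 where "i0 = Poly_Mapping.lookup I0 v"
  have l: "Poly_Mapping.lookup (off M) i = (if i = v then 0 else Poly_Mapping.lookup M i)" for M i
    by (simp add: off_def lookup_minus lookup_single when_def)
  have off: "M = off M + Poly_Mapping.single v (Poly_Mapping.lookup M v)" for M
    by (rule poly_mapping_eqI) (simp add: lookup_add l lookup_single when_def)
  have off_keys: "v \<notin> Poly_Mapping.keys (off M)" "Poly_Mapping.keys (off M) \<subseteq> Poly_Mapping.keys M" for M
    by (simp_all add: subset_iff in_keys_iff l)
  define J0 where "J0 = {I \<in> J. Poly_Mapping.lookup I v = i0}"
  define c' where "c' K = c (K + Poly_Mapping.single v i0)" for K
  have c': "c' (off I) = c I" if "I \<in> J0" for I
    using that off[of I] by (simp add: c'_def J0_def)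
  have inj: "inj_on off J0"
  proof (rule inj_onI)
    fix I K assume "I \<in> J0" "K \<in> J0" "off I = off K"
    then show "I = K" using off[of I] off[of K] by (simp add: J0_def)
  qed
  have sub: "\<forall>I\<in>off ` J0. Poly_Mapping.keys I \<subseteq> V"
  proof
    fix K assume "K \<in> off ` J0"
    then obtain I where I: "K = off I" "I \<in> J" by (auto simp: J0_def)
    then have "Poly_Mapping.keys I \<subseteq> insert v V" using insert.prems(4) by simp
    then show "Poly_Mapping.keys K \<subseteq> V" using off_keys[of I] unfolding I(1) by blast
  qed
  have fin: "finite (off ` J0)" using insert.prems(3) by (simp add: J0_def)
  have "off I0 \<in> off ` J0" using insert.prems(5) by (simp add: J0_def i0_def)
  from insert.IH[OF insert.prems(1,2) fin sub this, of c']
  obtain w where w: "\<forall>u. absv (w u) \<le> \<rho>" "absv (c' (off I0)) * \<sigma> ^ mdeg (off I0) \<le> absv (\<Sum>I\<in>off ` J0. c' I * wprod w I)"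
    by (elim exE conjE) (rule that)
  \<comment> \<open>With the other coordinates fixed, the sum is a polynomial in the coordinate at
    v, and its coefficient at \<open>i0\<close> is the sum already bounded below by
    induction.\<close>
  define Q where "Q = (\<Sum>I\<in>J. monom (c I * wprod w (off I)) (Poly_Mapping.lookup I v))"
  have I0: "I0 \<in> J0" using insert.prems(5) by (simp add: J0_def i0_def)
  have "coeff Q i0 = (\<Sum>I\<in>J. if Poly_Mapping.lookup I v = i0 then c I * wprod w (off I) else 0)"
    unfolding Q_def coeff_sum by (intro sum.cong refl) simp
  also have "\<dots> = (\<Sum>I\<in>J0. c I * wprod w (off I))" unfolding J0_def by (rule sum.inter_filter[symmetric, OF insert.prems(3)])
  also have "\<dots> = (\<Sum>K\<in>off ` J0. c' K * wprod w K)" by (simp add: sum.reindex[OF inj] c')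
  finally have coeff: "absv (c I0) * \<sigma> ^ mdeg (off I0) \<le> absv (coeff Q i0)" using w(2) c'[OF I0] by simp
  have deg: "mdeg I0 = mdeg (off I0) + i0"
  proof -
    have "mdeg (Poly_Mapping.single v i0) = i0" by (cases "i0 = 0") (simp_all add: mdeg_def)
    then show ?thesis using arg_cong[OF off[of I0], of mdeg] by (simp add: i0_def)
  qed
  have "\<exists>t. absv t \<le> \<rho> \<and> absv (coeff Q i0) * \<sigma> ^ i0 \<le> absv (poly Q t)"
  proof (cases "Q = 0")
    case True
    then show ?thesis using insert.prems(1,2) by (intro exI[of _ 0]) simp
  next
    case False
    obtain Z where Z: "finite Z" "\<And>t i. absv t \<notin> Z \<Longrightarrow> absv (coeff Q i) * absv t ^ i \<le> absv (poly Q t)"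
      using poly_generic[OF False] by metis
    obtain t where t: "\<sigma> < absv t" "absv t < \<rho>" "absv t \<notin> Z" by (rule absv_dense_avoid[OF Z(1) insert.prems(1,2)])
    have "absv (coeff Q i0) * \<sigma> ^ i0 \<le> absv (coeff Q i0) * absv t ^ i0"
      using t insert.prems(1) by (intro mult_left_mono power_mono absv_nonneg) auto
    also have "\<dots> \<le> absv (poly Q t)" by (rule Z(2)[OF t(3)])
    finally show ?thesis using t(2) by (intro exI[of _ t]) simp
  qed
  then obtain t where t: "absv t \<le> \<rho>" "absv (coeff Q i0) * \<sigma> ^ i0 \<le> absv (poly Q t)" by (elim exE conjE) (rule that)
  have wp: "wprod (w(v := t)) I = wprod w (off I) * t ^ Poly_Mapping.lookup I v" for I
  proof -
    have "wprod (w(v := t)) (off I) = wprod w (off I)"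
      unfolding wprod_def using off_keys(1)[of I] by (intro prod.cong) auto
    moreover have "wprod (w(v := t)) (Poly_Mapping.single v n) = t ^ n" for n
      by (cases "n = 0") (simp_all add: wprod_def)
    ultimately show ?thesis using arg_cong[OF off[of I], of "wprod (w(v := t))"] by (simp add: wprod_add)
  qed
  have "poly Q t = (\<Sum>I\<in>J. c I * wprod (w(v := t)) I)"
    unfolding Q_def poly_sum by (intro sum.cong refl) (simp add: poly_monom wp mult.assoc)
  moreover have "absv (c I0) * \<sigma> ^ mdeg I0 \<le> absv (coeff Q i0) * \<sigma> ^ i0"
    unfolding deg power_add mult.assoc[symmetric] using coeff insert.prems(1) by (intro mult_right_mono) simp_all
  ultimately have "absv (c I0) * \<sigma> ^ mdeg I0 \<le> absv (\<Sum>I\<in>J. c I * wprod (w(v := t)) I)" using t(2) by (metis order_trans)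
  moreover have "\<forall>u. absv ((w(v := t)) u) \<le> \<rho>" using t(1) w(1) by simp
  ultimately show ?case by (intro exI[of _ "w(v := t)"] conjI)
qed

text \<open>Smallness at all w bounds each linear form on the vectors \<open>wprod w\<close>, hence
  by \<open>gauss_lower\<close> its coefficient at \<open>I0\<close>; these coefficients bound the
  value at \<open>b I0\<close>.\<close>

lemma vanishing_coefficients:
  fixes A :: "('k, 'a::comm_ring_1) normed_alg" and b :: "('r::finite \<Rightarrow>\<^sub>0 nat) \<Rightarrow> 'a"
  assumes A: "nonarch_algebra absv A" and x: "x \<in> spectrum A" and b: "\<And>I. b I \<in> alg_carrier A" and r: "0 < \<rho>"
    and small: "\<And>\<epsilon>. 0 < \<epsilon> \<Longrightarrow> \<forall>\<^sub>F N in sequentially. \<forall>w. (\<forall>v. absv (w v) \<le> \<rho>) \<longrightarrow>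
      x (\<Sum>I\<in>{I. mdeg I \<le> N}. alg_const A (wprod w I) * b I) \<le> \<epsilon>"
  shows "x (b I0) = 0"
proof -
  interpret nonarch_algebra absv A by (rule A)
  define \<sigma> where "\<sigma> = \<rho> / 2"
  have s: "0 < \<sigma>" "\<sigma> < \<rho>" using r by (simp_all add: \<sigma>_def)
  have "x (b I0) \<le> 0 + e" if e: "0 < e" for e
  proof -
    have "0 < e / 2 * \<sigma> ^ mdeg I0" using e s by simp
    from eventually_happens'[OF sequentially_bot eventually_conj[OF small[OF this] eventually_ge_at_top[of "mdeg I0"]]]
    obtain N where N: "\<forall>w. (\<forall>v. absv (w v) \<le> \<rho>) \<longrightarrow> x (\<Sum>I\<in>{I. mdeg I \<le> N}. alg_const A (wprod w I) * b I) \<le> e / 2 * \<sigma> ^ mdeg I0"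
      "mdeg I0 \<le> N" by (elim exE conjE) (rule that)
    let ?J = "{I :: 'r \<Rightarrow>\<^sub>0 nat. mdeg I \<le> N}"
    have cs: "coord_seminorm absv ?J (\<lambda>c. x (\<Sum>I\<in>?J. alg_const A (c I) * b I))"
      by (rule coord_seminorm_spec[OF x]) (rule b)
    \<comment> \<open>Accuracy 1/2 suffices: the factor 2 that it costs is absorbed by the e / 2
      above.\<close>
    have half: "0 < (1/2 :: real)" "1/2 < (1 :: real)" by simp_all
    obtain n L a where F: "functionals ?J (\<lambda>c. x (\<Sum>I\<in>?J. alg_const A (c I) * b I)) (1/2) n L a"
      using functionals_exist[OF finite_mdeg_le cs half] by (elim exE) (rule that)
    have lower: "\<forall>c. (1 - 1/2) * fmax n (\<lambda>k. a k * absv (lincomb ?J (L k) c)) \<le> x (\<Sum>I\<in>?J. alg_const A (c I) * b I)"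
      and upper: "\<forall>c. x (\<Sum>I\<in>?J. alg_const A (c I) * b I) \<le> fmax n (\<lambda>k. a k * absv (lincomb ?J (L k) c))"
      and a_pos: "\<forall>k<n. 0 < a k"
      using F unfolding functionals_def by blast+
    define u where "u I = (if I = I0 then 1 else 0 :: 'k)" for I
    have "(\<Sum>I\<in>?J. alg_const A (u I) * b I) = (\<Sum>I\<in>?J. if I = I0 then b I else 0)"
      by (intro sum.cong refl) (simp add: u_def const_1 const_0)
    also have "\<dots> = b I0" by (subst sum.delta[OF finite_mdeg_le]) (simp add: N(2))
    finally have "x (b I0) = x (\<Sum>I\<in>?J. alg_const A (u I) * b I)" by simp
    also have "\<dots> \<le> fmax n (\<lambda>k. a k * absv (lincomb ?J (L k) u))" by (rule spec[OF upper])
    also have "\<dots> \<le> e" unfolding fmax_le_iff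
    proof (intro conjI allI impI)
      fix k assume k: "k < n"
      have a: "0 < a k" using a_pos k by simp
      have "lincomb ?J (L k) u = (\<Sum>I\<in>?J. if I = I0 then L k I else 0)"
        unfolding lincomb_def by (intro sum.cong refl) (simp add: u_def)
      also have "\<dots> = L k I0" by (subst sum.delta[OF finite_mdeg_le]) (simp add: N(2))
      finally have lu: "lincomb ?J (L k) u = L k I0" .
      have "I0 \<in> ?J" using N(2) by simp
      from gauss_lower[OF finite s finite_mdeg_le _ this, of UNIV "L k"]
      obtain w where w: "\<forall>v. absv (w v) \<le> \<rho>" "absv (L k I0) * \<sigma> ^ mdeg I0 \<le> absv (lincomb ?J (L k) (wprod w))"
        by (auto simp: lincomb_def)
      have "a k * (absv (L k I0) * \<sigma> ^ mdeg I0) \<le> a k * absv (lincomb ?J (L k) (wprod w))"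
        using w(2) a by (intro mult_left_mono) simp_all
      also have "\<dots> \<le> fmax n (\<lambda>k. a k * absv (lincomb ?J (L k) (wprod w)))" using fmax_ge[OF k, of "\<lambda>k. a k * absv (lincomb ?J (L k) (wprod w))"] .
      also have "\<dots> \<le> 2 * x (\<Sum>I\<in>?J. alg_const A (wprod w I) * b I)" using spec[OF lower, of "wprod w"] by simp
      also have "\<dots> \<le> e * \<sigma> ^ mdeg I0" using mp[OF spec[OF N(1)] w(1)] by simp
      finally have "(a k * absv (L k I0)) * \<sigma> ^ mdeg I0 \<le> e * \<sigma> ^ mdeg I0" by (simp add: mult.assoc)
      then show "a k * absv (lincomb ?J (L k) u) \<le> e" unfolding lu by (rule mult_right_le_imp_le) (simp add: s)
    qed (use e in simp)
    finally show ?thesis by simp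
  qed
  then have "x (b I0) \<le> 0" by (rule field_le_epsilon)
  then show ?thesis using spec_nonneg[OF x b, of I0] by simp
qed

text \<open>The elements with a value in k form a subalgebra, which contains the variables and hence
  all polynomials; completeness of k extends this to their limits.\<close>

lemma values_from_variables:
  fixes \<alpha> :: "('v, 'k) mfps \<Rightarrow> real"
  assumes \<alpha>: "\<alpha> \<in> spectrum K1" and v: "\<And>v. \<exists>c. \<alpha> (mvar v - mconst c) = 0" and g: "g \<in> alg_carrier K1"
  shows "\<exists>c. \<alpha> (g - mconst c) = 0"
proof -
  interpret A: nonarch_algebra absv "K1 :: ('k, ('v, 'k) mfps) normed_alg" by (rule nonarch_algebra_K1)
  interpret T: tate_algebra absv "ground absv" 1 by (rule tate_ground) simp
  define S where "S = {g \<in> alg_carrier K1. \<exists>c. \<alpha> (g - mconst c) = 0}"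
  have zero: "\<alpha> h = 0" if "h \<in> alg_carrier K1" "\<alpha> h \<le> 0" for h using A.spec_nonneg[OF \<alpha> that(1)] that(2) by simp
  have S_const: "mconst c \<in> S" for c using A.spec_0[OF \<alpha>] by (auto simp: S_def K1_mconst intro!: exI[of _ c])
  have S_add: "f + h \<in> S" if fS: "f \<in> S" "h \<in> S" for f h
  proof -
    obtain c d where c: "\<alpha> (f - mconst c) = 0" and d: "\<alpha> (h - mconst d) = 0" using fS by (auto simp: S_def)
    have fh: "f \<in> alg_carrier K1" "h \<in> alg_carrier K1" using fS by (simp_all add: S_def)
    have eq: "f + h - mconst (c + d) = (f - mconst c) + (h - mconst d)" by (simp add: mconst_add)
    have "\<alpha> (f + h - mconst (c + d)) \<le> 0"
      unfolding eq using A.spec_add[OF \<alpha> A.carrier_diff[OF fh(1) K1_mconst] A.carrier_diff[OF fh(2) K1_mconst], of c d] c d by simp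
    then have "\<alpha> (f + h - mconst (c + d)) = 0" by (intro zero A.carrier_diff A.carrier_add fh K1_mconst)
    then show ?thesis using fh by (auto simp: S_def A.carrier_add)
  qed
  have S_mult: "f * h \<in> S" if fS: "f \<in> S" "h \<in> S" for f h
  proof -
    obtain c d where c: "\<alpha> (f - mconst c) = 0" and d: "\<alpha> (h - mconst d) = 0" using fS by (auto simp: S_def)
    have fh: "f \<in> alg_carrier K1" "h \<in> alg_carrier K1" using fS by (simp_all add: S_def)
    have df: "f - mconst c \<in> alg_carrier K1" "h - mconst d \<in> alg_carrier K1" by (intro A.carrier_diff fh K1_mconst)+
    have "f * h - mconst (c * d) = (f - mconst c) * h + mconst c * (h - mconst d)" by (simp add: mconst_mult algebra_simps)
    then have "\<alpha> (f * h - mconst (c * d)) \<le> max (\<alpha> ((f - mconst c) * h)) (\<alpha> (mconst c * (h - mconst d)))"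
      using A.spec_add[OF \<alpha> A.carrier_mult[OF df(1) fh(2)] A.carrier_mult[OF K1_mconst df(2)], of c] by simp
    also have "\<dots> = 0" by (simp add: A.spec_mult[OF \<alpha>] df fh K1_mconst c d)
    finally have "\<alpha> (f * h - mconst (c * d)) = 0" by (intro zero A.carrier_diff A.carrier_mult fh K1_mconst)
    then show ?thesis using fh by (auto simp: S_def A.carrier_mult)
  qed
  have S_mmono: "mmono M \<in> S" for M
  proof (induction M rule: exponent_induct)
    case zero
    show ?case using S_const[of 1] by simp
  next
    case (add M u)
    have "mvar u \<in> S" using v[of u] by (simp add: S_def K1_mvar)
    then show ?case unfolding mmono_add mmono_single by (rule S_mult[OF add])
  qed
  have S_sum: "sum h X \<in> S" if "\<And>i. i \<in> X \<Longrightarrow> h i \<in> S" for h :: "('v \<Rightarrow>\<^sub>0 nat) \<Rightarrow> ('v, 'k) mfps" and X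
    using that
  proof (induction X rule: infinite_finite_induct)
    case (insert i X)
    then show ?case by (simp add: S_add)
  qed (use S_const[of 0] in simp_all)
  have near: "\<exists>c. \<alpha> (g - mconst c) \<le> e" if e: "0 < e" for e
  proof -
    obtain X where X: "finite X" "\<And>Y. X \<subseteq> Y \<Longrightarrow> alg_norm K1 (g - mtrunc Y g) \<le> e" using T.mtrunc_approx[OF g e] by auto
    have t: "mtrunc X g \<in> S" unfolding mtrunc_eq_sum[OF X(1)] by (intro S_sum S_mult S_const S_mmono)
    then obtain c where c: "\<alpha> (mtrunc X g - mconst c) = 0" and tc: "mtrunc X g \<in> alg_carrier K1" by (auto simp: S_def)
    have "\<alpha> (g - mconst c) \<le> max (\<alpha> (g - mtrunc X g)) (\<alpha> (mtrunc X g - mconst c))"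
      using A.spec_add[OF \<alpha> A.carrier_diff[OF g tc] A.carrier_diff[OF tc K1_mconst], of c] by simp
    moreover have "\<alpha> (g - mtrunc X g) \<le> e"
      by (rule order_trans[OF A.spec_le_norm[OF \<alpha> A.carrier_diff[OF g tc]] X(2)[OF order_refl]])
    ultimately show ?thesis using c e by (intro exI[of _ c]) simp
  qed
  have dist: "absv (c - d) \<le> max (\<alpha> (g - mconst c)) (\<alpha> (g - mconst d))" for c d
  proof -
    have "absv (d - c) = \<alpha> ((g - mconst c) - (g - mconst d))" using spec_mconst[OF \<alpha>, of "d - c"] by (simp add: mconst_diff)
    also have "\<dots> \<le> max (\<alpha> (g - mconst c)) (\<alpha> (g - mconst d))" by (intro A.spec_diff[OF \<alpha>] A.carrier_diff g K1_mconst)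
    finally show ?thesis by (simp only: absv_diff_commute[of c d])
  qed
  have "\<forall>n. \<exists>c. \<alpha> (g - mconst c) \<le> inverse (real (Suc n))" by (intro allI near) simp
  then obtain c where c: "\<forall>n. \<alpha> (g - mconst (c n)) \<le> inverse (real (Suc n))" unfolding choice_iff by (rule exE)
  have "\<exists>l. (\<lambda>n. absv (c n - l)) \<longlonglongrightarrow> 0"
  proof (rule absv_complete)
    fix e :: real assume e: "0 < e"
    obtain N where N: "inverse (real (Suc N)) < e" using reals_Archimedean[OF e] by (rule exE)
    have small: "\<alpha> (g - mconst (c n)) < e" if "N \<le> n" for n
    proof -
      have "inverse (real (Suc n)) \<le> inverse (real (Suc N))" using that by (intro le_imp_inverse_le) auto
      then show ?thesis using c[rule_format, of n] N by linarith
    qed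
    show "\<exists>N. \<forall>m\<ge>N. \<forall>n\<ge>N. absv (c m - c n) < e"
    proof (intro exI[of _ N] allI impI)
      fix m n assume "N \<le> m" "N \<le> n"
      then show "absv (c m - c n) < e" using dist[of "c m" "c n"] small[of m] small[of n] by linarith
    qed
  qed
  then obtain l where l: "(\<lambda>n. absv (c n - l)) \<longlonglongrightarrow> 0" by (rule exE)
  have "\<alpha> (g - mconst l) \<le> inverse (real (Suc n)) + absv (c n - l)" for n
  proof -
    have eq: "g - mconst l = (g - mconst (c n)) + mconst (c n - l)" by (simp add: mconst_diff)
    have "\<alpha> (g - mconst l) \<le> \<alpha> (g - mconst (c n)) + \<alpha> (mconst (c n - l))"
      unfolding eq by (rule A.spec_subadd[OF \<alpha> A.carrier_diff[OF g K1_mconst] K1_mconst])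
    then show ?thesis using c[rule_format, of n] by (simp add: spec_mconst[OF \<alpha>])
  qed
  moreover have "(\<lambda>n. inverse (real (Suc n)) + absv (c n - l)) \<longlonglongrightarrow> 0 + 0" by (intro tendsto_add LIMSEQ_inverse_real_of_nat l)
  ultimately have "\<alpha> (g - mconst l) \<le> 0" by (intro LIMSEQ_le_const[of _ 0]) auto
  then have "\<alpha> (g - mconst l) = 0" by (intro zero A.carrier_diff g K1_mconst)
  then show ?thesis by (rule exI)
qed

lemma analytic_imp_values:
  fixes \<alpha> :: "('s \<times> ('r::finite \<Rightarrow>\<^sub>0 nat), 'k) mfps \<Rightarrow> real"
  assumes \<alpha>: "\<alpha> \<in> spectrum K1" and an: "analytic_map absv (Ev absv \<alpha> :: _ \<Rightarrow> ('s, 'k) mfps \<Rightarrow> real)" and g: "g \<in> alg_carrier K1"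
  shows "\<exists>c. \<alpha> (g - mconst c) = 0"
proof (rule values_from_variables[OF \<alpha> _ g])
  fix v :: "'s \<times> ('r \<Rightarrow>\<^sub>0 nat)"
  obtain \<phi> where \<phi>: "induced_map absv (ground absv) \<phi> (Ev absv \<alpha> :: _ \<Rightarrow> ('s, 'k) mfps \<Rightarrow> real)"
    using an unfolding analytic_map_def by (rule exE)
  \<comment> \<open>Comparison on a single closed polydisk already determines all
    coefficients.\<close>
  define \<rho> where "\<rho> = (1/2 :: real)"
  have r: "0 < \<rho>" "\<rho> < 1" and r01: "\<rho> \<in> {0<..<1}" by (simp_all add: \<rho>_def)
  have hom: "bounded_alg_hom K1 (tate (ground absv) \<rho>) (\<phi> \<rho>)"
    using \<phi> r01 by (simp add: induced_map_def closed_disk_alg_def)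
  have Ev: "Ev absv \<alpha> (restrict x (disk_series (ground absv))) f = x (\<phi> \<rho> f)"
    if "x \<in> spectrum (tate (ground absv) \<rho>)" "f \<in> alg_carrier K1" for x f
  proof -
    have "Ev absv \<alpha> (restrict x (disk_series (ground absv))) = (\<lambda>f\<in>alg_carrier (closed_disk_alg absv). x (\<phi> \<rho> f))"
      using \<phi> r01 that(1) by (simp add: induced_map_def)
    then show ?thesis using that(2) by (simp add: closed_disk_alg_def)
  qed
  interpret M: nonarch_algebra absv "K1 :: ('k, ('r, 's, 'k) coeff_series) normed_alg" by (rule nonarch_algebra_K1)
  interpret K: nonarch_algebra absv "K1 :: ('k, ('s, 'k) mfps) normed_alg" by (rule nonarch_algebra_K1)
  interpret T: tate_algebra absv "ground absv" \<rho> by (rule tate_ground[OF r(1)])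
  interpret D: nonarch_algebra absv "tate (ground absv) \<rho> :: ('k, ('r, 'k) mfps) normed_alg" by (rule T.nonarch_algebra_tate)
  define l where "l = fst v"
  define S where "S = (mvar l :: ('s, 'k) mfps)"
  have S: "S \<in> alg_carrier K1" unfolding S_def by (rule K1_mvar)
  define h where "h = \<phi> \<rho> S"
  have h: "h \<in> alg_carrier (tate (ground absv) \<rho>)" unfolding h_def by (rule bounded_alg_homD(1)[OF hom S])
  define b where "b I = mvar (l, I) - mconst (mcoeff h I)" for I :: "'r \<Rightarrow>\<^sub>0 nat"
  have b: "b I \<in> alg_carrier K1" for I unfolding b_def by (intro M.carrier_diff K1_mvar K1_mconst)
  have "\<alpha> (b (snd v)) = 0"
  proof (rule vanishing_coefficients[OF nonarch_algebra_K1 \<alpha> b r(1)])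
    fix e :: real assume e: "0 < e"
    obtain N0 where N0: "\<forall>n\<ge>N0. alg_norm K1 S * \<rho> ^ n < e" using power_decay[OF r e] by (rule exE)
    have "\<forall>\<^sub>F N in sequentially. alg_norm (tate (ground absv) \<rho>) (h - mtrunc {I. mdeg I \<le> N} h) \<le> e"
      by (rule T.mtrunc_deg_approx[OF h e])
    with eventually_ge_at_top[of N0]
    show "\<forall>\<^sub>F N in sequentially. \<forall>w. (\<forall>v. absv (w v) \<le> \<rho>) \<longrightarrow>
        \<alpha> (\<Sum>I\<in>{I. mdeg I \<le> N}. alg_const K1 (wprod w I) * b I) \<le> e"
    proof eventually_elim
      case (elim N)
      show ?case
      proof (intro allI impI)
        fix w :: "'r \<Rightarrow> 'k" assume w: "\<forall>v. absv (w v) \<le> \<rho>"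
        define t where "t = mtrunc {I. mdeg I \<le> N} h"
        have tp: "t \<in> polys" unfolding t_def by (rule mtrunc_polys[OF finite_mdeg_le])
        have tc: "t \<in> alg_carrier (tate (ground absv) \<rho>)" unfolding t_def by (rule T.mtrunc_carrier[OF h])
        \<comment> \<open>\<open>Ev\<close> yields only absolute values. Applied to S - d, where d
          is the value at w of a truncation of h, it shows that \<open>usub_at w S\<close> itself is
          close to the constant d at \<alpha>.\<close>
        define d where "d = peval w t"
        have d: "d = (\<Sum>I\<in>{I. mdeg I \<le> N}. wprod w I * mcoeff h I)"
          unfolding d_def t_def mtrunc_eq_sum[OF finite_mdeg_le]
          by (simp add: peval_sum peval_mult polys_mult polys_mconst polys_mmono mult.commute)
        note Sw = S r w[rule_format]
        have "mconst d = (\<Sum>I\<in>{I. mdeg I \<le> N}. mconst (wprod w I) * mconst (mcoeff h I) :: ('r, 's, 'k) coeff_series)"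
          unfolding d by (rule mfps_eqI) (simp add: mcoeff_sum mcoeff_mconst)
        moreover have "mcoeff (usub S) I = mvar (l, I)" for I :: "'r \<Rightarrow>\<^sub>0 nat"
          by (simp add: S_def usub_mvar universal_series_def)
        ultimately have eq: "(\<Sum>I\<in>{I. mdeg I \<le> N}. alg_const K1 (wprod w I) * b I) = ucomb S N (wprod w) - mconst d"
          by (simp add: ucomb_def b_def right_diff_distrib sum_subtractf)
        obtain x where x: "x \<in> spectrum (tate (ground absv) \<rho>)" "\<forall>p\<in>polys. x p = absv (peval w p)"
          using rigid_point_exists[OF r(1) w] by (elim bexE) (rule that)
        have f: "S + mconst (- d) \<in> alg_carrier K1" by (intro K.carrier_add S K1_mconst)
        have "\<alpha> (usub_at w S - mconst d) = \<alpha> (usub_at w (S + mconst (- d)))"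
          unfolding usub_at_add usub_at_mconst by (simp add: mconst_minus)
        also have "\<dots> = x (\<phi> \<rho> (S + mconst (- d)))"
          using Ev_at_point[OF \<alpha> r w x f] Ev[OF x(1) f] by simp
        also have "\<phi> \<rho> (S + mconst (- d)) = h - mconst d"
          using bounded_alg_homD(2)[OF hom S K1_mconst[of "- d"]] bounded_alg_homD(4)[OF hom, of "- d"] by (simp add: h_def mconst_minus)
        also have "x (h - mconst d) \<le> max (x (h - t)) (x (t - mconst d))"
          using D.spec_add[OF x(1) D.carrier_diff[OF h tc] D.carrier_diff[OF tc D.const_carrier[of d]]] by simp
        also have "\<dots> \<le> e"
        proof -
          have "x (t - mconst d) = 0" using x(2) polys_diff[OF tp polys_mconst[of d]] by (simp add: peval_diff tp polys_mconst d_def)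
          moreover have "x (h - t) \<le> e"
            using order_trans[OF D.spec_le_norm[OF x(1) D.carrier_diff[OF h tc]]] elim(2) by (simp add: t_def)
          ultimately show ?thesis using e by simp
        qed
        finally have 1: "\<alpha> (usub_at w S - mconst d) \<le> e" .
        have "\<alpha> (usub_at w S - ucomb S N (wprod w)) \<le> alg_norm K1 S * \<rho> ^ N"
          by (rule order_trans[OF M.spec_le_norm[OF \<alpha> M.carrier_diff[OF usub_at_carrier[OF Sw] ucomb_carrier[OF S]]] usub_at_approx[OF Sw]])
        then have 2: "\<alpha> (usub_at w S - ucomb S N (wprod w)) \<le> e" using N0[rule_format, OF elim(1)] by linarith
        have eq2: "ucomb S N (wprod w) - mconst d = (usub_at w S - mconst d) - (usub_at w S - ucomb S N (wprod w))" by simp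
        have "\<alpha> (ucomb S N (wprod w) - mconst d) \<le> max (\<alpha> (usub_at w S - mconst d)) (\<alpha> (usub_at w S - ucomb S N (wprod w)))"
          unfolding eq2
          by (rule M.spec_diff[OF \<alpha> M.carrier_diff[OF usub_at_carrier[OF Sw] K1_mconst] M.carrier_diff[OF usub_at_carrier[OF Sw] ucomb_carrier[OF S]]])
        then show "\<alpha> (\<Sum>I\<in>{I. mdeg I \<le> N}. alg_const K1 (wprod w I) * b I) \<le> e" unfolding eq using 1 2 by linarith
      qed
    qed
  qed
  then show "\<exists>c. \<alpha> (mvar v - mconst c) = 0" by (intro exI[of _ "mcoeff h (snd v)"]) (simp add: b_def l_def)
qed

end

theorem theorem4p8:
  fixes absv :: "'k::alg_closed_field \<Rightarrow> real"
  assumes "complete_nonarch_field absv"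
  shows "\<exists>Ev :: (('r::finite, 's::finite, 'k) coeff_series \<Rightarrow> real) \<Rightarrow>
               (('r, 'k) mfps \<Rightarrow> real) \<Rightarrow> (('s, 'k) mfps \<Rightarrow> real).
    (\<forall>\<alpha>\<in>spectrum (mor_alg absv).
       continuous_map (open_disk_top (ground absv)) (spectrum_top (closed_disk_alg absv)) (Ev \<alpha>)) \<and>
    (\<forall>\<alpha>\<in>spectrum (mor_alg absv).
       (analytic_map absv (Ev \<alpha>) \<longleftrightarrow> rigid (mor_alg absv) \<alpha>) \<and>
       (rigid (mor_alg absv) \<alpha> \<longrightarrow>
          (\<forall>z\<in>open_disk (ground absv). Ev \<alpha> z = Phi_at absv \<alpha> z))) \<and>
    (\<forall>z\<in>open_disk (ground absv).
       continuous_map (spectrum_top (mor_alg absv)) (spectrum_top (closed_disk_alg absv))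
         (\<lambda>\<alpha>. Ev \<alpha> z))"
proof -
  interpret complete_nonarch_field absv by (rule assms)
  interpret alg_closed_nonarch_field absv ..
  \<comment> \<open>A rigid point amounts to a character \<theta> with values in k whose absolute
    value is \<alpha>; both implications of the equivalence pass through it.\<close>
  have vals: "\<exists>\<theta>. \<forall>g\<in>alg_carrier K1. \<alpha> (g - mconst (\<theta> g)) = 0" if "rigid K1 \<alpha>"
    for \<alpha> :: "('r, 's, 'k) coeff_series \<Rightarrow> real"
  proof -
    have "\<alpha> \<in> spectrum K1" using that by (simp add: rigid_def)
    then show ?thesis using rigid_imp_values[OF _ that] by (intro bchoice ballI) 
  qed
  show ?thesis unfolding mor_alg_def closed_disk_alg_def
  proof (intro exI[of _ "Ev absv"] conjI ballI impI iffI)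
    fix \<alpha> :: "('r, 's, 'k) coeff_series \<Rightarrow> real" assume \<alpha>: "\<alpha> \<in> spectrum K1"
    show "continuous_map (open_disk_top (ground absv)) (spectrum_top (K1 :: ('k, ('s, 'k) mfps) normed_alg)) (Ev absv \<alpha>)"
      by (rule continuous_map_Ev_disk[OF \<alpha>])
    show "rigid K1 \<alpha>" if "analytic_map absv (Ev absv \<alpha> :: _ \<Rightarrow> ('s, 'k) mfps \<Rightarrow> real)"
    proof -
      have "\<forall>g\<in>alg_carrier K1. \<exists>c. \<alpha> (g - mconst c) = 0" using analytic_imp_values[OF \<alpha> that] by (rule ballI)
      from bchoice[OF this] obtain \<theta> where "\<forall>g\<in>alg_carrier K1. \<alpha> (g - mconst (\<theta> g)) = 0" by (rule exE)
      then show ?thesis by (rule values_imp_rigid[OF \<alpha>])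
    qed
    show "analytic_map absv (Ev absv \<alpha> :: _ \<Rightarrow> ('s, 'k) mfps \<Rightarrow> real)" if "rigid K1 \<alpha>"
      using vals[OF that] by (elim exE) (rule analytic_Ev[OF \<alpha>])
    fix z :: "('r, 'k) mfps \<Rightarrow> real" assume z: "z \<in> open_disk (ground absv)"
    show "(Ev absv \<alpha> z :: ('s, 'k) mfps \<Rightarrow> real) = Phi_at absv \<alpha> z" if "rigid K1 \<alpha>"
      using vals[OF that] by (elim exE) (rule Ev_eq_Phi_at[OF \<alpha> _ z])
  next
    fix z :: "('r, 'k) mfps \<Rightarrow> real" assume "z \<in> open_disk (ground absv)"
    then show "continuous_map (spectrum_top K1) (spectrum_top (K1 :: ('k, ('s, 'k) mfps) normed_alg))
        (\<lambda>\<alpha> :: ('r, 's, 'k) coeff_series \<Rightarrow> real. Ev absv \<alpha> z)"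
      by (rule continuous_map_Ev_mor)
  qed
qed

end
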